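(* Consider the symmetric long-range exclusion process in dimension $d\ge 1$ with exponent $\alpha>0$, at density $\rho\in(0,1)$. Let $f$ be a local function with $\deg(f)=1$. Then, as $t\to\infty$: In $d=1$: $\sigma_t^2(f)\sim t$ if $\alpha<1$; $\sigma_t^2(f)\sim t\log t$ if $\alpha=1$; $\sigma_t^2(f)\sim t^{2-1/\alpha}$ if $1<\alpha<2$; $\sigma_t^2(f)\sim t^{3/2}(\log t)^{-1/2}$ if $\alpha=2$; $\sigma_t^2(f)\sim t^{3/2}$ if $\alpha>2$. In $d=2$: $\sigma_t^2(f)\sim t$ if $\alpha<2$; $\sigma_t^2(f)\sim t\log(\log t)$ if $\alpha=2$; $\sigma_t^2(f)\sim t\log t$ if $\alpha>2$. In $d\ge3$: $\sigma_t^2(f)\sim t$ for all $\alpha>0$.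
   Context: Notation: $a(t)\sim b(t)$ means that $\lim_{t\to\infty}a(t)/b(t)$ exists and lies in $(0,\infty)$. Symmetric long-range kernel: $s(0)=0$, $s(y)=\frac{c}{|y|^{d+\alpha}}\sum_{i=1}^d\frac{b_i^++b_i^-}{2}\mathbf{1}_{y_i\neq0}$ for $y\in\mathbb{Z}^d\setminus\{0\}$, where $b_i^\pm>0$ are constants and $c$ normalizes $s$ to a probability. The exclusion process with jump probability $s$ is the Markov process $\eta_t$ on $\Omega=\{0,1\}^{\mathbb{Z}^d}$ with generator acting on local functions (depending on finitely many coordinates) by $\mathcal{L}f(\eta)=\sum_{x,y}s(y)\eta(x)(1-\eta(x+y))[f(\eta^{x,x+y})-f(\eta)]$, where $\eta^{x,x+y}$ is $\eta$ with the values at $x,x+y$ exchanged. It is started from the invariant Bernoulli product measure $\nu_\rho$ of density $\rho$; $\mathbb{E}_\rho$ is the corresponding expectation. Set $\Gamma_f(t)=\int_0^tf(\eta_s)ds$ and $\sigma_t^2(f)=\mathbb{E}_\rho[\Gamma_f(t)^2]$. Degree: with $\mu_f(z)=\int f\,d\nu_z$, $\deg(f)=1$ means $\mu_f(\rho)=0$ and $\mu_f'(\rho)\neq0$. *)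

theory Defs
  imports "HOL-Probability.Probability"
begin

section \<open>The symmetric long-range kernel\<close>

definition eucl_norm :: "int ^ ('d::finite) \<Rightarrow> real" where
  "eucl_norm y = norm (\<chi> i. real_of_int (y $ i))"

definition raw_kernel :: "(('d::finite) \<Rightarrow> real) \<Rightarrow> ('d \<Rightarrow> real) \<Rightarrow> real \<Rightarrow> int ^ 'd \<Rightarrow> real" where
  "raw_kernel bp bm \<alpha> y =
     (if y = 0 then 0
      else (1 / eucl_norm y powr (real CARD('d) + \<alpha>)) *
           (\<Sum>i\<in>UNIV. (bp i + bm i) / 2 * of_bool (y $ i \<noteq> 0)))"

definition kernel_const :: "(('d::finite) \<Rightarrow> real) \<Rightarrow> ('d \<Rightarrow> real) \<Rightarrow> real \<Rightarrow> real" where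
  "kernel_const bp bm \<alpha> = 1 / (\<Sum>\<^sub>\<infinity>y\<in>UNIV. raw_kernel bp bm \<alpha> y)"

definition sym_kernel :: "(('d::finite) \<Rightarrow> real) \<Rightarrow> ('d \<Rightarrow> real) \<Rightarrow> real \<Rightarrow> int ^ 'd \<Rightarrow> real" where
  "sym_kernel bp bm \<alpha> y = kernel_const bp bm \<alpha> * raw_kernel bp bm \<alpha> y"

section \<open>Configurations, local functions and the pregenerator\<close>

text \<open>
  The value \<^term>\<open>True\<close> means that a site is occupied. The topology on configurations is the
  library's product topology on functions, with the discrete topology on \<^typ>\<open>bool\<close>.
\<close>

type_synonym 'd config = "int ^ 'd \<Rightarrow> bool"

abbreviation config_space :: "'d config measure" where
  "config_space \<equiv> PiM UNIV (\<lambda>_. count_space UNIV)"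

definition bernoulli_product :: "real \<Rightarrow> 'd config measure" where
  "bernoulli_product \<rho> = PiM UNIV (\<lambda>_. measure_pmf (bernoulli_pmf \<rho>))"

definition local_fun :: "('d config \<Rightarrow> real) \<Rightarrow> bool" where
  "local_fun f \<longleftrightarrow>
     (\<exists>A. finite A \<and> (\<forall>\<eta> \<xi>. (\<forall>x\<in>A. \<eta> x = \<xi> x) \<longrightarrow> f \<eta> = f \<xi>))"

definition exchange :: "'d config \<Rightarrow> int ^ 'd \<Rightarrow> int ^ 'd \<Rightarrow> 'd config" where
  "exchange \<eta> x y = \<eta>(x := \<eta> y, y := \<eta> x)"

text \<open>For local \<^term>\<open>f\<close> and summable \<^term>\<open>s\<close> the double series converges absolutely.\<close>

definition exclusion_gen :: "(int ^ 'd \<Rightarrow> real) \<Rightarrow> ('d config \<Rightarrow> real) \<Rightarrow> 'd config \<Rightarrow> real" where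
  "exclusion_gen s f \<eta> =
     (\<Sum>\<^sub>\<infinity>(x, y)\<in>UNIV. s y * of_bool (\<eta> x) * (1 - of_bool (\<eta> (x + y))) *
        (f (exchange \<eta> x (x + y)) - f \<eta>))"

section \<open>Markov semigroups and the exclusion process\<close>

text \<open>
  The configuration space is compact, so bounded continuous functions with the supremum norm
  are all of \<open>C(\<Omega>)\<close>.
\<close>

definition markov_semigroup ::
  "(real \<Rightarrow> ('a::topological_space \<Rightarrow>\<^sub>C real) \<Rightarrow> ('a \<Rightarrow>\<^sub>C real)) \<Rightarrow> bool" where
  "markov_semigroup S \<longleftrightarrow>
     (\<forall>t\<ge>0. linear (S t)) \<and>
     (\<forall>g. S 0 g = g) \<and>
     (\<forall>t\<ge>0. \<forall>g. continuous (at_right t) (\<lambda>u. S u g)) \<and>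
     (\<forall>t\<ge>0. \<forall>u\<ge>0. \<forall>g. S (t + u) g = S t (S u g)) \<and>
     (\<forall>t\<ge>0. S t (const_bcontfun 1) = const_bcontfun 1) \<and>
     (\<forall>t\<ge>0. \<forall>g. (\<forall>x. 0 \<le> apply_bcontfun g x) \<longrightarrow> (\<forall>x. 0 \<le> apply_bcontfun (S t g) x))"

definition generator_graph ::
  "(real \<Rightarrow> ('a::topological_space \<Rightarrow>\<^sub>C real) \<Rightarrow> ('a \<Rightarrow>\<^sub>C real))
     \<Rightarrow> (('a \<Rightarrow>\<^sub>C real) \<times> ('a \<Rightarrow>\<^sub>C real)) set" where
  "generator_graph S = {(g, h). ((\<lambda>t. (S t g - g) /\<^sub>R t) \<longlongrightarrow> h) (at_right 0)}"

text \<open>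
  The pregenerator is only given on local functions; the generator of the process is its closure
  in \<open>C(\<Omega>)\<close>, which determines the semigroup uniquely.
\<close>

definition exclusion_semigroup ::
  "(int ^ 'd \<Rightarrow> real) \<Rightarrow> (real \<Rightarrow> ('d config \<Rightarrow>\<^sub>C real) \<Rightarrow> ('d config \<Rightarrow>\<^sub>C real)) \<Rightarrow> bool" where
  "exclusion_semigroup s S \<longleftrightarrow>
     markov_semigroup S \<and>
     generator_graph S =
       closure {(g, h). local_fun (apply_bcontfun g) \<and>
                        apply_bcontfun h = exclusion_gen s (apply_bcontfun g)}"

definition history :: "'w measure \<Rightarrow> (real \<Rightarrow> 'w \<Rightarrow> 'd config) \<Rightarrow> real \<Rightarrow> 'w measure" where
  "history M \<eta> t =
     vimage_algebra (space M) (\<lambda>\<omega>. \<lambda>u\<in>{0..t}. \<eta> u \<omega>) (PiM {0..t} (\<lambda>_. config_space))"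

definition cadlag :: "(real \<Rightarrow> 'a::topological_space) \<Rightarrow> bool" where
  "cadlag p \<longleftrightarrow>
     (\<forall>t\<ge>0. continuous (at_right t) p) \<and> (\<forall>t>0. \<exists>l. (p \<longlongrightarrow> l) (at_left t))"

text \<open>Only the values \<open>\<eta> t\<close> with \<open>t \<ge> 0\<close> matter.\<close>

definition exclusion_process ::
  "(int ^ 'd \<Rightarrow> real) \<Rightarrow> 'd config measure \<Rightarrow> 'w measure \<Rightarrow> (real \<Rightarrow> 'w \<Rightarrow> 'd config) \<Rightarrow> bool"
  where
  "exclusion_process s init M \<eta> \<longleftrightarrow>
     prob_space M \<and>
     (\<forall>t\<ge>0. \<eta> t \<in> measurable M config_space) \<and>
     (\<forall>\<omega>\<in>space M. cadlag (\<lambda>t. \<eta> t \<omega>)) \<and>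
     distr M config_space (\<eta> 0) = init \<and>
     (\<exists>S. exclusion_semigroup s S \<and>
       (\<forall>t\<ge>0. \<forall>u\<ge>0. \<forall>g. AE \<omega> in M.
          real_cond_exp M (history M \<eta> t) (\<lambda>\<omega>'. apply_bcontfun g (\<eta> (t + u) \<omega>')) \<omega>
            = apply_bcontfun (S u g) (\<eta> t \<omega>)))"

section \<open>Additive functionals, degree and asymptotic order\<close>

definition occ_time :: "(real \<Rightarrow> 'w \<Rightarrow> 'd config) \<Rightarrow> ('d config \<Rightarrow> real) \<Rightarrow> real \<Rightarrow> 'w \<Rightarrow> real" where
  "occ_time \<eta> f t \<omega> = (LBINT u:{0..t}. f (\<eta> u \<omega>))"

definition occ_var ::
  "'w measure \<Rightarrow> (real \<Rightarrow> 'w \<Rightarrow> 'd config) \<Rightarrow> ('d config \<Rightarrow> real) \<Rightarrow> real \<Rightarrow> real" where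
  "occ_var M \<eta> f t = (\<integral>\<omega>. (occ_time \<eta> f t \<omega>)\<^sup>2 \<partial>M)"

definition bernoulli_mean :: "('d config \<Rightarrow> real) \<Rightarrow> real \<Rightarrow> real" where
  "bernoulli_mean f z = (\<integral>\<eta>. f \<eta> \<partial>bernoulli_product z)"

text \<open>
  The derivative is taken at an interior point \<open>\<rho> \<in> (0,1)\<close>, so the clamping of
  \<^const>\<open>bernoulli_pmf\<close> outside the unit interval is irrelevant.
\<close>

definition degree_one :: "real \<Rightarrow> ('d config \<Rightarrow> real) \<Rightarrow> bool" where
  "degree_one \<rho> f \<longleftrightarrow>
     bernoulli_mean f \<rho> = 0 \<and>
     (\<exists>D. (bernoulli_mean f has_real_derivative D) (at \<rho>) \<and> D \<noteq> 0)"

definition same_order :: "(real \<Rightarrow> real) \<Rightarrow> (real \<Rightarrow> real) \<Rightarrow> bool" (infix \<open>\<asymp>\<close> 50) where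
  "a \<asymp> b \<longleftrightarrow> (\<exists>L>0. ((\<lambda>t. a t / b t) \<longlongrightarrow> L) at_top)"

end

theory Submission
  imports Defs "HOL-Real_Asymp.Real_Asymp"
begin

text \<open>
  For a local \<open>f\<close> of degree one write \<open>f = \<Sum>\<^sub>A c(A) \<Prod>\<^sub>x\<^sub>\<in>\<^sub>A (\<eta>(x) - \<rho>)\<close> with \<open>c(\<emptyset>) = 0\<close> and
  \<open>\<Sum>\<^sub>x c({x}) \<noteq> 0\<close>. By duality, the semigroup applied to such products is governed by finitely many exclusion
  particles. The terms with one particle contribute
  \<open>\<rho>(1 - \<rho>) \<Sum> c({x}) c({y}) p\<^sub>t(x - y)\<close> to the stationary correlation \<open>C(t)\<close>, where \<open>p\<^sub>t\<close> is the heat kernel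
  of the random walk with jump law \<open>s\<close>, and by negative correlation all other terms are
  \<open>O(p\<^sub>t(0)\<^sup>2)\<close>. The Fourier representation of \<open>p\<^sub>t\<close> and the behaviour of the characteristic exponent
  near the origin give the decay of \<open>p\<^sub>t(0)\<close> in each regime, and since the variance is
  \<open>2 \<integral>\<^sub>0\<^sup>t (t - u) C(u) du\<close>, two applications of L'Hospital's rule finish the proof in the recurrent
  cases. In the transient cases \<open>C\<close> is integrable, nonnegative and \<open>C(0) > 0\<close>, and the variance is linear.
\<close>

section \<open>Markov semigroups and their generators\<close>

text \<open>The process is given only through a semigroup whose generator is the closure of a
  pregenerator on local functions, so no particle system is constructed. Every probabilistic
  identity comes from one comparison principle: \<open>n\<close> exclusion particles have total jump
  rate at most \<open>n\<close>, hence bounded solutions of their backward equation are determined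
  by the initial values. Duality, the link to the heat kernel and negative correlation are all
  comparisons of this kind.

  The order relation demands an actual limit. In the recurrent regimes two-sided heat kernel bounds
  are therefore too weak, and \<open>t * psi\<close> must converge after rescaling by t^(-1/2),
  t^(-1/\<alpha>) or (t ln t)^(-1/2). Linear growth needs only lower bounds on \<open>psi\<close>,
  because the derivative of the variance is monotone and bounded. The delicate case is \<alpha> = 2
  in dimension two: the second moment diverges logarithmically, and the exponent is split into two
  coordinate parts and a cross term that carries no logarithm.\<close>

lemma markov_contraction:
  assumes S: "markov_semigroup S" and t: "t \<ge> 0"
  shows "norm (S t g) \<le> norm (g :: 'a::topological_space \<Rightarrow>\<^sub>C real)"
proof -
  have lin: "linear (S t)" and one: "S t (const_bcontfun 1) = const_bcontfun 1"
    and pos: "\<And>h. (\<forall>x. 0 \<le> apply_bcontfun h x) \<Longrightarrow> (\<forall>x. 0 \<le> apply_bcontfun (S t h) x)"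
    using S t unfolding markov_semigroup_def by auto
  have le: "apply_bcontfun (S t h) x \<le> norm h" for h x
  proof -
    \<comment> \<open>Positivity applied to the nonnegative function \<open>norm h\<close> minus
      \<open>h\<close>, together with \<open>S t 1 = 1\<close>, bounds \<open>S t h\<close> from
      above; \<open>h = - g\<close> then gives the lower bound.\<close>
    let ?k = "norm h *\<^sub>R const_bcontfun 1 - h"
    have "0 \<le> apply_bcontfun ?k y" for y
      using norm_bounded[of h y] by (auto simp: minus_bcontfun.rep_eq scaleR_bcontfun.rep_eq const_bcontfun.rep_eq)
    then have "0 \<le> apply_bcontfun (S t ?k) x" using pos by blast
    also have "S t ?k = norm h *\<^sub>R const_bcontfun 1 - S t h"
      using lin one by (simp add: linear_diff linear_cmul)
    finally show ?thesis by (simp add: minus_bcontfun.rep_eq scaleR_bcontfun.rep_eq const_bcontfun.rep_eq)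
  qed
  have "norm (apply_bcontfun (S t g) x) \<le> norm g" for x
  proof -
    have "apply_bcontfun (S t (-g)) x \<le> norm g" using le[of "-g" x] by simp
    moreover have "S t (-g) = - S t g" using lin by (simp add: linear_neg)
    ultimately show ?thesis using le[of g x] by (simp add: uminus_bcontfun.rep_eq)
  qed
  then show ?thesis by (rule norm_bound)
qed

lemma markov_bounded_linear:
  assumes "markov_semigroup S" "t \<ge> 0"
  shows "bounded_linear (S t :: _ \<Rightarrow> ('a::topological_space \<Rightarrow>\<^sub>C real))"
  using assms markov_contraction[OF assms]
  by (auto simp: markov_semigroup_def intro!: bounded_linear_intro[where K=1] simp: linear_add linear_cmul)

text \<open>Factoring out the contraction \<open>S r\<close> moves an increment to time zero. This
  is how right continuity at 0 becomes continuity from both sides.\<close>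

lemma markov_diff:
  assumes "markov_semigroup S" "0 \<le> r" "r \<le> t"
  shows "norm (S t g - S r g) \<le> norm (S (t - r) g - (g :: 'a::topological_space \<Rightarrow>\<^sub>C real))"
proof -
  have "S t g = S r (S (t - r) g)"
    using assms unfolding markov_semigroup_def by (metis add.commute diff_add_cancel diff_ge_0_iff_ge)
  then have "S t g - S r g = S r (S (t - r) g - g)"
    using markov_bounded_linear[of S r] assms by (simp add: bounded_linear.linear linear_diff)
  then show ?thesis using markov_contraction[of S r] assms by simp
qed

lemma markov_continuous:
  fixes g :: "'a::topological_space \<Rightarrow>\<^sub>C real"
  assumes S: "markov_semigroup S"
  shows "continuous_on {0..} (\<lambda>t. S t g)"
proof -
  have z: "((\<lambda>u. S u g) \<longlongrightarrow> S 0 g) (at_right 0)"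
    using S unfolding markov_semigroup_def continuous_within by auto
  have *: "\<exists>d>0. \<forall>u. 0 \<le> u \<longrightarrow> u < d \<longrightarrow> norm (S u g - g) < e" if e: "e > 0" for e
  proof -
    have "eventually (\<lambda>u. dist (S u g) (S 0 g) < e) (at_right 0)" using z e by (rule tendstoD)
    then obtain d where "d > 0" "\<And>u. 0 < u \<Longrightarrow> u < d \<Longrightarrow> dist (S u g) (S 0 g) < e"
      unfolding eventually_at_right_field by auto
    moreover have "S 0 g = g" using S by (auto simp: markov_semigroup_def)
    ultimately show ?thesis using e by (intro exI[of _ d]) (metis dist_norm le_less norm_zero right_minus_eq)
  qed
  show ?thesis unfolding continuous_on_iff
  proof (intro ballI allI impI)
    fix t e :: real assume t: "t \<in> {0..}" and e: "e > 0"
    obtain d where d: "d > 0" "\<And>u. 0 \<le> u \<Longrightarrow> u < d \<Longrightarrow> norm (S u g - g) < e" using *[OF e] by blast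
    have "dist (S r g) (S t g) < e" if r: "r \<in> {0..}" "dist r t < d" for r
    proof (cases "r \<le> t")
      case True
      then show ?thesis using markov_diff[OF S, of r t g] d(2)[of "t - r"] r
        by (auto simp: dist_norm norm_minus_commute)
    next
      case False
      then show ?thesis using markov_diff[OF S, of t r g] d(2)[of "r - t"] r t
        by (auto simp: dist_norm)
    qed
    then show "\<exists>d>0. \<forall>x'\<in>{0..}. dist x' t < d \<longrightarrow> dist (S x' g) (S t g) < e" using d(1) by auto
  qed
qed

lemma markov_graph:
  assumes S: "markov_semigroup S" and t: "t \<ge> 0" and gh: "(g, h) \<in> generator_graph S"
  shows "(S t g, S t h) \<in> generator_graph (S :: _ \<Rightarrow> ('a::topological_space \<Rightarrow>\<^sub>C real) \<Rightarrow> _)"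
proof -
  note bl = markov_bounded_linear[OF S t]
  have "((\<lambda>u. S t ((S u g - g) /\<^sub>R u)) \<longlongrightarrow> S t h) (at_right 0)"
    using gh unfolding generator_graph_def by (auto intro!: bounded_linear.tendsto[OF bl])
  moreover have "eventually (\<lambda>u. S t ((S u g - g) /\<^sub>R u) = (S u (S t g) - S t g) /\<^sub>R u) (at_right 0)"
    unfolding eventually_at_right_field
  proof (intro exI[of _ 1] conjI allI impI)
    fix u :: real assume u: "u > 0"
    have "S t (S u g) = S u (S t g)"
      using S t u unfolding markov_semigroup_def by (metis add.commute less_imp_le)
    then show "S t ((S u g - g) /\<^sub>R u) = (S u (S t g) - S t g) /\<^sub>R u"
      using bl by (simp add: bounded_linear.linear linear_diff linear_cmul)
  qed simp
  ultimately show ?thesis unfolding generator_graph_def by (auto intro: Lim_transform_eventually)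
qed

lemma markov_derivative:
  fixes g h :: "'a::topological_space \<Rightarrow>\<^sub>C real"
  assumes S: "markov_semigroup S" and t: "t \<ge> 0" and gh: "(g, h) \<in> generator_graph S"
  shows "((\<lambda>t. S t g) has_vector_derivative S t h) (at t within {0..})"
proof -
  define q where "q u = norm ((S u g - g) /\<^sub>R u - h)" for u
  have q0: "(q \<longlongrightarrow> 0) (at_right 0)"
    using gh unfolding generator_graph_def q_def by (auto intro!: tendsto_norm_zero LIM_zero)
  have cont: "continuous_on {0..} (\<lambda>t. S t h)" by (rule markov_continuous[OF S])
  have semi: "S (r + u) g = S r (S u g)" if "r \<ge> 0" "u \<ge> 0" for r u
    using S that unfolding markov_semigroup_def by auto
  have key: "norm ((S (r + u) g - S r g) /\<^sub>R u - S r h) \<le> q u" if r: "r \<ge> 0" and u: "u > 0" for r u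
  proof -
    note bl = markov_bounded_linear[OF S r]
    have "(S (r + u) g - S r g) /\<^sub>R u - S r h = S r ((S u g - g) /\<^sub>R u - h)"
      using bl semi[of r u] r u by (simp add: bounded_linear.linear linear_diff linear_cmul)
    then show ?thesis unfolding q_def using markov_contraction[OF S r] by simp
  qed
  show ?thesis
    unfolding has_vector_derivative_def has_derivative_within_alt
  proof (intro conjI allI impI bounded_linear_scaleR_left)
    fix e :: real assume e: "e > 0"
    from tendstoD[OF q0, of "e/2"] e obtain d1 where d1: "d1 > 0" "\<And>u. 0 < u \<Longrightarrow> u < d1 \<Longrightarrow> q u < e/2"
      unfolding eventually_at_right_field by auto (metis abs_of_nonneg norm_ge_zero q_def)
    from cont t e obtain d2 where d2: "d2 > 0" "\<And>r. r \<ge> 0 \<Longrightarrow> dist r t < d2 \<Longrightarrow> dist (S r h) (S t h) < e/2"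
      unfolding continuous_on_iff by (metis atLeast_iff half_gt_zero)
    show "\<exists>d>0. \<forall>y\<in>{0..}. norm (y - t) < d \<longrightarrow>
            norm (S y g - S t g - (y - t) *\<^sub>R S t h) \<le> e * norm (y - t)"
    proof (intro exI[of _ "min d1 d2"] conjI ballI impI)
      fix y :: real assume y: "y \<in> {0..}" and yd: "norm (y - t) < min d1 d2"
      consider "y = t" | "y > t" | "y < t" by linarith
      then show "norm (S y g - S t g - (y - t) *\<^sub>R S t h) \<le> e * norm (y - t)"
      proof cases
        case 2
        have "norm ((S y g - S t g) /\<^sub>R (y - t) - S t h) \<le> e"
          using key[of t "y - t"] d1(2)[of "y - t"] 2 yd t e by (simp add: abs_if split: if_splits)
        moreover have "S y g - S t g - (y - t) *\<^sub>R S t h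
            = (y - t) *\<^sub>R ((S y g - S t g) /\<^sub>R (y - t) - S t h)"
          using 2 by (simp add: scaleR_diff_right)
        ultimately show ?thesis using 2 by (simp add: mult.commute mult_right_mono)
      next
        \<comment> \<open>For a left increment the quotient is based at \<open>y\<close>, so it is
          compared with \<open>S y h\<close> first; continuity in time replaces this by
          \<open>S t h\<close>. Each replacement costs \<open>e / 2\<close>.\<close>
        case 3
        have "norm ((S t g - S y g) /\<^sub>R (t - y) - S y h) \<le> e / 2"
          using key[of y "t - y"] d1(2)[of "t - y"] 3 yd y e by (simp add: abs_if split: if_splits)
        moreover have "norm (S y h - S t h) \<le> e / 2"
          using d2(2)[of y] y yd by (simp add: dist_norm)
        ultimately have "norm ((S t g - S y g) /\<^sub>R (t - y) - S t h) \<le> e"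
          using norm_triangle_ineq[of "(S t g - S y g) /\<^sub>R (t - y) - S y h" "S y h - S t h"] by simp
        moreover have "norm (S y g - S t g - (y - t) *\<^sub>R S t h)
            = (t - y) * norm ((S t g - S y g) /\<^sub>R (t - y) - S t h)"
        proof -
          have *: "S y g - S t g - a *\<^sub>R S t h = a *\<^sub>R (X - S t h)"
            if "a *\<^sub>R X = - (S t g - S y g)" for a X
            using that by (simp add: scaleR_diff_right)
          have "(y - t) / (t - y) = -1" using 3 by (simp add: field_simps)
          then have "(y - t) *\<^sub>R ((S t g - S y g) /\<^sub>R (t - y)) = - (S t g - S y g)"
            by (simp add: divide_inverse)
          from *[OF this] show ?thesis using 3 by (simp only: norm_scaleR) simp
        qed
        moreover have "norm (y - t) = t - y" using 3 by simp
        ultimately show ?thesis using mult_left_mono[of _ e "t - y"] 3 by (simp only: mult.commute[of e])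
      qed simp
    qed (use d1 d2 in auto)
  qed
qed

text \<open>The derivative of \<open>B (S (t - u) g) (S u h)\<close> in \<open>u\<close> is the
  difference of the two sides of the symmetry hypothesis, which applies because the semigroup
  preserves the graph. The function is constant, and its end values are the two sides of the
  claim.\<close>

lemma generator_symmetric_semigroup:
  fixes S :: "real \<Rightarrow> ('a::topological_space \<Rightarrow>\<^sub>C real) \<Rightarrow> ('a \<Rightarrow>\<^sub>C real)"
    and B :: "_ \<Rightarrow> _ \<Rightarrow> real"
  assumes S: "markov_semigroup S" and B: "bounded_bilinear B"
    and sym: "\<And>g g' h h'. (g, g') \<in> generator_graph S \<Longrightarrow> (h, h') \<in> generator_graph S \<Longrightarrow> B g h' = B g' h"
    and g: "(g, g') \<in> generator_graph S" and h: "(h, h') \<in> generator_graph S" and t: "t \<ge> 0"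
  shows "B g (S t h) = B (S t g) h"
proof -
  define F where "F u = B (S (t - u) g) (S u h)" for u
  have dF: "(F has_vector_derivative 0) (at u within {0..t})" if u: "u \<in> {0..t}" for u
  proof -
    have h1: "((\<lambda>u. S u h) has_vector_derivative S u h') (at u within {0..t})"
      using markov_derivative[OF S _ h, of u] u by (auto intro: has_vector_derivative_within_subset)
    have "((\<lambda>u. S u g) has_vector_derivative S (t - u) g') (at (t - u) within (\<lambda>u. t - u) ` {0..t})"
      using markov_derivative[OF S _ g, of "t - u"] u by (auto intro: has_vector_derivative_within_subset)
    then have g1: "((\<lambda>u. S (t - u) g) has_vector_derivative (-1) *\<^sub>R S (t - u) g') (at u within {0..t})"
      by (rule vector_diff_chain_within[rotated, unfolded o_def])
         (auto intro!: derivative_eq_intros simp flip: has_real_derivative_iff_has_vector_derivative)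
    have "(F has_vector_derivative (B (S (t - u) g) (S u h') + B (- S (t - u) g') (S u h))) (at u within {0..t})"
      unfolding F_def using bounded_bilinear.has_vector_derivative[OF B g1 h1] by simp
    moreover have "B (S (t - u) g) (S u h') = B (S (t - u) g') (S u h)"
      by (rule sym) (use markov_graph[OF S _ g, of "t - u"] markov_graph[OF S _ h, of u] u in auto)
    ultimately show ?thesis using bounded_bilinear.minus_left[OF B] by simp
  qed
  have "\<exists>c. \<forall>u\<in>{0..t}. F u = c"
    by (rule has_vector_derivative_zero_constant[OF _ dF]) auto
  then have "F 0 = F t" using t by auto
  then show ?thesis using S unfolding F_def markov_semigroup_def by auto
qed

text \<open>
  The hypothesis on \<open>D\<close> is what a generator with jump rates at most \<open>L\<close> satisfies. It turns a lower
  bound \<open>- M (L t)^n / n!\<close> on \<open>exp (L t) w\<close> into the next one.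
\<close>

lemma bounded_rate_maximum_principle:
  fixes w D :: "real \<Rightarrow> 'i \<Rightarrow> real"
  assumes L: "L \<ge> 0"
    and bd: "\<And>t i. 0 \<le> t \<Longrightarrow> - M \<le> w t i"
    and init: "\<And>i. 0 \<le> w 0 i"
    and der: "\<And>t i. 0 \<le> t \<Longrightarrow> ((\<lambda>t. w t i) has_real_derivative D t i) (at t within {0..})"
    and gen: "\<And>t i m. 0 \<le> t \<Longrightarrow> 0 \<le> m \<Longrightarrow> (\<And>j. - m \<le> w t j) \<Longrightarrow> - L * m \<le> D t i + L * w t i"
    and t: "0 \<le> t"
  shows "0 \<le> w t i"
proof -
  define M' where "M' = max M 0"
  have M': "M' \<ge> 0" "\<And>t i. t \<ge> 0 \<Longrightarrow> -M' \<le> w t i"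
  proof -
    show "-M' \<le> w t i" if "t \<ge> 0" for t i using bd[OF that, of i] unfolding M'_def by linarith
  qed (simp add: M'_def)
  have step: "- exp (L * t) * (M' * (L * t) ^ n / fact n) \<le> w t i" if "t \<ge> 0" for n t i
    using that
  proof (induction n arbitrary: t i)
    case 0
    have "- exp (L * t) * M' \<le> - 1 * M'" using M'(1) L 0 by (intro mult_right_mono) auto
    then show ?case using M'(2)[OF 0, of i] by simp
  next
    case (Suc n)
    show ?case
    proof -
      \<comment> \<open>\<open>exp (L * r)\<close> is the integrating factor for the diagonal rate
        \<open>L\<close>. For \<open>r\<close> up to \<open>t\<close>, the two constant factors
        \<open>exp (L * t)\<close> dominate this factor and the one in the induction hypothesis, so
        that in the second summand only the power of \<open>L * r\<close> is differentiated.\<close>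
      define G where "G r = exp (L * r) * w r i + exp (L * t) * (exp (L * t) * (M' * (L * r) ^ Suc n / fact (Suc n)))" for r
      have "G 0 \<le> G t"
      proof (rule DERIV_nonneg_imp_increasing_open[of 0 t G])
        show "\<exists>y. (G has_real_derivative y) (at r) \<and> y \<ge> 0" if r: "0 < r" "r < t" for r
        proof -
          have w': "((\<lambda>t. w t i) has_real_derivative D r i) (at r)"
          proof -
            have "at r within {0..} = at r" by (rule at_within_open_subset[of r "{0<..}"]) (use r in auto)
            then show ?thesis using der[of r i] r by (simp only: less_imp_le)
          qed
          have "((\<lambda>r. (L * r) ^ Suc n) has_real_derivative (1 + real n) * (L * r) ^ n * L) (at r)"
            using DERIV_power_Suc[OF DERIV_cmult_Id[of L r "UNIV"], of n] by (simp add: algebra_simps)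
          from DERIV_cmult[OF this, of "M' / fact (Suc n)"]
          have p: "((\<lambda>r. M' * (L * r) ^ Suc n / fact (Suc n)) has_real_derivative L * (M' * (L * r) ^ n / fact n)) (at r)"
          proof (rule has_field_derivative_transform_within[OF DERIV_cong, OF _ _ zero_less_one])
            show "M' / fact (Suc n) * ((1 + real n) * (L * r) ^ n * L) = L * (M' * (L * r) ^ n / fact n)"
              by (simp add: divide_simps del: of_nat_Suc)
          qed auto
          have e: "((\<lambda>r. exp (L * r)) has_real_derivative exp (L * r) * L) (at r)"
            using DERIV_fun_exp[OF DERIV_cmult_Id[of L r "UNIV"]] by simp
          have "(G has_real_derivative (exp (L * r) * L * w r i + D r i * exp (L * r)
                 + exp (L * t) * (exp (L * t) * (L * (M' * (L * r) ^ n / fact n))))) (at r)"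
            unfolding G_def
            by (rule DERIV_add[OF DERIV_mult[OF e w'] DERIV_cmult[OF DERIV_cmult[OF p]]])
          moreover have "0 \<le> exp (L * r) * L * w r i + D r i * exp (L * r)
                 + exp (L * t) * (exp (L * t) * (L * (M' * (L * r) ^ n / fact n)))"
          proof -
            let ?m = "exp (L * r) * (M' * (L * r) ^ n / fact n)"
            have m: "0 \<le> ?m" using M' L r by simp
            have "- L * ?m \<le> D r i + L * w r i"
            proof (rule gen)
              show "- ?m \<le> w r j" for j using Suc.IH[of r j] r by simp
            qed (use r m in auto)
            then have "exp (L * r) * (- L * ?m) \<le> exp (L * r) * (D r i + L * w r i)"
              by (rule mult_left_mono) simp
            moreover have "exp (L * r) * (L * ?m) \<le> exp (L * t) * (exp (L * t) * (L * (M' * (L * r) ^ n / fact n)))"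
            proof -
              have e: "exp (L * r) \<le> exp (L * t)" using r L by (simp add: mult_left_mono)
              have "exp (L * r) * exp (L * r) * (L * (M' * (L * r) ^ n / fact n))
                \<le> exp (L * t) * exp (L * t) * (L * (M' * (L * r) ^ n / fact n))"
                by (intro mult_right_mono mult_mono e) (use M' L r in auto)
              then show ?thesis by (simp add: mult_ac)
            qed
            ultimately show ?thesis by (simp add: algebra_simps)
          qed
          ultimately show ?thesis by blast
        qed
        have "continuous_on {0..t} (\<lambda>t. w t i)"
          by (rule DERIV_continuous_on[of _ _ "\<lambda>t. D t i"], rule DERIV_subset[OF der]) auto
        then show "continuous_on {0..t} G" unfolding G_def by (intro continuous_intros) auto
      qed (use Suc.prems in simp)
      then have "0 \<le> exp (L * t) * (w t i + exp (L * t) * (M' * (L * t) ^ Suc n / fact (Suc n)))"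
        using init[of i] by (simp add: G_def algebra_simps del: power_Suc fact_Suc)
      then show ?thesis by (simp add: zero_le_mult_iff del: power_Suc fact_Suc)
    qed
  qed
  have "(\<lambda>n. (L * t) ^ n /\<^sub>R fact n) \<longlonglongrightarrow> 0" by (rule summable_LIMSEQ_zero[OF summable_exp_generic])
  then have "(\<lambda>n. - exp (L * t) * (M' * ((L * t) ^ n /\<^sub>R fact n))) \<longlonglongrightarrow> - exp (L * t) * (M' * 0)"
    by (intro tendsto_intros)
  then have "- exp (L * t) * (M' * 0) \<le> w t i"
    by (rule LIMSEQ_le_const2) (use step[OF t] in \<open>auto simp: field_simps intro!: exI[of _ 0]\<close>)
  then show ?thesis by simp
qed

section \<open>The generator on continuous functions\<close>

text \<open>Completeness makes absolutely convergent series of continuous functions converge in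
  norm, so the generator can be written as an infinite sum of functions and not merely
  pointwise.\<close>

instance bcontfun :: (topological_space, complete_space) complete_space
proof
  fix f :: "nat \<Rightarrow> ('a, 'b) bcontfun"
  assume "Cauchy f"
  then obtain g where "uniform_limit UNIV f g sequentially"
    using uniformly_convergent_eq_cauchy[of "\<lambda>_. True" f]
    unfolding Cauchy_def uniform_limit_sequentially_iff
    by (metis dist_fun_lt_imp_dist_val_lt)
  from uniform_limit_bcontfunE[OF this sequentially_bot]
  obtain l' where "g = apply_bcontfun l'" "(f \<longlonglongrightarrow> l')" by metis
  then show "convergent f" by (intro convergentI)
qed
instance bcontfun :: (topological_space, banach) banach ..

lemma abs_apply_bcontfun_le: "\<bar>apply_bcontfun g x\<bar> \<le> norm (g :: 'a::topological_space \<Rightarrow>\<^sub>C real)"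
  using norm_bounded[of g x] by simp

lemma local_funI:
  assumes "finite A" "\<And>\<eta> \<xi>. (\<And>x. x \<in> A \<Longrightarrow> \<eta> x = \<xi> x) \<Longrightarrow> f \<eta> = f \<xi>"
  shows "local_fun f"
  using assms unfolding local_fun_def by blast

text \<open>A local function takes finitely many values and is constant near each configuration,
  because fixing finitely many coordinates is an open condition in a product of discrete
  spaces.\<close>

lemma local_fun_bcontfun:
  assumes "local_fun (f :: 'd::finite config \<Rightarrow> real)"
  shows "f \<in> bcontfun"
proof -
  obtain A where A: "finite A" and fA: "\<And>\<eta> \<xi>. (\<forall>x\<in>A. \<eta> x = \<xi> x) \<Longrightarrow> f \<eta> = f \<xi>"
    using assms unfolding local_fun_def by blast
  have "f \<eta> \<in> f ` (\<lambda>B x. x \<in> B) ` Pow A" for \<eta>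
  proof -
    have "f \<eta> = f (\<lambda>x. x \<in> {x\<in>A. \<eta> x})" by (rule fA) auto
    then show ?thesis by blast
  qed
  then have "range f \<subseteq> f ` (\<lambda>B x. x \<in> B) ` Pow A" by blast
  then have bd: "bounded (range f)" using A by (meson finite_Pow_iff finite_imageI finite_imp_bounded finite_subset)
  have "(f \<longlongrightarrow> f \<eta>) (at \<eta>)" for \<eta>
  proof -
    have "open ((\<lambda>\<xi>. \<xi> x) -` {\<eta> x})" for x
      using discrete_topology_class.open_discrete[of "{\<eta> x}"] by (intro open_vimage) auto
    then have "open (\<Inter>x\<in>A. (\<lambda>\<xi>. \<xi> x) -` {\<eta> x})" using A by (intro open_INT) auto
    then have "eventually (\<lambda>\<xi>. \<xi> \<in> (\<Inter>x\<in>A. (\<lambda>\<xi>. \<xi> x) -` {\<eta> x})) (at \<eta>)"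
      by (rule eventually_at_in_open') auto
    then have "eventually (\<lambda>\<xi>. f \<xi> = f \<eta>) (at \<eta>)"
      by eventually_elim (auto intro!: fA)
    then show ?thesis by (rule tendsto_eventually)
  qed
  then have "continuous_on UNIV f" by (simp add: continuous_on_def)
  then show ?thesis using bd by (simp add: bcontfun_def)
qed

section \<open>Exchanges of two sites as operators on continuous functions\<close>

lemma exchange_commute: "exchange \<eta> x z = exchange \<eta> z x"
  by (simp add: exchange_def fun_eq_iff)

lemma exchange_exchange: "exchange (exchange \<eta> x z) x z = \<eta>"
  by (auto simp: exchange_def)

lemma exchange_apply: "exchange \<eta> x z y = \<eta> (Transposition.transpose x z y)"
  by (auto simp: exchange_def Transposition.transpose_def)

lemma exchange_eq: "\<eta> x = \<eta> z \<Longrightarrow> exchange \<eta> x z = \<eta>"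
  by (simp add: exchange_def fun_eq_iff)

lemma continuous_on_exchange: "continuous_on UNIV (\<lambda>\<eta> :: 'd::finite config. exchange \<eta> x z)"
  by (rule continuous_on_coordinatewise_then_product)
     (simp add: exchange_apply continuous_on_product_coordinates)

definition swapC :: "int ^ 'd \<Rightarrow> int ^ 'd \<Rightarrow> ('d::finite config \<Rightarrow>\<^sub>C real) \<Rightarrow> ('d config \<Rightarrow>\<^sub>C real)" where
  "swapC x z g = Bcontfun (\<lambda>\<eta>. apply_bcontfun g (exchange \<eta> x z))"

lemma apply_swapC: "apply_bcontfun (swapC x z g) \<eta> = apply_bcontfun g (exchange \<eta> x z)"
proof -
  have "(\<lambda>\<eta>. apply_bcontfun g (exchange \<eta> x z)) \<in> bcontfun"
    by (rule bcontfun_normI[where b = "norm g"])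
       (auto intro!: abs_apply_bcontfun_le continuous_on_compose2[OF _ continuous_on_exchange])
  then show ?thesis by (simp add: swapC_def Bcontfun_inverse)
qed

lemma norm_swapC: "norm (swapC x z g) \<le> norm g"
  by (rule norm_bound) (simp add: apply_swapC abs_apply_bcontfun_le)

lemma bounded_linear_apply_bcontfun: "bounded_linear (\<lambda>g :: 'a::topological_space \<Rightarrow>\<^sub>C real. apply_bcontfun g x)"
  by (rule bounded_linear_intro[where K = 1])
     (auto simp: plus_bcontfun.rep_eq scaleR_bcontfun.rep_eq abs_apply_bcontfun_le)

section \<open>The generator as a norm-convergent series of exchanges\<close>

locale symmetric_kernel =
  fixes s :: "int ^ 'd::finite \<Rightarrow> real"
  assumes nonneg: "\<And>y. 0 \<le> s y"
    and symm: "\<And>y. s (- y) = s y"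
    and has_sum_one: "(s has_sum 1) UNIV"
begin

lemma symm': "s (x - z) = s (z - x)"
  using symm[of "z - x"] by simp

lemma has_sum_shift: "((\<lambda>z. s (z - x)) has_sum 1) UNIV"
proof -
  have "bij_betw (\<lambda>z. z - x) UNIV UNIV"
    by (rule bij_betwI[where g = "\<lambda>z. z + x"]) auto
  from has_sum_reindex_bij_betw[OF this, of s 1] show ?thesis using has_sum_one by simp
qed

lemma summable_shift: "(\<lambda>z. s (z - x)) summable_on B"
  using has_sum_shift summable_on_subset_banach has_sum_imp_summable by blast

lemma infsum_shift_le: "(\<Sum>\<^sub>\<infinity>z\<in>B. s (z - x)) \<le> 1"
proof -
  have "(\<Sum>\<^sub>\<infinity>z\<in>B. s (z - x)) \<le> (\<Sum>\<^sub>\<infinity>z\<in>UNIV. s (z - x))"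
    by (rule infsum_mono2) (auto simp: summable_shift nonneg)
  then show ?thesis using has_sum_shift[of x] by (simp add: infsumI)
qed

lemma summable_shift_bounded:
  fixes w :: "_ \<Rightarrow> 'b::banach"
  assumes "\<And>z. z \<in> B \<Longrightarrow> norm (w z) \<le> M"
  shows "(\<lambda>z. s (z - x) *\<^sub>R w z) summable_on B"
proof (rule abs_summable_summable, rule summable_on_comparison_test)
  show "(\<lambda>z. M * s (z - x)) summable_on B" by (intro summable_on_cmult_right summable_shift)
qed (use assms nonneg in \<open>auto simp: mult.commute[of "s _"] intro!: mult_right_mono\<close>)

lemma summable_pairs:
  assumes "finite A"
  shows "(\<lambda>(x, z). s (z - x)) summable_on (A \<times> UNIV \<union> UNIV \<times> A)"
proof -
  have a: "(\<lambda>(x, z). s (z - x)) summable_on (Sigma A (\<lambda>_. UNIV))"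
    using assms summable_shift nonneg
    by (intro summable_on_SigmaI[where g = "\<lambda>x. \<Sum>\<^sub>\<infinity>z. s (z - x)"]) (auto simp: has_sum_infsum)
  have "(\<lambda>(x, z). s (z - x)) summable_on (UNIV \<times> A)"
    by (subst summable_on_swap)
       (use a in \<open>simp add: case_prod_unfold symm'\<close>)
  then show ?thesis using a by (intro summable_on_union) auto
qed

text \<open>The stirring form of the generator: for symmetric \<open>s\<close> the two directed
  jumps across a bond combine into an exchange at rate \<open>s (z - x)\<close> that ignores
  occupation. Each bond occurs twice among the ordered pairs, whence the factor 1/2. In this form
  self-adjointness and the action on products can be read off from single exchanges.\<close>

definition genC :: "('d config \<Rightarrow>\<^sub>C real) \<Rightarrow> ('d config \<Rightarrow>\<^sub>C real)" where
  "genC g = (\<Sum>\<^sub>\<infinity>(x, z)\<in>UNIV. (s (z - x) / 2) *\<^sub>R (swapC x z g - g))"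

text \<open>Exchanges that miss the finite support leave \<open>g\<close> unchanged, and the rates
  of the bonds meeting the support are summable.\<close>

lemma summable_genC:
  assumes "local_fun (apply_bcontfun g)"
  shows "(\<lambda>(x, z). (s (z - x) / 2) *\<^sub>R (swapC x z g - g)) summable_on UNIV"
proof -
  obtain A where A: "finite A" and gA: "\<And>\<eta> \<xi>. (\<forall>x\<in>A. \<eta> x = \<xi> x) \<Longrightarrow> apply_bcontfun g \<eta> = apply_bcontfun g \<xi>"
    using assms unfolding local_fun_def by blast
  have z: "swapC x z g = g" if "x \<notin> A" "z \<notin> A" for x z
    by (rule bcontfun_eqI, unfold apply_swapC, rule gA) (use that in \<open>auto simp: exchange_def\<close>)
  have "(\<lambda>(x, z). (s (z - x) / 2) *\<^sub>R (swapC x z g - g)) summable_on (A \<times> UNIV \<union> UNIV \<times> A)"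
  proof (rule abs_summable_summable, rule summable_on_comparison_test)
    show "(\<lambda>p. norm g * (case p of (x, z) \<Rightarrow> s (z - x))) summable_on (A \<times> UNIV \<union> UNIV \<times> A)"
      by (intro summable_on_cmult_right summable_pairs A)
    show "norm (case p of (x, z) \<Rightarrow> (s (z - x) / 2) *\<^sub>R (swapC x z g - g))
        \<le> norm g * (case p of (x, z) \<Rightarrow> s (z - x))" for p
    proof (cases p)
      case (Pair x z)
      have "norm (swapC x z g - g) \<le> 2 * norm g"
        using norm_triangle_ineq4[of "swapC x z g" g] norm_swapC[of x z g] by simp
      then have "s (z - x) * norm (swapC x z g - g) \<le> s (z - x) * (2 * norm g)"
        by (rule mult_left_mono[OF _ nonneg])
      then show ?thesis using Pair nonneg by (simp add: mult_ac)
    qed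
  qed auto
  moreover have "(s (z - x) / 2) *\<^sub>R (swapC x z g - g) = 0" if "(x, z) \<notin> A \<times> UNIV \<union> UNIV \<times> A" for x z
    using z[of x z] that by simp
  ultimately show ?thesis
    by (subst summable_on_cong_neutral[of "A \<times> UNIV \<union> UNIV \<times> A"]) (auto split: prod.splits)
qed

lemma has_sum_genC:
  assumes "local_fun (apply_bcontfun g)"
  shows "((\<lambda>(x, z). (s (z - x) / 2) *\<^sub>R (swapC x z g - g)) has_sum genC g) UNIV"
  unfolding genC_def by (rule has_sum_infsum[OF summable_genC[OF assms]])

text \<open>Adding the contributions of a bond in both orders removes the occupation factors: if
  exactly one end is occupied, one order counts, and otherwise the exchange changes nothing. The
  jump form is indexed by displacements, hence the final change of variables.\<close>

lemma apply_genC: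
  assumes "local_fun (apply_bcontfun g)"
  shows "apply_bcontfun (genC g) = exclusion_gen s (apply_bcontfun g)"
proof
  fix \<eta>
  define \<Delta> where "\<Delta> = (\<lambda>(x, z). s (z - x) * (apply_bcontfun g (exchange \<eta> x z) - apply_bcontfun g \<eta>))"
  define T where "T = (\<lambda>(x, z). s (z - x) * of_bool (\<eta> x) * (1 - of_bool (\<eta> z)) *
     (apply_bcontfun g (exchange \<eta> x z) - apply_bcontfun g \<eta>))"
  have hs: "((\<lambda>p. \<Delta> p / 2) has_sum apply_bcontfun (genC g) \<eta>) UNIV"
    using has_sum_bounded_linear[OF bounded_linear_apply_bcontfun[of \<eta>] has_sum_genC[OF assms]]
    by (simp add: \<Delta>_def case_prod_unfold scaleR_bcontfun.rep_eq minus_bcontfun.rep_eq apply_swapC o_def)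
  then have "(\<lambda>p. \<Delta> p / 2) summable_on UNIV" by (rule has_sum_imp_summable)
  then have "\<Delta> summable_on UNIV" using summable_on_cmult_right[of "\<lambda>p. \<Delta> p / 2" UNIV 2] by simp
  then have "T summable_on UNIV"
  proof (intro abs_summable_summable[of T], elim summable_on_comparison_test[OF summable_on_iff_abs_summable_on_real[THEN iffD1]])
    show "norm (T p) \<le> norm (\<Delta> p)" for p
      by (cases p) (auto simp: T_def \<Delta>_def abs_mult of_bool_def)
  qed simp
  then obtain c where c: "(T has_sum c) UNIV" by (auto simp: summable_on_def)
  have c': "((\<lambda>p. T (prod.swap p)) has_sum c) UNIV"
    using has_sum_reindex_bij_betw[OF bij_swap, of T c] c by simp
  have "T p + T (prod.swap p) = \<Delta> p" for p
  proof -
    obtain x z where p: "p = (x, z)" by force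
    show ?thesis using exchange_eq[of \<eta> x z] symm'[of x z]
      by (cases "\<eta> x"; cases "\<eta> z") (auto simp: p T_def \<Delta>_def exchange_commute[of \<eta> z x])
  qed
  then have "((\<lambda>p. \<Delta> p / 2) has_sum (c + c) / 2) UNIV"
    using has_sum_divide_const[OF has_sum_add[OF c c'], of 2] by simp
  with hs have eq: "apply_bcontfun (genC g) \<eta> = c" using has_sum_unique by fastforce
  have bij: "bij_betw (\<lambda>(x, y). (x, x + y)) UNIV (UNIV :: ((int ^ 'd) \<times> (int ^ 'd)) set)"
    by (rule bij_betwI[where g = "\<lambda>(x, z). (x, z - x)"]) auto
  have "exclusion_gen s (apply_bcontfun g) \<eta> = (\<Sum>\<^sub>\<infinity>p\<in>UNIV. T (case p of (x, y) \<Rightarrow> (x, x + y)))"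
    unfolding exclusion_gen_def T_def by (simp add: case_prod_unfold)
  also have "\<dots> = infsum T UNIV" by (rule infsum_reindex_bij_betw[OF bij])
  also have "\<dots> = c" using c by (rule infsumI)
  finally show "apply_bcontfun (genC g) \<eta> = exclusion_gen s (apply_bcontfun g) \<eta>" using eq by simp
qed

end

section \<open>Products over finite sets of sites and their dual motion\<close>

definition prodC :: "(bool \<Rightarrow> real) \<Rightarrow> (int ^ 'd) set \<Rightarrow> ('d::finite config \<Rightarrow>\<^sub>C real)" where
  "prodC \<phi> A = Bcontfun (\<lambda>\<eta>. \<Prod>x\<in>A. \<phi> (\<eta> x))"

lemma local_prod: "local_fun (\<lambda>\<eta> :: 'd config. \<Prod>x\<in>A. (\<phi> (\<eta> x) :: real))"
proof (cases "finite A")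
  case True
  then show ?thesis by (rule local_funI) (auto intro: prod.cong)
qed (auto intro: local_funI[of "{}"])

lemma apply_prodC: "apply_bcontfun (prodC \<phi> A) \<eta> = (\<Prod>x\<in>A. \<phi> (\<eta> x))"
  unfolding prodC_def by (subst Bcontfun_inverse) (auto intro: local_fun_bcontfun local_prod)

lemma local_prodC: "local_fun (apply_bcontfun (prodC \<phi> A))"
  using local_prod[of \<phi> A] by (simp add: apply_prodC[abs_def])

lemma norm_prodC_le:
  assumes "\<And>b. \<bar>\<phi> b\<bar> \<le> 1"
  shows "norm (prodC \<phi> A) \<le> 1"
  by (rule norm_bound) (use assms in \<open>auto simp: apply_prodC abs_prod intro: prod_le_1\<close>)

lemma swapC_prodC_out:
  assumes "x \<in> A \<longleftrightarrow> z \<in> A"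
  shows "swapC x z (prodC \<phi> A) = prodC \<phi> A"
proof (rule bcontfun_eqI)
  fix \<eta>
  have "Transposition.transpose x z ` A = A" using assms by (rule Transposition.transpose_image_eq)
  then have "bij_betw (Transposition.transpose x z) A A" by (auto simp: bij_betw_def)
  then show "apply_bcontfun (swapC x z (prodC \<phi> A)) \<eta> = apply_bcontfun (prodC \<phi> A) \<eta>"
    unfolding apply_swapC apply_prodC exchange_apply by (rule prod.reindex_bij_betw)
qed

lemma swapC_prodC:
  assumes "x \<in> A" "z \<notin> A"
  shows "swapC x z (prodC \<phi> A) = prodC \<phi> (insert z (A - {x}))"
proof (rule bcontfun_eqI)
  fix \<eta>
  have "bij_betw (Transposition.transpose x z) A (insert z (A - {x}))"
    unfolding bij_betw_def using assms by (auto simp: image_iff Transposition.transpose_def inj_on_def)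
  then show "apply_bcontfun (swapC x z (prodC \<phi> A)) \<eta> = apply_bcontfun (prodC \<phi> (insert z (A - {x}))) \<eta>"
    unfolding apply_swapC apply_prodC exchange_apply by (rule prod.reindex_bij_betw)
qed

text \<open>Only bonds with exactly one end in \<open>A\<close> act on the product, and they carry
  that site to the other end. The generator thus acts on the index set as exclusion of
  \<open>card A\<close> particles; the two orders of a bond absorb the factor 1/2.\<close>

lemma (in symmetric_kernel) genC_prodC:
  assumes A: "finite A"
  shows "genC (prodC \<phi> A) =
    (\<Sum>x\<in>A. \<Sum>\<^sub>\<infinity>z\<in>-A. s (z - x) *\<^sub>R (prodC \<phi> (insert z (A - {x})) - prodC \<phi> A))"
proof -
  define t where "t = (\<lambda>(x, z). (s (z - x) / 2) *\<^sub>R (swapC x z (prodC \<phi> A) - prodC \<phi> A))"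
  have sm: "t summable_on B" for B
    using summable_genC[OF local_prodC, of \<phi> A] summable_on_subset_banach unfolding t_def by blast
  have "genC (prodC \<phi> A) = infsum t UNIV" unfolding genC_def t_def ..
  also have "\<dots> = infsum t (A \<times> (-A) \<union> (-A) \<times> A)"
  proof (rule infsum_cong_neutral)
    have "t (x, z) = 0" if "x \<in> A \<longleftrightarrow> z \<in> A" for x z
      using swapC_prodC_out[OF that] by (simp add: t_def)
    then show "t p = 0" if "p \<in> UNIV - (A \<times> (-A) \<union> (-A) \<times> A)" for p using that by (cases p) auto
  qed auto
  also have "\<dots> = infsum t (A \<times> (-A)) + infsum t ((-A) \<times> A)"
    by (rule infsum_Un_disjoint) (auto simp: sm)
  also have "infsum t ((-A) \<times> A) = infsum t (A \<times> (-A))"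
  proof -
    have "bij_betw prod.swap (A \<times> (-A)) ((-A) \<times> A)" by (auto simp: bij_betw_def inj_on_def)
    then have "infsum t ((-A) \<times> A) = infsum (\<lambda>p. t (prod.swap p)) (A \<times> (-A))"
      by (rule infsum_reindex_bij_betw[symmetric])
    moreover have "t (prod.swap p) = t p" for p
    proof -
      obtain x z where p: "p = (x, z)" by force
      have "swapC x z (prodC \<phi> A) = swapC z x (prodC \<phi> A)"
        by (simp add: swapC_def exchange_commute)
      then show ?thesis by (simp add: p t_def symm'[of x z])
    qed
    ultimately show ?thesis by simp
  qed
  also have "infsum t (A \<times> (-A)) = (\<Sum>x\<in>A. \<Sum>\<^sub>\<infinity>z\<in>-A. t (x, z))"
    using infsum_Sigma_banach[where A = A and B = "\<lambda>_. -A", OF sm] A by simp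
  also have "(\<Sum>x\<in>A. \<Sum>\<^sub>\<infinity>z\<in>-A. t (x, z)) + (\<Sum>x\<in>A. \<Sum>\<^sub>\<infinity>z\<in>-A. t (x, z)) = (\<Sum>x\<in>A. 2 *\<^sub>R (\<Sum>\<^sub>\<infinity>z\<in>-A. t (x, z)))"
    by (simp add: sum.distrib scaleR_2)
  also have "\<dots> = (\<Sum>x\<in>A. \<Sum>\<^sub>\<infinity>z\<in>-A. s (z - x) *\<^sub>R (prodC \<phi> (insert z (A - {x})) - prodC \<phi> A))"
  proof (rule sum.cong[OF refl])
    fix x assume x: "x \<in> A"
    have "2 *\<^sub>R (\<Sum>\<^sub>\<infinity>z\<in>-A. t (x, z)) = (\<Sum>\<^sub>\<infinity>z\<in>-A. 2 *\<^sub>R t (x, z))"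
      by (simp add: infsum_scaleR_right)
    also have "\<dots> = (\<Sum>\<^sub>\<infinity>z\<in>-A. s (z - x) *\<^sub>R (prodC \<phi> (insert z (A - {x})) - prodC \<phi> A))"
      by (rule infsum_cong) (simp add: t_def swapC_prodC x)
    finally show "2 *\<^sub>R (\<Sum>\<^sub>\<infinity>z\<in>-A. t (x, z)) = \<dots>" .
  qed
  finally show ?thesis .
qed

section \<open>Integration with respect to product measures\<close>

text \<open>A countable base on \<open>bool\<close> identifies the product sigma-algebra on
  configurations with the Borel sets, so continuous functions become measurable.\<close>

instance bool :: second_countable_topology
proof
  have "(open :: bool set \<Rightarrow> bool) = generate_topology UNIV"
    by (auto simp: fun_eq_iff discrete_topology_class.open_discrete intro: generate_topology.Basis)
  then show "\<exists>B :: bool set set. countable B \<and> open = generate_topology B"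
    by (intro exI[of _ UNIV]) (auto intro: countable_finite)
qed

lemma sets_config_space: "sets (config_space :: 'd::finite config measure) = sets borel"
proof -
  have "sets (config_space :: 'd config measure) = sets (PiM UNIV (\<lambda>_. borel))"
    by (intro sets_PiM_cong) (auto simp: sets_borel_eq_count_space)
  then show ?thesis using sets_PiM_equal_borel[where 'a = "int ^ 'd" and 'b = bool] by simp
qed

lemma borel_measurable_bcontfun:
  fixes g :: "'d::finite config \<Rightarrow>\<^sub>C real"
  assumes "sets \<nu> = sets config_space"
  shows "apply_bcontfun g \<in> borel_measurable \<nu>"
proof -
  have "apply_bcontfun g \<in> borel_measurable borel" by (rule borel_measurable_continuous_onI) simp
  then show ?thesis using assms sets_config_space measurable_cong_sets by blast
qed

lemma integrable_bcontfun:
  fixes g :: "'d::finite config \<Rightarrow>\<^sub>C real"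
  assumes "prob_space \<nu>" and sets: "sets \<nu> = sets config_space"
  shows "integrable \<nu> (apply_bcontfun g)"
proof -
  interpret prob_space \<nu> by fact
  show ?thesis
    using borel_measurable_bcontfun[OF sets] abs_apply_bcontfun_le
    by (intro integrable_const_bound[where B = "norm g"]) auto
qed

lemma integrable_bcontfun_mult:
  fixes g h :: "'d::finite config \<Rightarrow>\<^sub>C real"
  assumes "prob_space \<nu>" and sets: "sets \<nu> = sets config_space"
  shows "integrable \<nu> (\<lambda>\<eta>. apply_bcontfun g \<eta> * apply_bcontfun h \<eta>)"
proof -
  interpret prob_space \<nu> by fact
  show ?thesis
    using borel_measurable_bcontfun[OF sets]
    by (intro integrable_const_bound[where B = "norm g * norm h"])
       (auto simp: abs_mult intro!: mult_mono abs_apply_bcontfun_le)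
qed

section \<open>The scalar product of the Bernoulli measure and centred products\<close>

definition ip :: "'d::finite config measure \<Rightarrow> ('d config \<Rightarrow>\<^sub>C real) \<Rightarrow> ('d config \<Rightarrow>\<^sub>C real) \<Rightarrow> real" where
  "ip \<nu> g h = (\<integral>\<eta>. apply_bcontfun g \<eta> * apply_bcontfun h \<eta> \<partial>\<nu>)"

lemma bounded_bilinear_ip:
  assumes "prob_space \<nu>" and sets: "sets \<nu> = sets (config_space :: 'd::finite config measure)"
  shows "bounded_bilinear (ip \<nu>)"
proof -
  interpret prob_space \<nu> by fact
  note int = integrable_bcontfun_mult[OF assms]
  show ?thesis
  proof
    fix a a' b b' :: "'d config \<Rightarrow>\<^sub>C real" and r :: real
    show "ip \<nu> (a + a') b = ip \<nu> a b + ip \<nu> a' b"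
      using int by (simp add: ip_def plus_bcontfun.rep_eq distrib_right)
    show "ip \<nu> a (b + b') = ip \<nu> a b + ip \<nu> a b'"
      using int by (simp add: ip_def plus_bcontfun.rep_eq distrib_left)
    show "ip \<nu> (r *\<^sub>R a) b = r *\<^sub>R ip \<nu> a b"
      by (simp add: ip_def scaleR_bcontfun.rep_eq mult.assoc)
    show "ip \<nu> a (r *\<^sub>R b) = r *\<^sub>R ip \<nu> a b"
      by (simp add: ip_def scaleR_bcontfun.rep_eq mult.left_commute)
    show "\<exists>K. \<forall>a b. norm (ip \<nu> a b) \<le> norm a * norm b * K"
    proof (intro exI[of _ 1] allI)
      fix a b :: "'d config \<Rightarrow>\<^sub>C real"
      have "norm (ip \<nu> a b) \<le> (\<integral>\<eta>. norm (apply_bcontfun a \<eta> * apply_bcontfun b \<eta>) \<partial>\<nu>)"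
        unfolding ip_def by (rule integral_norm_bound)
      also have "\<dots> \<le> (\<integral>\<eta>. norm a * norm b \<partial>\<nu>)"
        using int[of a b] abs_apply_bcontfun_le[of a] abs_apply_bcontfun_le[of b]
        by (intro integral_mono integrable_norm) (auto simp: abs_mult intro!: mult_mono)
      finally show "norm (ip \<nu> a b) \<le> norm a * norm b * 1" by (simp add: prob_space)
    qed
  qed
qed

lemma sets_bernoulli_product: "sets (bernoulli_product \<rho>) = sets config_space"
  unfolding bernoulli_product_def by (intro sets_PiM_cong) auto

lemma space_bernoulli_product [simp]: "space (bernoulli_product \<rho>) = UNIV"
  by (simp add: bernoulli_product_def space_PiM)

lemma prob_space_bernoulli_product: "prob_space (bernoulli_product \<rho>)"
  unfolding bernoulli_product_def by (intro prob_space_PiM prob_space_measure_pmf)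

lemma distr_bernoulli_exchange:
  "distr (bernoulli_product \<rho>) (bernoulli_product \<rho>) (\<lambda>\<eta>. exchange \<eta> x z) = bernoulli_product \<rho>"
proof -
  have "distr (PiM UNIV (\<lambda>_. measure_pmf (bernoulli_pmf \<rho>))) (PiM UNIV (\<lambda>i. (\<lambda>_. measure_pmf (bernoulli_pmf \<rho>)) (Transposition.transpose x z i)))
     (\<lambda>\<eta>. \<lambda>n\<in>UNIV. \<eta> (Transposition.transpose x z n)) = PiM UNIV (\<lambda>i. (\<lambda>_. measure_pmf (bernoulli_pmf \<rho>)) (Transposition.transpose x z i))"
    by (rule distr_PiM_reindex) (auto simp: prob_space_measure_pmf)
  then show ?thesis by (simp add: bernoulli_product_def exchange_apply[abs_def] restrict_def)
qed

lemma integral_bernoulli_exchange: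
  fixes F :: "'d::finite config \<Rightarrow> real"
  assumes F: "F \<in> borel_measurable (bernoulli_product \<rho>)"
  shows "(\<integral>\<eta>. F (exchange \<eta> x z) \<partial>bernoulli_product \<rho>) = (\<integral>\<eta>. F \<eta> \<partial>bernoulli_product \<rho>)"
proof -
  have "(\<lambda>\<eta> :: 'd config. exchange \<eta> x z) \<in> measurable borel borel"
    by (rule borel_measurable_continuous_onI[OF continuous_on_exchange])
  then have m: "(\<lambda>\<eta> :: 'd config. exchange \<eta> x z) \<in> measurable (bernoulli_product \<rho>) (bernoulli_product \<rho>)"
    using sets_bernoulli_product sets_config_space measurable_cong_sets by blast
  show ?thesis
    by (subst (2) distr_bernoulli_exchange[symmetric, of _ x z], subst integral_distr[OF m]) (simp_all add: F)
qed

lemma integral_bernoulli_prod: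
  fixes A :: "(int ^ 'd::finite) set" and h :: "_ \<Rightarrow> _ \<Rightarrow> real"
  assumes A: "finite A" and z: "0 \<le> z" "z \<le> 1"
  shows "(\<integral>\<eta>. (\<Prod>x\<in>A. h x (\<eta> x)) \<partial>bernoulli_product z) = (\<Prod>x\<in>A. z * h x True + (1 - z) * h x False)"
proof -
  let ?B = "measure_pmf (bernoulli_pmf z)"
  interpret product_prob_space "\<lambda>_::int ^ 'd. ?B" UNIV
    by unfold_locales
  have "(\<integral>\<eta>. (\<Prod>x\<in>A. h x (\<eta> x)) \<partial>bernoulli_product z)
      = (\<integral>\<eta>. (\<Prod>x\<in>A. h x (restrict \<eta> A x)) \<partial>bernoulli_product z)"
    by (intro Bochner_Integration.integral_cong prod.cong) auto
  also have "\<dots> = (\<integral>\<eta>. (\<Prod>x\<in>A. h x (\<eta> x)) \<partial>distr (bernoulli_product z) (PiM A (\<lambda>_. ?B)) (\<lambda>\<eta>. restrict \<eta> A))"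
    unfolding bernoulli_product_def
  proof (rule integral_distr[symmetric])
    show "(\<lambda>\<eta>. restrict \<eta> A) \<in> measurable (PiM UNIV (\<lambda>_. ?B)) (PiM A (\<lambda>_. ?B))"
      by (rule measurable_restrict_subset) simp
  qed (auto intro!: borel_measurable_prod measurable_compose[OF measurable_component_singleton])
  also have "distr (bernoulli_product z) (PiM A (\<lambda>_. ?B)) (\<lambda>\<eta>. restrict \<eta> A) = PiM A (\<lambda>_. ?B)"
    unfolding bernoulli_product_def by (rule distr_PiM_restrict_finite) (use A in \<open>auto intro: prob_space_measure_pmf\<close>)
  also have "(\<integral>\<eta>. (\<Prod>x\<in>A. h x (\<eta> x)) \<partial>PiM A (\<lambda>_. ?B)) = (\<Prod>x\<in>A. \<integral>b. h x b \<partial>?B)"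
    by (rule product_integral_prod[OF A]) (auto intro!: integrable_measure_pmf_finite)
  also have "\<dots> = (\<Prod>x\<in>A. z * h x True + (1 - z) * h x False)"
    using z by (intro prod.cong) auto
  finally show ?thesis .
qed

text \<open>Sites are independent and centred: a site lying in only one of the two sets contributes
  a factor 0, a common site its variance \<open>\<rho> * (1 - \<rho>)\<close>.\<close>

lemma ip_bernoulli_prodC:
  assumes A: "finite A" "finite B" and \<rho>: "0 \<le> \<rho>" "\<rho> \<le> 1"
  defines "\<psi> \<equiv> (\<lambda>b. of_bool b - \<rho>)"
  shows "ip (bernoulli_product \<rho>) (prodC \<psi> A) (prodC \<psi> B) = (if A = B then (\<rho> * (1 - \<rho>)) ^ card A else 0)"
proof -
  define h where "h x b = (if x \<in> A then \<psi> b else 1) * (if x \<in> B then \<psi> b else 1)" for x b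
  have "ip (bernoulli_product \<rho>) (prodC \<psi> A) (prodC \<psi> B) = (\<integral>\<eta>. (\<Prod>x\<in>A\<union>B. h x (\<eta> x)) \<partial>bernoulli_product \<rho>)"
    unfolding ip_def
  proof (rule Bochner_Integration.integral_cong[OF refl])
    fix \<eta> :: "'a config"
    have "(\<Prod>x\<in>A. \<psi> (\<eta> x)) = (\<Prod>x\<in>A\<union>B. if x \<in> A then \<psi> (\<eta> x) else 1)"
      by (rule prod.mono_neutral_cong_left) (use A in auto)
    moreover have "(\<Prod>x\<in>B. \<psi> (\<eta> x)) = (\<Prod>x\<in>A\<union>B. if x \<in> B then \<psi> (\<eta> x) else 1)"
      by (rule prod.mono_neutral_cong_left) (use A in auto)
    ultimately show "apply_bcontfun (prodC \<psi> A) \<eta> * apply_bcontfun (prodC \<psi> B) \<eta> = (\<Prod>x\<in>A\<union>B. h x (\<eta> x))"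
      by (simp add: apply_prodC h_def prod.distrib)
  qed
  also have "\<dots> = (\<Prod>x\<in>A\<union>B. \<rho> * h x True + (1 - \<rho>) * h x False)"
    by (rule integral_bernoulli_prod) (use A \<rho> in auto)
  also have "\<dots> = (\<Prod>x\<in>A\<union>B. if x \<in> A \<and> x \<in> B then \<rho> * (1 - \<rho>) else 0)"
    by (intro prod.cong) (auto simp: h_def \<psi>_def algebra_simps)
  also have "\<dots> = (if A = B then (\<rho> * (1 - \<rho>)) ^ card A else 0)"
  proof (cases "A = B")
    case False
    then obtain x where "x \<in> A \<union> B" "\<not> (x \<in> A \<and> x \<in> B)" by blast
    then have "(\<Prod>x\<in>A\<union>B. if x \<in> A \<and> x \<in> B then \<rho> * (1 - \<rho>) else 0) = 0"
      using A by (intro prod_zero) auto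
    then show ?thesis using False by simp
  qed simp
  finally show ?thesis .
qed

lemma local_fun_expand:
  fixes f :: "'d::finite config \<Rightarrow> real"
  assumes "local_fun f"
  obtains \<Lambda> c where "finite \<Lambda>" "\<And>\<eta>. f \<eta> = (\<Sum>A\<in>Pow \<Lambda>. c A * (\<Prod>x\<in>A. of_bool (\<eta> x) - \<rho>))"
proof -
  have ex: "\<exists>c. \<forall>\<eta>. f \<eta> = (\<Sum>A\<in>Pow \<Lambda>. c A * (\<Prod>x\<in>A. of_bool (\<eta> x) - \<rho>))"
    if "finite \<Lambda>" "\<And>\<eta> \<xi>. (\<forall>x\<in>\<Lambda>. \<eta> x = \<xi> x) \<Longrightarrow> f \<eta> = f \<xi>" for \<Lambda> and f :: "'d config \<Rightarrow> real"
    using that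
  proof (induction \<Lambda> arbitrary: f)
    case empty
    have "f \<eta> = f (\<lambda>_. False)" for \<eta> by (rule empty) simp
    then show ?case by (intro exI[of _ "\<lambda>_. f (\<lambda>_. False)"]) simp
  next
    case (insert y \<Lambda>)
    \<comment> \<open>Site \<open>y\<close> is split off: \<open>f\<close> is the mean over the
      value at \<open>y\<close> under density \<open>\<rho>\<close>, plus the centred value at
      \<open>y\<close> times the discrete derivative. Neither coefficient depends on
      \<open>y\<close>, so both expand over the smaller support.\<close>
    define f1 f0 where "f1 \<eta> = f (\<eta>(y := True))" and "f0 \<eta> = f (\<eta>(y := False))" for \<eta>
    have "\<exists>c. \<forall>\<eta>. \<rho> * f1 \<eta> + (1 - \<rho>) * f0 \<eta> = (\<Sum>A\<in>Pow \<Lambda>. c A * (\<Prod>x\<in>A. of_bool (\<eta> x) - \<rho>))"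
      by (rule insert.IH) (auto simp: f1_def f0_def intro!: arg_cong2[where f = "(+)"] arg_cong2[where f = "(*)"] insert.prems)
    then obtain c where c: "\<And>\<eta>. \<rho> * f1 \<eta> + (1 - \<rho>) * f0 \<eta> = (\<Sum>A\<in>Pow \<Lambda>. c A * (\<Prod>x\<in>A. of_bool (\<eta> x) - \<rho>))" by blast
    have "\<exists>c. \<forall>\<eta>. f1 \<eta> - f0 \<eta> = (\<Sum>A\<in>Pow \<Lambda>. c A * (\<Prod>x\<in>A. of_bool (\<eta> x) - \<rho>))"
      by (rule insert.IH) (auto simp: f1_def f0_def intro!: arg_cong2[where f = "(-)"] insert.prems)
    then obtain c' where c': "\<And>\<eta>. f1 \<eta> - f0 \<eta> = (\<Sum>A\<in>Pow \<Lambda>. c' A * (\<Prod>x\<in>A. of_bool (\<eta> x) - \<rho>))" by blast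
    have "f \<eta> = (\<Sum>A\<in>Pow (insert y \<Lambda>). (if y \<in> A then c' (A - {y}) else c A) * (\<Prod>x\<in>A. of_bool (\<eta> x) - \<rho>))" for \<eta>
    proof -
      have "\<eta>(y := \<eta> y) = \<eta>" by simp
      then have "f \<eta> = (\<rho> * f1 \<eta> + (1 - \<rho>) * f0 \<eta>) + (of_bool (\<eta> y) - \<rho>) * (f1 \<eta> - f0 \<eta>)"
        by (cases "\<eta> y") (auto simp: f1_def f0_def algebra_simps)
      also have "(of_bool (\<eta> y) - \<rho>) * (f1 \<eta> - f0 \<eta>)
        = (\<Sum>A\<in>Pow \<Lambda>. c' A * ((of_bool (\<eta> y) - \<rho>) * (\<Prod>x\<in>A. of_bool (\<eta> x) - \<rho>)))"
        unfolding c' sum_distrib_left by (intro sum.cong) auto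
      also have "\<dots> = (\<Sum>A\<in>Pow \<Lambda>. c' A * (\<Prod>x\<in>insert y A. of_bool (\<eta> x) - \<rho>))"
      proof (intro sum.cong refl arg_cong2[where f = "(*)"])
        fix A assume "A \<in> Pow \<Lambda>"
        then have "finite A" "y \<notin> A" using insert.hyps finite_subset by auto
        then show "(of_bool (\<eta> y) - \<rho>) * (\<Prod>x\<in>A. of_bool (\<eta> x) - \<rho>) = (\<Prod>x\<in>insert y A. of_bool (\<eta> x) - \<rho>)"
          by simp
      qed
      also have "\<dots> = (\<Sum>A\<in>insert y ` Pow \<Lambda>. c' (A - {y}) * (\<Prod>x\<in>A. of_bool (\<eta> x) - \<rho>))"
      proof (subst sum.reindex)
        show "inj_on (insert y) (Pow \<Lambda>)" using insert.hyps by (auto simp: inj_on_def)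
      qed (use insert.hyps in \<open>auto intro!: sum.cong arg_cong2[where f = "(*)"] arg_cong[where f = c']\<close>)
      also have "\<dots> = (\<Sum>A\<in>insert y ` Pow \<Lambda>. (if y \<in> A then c' (A - {y}) else c A) * (\<Prod>x\<in>A. of_bool (\<eta> x) - \<rho>))"
        by (intro sum.cong) auto
      also have "(\<rho> * f1 \<eta> + (1 - \<rho>) * f0 \<eta>) = (\<Sum>A\<in>Pow \<Lambda>. (if y \<in> A then c' (A - {y}) else c A) * (\<Prod>x\<in>A. of_bool (\<eta> x) - \<rho>))"
        unfolding c by (intro sum.cong) (use insert.hyps in auto)
      finally show ?thesis
        unfolding Pow_insert using insert.hyps by (subst sum.union_disjoint) auto
    qed
    then show ?case by (intro exI[of _ "\<lambda>A. if y \<in> A then c' (A - {y}) else c A"]) simp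
  qed
  obtain \<Lambda> where \<Lambda>: "finite \<Lambda>" "\<And>\<eta> \<xi>. (\<forall>x\<in>\<Lambda>. \<eta> x = \<xi> x) \<Longrightarrow> f \<eta> = f \<xi>"
    using assms unfolding local_fun_def by blast
  obtain c where "\<forall>\<eta>. f \<eta> = (\<Sum>A\<in>Pow \<Lambda>. c A * (\<Prod>x\<in>A. of_bool (\<eta> x) - \<rho>))"
    using ex[OF \<Lambda>] ..
  then show ?thesis by (intro that[OF \<Lambda>(1), of c]) simp
qed

text \<open>Under density \<open>z\<close> each centred site has mean \<open>z - \<rho>\<close>, so
  the mean of \<open>f\<close> is a polynomial in \<open>z - \<rho>\<close>. Its value and its
  derivative at \<open>\<rho>\<close> single out the empty set and the singletons.\<close>

lemma degree_one_coefficients: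
  fixes f :: "'d::finite config \<Rightarrow> real"
  assumes \<rho>: "0 < \<rho>" "\<rho> < 1" and \<Lambda>: "finite \<Lambda>" and deg: "degree_one \<rho> f"
    and f: "\<And>\<eta>. f \<eta> = (\<Sum>A\<in>Pow \<Lambda>. c A * (\<Prod>x\<in>A. of_bool (\<eta> x) - \<rho>))"
  shows "c {} = 0" "(\<Sum>x\<in>\<Lambda>. c {x}) \<noteq> 0"
proof -
  have mean: "bernoulli_mean f z = (\<Sum>A\<in>Pow \<Lambda>. c A * (z - \<rho>) ^ card A)" if z: "0 \<le> z" "z \<le> 1" for z
  proof -
    interpret prob_space "bernoulli_product z :: 'd config measure" by (rule prob_space_bernoulli_product)
    have "bernoulli_mean f z = (\<integral>\<eta>. (\<Sum>A\<in>Pow \<Lambda>. c A * apply_bcontfun (prodC (\<lambda>b. of_bool b - \<rho>) A) \<eta>) \<partial>bernoulli_product z)"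
      by (simp add: bernoulli_mean_def f apply_prodC)
    also have "\<dots> = (\<Sum>A\<in>Pow \<Lambda>. c A * (\<integral>\<eta>. apply_bcontfun (prodC (\<lambda>b. of_bool b - \<rho>) A) \<eta> \<partial>bernoulli_product z))"
      by (subst Bochner_Integration.integral_sum)
         (auto intro!: integrable_mult_right integrable_bcontfun sets_bernoulli_product prob_space_bernoulli_product)
    also have "\<dots> = (\<Sum>A\<in>Pow \<Lambda>. c A * (z - \<rho>) ^ card A)"
    proof (intro sum.cong refl arg_cong2[where f = "(*)"])
      fix A assume "A \<in> Pow \<Lambda>"
      then have "finite A" using \<Lambda> finite_subset by auto
      then show "(\<integral>\<eta>. apply_bcontfun (prodC (\<lambda>b. of_bool b - \<rho>) A) \<eta> \<partial>bernoulli_product z) = (z - \<rho>) ^ card A"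
        unfolding apply_prodC by (subst integral_bernoulli_prod[OF _ z]) (auto simp: algebra_simps)
    qed
    finally show ?thesis .
  qed
  have "(\<Sum>A\<in>Pow \<Lambda>. c A * (0::real) ^ card A) = (\<Sum>A\<in>{{}}. c A * (0::real) ^ card A)"
    by (rule sum.mono_neutral_right) (use \<Lambda> in \<open>auto dest: finite_subset simp: card_gt_0_iff power_0_left\<close>)
  then show "c {} = 0" using deg mean[of \<rho>] \<rho> by (simp add: degree_one_def)
  obtain D where D: "(bernoulli_mean f has_real_derivative D) (at \<rho>)" "D \<noteq> 0"
    using deg unfolding degree_one_def by blast
  have "((\<lambda>z. \<Sum>A\<in>Pow \<Lambda>. c A * (z - \<rho>) ^ card A) has_real_derivative D) (at \<rho>)"
    by (rule has_field_derivative_transform_within_open[OF D(1), of "{0<..<1}"]) (use \<rho> mean in auto)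
  moreover have "((\<lambda>z. \<Sum>A\<in>Pow \<Lambda>. c A * (z - \<rho>) ^ card A) has_real_derivative
     (\<Sum>A\<in>Pow \<Lambda>. c A * (real (card A) * (\<rho> - \<rho>) ^ (card A - 1)))) (at \<rho>)"
    by (auto intro!: derivative_eq_intros sum.cong)
  ultimately have "D = (\<Sum>A\<in>Pow \<Lambda>. c A * (real (card A) * (\<rho> - \<rho>) ^ (card A - 1)))"
    by (rule DERIV_unique)
  then have "D = (\<Sum>A\<in>Pow \<Lambda>. c A * (real (card A) * 0 ^ (card A - 1)))" by simp
  also have "\<dots> = (\<Sum>A\<in>(\<lambda>x. {x}) ` \<Lambda>. c A * (real (card A) * 0 ^ (card A - 1)))"
  proof (rule sum.mono_neutral_right)
    show "\<forall>A\<in>Pow \<Lambda> - (\<lambda>x. {x}) ` \<Lambda>. c A * (real (card A) * 0 ^ (card A - 1)) = 0"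
    proof
      fix A assume A: "A \<in> Pow \<Lambda> - (\<lambda>x. {x}) ` \<Lambda>"
      then have "card A \<noteq> 1" by (auto simp: card_1_singleton_iff)
      then show "c A * (real (card A) * 0 ^ (card A - 1)) = 0" by (cases "card A") auto
    qed
  qed (use \<Lambda> in auto)
  also have "\<dots> = (\<Sum>x\<in>\<Lambda>. c {x})" by (subst sum.reindex) auto
  finally show "(\<Sum>x\<in>\<Lambda>. c {x}) \<noteq> 0" using D by simp
qed

section \<open>Reversibility and duality\<close>

lemma has_sum_diff:
  fixes f g :: "'a \<Rightarrow> real"
  assumes "(f has_sum a) A" "(g has_sum b) A"
  shows "((\<lambda>x. f x - g x) has_sum (a - b)) A"
  using has_sum_add[OF assms(1) has_sum_uminusI[OF assms(2)]] by simp

context symmetric_kernel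
begin

lemma genC_graph:
  assumes "exclusion_semigroup s S" "local_fun (apply_bcontfun g)"
  shows "(g, genC g) \<in> generator_graph S"
  using assms apply_genC[OF assms(2)] closure_subset unfolding exclusion_semigroup_def by fastforce

text \<open>Each exchange operator is self-adjoint, being an involution that preserves the Bernoulli
  measure, and the bounded bilinear form passes through the norm-convergent series.\<close>

lemma ip_genC:
  assumes g: "local_fun (apply_bcontfun g)" and h: "local_fun (apply_bcontfun h)"
  shows "ip (bernoulli_product \<rho>) g (genC h) = ip (bernoulli_product \<rho>) (genC g) h"
proof -
  let ?ip = "ip (bernoulli_product \<rho>)"
  interpret bounded_bilinear ?ip
    by (rule bounded_bilinear_ip[OF prob_space_bernoulli_product sets_bernoulli_product])
  have swap: "?ip g (swapC x z h) = ?ip (swapC x z g) h" for x z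
  proof -
    have "?ip g (swapC x z h) = (\<integral>\<eta>. apply_bcontfun g (exchange \<eta> x z) * apply_bcontfun (swapC x z h) (exchange \<eta> x z) \<partial>bernoulli_product \<rho>)"
      unfolding ip_def
      by (rule integral_bernoulli_exchange[symmetric])
         (intro borel_measurable_times borel_measurable_bcontfun sets_bernoulli_product)
    then show ?thesis by (simp add: ip_def apply_swapC exchange_exchange)
  qed
  have "((\<lambda>p. ?ip g (case p of (x, z) \<Rightarrow> (s (z - x) / 2) *\<^sub>R (swapC x z h - h))) has_sum ?ip g (genC h)) UNIV"
    using has_sum_bounded_linear[OF bounded_linear_right has_sum_genC[OF h]] by (simp add: o_def)
  moreover have "((\<lambda>p. ?ip (case p of (x, z) \<Rightarrow> (s (z - x) / 2) *\<^sub>R (swapC x z g - g)) h) has_sum ?ip (genC g) h) UNIV"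
    using has_sum_bounded_linear[OF bounded_linear_left has_sum_genC[OF g]] by (simp add: o_def)
  moreover have "?ip g (case p of (x, z) \<Rightarrow> (s (z - x) / 2) *\<^sub>R (swapC x z h - h))
      = ?ip (case p of (x, z) \<Rightarrow> (s (z - x) / 2) *\<^sub>R (swapC x z g - g)) h" for p
    by (cases p) (simp add: scaleR_left scaleR_right diff_left diff_right swap)
  ultimately show ?thesis using has_sum_unique by fastforce
qed

text \<open>The graph is the closure of its local part, so symmetry is extended in one argument at a
  time: with the other pair fixed, the identity cuts out a closed set that contains the local
  graph.\<close>

lemma ip_generator_symmetric:
  assumes S: "exclusion_semigroup s S"
    and g: "(g, g') \<in> generator_graph S" and h: "(h, h') \<in> generator_graph S"
  shows "ip (bernoulli_product \<rho>) g h' = ip (bernoulli_product \<rho>) g' h"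
proof -
  let ?ip = "ip (bernoulli_product \<rho>)"
  define P where "P = {(g, h). local_fun (apply_bcontfun g) \<and> apply_bcontfun h = exclusion_gen s (apply_bcontfun g)}"
  have graph: "generator_graph S = closure P" using S unfolding exclusion_semigroup_def P_def by blast
  have P: "local_fun (apply_bcontfun g) \<and> h = genC g" if "(g, h) \<in> P" for g h
    using that apply_genC[of g] unfolding P_def by (auto simp: apply_bcontfun_inject[symmetric])
  note cont = bounded_bilinear.continuous_on[OF bounded_bilinear_ip[OF prob_space_bernoulli_product sets_bernoulli_product]]
  have 1: "?ip g k' = ?ip g' k" if k: "(k, k') \<in> P" for k k'
  proof -
    have "closed {q. ?ip (fst q) k' = ?ip (snd q) k}"
      by (intro closed_Collect_eq cont continuous_intros)
    moreover have "P \<subseteq> {q. ?ip (fst q) k' = ?ip (snd q) k}"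
      using k by (auto dest!: P intro: ip_genC)
    ultimately have "closure P \<subseteq> {q. ?ip (fst q) k' = ?ip (snd q) k}" by (rule closure_minimal[rotated])
    then show ?thesis using g graph by auto
  qed
  have "closed {q. ?ip g (snd q) = ?ip g' (fst q)}"
    by (intro closed_Collect_eq cont continuous_intros)
  moreover have "P \<subseteq> {q. ?ip g (snd q) = ?ip g' (fst q)}" using 1 by auto
  ultimately have "closure P \<subseteq> {q. ?ip g (snd q) = ?ip g' (fst q)}" by (rule closure_minimal[rotated])
  then show ?thesis using h graph by auto
qed

lemma ip_semigroup:
  assumes S: "exclusion_semigroup s S" and "t \<ge> 0"
    and "(g, g') \<in> generator_graph S" "(h, h') \<in> generator_graph S"
  shows "ip (bernoulli_product \<rho>) g (S t h) = ip (bernoulli_product \<rho>) (S t g) h"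
  using assms
  by (intro generator_symmetric_semigroup[of S "ip (bernoulli_product \<rho>)" g g' h h' t]
      bounded_bilinear_ip prob_space_bernoulli_product sets_bernoulli_product ip_generator_symmetric)
     (auto simp: exclusion_semigroup_def)

text \<open>Reversibility turns a correlation over time \<open>2 * t\<close> into a squared norm;
  this is the source of nonnegativity of the stationary correlations.\<close>

lemma ip_semigroup_square:
  assumes S: "exclusion_semigroup s S" and t: "t \<ge> 0" and g: "local_fun (apply_bcontfun g)"
  shows "ip (bernoulli_product \<rho>) g (S (2 * t) g) = ip (bernoulli_product \<rho>) (S t g) (S t g)"
proof -
  have M: "markov_semigroup S" using S by (simp add: exclusion_semigroup_def)
  then have "S (2 * t) g = S t (S t g)"
    using t unfolding markov_semigroup_def by (metis mult_2)
  then show ?thesis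
    using ip_semigroup[OF S t genC_graph[OF S g] markov_graph[OF M t genC_graph[OF S g]]] by simp
qed

text \<open>The backward generator of exclusion particles occupying the finite set \<open>A\<close>,
  acting on functions of the occupied set; jumps onto occupied sites are suppressed.\<close>

definition excl_rate :: "((int ^ 'd) set \<Rightarrow> real) \<Rightarrow> (int ^ 'd) set \<Rightarrow> real" where
  "excl_rate w A = (\<Sum>x\<in>A. \<Sum>\<^sub>\<infinity>z\<in>-A. s (z - x) * (w (insert z (A - {x})) - w A))"

lemma card_move:
  assumes "finite A" "card A = n" "x \<in> A" "z \<notin> A"
  shows "finite (insert z (A - {x}))" "card (insert z (A - {x})) = n"
  using assms by (auto simp: card_Diff_singleton card_gt_0_iff) (metis Suc_pred card_gt_0_iff empty_iff)

lemma summable_rate: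
  fixes w :: "(int ^ 'd) set \<Rightarrow> real"
  assumes A: "finite A" "card A = n" and x: "x \<in> A"
    and M: "\<And>B. finite B \<Longrightarrow> card B = n \<Longrightarrow> \<bar>w B\<bar> \<le> M"
  shows "(\<lambda>z. s (z - x) * (w (insert z (A - {x})) - w A)) summable_on (-A)"
proof -
  have "\<bar>w (insert z (A - {x})) - w A\<bar> \<le> M + M" if "z \<in> -A" for z
    using M[OF card_move[OF A x, of z]] M[OF A] that by auto
  then show ?thesis
    using summable_shift_bounded[of "-A" "\<lambda>z. w (insert z (A - {x})) - w A" "M + M" x] by simp
qed

lemma excl_rate_diff:
  fixes w v :: "(int ^ 'd) set \<Rightarrow> real"
  assumes A: "finite A" "card A = n"
    and M: "\<And>B. finite B \<Longrightarrow> card B = n \<Longrightarrow> \<bar>w B\<bar> \<le> M"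
    and N: "\<And>B. finite B \<Longrightarrow> card B = n \<Longrightarrow> \<bar>v B\<bar> \<le> N"
  shows "excl_rate (\<lambda>B. w B - v B) A = excl_rate w A - excl_rate v A"
  unfolding excl_rate_def sum_subtractf[symmetric]
proof (rule sum.cong[OF refl])
  fix x assume x: "x \<in> A"
  show "(\<Sum>\<^sub>\<infinity>z\<in>-A. s (z - x) * (w (insert z (A - {x})) - v (insert z (A - {x})) - (w A - v A)))
    = (\<Sum>\<^sub>\<infinity>z\<in>-A. s (z - x) * (w (insert z (A - {x})) - w A)) - (\<Sum>\<^sub>\<infinity>z\<in>-A. s (z - x) * (v (insert z (A - {x})) - v A))"
    using has_sum_diff[OF has_sum_infsum[OF summable_rate[OF A x M]] has_sum_infsum[OF summable_rate[OF A x N]]]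
    by (intro infsumI) (simp add: algebra_simps)
qed

text \<open>Each of the \<open>n\<close> particles jumps at total rate at most 1, because jumps onto
  occupied sites are dropped. Adding \<open>n * w A\<close> therefore leaves a combination of values
  of \<open>w\<close> on \<open>n\<close>-point sets with nonnegative weights of total
  \<open>n\<close>.\<close>

lemma excl_rate_lower:
  fixes w :: "(int ^ 'd) set \<Rightarrow> real"
  assumes A: "finite A" "card A = n"
    and M: "\<And>B. finite B \<Longrightarrow> card B = n \<Longrightarrow> \<bar>w B\<bar> \<le> M"
    and m: "\<And>B. finite B \<Longrightarrow> card B = n \<Longrightarrow> - m \<le> w B"
  shows "- real n * m \<le> excl_rate w A + real n * w A"
proof -
  have "- m \<le> (\<Sum>\<^sub>\<infinity>z\<in>-A. s (z - x) * (w (insert z (A - {x})) - w A)) + w A" if x: "x \<in> A" for x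
  proof -
    have "(\<Sum>\<^sub>\<infinity>z\<in>-A. - (w A + m) * s (z - x)) \<le> (\<Sum>\<^sub>\<infinity>z\<in>-A. s (z - x) * (w (insert z (A - {x})) - w A))"
    proof (rule infsum_mono)
      show "(\<lambda>z. - (w A + m) * s (z - x)) summable_on - A" by (intro summable_on_cmult_right summable_shift)
      show "(\<lambda>z. s (z - x) * (w (insert z (A - {x})) - w A)) summable_on - A" by (rule summable_rate[OF A x M])
      fix z assume "z \<in> - A"
      then have "- m \<le> w (insert z (A - {x}))" using m[OF card_move[OF A x]] by auto
      then have "s (z - x) * (- (w A + m)) \<le> s (z - x) * (w (insert z (A - {x})) - w A)"
        by (intro mult_left_mono nonneg) auto
      then show "- (w A + m) * s (z - x) \<le> s (z - x) * (w (insert z (A - {x})) - w A)" by (simp add: mult.commute)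
    qed
    moreover have "(\<Sum>\<^sub>\<infinity>z\<in>-A. - (w A + m) * s (z - x)) = - (w A + m) * (\<Sum>\<^sub>\<infinity>z\<in>-A. s (z - x))"
      by (rule infsum_cmult_right) (simp add: summable_shift)
    moreover have "(w A + m) * (\<Sum>\<^sub>\<infinity>z\<in>-A. s (z - x)) \<le> (w A + m) * 1"
      using m[OF A] by (intro mult_left_mono infsum_shift_le) auto
    ultimately show ?thesis by (simp add: algebra_simps)
  qed
  then have "(\<Sum>x\<in>A. - m) \<le> (\<Sum>x\<in>A. (\<Sum>\<^sub>\<infinity>z\<in>-A. s (z - x) * (w (insert z (A - {x})) - w A)) + w A)"
    by (rule sum_mono)
  then show ?thesis using A by (simp add: excl_rate_def sum.distrib)
qed

lemma exclusion_maximum_principle: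
  fixes w D :: "real \<Rightarrow> (int ^ 'd) set \<Rightarrow> real"
  assumes bd: "\<And>t A. 0 \<le> t \<Longrightarrow> finite A \<Longrightarrow> card A = n \<Longrightarrow> \<bar>w t A\<bar> \<le> M"
    and init: "\<And>A. finite A \<Longrightarrow> card A = n \<Longrightarrow> 0 \<le> w 0 A"
    and der: "\<And>t A. 0 \<le> t \<Longrightarrow> finite A \<Longrightarrow> card A = n \<Longrightarrow>
       ((\<lambda>t. w t A) has_real_derivative D t A) (at t within {0..})"
    and gen: "\<And>t A. 0 \<le> t \<Longrightarrow> finite A \<Longrightarrow> card A = n \<Longrightarrow> excl_rate (w t) A \<le> D t A"
    and t: "0 \<le> t" and A: "finite A" "card A = n"
  shows "0 \<le> w t A"
proof -
  \<comment> \<open>The comparison principle ranges over all elements of an index type, so functions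
    are extended by 0 off the finite \<open>n\<close>-point sets.\<close>
  define G where "G A \<longleftrightarrow> finite A \<and> card A = n" for A :: "(int ^ 'd) set"
  have "0 \<le> (if G A then w t A else 0)"
  proof (rule bounded_rate_maximum_principle[where L = "real n" and M = "\<bar>M\<bar>"
        and w = "\<lambda>t A. if G A then w t A else 0" and D = "\<lambda>t A. if G A then D t A else 0"])
    show "- \<bar>M\<bar> \<le> (if G A then w t A else 0)" if "0 \<le> t" for t A
      using bd[OF that, of A] by (auto simp: G_def)
    show "((\<lambda>t. if G A then w t A else 0) has_real_derivative (if G A then D t A else 0)) (at t within {0..})"
      if "0 \<le> t" for t A using der[OF that, of A] by (auto simp: G_def)
    show "- real n * m \<le> (if G A then D t A else 0) + real n * (if G A then w t A else 0)"
      if "0 \<le> t" "0 \<le> m" and lb: "\<And>B. - m \<le> (if G B then w t B else 0)" for t A m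
    proof (cases "G A")
      case True
      have "- m \<le> w t B" if "finite B" "card B = n" for B using lb[of B] that by (simp add: G_def)
      then have "- real n * m \<le> excl_rate (w t) A + real n * w t A"
        using bd[OF \<open>0 \<le> t\<close>] True by (intro excl_rate_lower[where M = M]) (simp_all add: G_def)
      then show ?thesis using gen[OF \<open>0 \<le> t\<close>, of A] True by (auto simp: G_def)
    qed (use that in auto)
  qed (use init t in \<open>auto simp: G_def\<close>)
  then show ?thesis using A by (simp add: G_def)
qed

text \<open>\<open>S t\<close> commutes with the generator, and on products the generator moves only
  the index set. Hence any bounded functional of the evolved products solves the particle equation;
  integration against a product and evaluation at a configuration are the main instances.\<close>

lemma dual_derivative:
  assumes S: "exclusion_semigroup s S" and l: "bounded_linear l" and \<phi>: "\<And>b. \<bar>\<phi> b\<bar> \<le> 1"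
    and A: "finite A" and t: "t \<ge> 0"
  shows "((\<lambda>t. l (S t (prodC \<phi> A))) has_real_derivative excl_rate (\<lambda>B. l (S t (prodC \<phi> B))) A) (at t within {0..})"
proof -
  have M: "markov_semigroup S" using S by (simp add: exclusion_semigroup_def)
  have L: "bounded_linear (\<lambda>g. l (S t g))"
    by (rule bounded_linear_compose[OF l markov_bounded_linear[OF M t]])
  have "((\<lambda>t. l (S t (prodC \<phi> A))) has_vector_derivative l (S t (genC (prodC \<phi> A)))) (at t within {0..})"
    by (rule bounded_linear.has_vector_derivative[OF l
          markov_derivative[OF M t genC_graph[OF S local_prodC]]])
  moreover have "l (S t (genC (prodC \<phi> A))) = excl_rate (\<lambda>B. l (S t (prodC \<phi> B))) A"
    unfolding genC_prodC[OF A] excl_rate_def linear_sum[OF bounded_linear.linear[OF L]]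
  proof (rule sum.cong[OF refl])
    fix x
    have sm: "(\<lambda>z. s (z - x) *\<^sub>R (prodC \<phi> (insert z (A - {x})) - prodC \<phi> A)) summable_on - A"
    proof (rule summable_shift_bounded)
      show "norm (prodC \<phi> (insert z (A - {x})) - prodC \<phi> A) \<le> 2" for z
        using norm_triangle_ineq4[of "prodC \<phi> (insert z (A - {x}))" "prodC \<phi> A"]
          norm_prodC_le[of \<phi> A, OF \<phi>] norm_prodC_le[of \<phi> "insert z (A - {x})", OF \<phi>] by linarith
    qed
    show "l (S t (\<Sum>\<^sub>\<infinity>z\<in>- A. s (z - x) *\<^sub>R (prodC \<phi> (insert z (A - {x})) - prodC \<phi> A))) =
         (\<Sum>\<^sub>\<infinity>z\<in>- A. s (z - x) * (l (S t (prodC \<phi> (insert z (A - {x})))) - l (S t (prodC \<phi> A))))"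
      using infsumI[OF has_sum_bounded_linear[OF L has_sum_infsum[OF sm]]]
      by (simp add: o_def linear_cmul[OF bounded_linear.linear[OF L]] linear_diff[OF bounded_linear.linear[OF L]])
  qed
  ultimately show ?thesis by (simp add: has_real_derivative_iff_has_vector_derivative)
qed

lemma dual_bound:
  assumes S: "exclusion_semigroup s S" and l: "bounded_linear l" and \<phi>: "\<And>b. \<bar>\<phi> b\<bar> \<le> 1"
  shows "\<exists>K. \<forall>t\<ge>0. \<forall>B. \<bar>l (S t (prodC \<phi> B)) :: real\<bar> \<le> K"
proof -
  obtain K where K: "0 \<le> K" "\<And>g. norm (l g) \<le> norm g * K"
    using bounded_linear.nonneg_bounded[OF l] by blast
  have "\<bar>l (S t (prodC \<phi> B))\<bar> \<le> K" if "t \<ge> 0" for t B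
  proof -
    have "norm (S t (prodC \<phi> B)) \<le> 1"
      using markov_contraction[of S t "prodC \<phi> B"] norm_prodC_le[of \<phi> B, OF \<phi>] S that
      by (simp add: exclusion_semigroup_def)
    then have "norm (S t (prodC \<phi> B)) * K \<le> 1 * K" using K(1) by (rule mult_right_mono)
    then show ?thesis using K(2)[of "S t (prodC \<phi> B)"] by simp
  qed
  then show ?thesis by blast
qed

text \<open>Both sides solve the backward equation of the exclusion process with \<open>n\<close> particles.\<close>

lemma dual_unique:
  fixes v :: "real \<Rightarrow> (int ^ 'd) set \<Rightarrow> real"
  assumes S: "exclusion_semigroup s S" and l: "bounded_linear l" and \<phi>: "\<And>b. \<bar>\<phi> b\<bar> \<le> 1"
    and bd: "\<And>t A. 0 \<le> t \<Longrightarrow> finite A \<Longrightarrow> card A = n \<Longrightarrow> \<bar>v t A\<bar> \<le> M"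
    and der: "\<And>t A. 0 \<le> t \<Longrightarrow> finite A \<Longrightarrow> card A = n \<Longrightarrow>
       ((\<lambda>t. v t A) has_real_derivative excl_rate (v t) A) (at t within {0..})"
    and init: "\<And>A. finite A \<Longrightarrow> card A = n \<Longrightarrow> l (prodC \<phi> A) = v 0 A"
    and t: "0 \<le> t" and A: "finite A" "card A = n"
  shows "l (S t (prodC \<phi> A)) = v t A"
proof -
  define u where "u t A = l (S t (prodC \<phi> A))" for t A
  obtain K where K: "\<And>t B. t \<ge> 0 \<Longrightarrow> \<bar>u t B\<bar> \<le> K" 
    using dual_bound[OF S l, of \<phi>, OF \<phi>] by (auto simp: u_def)
  have ud: "((\<lambda>t. u t A) has_real_derivative excl_rate (u t) A) (at t within {0..})" if "0 \<le> t" "finite A" for t A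
    using dual_derivative[OF S l, of \<phi>, OF \<phi> that(2,1)] unfolding u_def .
  have u0: "u 0 A = v 0 A" if "finite A" "card A = n" for A
    using init[OF that] S unfolding u_def exclusion_semigroup_def markov_semigroup_def by simp
  have "0 \<le> u t A - v t A"
  proof (rule exclusion_maximum_principle[where w = "\<lambda>t A. u t A - v t A" and M = "K + M"
        and D = "\<lambda>t A. excl_rate (u t) A - excl_rate (v t) A", OF _ _ _ _ t A])
    show "\<bar>u t A - v t A\<bar> \<le> K + M" if "0 \<le> t" "finite A" "card A = n" for t A
      using K[of t A] bd[OF that] that by linarith
    show "excl_rate (\<lambda>A. u t A - v t A) A \<le> excl_rate (u t) A - excl_rate (v t) A"
      if "0 \<le> t" "finite A" "card A = n" for t A
      by (subst excl_rate_diff[OF that(2,3)]) (auto intro: K bd that(1))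
    show "((\<lambda>t. u t A - v t A) has_real_derivative excl_rate (u t) A - excl_rate (v t) A) (at t within {0..})"
      if "0 \<le> t" "finite A" "card A = n" for t A
      by (intro DERIV_diff ud der that)
  qed (simp add: u0)
  moreover have "0 \<le> v t A - u t A"
  proof (rule exclusion_maximum_principle[where w = "\<lambda>t A. v t A - u t A" and M = "M + K"
        and D = "\<lambda>t A. excl_rate (v t) A - excl_rate (u t) A", OF _ _ _ _ t A])
    show "\<bar>v t A - u t A\<bar> \<le> M + K" if "0 \<le> t" "finite A" "card A = n" for t A
      using K[of t A] bd[OF that] that by linarith
    show "excl_rate (\<lambda>A. v t A - u t A) A \<le> excl_rate (v t) A - excl_rate (u t) A"
      if "0 \<le> t" "finite A" "card A = n" for t A
      by (subst excl_rate_diff[OF that(2,3)]) (auto intro: K bd that(1))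
    show "((\<lambda>t. v t A - u t A) has_real_derivative excl_rate (v t) A - excl_rate (u t) A) (at t within {0..})"
      if "0 \<le> t" "finite A" "card A = n" for t A
      by (intro DERIV_diff ud der that)
  qed (simp add: u0)
  ultimately show ?thesis by (simp add: u_def)
qed

text \<open>Both functionals evolve by the same \<open>n\<close>-particle equation, so agreement on
  \<open>n\<close>-point products at time 0 persists. The site functions may differ, since the
  equation sees only the index set.\<close>

lemma dual_eq:
  assumes S: "exclusion_semigroup s S" and l: "bounded_linear l" "bounded_linear l'"
    and \<phi>: "\<And>b. \<bar>\<phi> b\<bar> \<le> 1" "\<And>b. \<bar>\<phi>' b\<bar> \<le> 1"
    and init: "\<And>A. finite A \<Longrightarrow> card A = n \<Longrightarrow> l (prodC \<phi> A) = l' (prodC \<phi>' A)"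
    and t: "0 \<le> t" and A: "finite A" "card A = n"
  shows "l (S t (prodC \<phi> A)) = (l' (S t (prodC \<phi>' A)) :: real)"
proof -
  obtain K where K: "\<And>t B. t \<ge> 0 \<Longrightarrow> \<bar>l' (S t (prodC \<phi>' B))\<bar> \<le> K" 
    using dual_bound[OF S l(2), of \<phi>', OF \<phi>(2)] by auto
  have S0: "S 0 g = g" for g using S unfolding exclusion_semigroup_def markov_semigroup_def by simp
  show ?thesis
    by (rule dual_unique[OF S l(1) \<phi>(1) K dual_derivative[OF S l(2), of \<phi>', OF \<phi>(2)] _ t A])
       (simp_all add: init S0)
qed

end

section \<open>Negative correlation and the decay of correlations\<close>

lemma has_sum_sum:
  fixes f :: "'a \<Rightarrow> 'b \<Rightarrow> 'c::topological_comm_monoid_add"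
  assumes "finite I" "\<And>i. i \<in> I \<Longrightarrow> (f i has_sum F i) A"
  shows "((\<lambda>x. \<Sum>i\<in>I. f i x) has_sum (\<Sum>i\<in>I. F i)) A"
  using assms by (induction I) (auto intro: has_sum_add)

context symmetric_kernel
begin

text \<open>Centred products over sets of different size are orthogonal at time 0, and the particle
  equation conserves the number of particles; the comparison is with the zero functional.\<close>

lemma duality_card_neq:
  assumes S: "exclusion_semigroup s S" and \<rho>: "0 \<le> \<rho>" "\<rho> \<le> 1" and t: "0 \<le> t"
    and A: "finite A" "finite B" "card A \<noteq> card B"
  defines "\<psi> \<equiv> (\<lambda>b. of_bool b - \<rho>)"
  shows "ip (bernoulli_product \<rho>) (prodC \<psi> A) (S t (prodC \<psi> B)) = 0"
proof -
  note bl = bounded_bilinear.bounded_linear_right[OF bounded_bilinear_ip[OF prob_space_bernoulli_product sets_bernoulli_product]]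
  have \<psi>: "\<bar>\<psi> b\<bar> \<le> 1" for b using \<rho> by (cases b) (auto simp: \<psi>_def)
  show ?thesis
    by (rule dual_eq[OF S bl bounded_linear_zero \<psi> \<psi> _ t A(2) refl])
       (use A \<rho> in \<open>auto simp: ip_bernoulli_prodC \<psi>_def\<close>)
qed

text \<open>Self-duality. As functions of \<open>B\<close> both sides solve the same particle
  equation, and at time 0 both equal the squared norm of the centred product if \<open>B = A\<close>
  and 0 otherwise. The evaluation on the right is the probability that particles started from
  \<open>A\<close> occupy \<open>B\<close>.\<close>

lemma duality:
  assumes S: "exclusion_semigroup s S" and \<rho>: "0 \<le> \<rho>" "\<rho> \<le> 1" and t: "0 \<le> t"
    and A: "finite A" "finite B" "card A = card B"
  defines "\<psi> \<equiv> (\<lambda>b. of_bool b - \<rho>)"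
  shows "ip (bernoulli_product \<rho>) (prodC \<psi> A) (S t (prodC \<psi> B))
    = (\<rho> * (1 - \<rho>)) ^ card A * apply_bcontfun (S t (prodC of_bool B)) (\<lambda>x. x \<in> A)"
proof -
  note bl = bounded_bilinear.bounded_linear_right[OF bounded_bilinear_ip[OF prob_space_bernoulli_product sets_bernoulli_product]]
  have \<psi>: "\<bar>\<psi> b\<bar> \<le> 1" for b using \<rho> by (cases b) (auto simp: \<psi>_def)
  have bl': "bounded_linear (\<lambda>g. (\<rho> * (1 - \<rho>)) ^ card A * apply_bcontfun g (\<lambda>x. x \<in> A))"
    by (intro bounded_linear_const_mult bounded_linear_apply_bcontfun)
  show ?thesis
  proof (rule dual_eq[OF S bl bl' \<psi> _ _ t A(2) refl])
    fix C :: "(int ^ 'd) set" assume C: "finite C" "card C = card B"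
    have "(\<Prod>x\<in>C. of_bool (x \<in> A)) = (if A = C then 1 else 0 :: real)"
    proof (cases "C \<subseteq> A")
      case True
      then have "C = A" using C A by (intro card_subset_eq) auto
      then show ?thesis by auto
    next
      case False
      then obtain x where "x \<in> C" "x \<notin> A" by blast
      then show ?thesis using C by (auto intro!: prod_zero)
    qed
    then show "ip (bernoulli_product \<rho>) (prodC \<psi> A) (prodC \<psi> C) =
        (\<rho> * (1 - \<rho>)) ^ card A * apply_bcontfun (prodC of_bool C) (\<lambda>x. x \<in> A)"
      using A C \<rho> by (simp add: ip_bernoulli_prodC \<psi>_def apply_prodC)
  qed auto
qed

lemma exclusion_positive:
  assumes S: "exclusion_semigroup s S" and t: "t \<ge> 0" and le: "\<And>\<eta>. apply_bcontfun g \<eta> \<le> apply_bcontfun h \<eta>"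
  shows "apply_bcontfun (S t g) \<eta> \<le> apply_bcontfun (S t h) \<eta>"
proof -
  have M: "markov_semigroup S" using S by (simp add: exclusion_semigroup_def)
  have "0 \<le> apply_bcontfun (S t (h - g)) \<eta>"
    using M t le unfolding markov_semigroup_def by (simp add: minus_bcontfun.rep_eq)
  then show ?thesis
    using linear_diff[OF bounded_linear.linear[OF markov_bounded_linear[OF M t]], of h g]
    by (simp add: minus_bcontfun.rep_eq)
qed

lemma exclusion_nonneg:
  assumes S: "exclusion_semigroup s S" and t: "t \<ge> 0" and "\<And>\<eta>. 0 \<le> apply_bcontfun g \<eta>"
  shows "0 \<le> apply_bcontfun (S t g) \<eta>"
  using assms unfolding exclusion_semigroup_def markov_semigroup_def by auto

text \<open>
  Liggett's inequality for two particles: the product solves the backward equation up to the source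
  term \<open>s (y - x) (u x - u y)\<^sup>2 \<ge> 0\<close>.
\<close>

lemma negative_correlation:
  fixes x y :: "int ^ 'd"
  assumes S: "exclusion_semigroup s S" and t: "t \<ge> 0" and xy: "x \<noteq> y"
  shows "apply_bcontfun (S t (prodC of_bool {x, y})) \<eta>
    \<le> apply_bcontfun (S t (prodC of_bool {x})) \<eta> * apply_bcontfun (S t (prodC of_bool {y})) \<eta>"
proof -
  define u where "u t x = apply_bcontfun (S t (prodC of_bool {x})) \<eta>" for t x
  define v where "v t A = apply_bcontfun (S t (prodC of_bool A)) \<eta>" for t A
  define U where "U t A = (\<Prod>x\<in>A. u t x)" for t A
  have M: "markov_semigroup S" using S by (simp add: exclusion_semigroup_def)
  have bound: "\<bar>v t A\<bar> \<le> 1" if "t \<ge> 0" for t A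
  proof -
    have "\<bar>v t A\<bar> \<le> norm (S t (prodC of_bool A))" unfolding v_def by (rule abs_apply_bcontfun_le)
    also have "\<dots> \<le> norm (prodC of_bool A)" by (rule markov_contraction[OF M that])
    also have "\<dots> \<le> 1" by (rule norm_prodC_le) simp
    finally show ?thesis .
  qed
  have uv: "u t x = v t {x}" for t x by (simp add: u_def v_def)
  have ubound: "\<bar>u t x\<bar> \<le> 1" if "t \<ge> 0" for t x unfolding uv by (rule bound[OF that])
  have Ubound: "\<bar>U t A\<bar> \<le> 1" if "t \<ge> 0" for t A
    unfolding U_def abs_prod by (intro prod_le_1) (simp add: ubound[OF that])
  have vd: "((\<lambda>t. v t A) has_real_derivative excl_rate (v t) A) (at t within {0..})" if "0 \<le> t" "finite A" for t A
    unfolding v_def by (rule dual_derivative[OF S bounded_linear_apply_bcontfun _ that(2,1)]) simp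
  have S0: "S 0 g = g" for g using M unfolding markov_semigroup_def by simp
  \<comment> \<open>The time derivative of \<open>U - v\<close>, with the product rule written as a
    sum over \<open>A\<close> so that the two points of the pair need not be named.\<close>
  define D where "D t A = (\<Sum>x\<in>A. excl_rate (v t) {x} * (\<Prod>z\<in>A - {x}. u t z)) - excl_rate (v t) A" for t A
  have "0 \<le> U t {x, y} - v t {x, y}"
  proof (rule exclusion_maximum_principle[where n = 2 and w = "\<lambda>t A. U t A - v t A" and M = 2 and D = D])
    show "\<bar>U t A - v t A\<bar> \<le> 2" if "0 \<le> t" for t A using bound[OF that, of A] Ubound[OF that, of A] by linarith
    show "0 \<le> U 0 A - v 0 A" for A by (simp add: U_def u_def v_def S0 apply_prodC)
    fix t :: real and A :: "(int ^ 'd) set" assume t: "0 \<le> t" and A: "finite A" "card A = 2"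
    then obtain a b where ab: "A = {a, b}" "a \<noteq> b" by (meson card_2_iff)
    have ud: "((\<lambda>t. u t x) has_real_derivative excl_rate (v t) {x}) (at t within {0..})" for x
      unfolding uv by (rule vd[OF t]) simp
    show "((\<lambda>t. U t A - v t A) has_real_derivative D t A) (at t within {0..})"
    proof -
      have "((\<lambda>t. u t a * u t b - v t A) has_real_derivative
          excl_rate (v t) {a} * u t b + excl_rate (v t) {b} * u t a - excl_rate (v t) A) (at t within {0..})"
        by (intro DERIV_diff DERIV_mult ud vd t A)
      moreover have "U t A = u t a * u t b" for t using ab by (simp add: U_def)
      moreover have "D t A = excl_rate (v t) {a} * u t b + excl_rate (v t) {b} * u t a - excl_rate (v t) A"
        using ab by (simp add: D_def insert_Diff_if)
      ultimately show ?thesis by simp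
    qed
    have rate1: "excl_rate (v t) {x} = (\<Sum>\<^sub>\<infinity>z\<in>-{x}. s (z - x) * (u t z - u t x))" for x
      by (simp add: excl_rate_def uv)
    have sm: "(\<lambda>z. s (z - x) * (u t z - u t x)) summable_on B" for x B
    proof -
      have "norm (u t z - u t x) \<le> 2" for z
        using ubound[OF t, of z] ubound[OF t, of x] by simp
      then show ?thesis using summable_shift_bounded[of B "\<lambda>z. u t z - u t x" 2 x] by simp
    qed
    \<comment> \<open>A lone particle may jump onto the other site, a particle of the pair may not.
      Isolating this jump exposes the source term.\<close>
    have split: "excl_rate (v t) {x} = s (y - x) * (u t y - u t x) + (\<Sum>\<^sub>\<infinity>z\<in>-{x, y}. s (z - x) * (u t z - u t x))"
      if "x \<noteq> y" for x y
    proof -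
      have "-{x} = insert y (-{x, y})" using that by auto
      then show ?thesis unfolding rate1 by (simp add: infsum_insert sm)
    qed
    have one: "(\<Sum>\<^sub>\<infinity>z\<in>-{x, y}. s (z - x) * (U t (insert z ({x, y} - {x})) - U t {x, y}))
      = u t y * (\<Sum>\<^sub>\<infinity>z\<in>-{x, y}. s (z - x) * (u t z - u t x))" if "x \<noteq> y" for x y
    proof -
      have "(\<Sum>\<^sub>\<infinity>z\<in>-{x, y}. s (z - x) * (U t (insert z ({x, y} - {x})) - U t {x, y}))
        = (\<Sum>\<^sub>\<infinity>z\<in>-{x, y}. u t y * (s (z - x) * (u t z - u t x)))"
        by (rule infsum_cong) (use that in \<open>auto simp: U_def algebra_simps insert_Diff_if\<close>)
      then show ?thesis by (simp add: infsum_cmult_right sm)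
    qed
    define I J where "I = (\<Sum>\<^sub>\<infinity>z\<in>-{a, b}. s (z - a) * (u t z - u t a))"
      and "J = (\<Sum>\<^sub>\<infinity>z\<in>-{b, a}. s (z - b) * (u t z - u t b))"
    have "excl_rate (v t) {a} = s (b - a) * (u t b - u t a) + I" "excl_rate (v t) {b} = s (b - a) * (u t a - u t b) + J"
      using split[of a b] split[of b a] ab(2) symm'[of a b] by (simp_all add: I_def J_def)
    note IJ = this
    have "excl_rate (U t) A = u t b * I + u t a * J"
      unfolding I_def J_def using ab(2) one[of a b] one[of b a] by (simp add: excl_rate_def ab(1) insert_commute)
    also have "\<dots> = excl_rate (v t) {a} * u t b + excl_rate (v t) {b} * u t a - s (b - a) * (u t b - u t a)\<^sup>2"
      unfolding IJ by (simp add: power2_eq_square algebra_simps)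
    also have "\<dots> \<le> excl_rate (v t) {a} * u t b + excl_rate (v t) {b} * u t a"
      using nonneg[of "b - a"] by simp
    also have "\<dots> = (\<Sum>x\<in>A. excl_rate (v t) {x} * (\<Prod>z\<in>A - {x}. u t z))"
      using ab by (simp add: insert_Diff_if)
    finally have "excl_rate (U t) A \<le> \<dots>" .
    moreover have "excl_rate (\<lambda>A. U t A - v t A) A = excl_rate (U t) A - excl_rate (v t) A"
      by (rule excl_rate_diff[OF A Ubound[OF t] bound[OF t]])
    ultimately show "excl_rate (\<lambda>A. U t A - v t A) A \<le> D t A" by (simp add: D_def)
  qed (use t xy in auto)
  then show ?thesis using xy by (simp add: U_def u_def v_def)
qed

end

text \<open>What the estimates use of the random walk: its start at the origin, its backward
  equation, and the maximum of the transition probability at the origin. The last comes from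
  symmetry of the jump law through the Fourier form \<open>hk\<close>, which is supplied
  later.\<close>

locale heat_kernel = symmetric_kernel s for s :: "int ^ 'd::finite \<Rightarrow> real" +
  fixes p :: "real \<Rightarrow> int ^ 'd \<Rightarrow> real"
  assumes p_0: "\<And>x. p 0 x = of_bool (x = 0)"
    and p_le: "\<And>t x. 0 \<le> t \<Longrightarrow> \<bar>p t x\<bar> \<le> p t 0"
    and p_le_1: "\<And>t. 0 \<le> t \<Longrightarrow> p t 0 \<le> 1"
    and p_derivative: "\<And>t x. 0 \<le> t \<Longrightarrow>
      ((\<lambda>t. p t x) has_real_derivative (\<Sum>\<^sub>\<infinity>z. s z * (p t (x + z) - p t x))) (at t within {0..})"
begin

lemma p_nonneg: "0 \<le> t \<Longrightarrow> 0 \<le> p t 0"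
  using p_le[of t 0] by linarith

lemma one_particle:
  assumes S: "exclusion_semigroup s S" and t: "t \<ge> 0" and A: "finite A"
  shows "apply_bcontfun (S t (prodC of_bool {x})) (\<lambda>y. y \<in> A) = (\<Sum>a\<in>A. p t (a - x))"
proof -
  \<comment> \<open>A single particle is a one-point set, so the sum over \<open>B\<close> serves to
    make \<open>v\<close> a function of sets.\<close>
  define v where "v t B = (\<Sum>x\<in>B. \<Sum>a\<in>A. p t (a - x))" for t B
  have "apply_bcontfun (S t (prodC of_bool {x})) (\<lambda>y. y \<in> A) = v t {x}"
  proof (rule dual_unique[OF S bounded_linear_apply_bcontfun, where n = 1 and M = "real (card A)"])
    show "\<bar>of_bool b\<bar> \<le> (1::real)" for b by simp
    show "\<bar>v t B\<bar> \<le> real (card A)" if t: "0 \<le> t" and B: "finite B" "card B = 1" for t B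
    proof -
      obtain x where B: "B = {x}" using B(2) by (rule card_1_singletonE)
      have "\<bar>v t B\<bar> \<le> (\<Sum>a\<in>A. \<bar>p t (a - x)\<bar>)" unfolding v_def B by simp
      also have "\<dots> \<le> (\<Sum>a\<in>A. 1)"
        using p_le[OF t] p_le_1[OF t] by (intro sum_mono) (meson order_trans)
      finally show ?thesis by simp
    qed
    show "apply_bcontfun (prodC of_bool B) (\<lambda>y. y \<in> A) = v 0 B" if B: "finite B" "card B = 1" for B
    proof -
      obtain x where B: "B = {x}" using B(2) by (rule card_1_singletonE)
      show ?thesis using A by (simp add: B v_def apply_prodC p_0 of_bool_def)
    qed
    show "((\<lambda>t. v t B) has_real_derivative excl_rate (v t) B) (at t within {0..})"
      if t: "0 \<le> t" and B: "finite B" "card B = 1" for t B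
    proof -
      obtain x where B: "B = {x}" using B(2) by (rule card_1_singletonE)
      have sm: "(\<lambda>z. s (z - x) * (p t (a - z) - p t (a - x))) summable_on UNIV" for a
      proof -
        have "norm (p t (a - z) - p t (a - x)) \<le> 2" for z
          using p_le[OF t, of "a - z"] p_le[OF t, of "a - x"] p_le_1[OF t] by simp
        then show ?thesis using summable_shift_bounded[of UNIV "\<lambda>z. p t (a - z) - p t (a - x)" 2 x] by simp
      qed
      have "excl_rate (v t) B = (\<Sum>\<^sub>\<infinity>z\<in>-{x}. s (z - x) * ((\<Sum>a\<in>A. p t (a - z)) - (\<Sum>a\<in>A. p t (a - x))))"
        by (simp add: excl_rate_def B v_def)
      also have "\<dots> = (\<Sum>\<^sub>\<infinity>z. \<Sum>a\<in>A. s (z - x) * (p t (a - z) - p t (a - x)))"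
        by (rule infsum_cong_neutral) (auto simp: sum_distrib_left sum_subtractf algebra_simps)
      also have "\<dots> = (\<Sum>a\<in>A. \<Sum>\<^sub>\<infinity>z. s (z - x) * (p t (a - z) - p t (a - x)))"
        by (intro infsumI has_sum_sum A has_sum_infsum sm)
      also have "\<dots> = (\<Sum>a\<in>A. \<Sum>\<^sub>\<infinity>z. s z * (p t (a - x + z) - p t (a - x)))"
      proof (rule sum.cong[OF refl])
        fix a
        \<comment> \<open>Reflecting the jump turns the motion of \<open>x\<close> into a motion of
          the difference \<open>a - x\<close>; symmetry of \<open>s\<close> absorbs the
          sign.\<close>
        have "bij (\<lambda>z. x - z)" by (rule bij_betwI[where g = "\<lambda>z. x - z"]) auto
        from infsum_reindex_bij_betw[OF this, of "\<lambda>z. s (z - x) * (p t (a - z) - p t (a - x))"]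
        show "(\<Sum>\<^sub>\<infinity>z. s (z - x) * (p t (a - z) - p t (a - x))) = (\<Sum>\<^sub>\<infinity>z. s z * (p t (a - x + z) - p t (a - x)))"
          by (simp add: symm algebra_simps)
      qed
      finally have "excl_rate (v t) B = (\<Sum>a\<in>A. \<Sum>\<^sub>\<infinity>z. s z * (p t (a - x + z) - p t (a - x)))" .
      then show ?thesis unfolding v_def B by (auto intro!: derivative_eq_intros p_derivative t)
    qed
  qed (use t in auto)
  then show ?thesis by (simp add: v_def)
qed

lemma one_particle_le:
  assumes "exclusion_semigroup s S" "t \<ge> 0" "finite A"
  shows "apply_bcontfun (S t (prodC of_bool {x})) (\<lambda>y. y \<in> A) \<le> real (card A) * p t 0"
proof -
  have "(\<Sum>a\<in>A. p t (a - x)) \<le> (\<Sum>a\<in>A. p t 0)"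
    using p_le[OF assms(2)] by (intro sum_mono) (meson abs_le_D1)
  then show ?thesis using one_particle[OF assms] by simp
qed

text \<open>Sets of different size contribute nothing. Otherwise \<open>B\<close> has at least two
  points: all but two are dropped, negative correlation separates these two, and each of the two
  factors is at most \<open>card A * p t 0\<close>.\<close>

lemma ip_prodC_le:
  assumes S: "exclusion_semigroup s S" and \<rho>: "0 \<le> \<rho>" "\<rho> \<le> 1" and t: "0 \<le> t"
    and A: "finite A" and B: "finite B" "\<not> (card A = 1 \<and> card B = 1)" "B \<noteq> {}"
  defines "\<psi> \<equiv> (\<lambda>b. of_bool b - \<rho>)"
  shows "\<bar>ip (bernoulli_product \<rho>) (prodC \<psi> A) (S t (prodC \<psi> B))\<bar> \<le> (real (card A) * p t 0)\<^sup>2"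
proof (cases "card A = card B")
  case False
  then show ?thesis using duality_card_neq[OF S \<rho> t A B(1) False] by (simp add: \<psi>_def)
next
  case True
  have "card B \<noteq> 0" "card B \<noteq> 1" using B True by auto
  then have "2 \<le> card B" by linarith
  then obtain x y where xy: "x \<in> B" "y \<in> B" "x \<noteq> y"
    by (metis card_2_iff' obtain_subset_with_card_n insert_subset card_2_iff)
  let ?A = "\<lambda>x. x \<in> A"
  have prod01: "0 \<le> (\<Prod>x\<in>C. of_bool (\<eta> x) :: real)" "(\<Prod>x\<in>C. of_bool (\<eta> x) :: real) \<le> 1" for \<eta> C
    by (auto intro: prod_nonneg prod_le_1)
  have n0: "0 \<le> apply_bcontfun (S t (prodC of_bool C)) \<eta>" for C \<eta>
    by (rule exclusion_nonneg[OF S t]) (simp add: apply_prodC prod01)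
  have "apply_bcontfun (S t (prodC of_bool B)) ?A \<le> apply_bcontfun (S t (prodC of_bool {x, y})) ?A"
  proof (rule exclusion_positive[OF S t])
    fix \<eta>
    have "(\<Prod>x\<in>B. of_bool (\<eta> x) :: real) = (\<Prod>x\<in>{x, y}. of_bool (\<eta> x)) * (\<Prod>x\<in>B - {x, y}. of_bool (\<eta> x))"
      using B xy by (metis empty_subsetI insert_subset mult.commute prod.subset_diff)
    also have "\<dots> \<le> (\<Prod>x\<in>{x, y}. of_bool (\<eta> x)) * 1" by (intro mult_left_mono prod01)
    finally show "apply_bcontfun (prodC of_bool B) \<eta> \<le> apply_bcontfun (prodC of_bool {x, y}) \<eta>"
      by (simp add: apply_prodC)
  qed
  also have "\<dots> \<le> apply_bcontfun (S t (prodC of_bool {x})) ?A * apply_bcontfun (S t (prodC of_bool {y})) ?A"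
    by (rule negative_correlation[OF S t xy(3)])
  also have "\<dots> \<le> (real (card A) * p t 0) * (real (card A) * p t 0)"
    by (intro mult_mono one_particle_le S t A n0) (simp add: p_nonneg t)
  finally have le: "apply_bcontfun (S t (prodC of_bool B)) ?A \<le> (real (card A) * p t 0)\<^sup>2"
    by (simp add: power2_eq_square)
  have \<chi>: "0 \<le> (\<rho> * (1 - \<rho>)) ^ card A" "(\<rho> * (1 - \<rho>)) ^ card A \<le> 1"
    using \<rho> by (auto intro!: power_le_one mult_le_one)
  have "(\<rho> * (1 - \<rho>)) ^ card A * apply_bcontfun (S t (prodC of_bool B)) ?A \<le> 1 * (real (card A) * p t 0)\<^sup>2"
    by (intro mult_mono le \<chi> n0) simp
  then show ?thesis using duality[OF S \<rho> t A B(1) True] \<chi> n0 by (simp add: \<psi>_def abs_mult)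
qed

text \<open>Pairs of singletons are evaluated exactly by duality and the one-particle formula, all
  other pairs are bounded quadratically. The remainder is therefore of smaller order as soon as
  \<open>p t 0\<close> tends to 0.\<close>

theorem correlation_estimate:
  assumes S: "exclusion_semigroup s S" and \<rho>: "0 \<le> \<rho>" "\<rho> \<le> 1" and \<Lambda>: "finite \<Lambda>" and c: "c {} = 0"
    and f: "\<And>\<eta>. apply_bcontfun f \<eta> = (\<Sum>A\<in>Pow \<Lambda>. c A * (\<Prod>x\<in>A. of_bool (\<eta> x) - \<rho>))"
  shows "\<exists>K\<ge>0. \<forall>t\<ge>0. \<bar>ip (bernoulli_product \<rho>) f (S t f)
      - \<rho> * (1 - \<rho>) * (\<Sum>x\<in>\<Lambda>. \<Sum>y\<in>\<Lambda>. c {x} * c {y} * p t (x - y))\<bar> \<le> K * (p t 0)\<^sup>2"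
proof -
  define \<psi> where "\<psi> = (\<lambda>b. of_bool b - \<rho>)"
  define K where "K = (\<Sum>A\<in>Pow \<Lambda>. \<Sum>B\<in>Pow \<Lambda>. \<bar>c A * c B\<bar> * (real (card \<Lambda>))\<^sup>2)"
  let ?ip = "ip (bernoulli_product \<rho>)"
  interpret bounded_bilinear ?ip
    by (rule bounded_bilinear_ip[OF prob_space_bernoulli_product sets_bernoulli_product])
  have M: "markov_semigroup S" using S by (simp add: exclusion_semigroup_def)
  have apply_sum: "apply_bcontfun (\<Sum>i\<in>I. g i) \<eta> = (\<Sum>i\<in>I. apply_bcontfun (g i) \<eta>)"
    for I and g :: "(int ^ 'd) set \<Rightarrow> 'd config \<Rightarrow>\<^sub>C real" and \<eta>
    by (rule linear_sum[OF bounded_linear.linear[OF bounded_linear_apply_bcontfun]])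
  have fsum: "f = (\<Sum>A\<in>Pow \<Lambda>. c A *\<^sub>R prodC \<psi> A)"
    by (rule bcontfun_eqI) (simp add: apply_sum scaleR_bcontfun.rep_eq f apply_prodC \<psi>_def)
  have "\<bar>?ip f (S t f) - \<rho> * (1 - \<rho>) * (\<Sum>x\<in>\<Lambda>. \<Sum>y\<in>\<Lambda>. c {x} * c {y} * p t (x - y))\<bar> \<le> K * (p t 0)\<^sup>2"
    if t: "t \<ge> 0" for t
  proof -
    note lin = bounded_linear.linear[OF markov_bounded_linear[OF M t]]
    define m where "m A B = (if card A = 1 \<and> card B = 1 then \<rho> * (1 - \<rho>) * p t (the_elem A - the_elem B) else 0)"
      for A B :: "(int ^ 'd) set"
    have "?ip f (S t f) = (\<Sum>A\<in>Pow \<Lambda>. \<Sum>B\<in>Pow \<Lambda>. c A * c B * ?ip (prodC \<psi> A) (S t (prodC \<psi> B)))"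
      unfolding fsum linear_sum[OF lin] linear_cmul[OF lin]
      by (simp add: sum_left sum_right scaleR_left scaleR_right sum_distrib_left mult.assoc)
         (subst sum.swap, intro sum.cong refl mult.left_commute)
    moreover have "\<rho> * (1 - \<rho>) * (\<Sum>x\<in>\<Lambda>. \<Sum>y\<in>\<Lambda>. c {x} * c {y} * p t (x - y))
        = (\<Sum>A\<in>Pow \<Lambda>. \<Sum>B\<in>Pow \<Lambda>. c A * c B * m A B)"
    proof -
      have inj: "inj_on (\<lambda>x. {x}) \<Lambda>" by simp
      have sub: "(\<lambda>x. {x}) ` \<Lambda> \<subseteq> Pow \<Lambda>" by auto
      have out: "card A \<noteq> 1" if "A \<in> Pow \<Lambda> - (\<lambda>x. {x}) ` \<Lambda>" for A
        using that by (metis DiffE PowD card_1_singletonE image_eqI insert_subset)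
      have "(\<Sum>A\<in>Pow \<Lambda>. \<Sum>B\<in>Pow \<Lambda>. c A * c B * m A B) = (\<Sum>A\<in>(\<lambda>x. {x}) ` \<Lambda>. \<Sum>B\<in>Pow \<Lambda>. c A * c B * m A B)"
        by (rule sum.mono_neutral_right[OF _ sub]) (use \<Lambda> out in \<open>auto simp: m_def intro!: sum.neutral\<close>)
      also have "\<dots> = (\<Sum>A\<in>(\<lambda>x. {x}) ` \<Lambda>. \<Sum>B\<in>(\<lambda>x. {x}) ` \<Lambda>. c A * c B * m A B)"
        by (intro sum.cong refl sum.mono_neutral_right[OF _ sub]) (use \<Lambda> out in \<open>auto simp: m_def\<close>)
      also have "\<dots> = (\<Sum>x\<in>\<Lambda>. \<Sum>y\<in>\<Lambda>. c {x} * c {y} * m {x} {y})"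
        by (simp add: sum.reindex[OF inj])
      finally show ?thesis by (simp add: m_def sum_distrib_left mult_ac)
    qed
    ultimately have "?ip f (S t f) - \<rho> * (1 - \<rho>) * (\<Sum>x\<in>\<Lambda>. \<Sum>y\<in>\<Lambda>. c {x} * c {y} * p t (x - y))
        = (\<Sum>A\<in>Pow \<Lambda>. \<Sum>B\<in>Pow \<Lambda>. c A * c B * (?ip (prodC \<psi> A) (S t (prodC \<psi> B)) - m A B))"
      by (simp add: sum_subtractf algebra_simps)
    also have "\<bar>\<dots>\<bar> \<le> (\<Sum>A\<in>Pow \<Lambda>. \<Sum>B\<in>Pow \<Lambda>. \<bar>c A * c B\<bar> * ((real (card \<Lambda>))\<^sup>2 * (p t 0)\<^sup>2))"
    proof (intro order_trans[OF sum_abs] sum_mono)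
      fix A B assume AB: "A \<in> Pow \<Lambda>" "B \<in> Pow \<Lambda>"
      then have fin: "finite A" "finite B" using \<Lambda> finite_subset by auto
      have "\<bar>?ip (prodC \<psi> A) (S t (prodC \<psi> B)) - m A B\<bar> \<le> (real (card \<Lambda>))\<^sup>2 * (p t 0)\<^sup>2" if "B \<noteq> {}"
      proof (cases "card A = 1 \<and> card B = 1")
        case True
        then obtain x y where "A = {x}" "B = {y}" by (metis card_1_singletonE)
        then show ?thesis
          using duality[OF S \<rho> t, of "{x}" "{y}"] one_particle[OF S t, of "{x}" y] by (simp add: m_def \<psi>_def)
      next
        case False
        have "(real (card A) * p t 0)\<^sup>2 \<le> (real (card \<Lambda>) * p t 0)\<^sup>2"
          using AB \<Lambda> p_nonneg[OF t] by (intro power_mono mult_right_mono) (auto intro: card_mono)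
        moreover have "m A B = 0" by (simp only: m_def False if_False)
        ultimately show ?thesis
          using ip_prodC_le[OF S \<rho> t fin(1) fin(2) False that] by (simp add: \<psi>_def power_mult_distrib)
      qed
      then show "\<bar>c A * c B * (?ip (prodC \<psi> A) (S t (prodC \<psi> B)) - m A B)\<bar>
          \<le> \<bar>c A * c B\<bar> * ((real (card \<Lambda>))\<^sup>2 * (p t 0)\<^sup>2)"
        using c by (cases "B = {}") (auto simp: abs_mult intro!: mult_left_mono)
    qed
    also have "\<dots> = K * (p t 0)\<^sup>2" by (simp only: K_def sum_distrib_right mult.assoc)
    finally show ?thesis .
  qed
  moreover have "K \<ge> 0" unfolding K_def by (intro sum_nonneg) auto
  ultimately show ?thesis by blast
qed

end

section \<open>The heat kernel of the random walk\<close>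

definition emb :: "int ^ 'd \<Rightarrow> real ^ ('d::finite)" where
  "emb y = (\<chi> i. real_of_int (y $ i))"

lemma emb_nth [simp]: "emb y $ i = real_of_int (y $ i)"
  by (simp add: emb_def)

lemma emb_add: "emb (x + y) = emb x + emb y"
  and emb_minus: "emb (- x) = - emb x"
  and emb_0 [simp]: "emb 0 = 0"
  by (simp_all add: vec_eq_iff)

lemma eucl_norm_emb: "eucl_norm y = norm (emb y)"
  by (simp add: eucl_norm_def emb_def)

definition tbox :: "(real ^ ('d::finite)) set" where
  "tbox = cbox (\<chi> i. - pi) (\<chi> i. pi)"

lemma mem_tbox: "\<theta> \<in> tbox \<longleftrightarrow> (\<forall>i. \<bar>\<theta> $ i\<bar> \<le> pi)"
  unfolding tbox_def mem_box_cart by (auto simp: abs_le_iff) (metis minus_le_iff)+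

text \<open>Lebesgue measure on vectors is the image of a product measure over \<open>Basis\<close>;
  relabelling \<open>Basis\<close> by the coordinate axes reduces the claim to the theorem on finite
  products.\<close>

lemma lborel_prod_cart:
  fixes f :: "'d::finite \<Rightarrow> real \<Rightarrow> 'a::{real_normed_field,banach,second_countable_topology}"
  assumes f: "\<And>i. integrable lborel (f i)"
  shows "integrable lborel (\<lambda>x::real ^ 'd. \<Prod>i\<in>UNIV. f i (x $ i))" (is ?int)
    and "(\<integral>x. (\<Prod>i\<in>UNIV. f i (x $ i)) \<partial>(lborel :: (real ^ 'd) measure)) = (\<Prod>i\<in>UNIV. \<integral>r. f i r \<partial>lborel)" (is ?eq)
proof -
  let ?e = "\<lambda>i::'d. axis i (1::real)"
  define F where "F b = f (inv ?e b)" for b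
  have inj: "inj ?e" by (auto simp: inj_on_def axis_eq_axis)
  then have bij: "bij_betw ?e UNIV Basis"
    by (auto simp: bij_betw_def Basis_vec_def)
  have F: "integrable lborel (F b)" for b by (simp add: F_def f)
  interpret product_sigma_finite "\<lambda>_::real ^ 'd. lborel :: real measure" ..
  have m1: "(\<lambda>g. \<Sum>b\<in>Basis. g b *\<^sub>R b :: real ^ 'd) \<in> measurable (PiM Basis (\<lambda>_. lborel)) borel"
    by (intro borel_measurable_sum borel_measurable_scaleR)
       (auto intro!: measurable_compose[OF measurable_component_singleton])
  have nth: "(\<lambda>x::real ^ 'd. x $ i) \<in> borel_measurable borel" for i
    by (intro borel_measurable_continuous_onI continuous_intros)
  have m2: "(\<lambda>x::real ^ 'd. \<Prod>i\<in>UNIV. f i (x $ i)) \<in> borel_measurable borel"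
    using borel_measurable_integrable[OF f]
    by (intro borel_measurable_prod measurable_compose[OF nth]) simp
  have eq: "(\<Prod>i\<in>UNIV. f i ((\<Sum>b\<in>Basis. g b *\<^sub>R b :: real ^ 'd) $ i)) = (\<Prod>b\<in>Basis. F b (g b))" for g
  proof -
    have "(\<Sum>b\<in>Basis. g b *\<^sub>R b :: real ^ 'd) $ i = g (?e i)" for i
      using inner_sum_left_Basis[of "?e i" g] by (simp add: inner_axis axis_in_Basis_iff)
    then have "(\<Prod>i\<in>UNIV. f i ((\<Sum>b\<in>Basis. g b *\<^sub>R b :: real ^ 'd) $ i)) = (\<Prod>i\<in>UNIV. F (?e i) (g (?e i)))"
      by (simp add: F_def inv_f_f[OF inj])
    also have "\<dots> = (\<Prod>b\<in>Basis. F b (g b))" by (rule prod.reindex_bij_betw[OF bij])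
    finally show ?thesis .
  qed
  show ?int
    by (subst lborel_eq, subst integrable_distr_eq[OF m1 m2], unfold eq)
       (rule product_integrable_prod[OF finite_Basis F])
  have "(\<integral>x. (\<Prod>i\<in>UNIV. f i (x $ i)) \<partial>(lborel :: (real ^ 'd) measure)) = (\<Prod>b\<in>Basis. \<integral>r. F b r \<partial>lborel)"
    by (subst lborel_eq, subst integral_distr[OF m1 m2], unfold eq)
       (rule product_integral_prod[OF finite_Basis F])
  also have "\<dots> = (\<Prod>i\<in>UNIV. \<integral>r. F (?e i) r \<partial>lborel)"
    by (rule prod.reindex_bij_betw[OF bij, symmetric])
  finally show ?eq by (simp add: F_def inv_f_f[OF inj])
qed

lemma integral_cos_int:
  assumes "k \<noteq> (0::int)"
  shows "(\<integral>r. indicator {-pi..pi} r *\<^sub>R exp (\<i> * of_real (r * of_int k)) \<partial>lborel) = (0::complex)"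
proof -
  define F where "F r = exp (\<i> * of_real (r * of_int k)) / (\<i> * of_int k)" for r :: real
  have "(\<integral>r. indicator {-pi..pi} r *\<^sub>R exp (\<i> * of_real (r * of_int k)) \<partial>lborel) = F pi - F (-pi)"
  proof (rule integral_FTC_Icc)
    fix x :: real
    have "((\<lambda>z. exp (\<i> * (z * of_int k)) / (\<i> * of_int k)) has_field_derivative
        exp (\<i> * (of_real x * of_int k))) (at (of_real x :: complex))"
    proof -
      have "\<i> * (E * \<i>) = - E" for E :: complex by (simp add: complex_eq_iff)
      then show ?thesis using assms by (auto intro!: derivative_eq_intros)
    qed
    from has_vector_derivative_real_field[OF this]
    show "(F has_vector_derivative exp (\<i> * of_real (x * of_int k))) (at x within {-pi..pi})"
      by (simp add: F_def[abs_def])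
  qed (auto intro!: continuous_intros)
  also have "F pi = F (-pi)"
  proof -
    have "exp (\<i> * of_real (pi * of_int k)) = exp (\<i> * of_real (- pi * of_int k)) * exp (2 * of_real pi * of_int k * \<i>)"
      unfolding exp_add[symmetric] by (rule arg_cong[where f = exp]) (simp add: algebra_simps)
    also have "exp (2 * of_real pi * of_int k * \<i>) = (1::complex)"
      unfolding exp_eq_1 by (auto simp: mult_ac)
    finally have "exp (\<i> * of_real (pi * of_int k)) = (exp (\<i> * of_real (- pi * of_int k)) :: complex)"
      by (simp only: mult_1_right)
    then show ?thesis by (simp only: F_def)
  qed
  finally show ?thesis by simp
qed

lemma integral_tbox_cos:
  "integral tbox (\<lambda>\<theta>. cos (\<theta> \<bullet> emb x)) = (2 * pi) ^ CARD('d) * of_bool (x = 0)" for x :: "int ^ 'd::finite"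
proof -
  \<comment> \<open>Complex exponentials factor over the coordinates, which the cosine of a scalar
    product does not; the real part is taken at the end.\<close>
  define f where "f i r = indicator {-pi..pi} r *\<^sub>R exp (\<i> * of_real (r * of_int (x $ i)))" for i :: 'd and r :: real
  have f: "integrable lborel (f i)" for i
  proof -
    have "set_integrable lborel {-pi..pi} (\<lambda>r. exp (\<i> * of_real (r * of_int (x $ i))) :: complex)"
      by (rule borel_integrable_atLeastAtMost') (intro continuous_intros)
    then show ?thesis by (simp only: f_def[abs_def] set_integrable_def)
  qed
  have prod: "(\<Prod>i\<in>UNIV. f i (\<theta> $ i)) = indicator tbox \<theta> *\<^sub>R exp (\<i> * of_real (\<theta> \<bullet> emb x))" for \<theta> :: "real ^ 'd"
  proof (cases "\<theta> \<in> tbox")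
    case True
    then have "\<theta> $ i \<in> {-pi..pi}" for i by (auto simp: mem_tbox abs_le_iff minus_le_iff)
    then have "(\<Prod>i\<in>UNIV. f i (\<theta> $ i)) = (\<Prod>i\<in>UNIV. exp (\<i> * of_real (\<theta> $ i * of_int (x $ i))))"
      by (intro prod.cong) (simp_all add: f_def)
    also have "\<dots> = exp (\<Sum>i\<in>UNIV. \<i> * of_real (\<theta> $ i * of_int (x $ i)))" by (simp add: exp_sum)
    also have "(\<Sum>i\<in>UNIV. \<i> * of_real (\<theta> $ i * of_int (x $ i))) = \<i> * of_real (\<theta> \<bullet> emb x)"
      by (simp add: inner_vec_def sum_distrib_left)
    finally show ?thesis using True by simp
  next
    case False
    then obtain i where "\<not> \<bar>\<theta> $ i\<bar> \<le> pi" by (auto simp: mem_tbox)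
    then have "f i (\<theta> $ i) = 0" by (auto simp: f_def indicator_def)
    then show ?thesis using False by (simp add: prod_zero_iff) blast
  qed
  have si: "set_integrable lborel tbox (\<lambda>\<theta>. exp (\<i> * of_real (\<theta> \<bullet> emb x)))"
    using lborel_prod_cart(1)[of f, OF f] unfolding prod set_integrable_def .
  have hk: "integral tbox (\<lambda>\<theta>. exp (\<i> * of_real (\<theta> \<bullet> emb x))) = (\<Prod>i\<in>UNIV. \<integral>r. f i r \<partial>lborel)"
    using lborel_prod_cart(2)[of f, OF f] set_borel_integral_eq_integral(2)[OF si]
    unfolding prod set_lebesgue_integral_def by simp
  have "integral tbox (\<lambda>\<theta>. cos (\<theta> \<bullet> emb x)) = Re (integral tbox (\<lambda>\<theta>. exp (\<i> * of_real (\<theta> \<bullet> emb x))))"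
    using integral_linear[OF set_borel_integral_eq_integral(1)[OF si] bounded_linear_Re]
    by (simp add: o_def Re_exp)
  also have "\<dots> = (2 * pi) ^ CARD('d) * of_bool (x = 0)"
  proof (cases "x = 0")
    case True
    then have "(\<integral>r. f i r \<partial>lborel) = of_real (2 * pi)" for i by (simp add: f_def scaleR_conv_of_real)
    then show ?thesis unfolding hk using True by (simp flip: of_real_power)
  next
    case False
    then obtain i where "x $ i \<noteq> 0" by (auto simp: vec_eq_iff)
    then have "(\<integral>r. f i r \<partial>lborel) = 0" unfolding f_def by (rule integral_cos_int)
    then have "(\<Prod>i\<in>UNIV. \<integral>r. f i r \<partial>lborel) = 0" by (auto simp: prod_zero_iff)
    then show ?thesis unfolding hk by (simp only: zero_complex.simps) (simp add: False)
  qed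
  finally show ?thesis .
qed

section \<open>Characteristic exponent and Fourier form of the heat kernel\<close>

context symmetric_kernel
begin

text \<open>The characteristic exponent of the walk that jumps at rate 1 with law \<open>s\<close>;
  it is real because \<open>s\<close> is symmetric.\<close>

definition psi :: "real ^ 'd \<Rightarrow> real" where
  "psi \<theta> = (\<Sum>\<^sub>\<infinity>y. s y * (1 - cos (\<theta> \<bullet> emb y)))"

lemma summable_bounded:
  fixes w :: "_ \<Rightarrow> real"
  assumes "\<And>y. \<bar>w y\<bar> \<le> M"
  shows "(\<lambda>y. s y * w y) summable_on B"
  using summable_shift_bounded[of B w M 0] assms by simp

lemma psi_summable: "(\<lambda>y. s y * (1 - cos (\<theta> \<bullet> emb y))) summable_on B"
proof (rule summable_bounded)
  show "\<bar>1 - cos (\<theta> \<bullet> emb y)\<bar> \<le> 2" for y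
    using cos_le_one[of "\<theta> \<bullet> emb y"] cos_ge_minus_one[of "\<theta> \<bullet> emb y"] unfolding abs_le_iff by linarith
qed

lemma psi_nonneg: "0 \<le> psi \<theta>"
  unfolding psi_def by (intro infsum_nonneg mult_nonneg_nonneg nonneg) simp

text \<open>Summation in the uniform norm yields continuity of the sum and its exchange with bounded
  functionals in one stroke.\<close>

lemma has_sum_bcontfun:
  fixes g :: "int ^ 'd \<Rightarrow> (real ^ 'd) \<Rightarrow>\<^sub>C real"
  assumes "\<And>y. norm (g y) \<le> M"
  shows "\<exists>G. ((\<lambda>y. s y *\<^sub>R g y) has_sum G) UNIV \<and>
    (\<forall>\<theta>. apply_bcontfun G \<theta> = (\<Sum>\<^sub>\<infinity>y. s y * apply_bcontfun (g y) \<theta>))"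
proof -
  have hs: "((\<lambda>y. s y *\<^sub>R g y) has_sum (\<Sum>\<^sub>\<infinity>y. s y *\<^sub>R g y)) UNIV"
    using summable_shift_bounded[of UNIV g M 0] assms by (intro has_sum_infsum) simp
  have "apply_bcontfun (\<Sum>\<^sub>\<infinity>y. s y *\<^sub>R g y) \<theta> = (\<Sum>\<^sub>\<infinity>y. s y * apply_bcontfun (g y) \<theta>)" for \<theta>
    using infsumI[OF has_sum_bounded_linear[OF bounded_linear_apply_bcontfun hs, of \<theta>]]
    by (simp add: o_def scaleR_bcontfun.rep_eq)
  with hs show ?thesis by blast
qed

lemma cos_bcontfun: "(\<lambda>\<theta>. cos (\<theta> \<bullet> v)) \<in> bcontfun" for v :: "real ^ 'd"
  by (rule bcontfun_normI[where b = 1]) (auto intro!: continuous_intros)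

lemma continuous_psi: "continuous_on UNIV psi"
proof -
  define g where "g y = const_bcontfun 1 - Bcontfun (\<lambda>\<theta>. cos (\<theta> \<bullet> emb y))" for y :: "int ^ 'd"
  have ag: "apply_bcontfun (g y) \<theta> = 1 - cos (\<theta> \<bullet> emb y)" for y \<theta>
    by (simp add: g_def minus_bcontfun.rep_eq const_bcontfun.rep_eq Bcontfun_inverse cos_bcontfun)
  have "norm (g y) \<le> 2" for y
  proof (rule norm_bound)
    show "norm (apply_bcontfun (g y) \<theta>) \<le> 2" for \<theta>
      using cos_le_one[of "\<theta> \<bullet> emb y"] cos_ge_minus_one[of "\<theta> \<bullet> emb y"]
      unfolding ag real_norm_def abs_le_iff by linarith
  qed
  then obtain G where "\<And>\<theta>. apply_bcontfun G \<theta> = (\<Sum>\<^sub>\<infinity>y. s y * apply_bcontfun (g y) \<theta>)"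
    using has_sum_bcontfun[of g 2] by auto
  then have "psi = apply_bcontfun G" by (simp add: fun_eq_iff psi_def ag)
  then show ?thesis by simp
qed

text \<open>Fourier inversion of the characteristic function \<open>exp (- t * psi \<theta>)\<close>
  at time \<open>t\<close>; the cosine suffices because this function is even in
  \<open>\<theta>\<close>.\<close>

definition hk :: "real \<Rightarrow> int ^ 'd \<Rightarrow> real" where
  "hk t x = integral tbox (\<lambda>\<theta>. cos (\<theta> \<bullet> emb x) * exp (- t * psi \<theta>)) / (2 * pi) ^ CARD('d)"

lemma continuous_on_psi [continuous_intros]:
  "continuous_on A f \<Longrightarrow> continuous_on A (\<lambda>x. psi (f x))"
  by (rule continuous_on_compose2[OF continuous_psi]) auto

lemma hk_integrable: "(\<lambda>\<theta>. cos (\<theta> \<bullet> emb x) * exp (- t * psi \<theta>)) integrable_on tbox"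
  unfolding tbox_def by (intro integrable_continuous continuous_intros)

text \<open>Cosines are eigenfunctions of the jump operator: the addition theorem leaves a sine sum,
  which vanishes by symmetry of \<open>s\<close>.\<close>

lemma sum_cos_shift: "(\<Sum>\<^sub>\<infinity>z. s z * (cos (\<theta> \<bullet> emb (x + z)) - cos (\<theta> \<bullet> emb x))) = - psi \<theta> * cos (\<theta> \<bullet> emb x)"
proof -
  let ?c = "\<lambda>z. cos (\<theta> \<bullet> emb z)" and ?s = "\<lambda>z. sin (\<theta> \<bullet> emb z)"
  have "(\<Sum>\<^sub>\<infinity>z. s z * ?s z) = (\<Sum>\<^sub>\<infinity>z. s (- z) * ?s (- z))"
    by (rule infsum_reindex_bij_betw[symmetric]) (auto intro: bij_betwI[where g = uminus])
  also have "\<dots> = (\<Sum>\<^sub>\<infinity>z. - (s z * ?s z))" by (simp add: symm emb_minus)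
  also have "\<dots> = - (\<Sum>\<^sub>\<infinity>z. s z * ?s z)" by (rule infsum_uminus)
  finally have sin0: "(\<Sum>\<^sub>\<infinity>z. s z * ?s z) = 0" by simp
  have s_sum: "(\<lambda>z. s z * ?s z) summable_on UNIV" by (rule summable_bounded[of _ 1]) simp
  have "((\<lambda>z. - ?c x * (s z * (1 - ?c z)) - ?s x * (s z * ?s z)) has_sum (- ?c x * psi \<theta> - ?s x * 0)) UNIV"
    using has_sum_infsum[OF psi_summable[of \<theta> UNIV]] has_sum_infsum[OF s_sum] sin0
    by (intro has_sum_diff has_sum_cmult_right) (simp_all add: psi_def)
  moreover have "- ?c x * (s z * (1 - ?c z)) - ?s x * (s z * ?s z) = s z * (?c (x + z) - ?c x)" for z
    by (simp add: emb_add inner_add_right cos_add algebra_simps)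
  ultimately show ?thesis by (simp add: infsumI mult.commute)
qed

lemma hk_generator:
  assumes t: "0 \<le> t"
  shows "(\<Sum>\<^sub>\<infinity>z. s z * (hk t (x + z) - hk t x))
    = integral tbox (\<lambda>\<theta>. cos (\<theta> \<bullet> emb x) * (- psi \<theta> * exp (- t * psi \<theta>))) / (2 * pi) ^ CARD('d)"
proof -
  define g where "g z = Bcontfun (\<lambda>\<theta>. cos (\<theta> \<bullet> emb (x + z))) - Bcontfun (\<lambda>\<theta>. cos (\<theta> \<bullet> emb x))" for z :: "int ^ 'd"
  \<comment> \<open>Integration against the heat factor is a bounded functional for the uniform
    norm, so it can be moved through the infinite sum over jumps.\<close>
  define l where "l h = integral tbox (\<lambda>\<theta>. apply_bcontfun h \<theta> * exp (- t * psi \<theta>))" for h :: "(real ^ 'd) \<Rightarrow>\<^sub>C real"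
  have ag: "apply_bcontfun (g z) \<theta> = cos (\<theta> \<bullet> emb (x + z)) - cos (\<theta> \<bullet> emb x)" for z \<theta>
    by (simp add: g_def minus_bcontfun.rep_eq Bcontfun_inverse cos_bcontfun)
  have int: "(\<lambda>\<theta>. apply_bcontfun h \<theta> * exp (- t * psi \<theta>)) integrable_on tbox" for h :: "(real ^ 'd) \<Rightarrow>\<^sub>C real"
    unfolding tbox_def by (intro integrable_continuous continuous_intros) auto
  have l: "bounded_linear l"
  proof (rule bounded_linear_intro[where K = "measure lborel (tbox :: (real ^ 'd) set)"])
    fix h k :: "(real ^ 'd) \<Rightarrow>\<^sub>C real" and r :: real
    show "l (h + k) = l h + l k"
      unfolding l_def by (subst integral_add[symmetric, OF int int]) (simp add: plus_bcontfun.rep_eq distrib_right)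
    show "l (r *\<^sub>R h) = r *\<^sub>R l h"
      by (simp add: l_def scaleR_bcontfun.rep_eq mult.assoc)
    show "norm (l h) \<le> norm h * measure lborel (tbox :: (real ^ 'd) set)"
      unfolding tbox_def
    proof (rule has_integral_bound)
      show "((\<lambda>\<theta>. apply_bcontfun h \<theta> * exp (- t * psi \<theta>)) has_integral l h) (cbox (\<chi> i. - pi) (\<chi> i. pi))"
        using int[of h] unfolding l_def tbox_def by (rule integrable_integral)
      show "norm (apply_bcontfun h \<theta> * exp (- t * psi \<theta>)) \<le> norm h" for \<theta>
      proof -
        have "\<bar>apply_bcontfun h \<theta>\<bar> * exp (- t * psi \<theta>) \<le> norm h * 1"
          using t psi_nonneg[of \<theta>] by (intro mult_mono abs_apply_bcontfun_le) auto
        then show ?thesis by (simp add: abs_mult)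
      qed
    qed simp
  qed
  have "norm (g y) \<le> 2" for y
  proof (rule norm_bound)
    show "norm (apply_bcontfun (g y) \<theta>) \<le> 2" for \<theta>
      using cos_le_one[of "\<theta> \<bullet> emb (x + y)"] cos_ge_minus_one[of "\<theta> \<bullet> emb (x + y)"]
        cos_le_one[of "\<theta> \<bullet> emb x"] cos_ge_minus_one[of "\<theta> \<bullet> emb x"]
      unfolding ag real_norm_def abs_le_iff by linarith
  qed
  then obtain G where G: "((\<lambda>y. s y *\<^sub>R g y) has_sum G) UNIV"
    "\<And>\<theta>. apply_bcontfun G \<theta> = (\<Sum>\<^sub>\<infinity>y. s y * apply_bcontfun (g y) \<theta>)"
    using has_sum_bcontfun[of g 2] by auto
  have lg: "l (g z) / (2 * pi) ^ CARD('d) = hk t (x + z) - hk t x" for z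
    unfolding l_def hk_def ag left_diff_distrib
    by (subst integral_diff[OF hk_integrable hk_integrable]) (simp add: diff_divide_distrib)
  have "((\<lambda>z. s z * l (g z)) has_sum l G) UNIV"
    using has_sum_bounded_linear[OF l G(1)] by (simp add: o_def linear_cmul[OF bounded_linear.linear[OF l]])
  from has_sum_divide_const[OF this, of "(2 * pi) ^ CARD('d)"]
  have "(\<Sum>\<^sub>\<infinity>z. s z * (l (g z) / (2 * pi) ^ CARD('d))) = l G / (2 * pi) ^ CARD('d)"
    by (intro infsumI) simp
  then show ?thesis
    unfolding lg by (simp add: l_def G(2) ag sum_cos_shift mult_ac)
qed

lemma hk_derivative:
  assumes t: "0 \<le> t"
  shows "((\<lambda>t. hk t x) has_real_derivative (\<Sum>\<^sub>\<infinity>z. s z * (hk t (x + z) - hk t x))) (at t within {0..})"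
proof -
  have "((\<lambda>t. integral tbox (\<lambda>\<theta>. cos (\<theta> \<bullet> emb x) * exp (- t * psi \<theta>))) has_real_derivative
      integral tbox (\<lambda>\<theta>. cos (\<theta> \<bullet> emb x) * (- psi \<theta> * exp (- t * psi \<theta>)))) (at t within {0..})"
    unfolding tbox_def
  proof (rule leibniz_rule_field_derivative)
    show "((\<lambda>t. cos (\<theta> \<bullet> emb x) * exp (- t * psi \<theta>)) has_real_derivative
        cos (\<theta> \<bullet> emb x) * (- psi \<theta> * exp (- t * psi \<theta>))) (at t within {0..})" for t \<theta>
      by (auto intro!: derivative_eq_intros)
    show "continuous_on ({0..} \<times> cbox (\<chi> i. - pi) (\<chi> i. pi))
        (\<lambda>(t, \<theta>). cos (\<theta> \<bullet> emb x) * (- psi \<theta> * exp (- t * psi \<theta>)))"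
      unfolding case_prod_unfold by (intro continuous_intros)
  qed (use t hk_integrable in \<open>auto simp: tbox_def\<close>)
  then show ?thesis
    unfolding hk_def[abs_def] hk_generator[OF t, unfolded hk_def] by (rule DERIV_cdivide)
qed

lemma hk_le:
  assumes "0 \<le> t"
  shows "\<bar>hk t x\<bar> \<le> hk t 0"
proof -
  have "norm (integral tbox (\<lambda>\<theta>. cos (\<theta> \<bullet> emb x) * exp (- t * psi \<theta>))) \<le> integral tbox (\<lambda>\<theta>. exp (- t * psi \<theta>))"
  proof (rule integral_norm_bound_integral[OF hk_integrable])
    show "norm (cos (\<theta> \<bullet> emb x) * exp (- t * psi \<theta>)) \<le> exp (- t * psi \<theta>)" for \<theta>
      using mult_right_mono[OF abs_cos_le_one[of "\<theta> \<bullet> emb x"], of "exp (- t * psi \<theta>)"] by (simp add: abs_mult)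
  qed (use hk_integrable[of 0 t] in simp)
  then show ?thesis by (simp add: hk_def divide_right_mono)
qed

lemma hk_0: "hk 0 x = of_bool (x = 0)"
  by (simp add: hk_def integral_tbox_cos)

lemma hk_le_1:
  assumes "0 \<le> t"
  shows "hk t 0 \<le> 1"
proof -
  have "hk t 0 \<le> hk 0 0"
    unfolding hk_def
  proof (intro divide_right_mono integral_le hk_integrable)
    show "cos (\<theta> \<bullet> emb 0) * exp (- t * psi \<theta>) \<le> cos (\<theta> \<bullet> emb 0) * exp (- 0 * psi \<theta>)" for \<theta>
      using assms psi_nonneg[of \<theta>] by simp
  qed auto
  then show ?thesis by (simp add: hk_0)
qed

sublocale heat_kernel s hk
  by unfold_locales (use hk_0 hk_le hk_le_1 hk_derivative in auto)

end

section \<open>Lower bounds for the characteristic exponent\<close>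

lemma summable_on_int_powr:
  assumes "1 < \<gamma>"
  shows "(\<lambda>k::int. (1 + \<bar>real_of_int k\<bar>) powr - \<gamma>) summable_on UNIV"
proof -
  have "summable (\<lambda>n. real n powr - \<gamma>)" using assms by (simp add: summable_real_powr_iff)
  then have "summable (\<lambda>n. real (Suc n) powr - \<gamma>)" by (subst summable_Suc_iff)
  then have n: "(\<lambda>n. real (Suc n) powr - \<gamma>) summable_on UNIV"
    by (intro summable_nonneg_imp_summable_on) auto
  have 1: "(\<lambda>k::int. (1 + \<bar>real_of_int k\<bar>) powr - \<gamma>) summable_on range int"
    using n by (subst summable_on_reindex) (auto simp: o_def add.commute)
  have 2: "(\<lambda>k::int. (1 + \<bar>real_of_int k\<bar>) powr - \<gamma>) summable_on range (\<lambda>n. - int n)"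
    using n by (subst summable_on_reindex) (auto simp: o_def add.commute inj_on_def)
  have "k \<in> range int \<union> range (\<lambda>n. - int n)" for k
    by (cases k rule: int_cases2) auto
  then have "range int \<union> range (\<lambda>n. - int n) = UNIV" by blast
  then show ?thesis using summable_on_union[OF 1 2] by simp
qed

text \<open>Since the norm dominates every coordinate, the power can be shared equally among the
  \<open>d\<close> coordinates. Each receives the exponent \<open>1 + \<beta> / d\<close>, which is
  above 1, and the multiple sum factors.\<close>

lemma summable_on_lattice_powr:
  assumes "0 < \<beta>"
  shows "(\<lambda>y::int ^ 'd::finite. (1 + norm (emb y)) powr - (real CARD('d) + \<beta>)) summable_on UNIV"
proof -
  define d where "d = real CARD('d)"
  have d: "d > 0" by (simp add: d_def)
  define \<gamma> where "\<gamma> = 1 + \<beta> / d"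
  have \<gamma>: "0 < \<gamma>" unfolding \<gamma>_def using assms d by (intro add_pos_pos divide_pos_pos) auto
  define h where "h k = (1 + \<bar>real_of_int k\<bar>) powr - \<gamma>" for k
  have h: "h summable_on UNIV" unfolding h_def
    by (rule summable_on_int_powr) (use assms d in \<open>simp add: \<gamma>_def\<close>)
  have h0: "0 \<le> h k" for k by (simp add: h_def)
  have le: "(1 + norm (emb y)) powr - (d + \<beta>) \<le> (\<Prod>i\<in>UNIV. h (y $ i))" for y :: "int ^ 'd"
  proof -
    have "(1 + norm (emb y)) powr - (d + \<beta>) = (\<Prod>i\<in>(UNIV :: 'd set). (1 + norm (emb y)) powr - \<gamma>)"
    proof -
      have "real CARD('d) * - \<gamma> = - (d + \<beta>)" using d by (simp add: \<gamma>_def d_def field_simps)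
      then show ?thesis using powr_power[of "1 + norm (emb y)" "- \<gamma>" "CARD('d)"] by (simp add: add_nonneg_eq_0_iff mult.commute)
    qed
    also have "\<dots> \<le> (\<Prod>i\<in>UNIV. h (y $ i))"
    proof (intro prod_mono conjI)
      fix i
      have "1 + \<bar>real_of_int (y $ i)\<bar> \<le> 1 + norm (emb y)"
        using component_le_norm_cart[of "emb y" i] by simp
      then show "(1 + norm (emb y)) powr - \<gamma> \<le> h (y $ i)"
        using \<gamma> unfolding h_def by (intro powr_mono2') auto
    qed simp
    finally show ?thesis .
  qed
  have "(\<lambda>y::int ^ 'd. \<Prod>i\<in>UNIV. h (y $ i)) summable_on UNIV"
  proof (rule nonneg_bdd_above_summable_on)
    show "bdd_above (sum (\<lambda>y::int ^ 'd. \<Prod>i\<in>UNIV. h (y $ i)) ` {F. F \<subseteq> UNIV \<and> finite F})"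
    proof (rule bdd_aboveI2)
      fix F :: "(int ^ 'd) set" assume "F \<in> {F. F \<subseteq> UNIV \<and> finite F}"
      then have F: "finite F" by simp
      \<comment> \<open>A finite set of lattice points lies in a finite cube with coordinate values
        in \<open>N\<close>, over which the sum of products factors.\<close>
      define N where "N = (\<Union>i. (\<lambda>y. y $ i) ` F)"
      have N: "finite N" using F by (simp add: N_def)
      have inj: "inj_on vec_lambda (PiE UNIV (\<lambda>_::'d. N))" by (simp add: inj_on_def)
      have "F \<subseteq> vec_lambda ` (PiE UNIV (\<lambda>_::'d. N))"
      proof
        fix y assume "y \<in> F"
        then have "vec_nth y \<in> PiE UNIV (\<lambda>_. N)" by (auto simp: N_def)
        then show "y \<in> vec_lambda ` (PiE UNIV (\<lambda>_::'d. N))" by (metis image_eqI vec_nth_inverse)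
      qed
      then have "(\<Sum>y\<in>F. \<Prod>i\<in>UNIV. h (y $ i)) \<le> (\<Sum>y\<in>vec_lambda ` (PiE UNIV (\<lambda>_::'d. N)). \<Prod>i\<in>UNIV. h (y $ i))"
        using N by (intro sum_mono2) (auto intro!: finite_PiE prod_nonneg h0)
      also have "\<dots> = (\<Sum>g\<in>PiE UNIV (\<lambda>_::'d. N). \<Prod>i\<in>UNIV. h (g i))"
        by (simp add: sum.reindex[OF inj])
      also have "\<dots> = (\<Prod>i\<in>(UNIV :: 'd set). \<Sum>k\<in>N. h k)"
        using N by (subst prod_sum_PiE) auto
      also have "\<dots> \<le> (\<Prod>i\<in>(UNIV :: 'd set). \<Sum>\<^sub>\<infinity>k. h k)"
        using N by (intro prod_mono conjI sum_nonneg h0 finite_sum_le_infsum h) auto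
      finally show "(\<Sum>y\<in>F. \<Prod>i\<in>UNIV. h (y $ i)) \<le> (\<Prod>i\<in>(UNIV :: 'd set). \<Sum>\<^sub>\<infinity>k. h k)" .
    qed
  qed (simp add: prod_nonneg h0)
  then show ?thesis
    by (rule summable_on_comparison_test) (use le in \<open>auto simp: d_def\<close>)
qed

lemma norm_emb_ge_1: "y \<noteq> 0 \<Longrightarrow> 1 \<le> norm (emb y)"
proof -
  assume "y \<noteq> 0"
  then obtain i where i: "y $ i \<noteq> 0" by (auto simp: vec_eq_iff)
  then have "1 \<le> \<bar>real_of_int (y $ i)\<bar>" by linarith
  then show ?thesis using component_le_norm_cart[of "emb y" i] by simp
qed

lemma summable_on_norm_powr:
  assumes "0 < \<beta>"
  shows "(\<lambda>y::int ^ 'd::finite. norm (emb y) powr - (real CARD('d) + \<beta>)) summable_on (UNIV - {0})"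
proof (rule summable_on_comparison_test)
  let ?e = "real CARD('d) + \<beta>"
  show "(\<lambda>y::int ^ 'd::finite. 2 powr ?e * (1 + norm (emb y)) powr - ?e) summable_on (UNIV - {0})"
    using summable_on_lattice_powr[OF assms, where 'd = 'd]
    by (intro summable_on_cmult_right) (rule summable_on_subset_banach[where A = UNIV], auto)
  show "norm (emb y) powr - ?e \<le> 2 powr ?e * (1 + norm (emb y)) powr - ?e" if "y \<in> UNIV - {0}" for y :: "int ^ 'd"
  proof -
    have "norm (emb y) powr - ?e \<le> ((1 + norm (emb y)) / 2) powr - ?e"
      using norm_emb_ge_1[of y] that assms by (intro powr_mono2') auto
    also have "\<dots> = 2 powr ?e * (1 + norm (emb y)) powr - ?e"
    proof -
      have "((1 + r) / 2) powr - e = 2 powr e * (1 + r) powr - e" if "0 \<le> r" for r e :: real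
        using that by (simp add: powr_divide powr_minus field_simps)
      from this[OF norm_ge_zero] show ?thesis .
    qed
    finally show ?thesis .
  qed
qed auto

lemma powr_split_square:
  assumes "0 < (x::real)"
  shows "x powr (1 - a) = x powr (- 1 - a) * x\<^sup>2"
proof -
  have "x powr (1 - a) = x powr ((- 1 - a) + 2)" by simp
  also have "\<dots> = x powr (- 1 - a) * x powr 2" by (rule powr_add)
  also have "x powr 2 = x\<^sup>2" using assms by (simp add: powr_numeral)
  finally show ?thesis .
qed

lemma half_le_sin:
  assumes "0 \<le> x" "x \<le> 1"
  shows "x / 2 \<le> sin (x::real)"
proof (cases "x = 0")
  case False
  then have "0 < x" using assms by simp
  then obtain z where z: "0 < z" "z < x" "sin x - sin 0 = (x - 0) * cos z"
    using MVT2[of 0 x sin cos] by (auto intro: DERIV_sin)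
  \<comment> \<open>The argument stays below 1, hence below \<pi> / 3, where the cosine is still at
    least 1/2.\<close>
  have "cos (pi / 3) \<le> cos z"
    using z assms pi_gt3 by (intro cos_monotone_0_pi_le) auto
  then have "x * (1 / 2) \<le> x * cos z" using assms by (intro mult_left_mono) (auto simp: cos_60)
  then show ?thesis using z by simp
qed simp

section \<open>The long-range kernel: symmetries and lower bounds for its exponent\<close>

locale lr_kernel =
  fixes b :: "'d::finite \<Rightarrow> real" and \<alpha> C :: real and s :: "int ^ 'd \<Rightarrow> real"
  assumes b: "\<And>i. 0 < b i" and \<alpha>: "0 < \<alpha>" and C: "0 < C"
    and s_eq: "\<And>y. s y = (if y = 0 then 0
      else C * norm (emb y) powr - (real CARD('d) + \<alpha>) * (\<Sum>i\<in>UNIV. b i * of_bool (y $ i \<noteq> 0)))"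
    and s_has_sum: "(s has_sum 1) UNIV"
begin

sublocale symmetric_kernel s
proof
  show "0 \<le> s y" for y
  proof -
    have "0 \<le> (\<Sum>i\<in>UNIV. b i * of_bool (y $ i \<noteq> 0))"
      by (intro sum_nonneg mult_nonneg_nonneg) (use b in \<open>auto simp: less_imp_le\<close>)
    then have "0 \<le> C * norm (emb y) powr - (real CARD('d) + \<alpha>) * (\<Sum>i\<in>UNIV. b i * of_bool (y $ i \<noteq> 0))"
      using C by (intro mult_nonneg_nonneg) auto
    then show ?thesis unfolding s_eq by simp
  qed
  show "s (- y) = s y" for y by (simp add: s_eq emb_minus)
qed (rule s_has_sum)

text \<open>The kernel is invariant under changing the sign of one coordinate. This is stronger than
  central symmetry and is what decouples coordinate \<open>i\<close> in
  \<open>psi_refl\<close>.\<close>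

definition refl :: "'d \<Rightarrow> int ^ 'd \<Rightarrow> int ^ 'd" where
  "refl i y = (\<chi> j. if j = i then - (y $ j) else y $ j)"

lemma refl_nth: "refl i y $ j = (if j = i then - (y $ j) else y $ j)"
  by (simp add: refl_def)

lemma refl_refl [simp]: "refl i (refl i y) = y"
  by (simp add: vec_eq_iff refl_nth)

lemma bij_refl: "bij (refl i)"
  by (rule bij_betwI[where g = "refl i"]) auto

lemma s_refl: "s (refl i y) = s y"
proof -
  have "norm (emb (refl i y)) = norm (emb y)"
    unfolding norm_vec_def L2_set_def by (intro arg_cong[where f = sqrt] sum.cong) (auto simp: refl_nth)
  moreover have "refl i y = 0 \<longleftrightarrow> y = 0" by (auto simp: vec_eq_iff refl_nth)
  moreover have "(refl i y $ j \<noteq> 0) = (y $ j \<noteq> 0)" for j by (simp add: refl_nth)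
  ultimately show ?thesis by (simp add: s_eq)
qed

lemma s_le: "y \<noteq> 0 \<Longrightarrow> s y \<le> C * (\<Sum>i\<in>UNIV. b i) * norm (emb y) powr - (real CARD('d) + \<alpha>)"
proof -
  assume y: "y \<noteq> 0"
  have "(\<Sum>i\<in>UNIV. b i * of_bool (y $ i \<noteq> 0)) \<le> (\<Sum>i\<in>UNIV. b i)"
    using b by (intro sum_mono) (auto simp: less_imp_le)
  then have "C * norm (emb y) powr - (real CARD('d) + \<alpha>) * (\<Sum>i\<in>UNIV. b i * of_bool (y $ i \<noteq> 0))
      \<le> C * norm (emb y) powr - (real CARD('d) + \<alpha>) * (\<Sum>i\<in>UNIV. b i)"
    using C by (intro mult_left_mono) auto
  then show ?thesis using y by (simp add: s_eq mult_ac)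
qed

definition c\<^sub>0 :: real where "c\<^sub>0 = C * Min (range b)"

lemma c0_pos: "0 < c\<^sub>0"
  using b C by (auto simp: c\<^sub>0_def)

lemma s_ge: "y \<noteq> 0 \<Longrightarrow> c\<^sub>0 * norm (emb y) powr - (real CARD('d) + \<alpha>) \<le> s y"
proof -
  assume y: "y \<noteq> 0"
  then obtain i where i: "y $ i \<noteq> 0" by (auto simp: vec_eq_iff)
  have "Min (range b) \<le> b i" by simp
  also have "\<dots> = b i * of_bool (y $ i \<noteq> 0)" using i by simp
  also have "\<dots> \<le> (\<Sum>i\<in>UNIV. b i * of_bool (y $ i \<noteq> 0))"
    using b by (intro member_le_sum) (auto simp: less_imp_le)
  finally have "C * norm (emb y) powr - (real CARD('d) + \<alpha>) * Min (range b)
      \<le> C * norm (emb y) powr - (real CARD('d) + \<alpha>) * (\<Sum>i\<in>UNIV. b i * of_bool (y $ i \<noteq> 0))"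
    using C by (intro mult_left_mono) auto
  then show ?thesis using y by (simp add: s_eq c\<^sub>0_def mult_ac)
qed

text \<open>Averaging over the reflection of coordinate \<open>i\<close> turns \<open>cos (A + B)\<close> into \<open>cos A cos B\<close>.\<close>

lemma psi_refl:
  "psi \<theta> = (\<Sum>\<^sub>\<infinity>y. s y * (1 - cos (\<theta> \<bullet> emb y - \<theta> $ i * real_of_int (y $ i)) * cos (\<theta> $ i * real_of_int (y $ i))))"
proof -
  let ?A = "\<lambda>y. \<theta> \<bullet> emb y - \<theta> $ i * real_of_int (y $ i)" and ?B = "\<lambda>y. \<theta> $ i * real_of_int (y $ i)"
  have inner: "\<theta> \<bullet> emb (refl i y) = ?A y - ?B y" for y
  proof -
    have "\<theta> \<bullet> emb (refl i y) = (\<Sum>j\<in>UNIV. \<theta> $ j * real_of_int (y $ j) - (if j = i then 2 * ?B y else 0))"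
      unfolding inner_vec_def by (intro sum.cong) (auto simp: refl_nth)
    also have "\<dots> = \<theta> \<bullet> emb y - 2 * ?B y" by (simp add: sum_subtractf inner_vec_def)
    finally show ?thesis by simp
  qed
  have 1: "((\<lambda>y. s y * (1 - cos (?A y + ?B y))) has_sum psi \<theta>) UNIV"
    using has_sum_infsum[OF psi_summable[of \<theta> UNIV]] by (simp add: psi_def)
  have "((\<lambda>y. s (refl i y) * (1 - cos (\<theta> \<bullet> emb (refl i y)))) has_sum psi \<theta>) UNIV"
    using has_sum_reindex_bij_betw[OF bij_refl, of "\<lambda>y. s y * (1 - cos (\<theta> \<bullet> emb y))"] 1 by simp
  then have 2: "((\<lambda>y. s y * (1 - cos (?A y - ?B y))) has_sum psi \<theta>) UNIV"
    by (simp only: s_refl inner)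
  have "((\<lambda>y. (s y * (1 - cos (?A y + ?B y)) + s y * (1 - cos (?A y - ?B y))) / 2) has_sum (psi \<theta> + psi \<theta>) / 2) UNIV"
    by (intro has_sum_divide_const has_sum_add 1 2)
  moreover have "(s y * (1 - cos (?A y + ?B y)) + s y * (1 - cos (?A y - ?B y))) / 2 = s y * (1 - cos (?A y) * cos (?B y))" for y
  proof -
    have "(r * (1 - cos (a + b)) + r * (1 - cos (a - b))) / 2 = r * (1 - cos a * cos b)" for r a b :: real
      unfolding cos_add cos_diff by (simp add: field_simps)
    then show ?thesis .
  qed
  ultimately have "((\<lambda>y. s y * (1 - cos (?A y) * cos (?B y))) has_sum psi \<theta>) UNIV" by simp
  then show ?thesis by (rule infsumI[symmetric])
qed

text \<open>By the inequality between product and squares, \<open>1 - cos A * cos B\<close> is at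
  least half of the squared sine of \<open>B\<close>, an expression in coordinate \<open>i\<close>
  alone.\<close>

lemma psi_ge_sin:
  "(\<Sum>\<^sub>\<infinity>y. s y * (sin (\<theta> $ i * real_of_int (y $ i)))\<^sup>2) / 2 \<le> psi \<theta>"
proof -
  let ?A = "\<lambda>y. \<theta> \<bullet> emb y - \<theta> $ i * real_of_int (y $ i)" and ?B = "\<lambda>y. \<theta> $ i * real_of_int (y $ i)"
  have "(\<Sum>\<^sub>\<infinity>y. s y * (sin (?B y))\<^sup>2) / 2 = (\<Sum>\<^sub>\<infinity>y. s y * ((sin (?B y))\<^sup>2 / 2))"
    using infsum_cmult_right'[of "1 / 2" "\<lambda>y. s y * (sin (?B y))\<^sup>2" UNIV] by simp
  also have "\<dots> \<le> psi \<theta>"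
    unfolding psi_refl[of \<theta> i]
  proof (rule infsum_mono)
    show "(\<lambda>y. s y * ((sin (?B y))\<^sup>2 / 2)) summable_on UNIV"
    proof (rule summable_bounded[where M = 1])
      show "\<bar>(sin (?B y))\<^sup>2 / 2\<bar> \<le> 1" for y
        using abs_square_le_1[of "sin (?B y)"] abs_sin_le_one[of "?B y"] by simp
    qed
    show "(\<lambda>y. s y * (1 - cos (?A y) * cos (?B y))) summable_on UNIV"
    proof (rule summable_bounded[where M = 2])
      fix y
      have "\<bar>cos (?A y) * cos (?B y)\<bar> \<le> 1" unfolding abs_mult by (intro mult_le_one) auto
      then show "\<bar>1 - cos (?A y) * cos (?B y)\<bar> \<le> 2" by linarith
    qed
    fix y
    have "2 * cos (?A y) * cos (?B y) \<le> (cos (?A y))\<^sup>2 + (cos (?B y))\<^sup>2" by (rule sum_squares_bound)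
    also have "\<dots> \<le> 1 + (1 - (sin (?B y))\<^sup>2)"
      by (simp add: cos_squared_eq)
    finally show "s y * ((sin (?B y))\<^sup>2 / 2) \<le> s y * (1 - cos (?A y) * cos (?B y))"
      by (intro mult_left_mono nonneg) simp
  qed
  finally show ?thesis .
qed

text \<open>In the slab the coordinate \<open>i\<close> equals \<open>k\<close> and the others lie
  in \<open>[0, k)\<close>. It has \<open>k ^ (d - 1)\<close> points, all of norm between
  \<open>k\<close> and \<open>d * k\<close>, and slabs for different \<open>k\<close> are
  disjoint.\<close>

definition slab :: "'d \<Rightarrow> nat \<Rightarrow> (int ^ 'd) set" where
  "slab i k = vec_lambda ` (PiE UNIV (\<lambda>j. if j = i then {int k} else {0..<int k}))"

lemma slab_mem: "y \<in> slab i k \<Longrightarrow> y $ j \<in> (if j = i then {int k} else {0..<int k})"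
proof -
  assume "y \<in> slab i k"
  then obtain g where g: "y = vec_lambda g" "g \<in> PiE UNIV (\<lambda>j. if j = i then {int k} else {0..<int k})"
    by (auto simp: slab_def)
  show ?thesis using PiE_mem[OF g(2), of j] by (simp add: g(1))
qed

lemma slab_nth: "y \<in> slab i k \<Longrightarrow> y $ i = int k"
  and slab_bound: "y \<in> slab i k \<Longrightarrow> \<bar>y $ j\<bar> \<le> int k"
  using slab_mem[of y i k i] slab_mem[of y i k j] by (auto split: if_splits)

lemma finite_slab: "finite (slab i k)"
  unfolding slab_def by (intro finite_imageI finite_PiE) auto

lemma card_slab: "card (slab i k) = k ^ (CARD('d) - 1)"
proof -
  have "card (slab i k) = card (PiE UNIV (\<lambda>j. if j = i then {int k} else {0..<int k}))"
    unfolding slab_def by (rule card_image) (simp add: inj_on_def)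
  also have "\<dots> = (\<Prod>j\<in>UNIV. if j = i then 1 else k)"
    by (subst card_PiE) (auto intro!: prod.cong)
  also have "\<dots> = k ^ (CARD('d) - 1)"
    by (simp add: prod.If_cases Collect_neg_eq[symmetric] card_Diff_singleton Compl_eq_Diff_UNIV)
  finally show ?thesis .
qed

text \<open>The power of the dimension comes from bounding the norm by \<open>d * k\<close> on a
  slab, the 1/2 from \<open>psi_ge_sin\<close>.\<close>

definition c\<^sub>1 :: real where "c\<^sub>1 = c\<^sub>0 * real CARD('d) powr - (real CARD('d) + \<alpha>) / 2"

lemma c1_pos: "0 < c\<^sub>1"
  using c0_pos by (simp add: c\<^sub>1_def)

text \<open>Only the slabs are kept of the whole lattice: \<open>k ^ (d - 1)\<close> points of
  weight of order \<open>k powr (- d - \<alpha>)\<close> leave the one-dimensional weight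
  \<open>k powr (- 1 - \<alpha>)\<close> in every dimension.\<close>

lemma psi_ge_sum:
  "c\<^sub>1 * (\<Sum>k=1..N. real k powr (- 1 - \<alpha>) * (sin (\<theta> $ i * real k))\<^sup>2) \<le> psi \<theta>"
proof -
  let ?d = "real CARD('d)"
  let ?w = "\<lambda>y. s y * (sin (\<theta> $ i * real_of_int (y $ i)))\<^sup>2"
  have "2 * c\<^sub>1 * (\<Sum>k=1..N. real k powr (- 1 - \<alpha>) * (sin (\<theta> $ i * real k))\<^sup>2)
     = (\<Sum>k=1..N. \<Sum>y\<in>slab i k. c\<^sub>0 * (?d * real k) powr - (?d + \<alpha>) * (sin (\<theta> $ i * real k))\<^sup>2)"
    unfolding sum_distrib_left
  proof (rule sum.cong[OF refl])
    fix k assume "k \<in> {1..N}"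
    then have k: "real k > 0" by simp
    have "(?d * real k) powr - (?d + \<alpha>) * real k ^ (CARD('d) - 1) = ?d powr - (?d + \<alpha>) * (real k powr - (?d + \<alpha>) * real k powr (?d - 1))"
      using k by (simp add: powr_mult powr_realpow[symmetric] of_nat_diff Suc_le_eq)
    also have "real k powr - (?d + \<alpha>) * real k powr (?d - 1) = real k powr (- 1 - \<alpha>)"
      unfolding powr_add[symmetric] by (rule arg_cong[where f = "(powr) (real k)"]) simp
    finally have "(?d * real k) powr - (?d + \<alpha>) * real k ^ (CARD('d) - 1) = ?d powr - (?d + \<alpha>) * real k powr (- 1 - \<alpha>)" .
    then show "2 * c\<^sub>1 * (real k powr (- 1 - \<alpha>) * (sin (\<theta> $ i * real k))\<^sup>2)
      = (\<Sum>y\<in>slab i k. c\<^sub>0 * (?d * real k) powr - (?d + \<alpha>) * (sin (\<theta> $ i * real k))\<^sup>2)"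
      by (simp add: card_slab c\<^sub>1_def mult_ac)
  qed
  also have "\<dots> \<le> (\<Sum>k=1..N. \<Sum>y\<in>slab i k. ?w y)"
  proof (intro sum_mono)
    fix k y assume k: "k \<in> {1..N}" and y: "y \<in> slab i k"
    have yi: "y $ i = int k" by (rule slab_nth[OF y])
    then have y0: "y \<noteq> 0" using k by (auto simp: vec_eq_iff intro: exI[of _ i])
    have "norm (emb y) \<le> (\<Sum>j\<in>UNIV. \<bar>emb y $ j\<bar>)" by (rule norm_le_l1_cart)
    also have "\<dots> \<le> (\<Sum>j\<in>(UNIV :: 'd set). real k)"
    proof (rule sum_mono)
      show "\<bar>emb y $ j\<bar> \<le> real k" for j using slab_bound[OF y, of j] by simp
    qed
    finally have "norm (emb y) \<le> ?d * real k" by simp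
    then have "(?d * real k) powr - (?d + \<alpha>) \<le> norm (emb y) powr - (?d + \<alpha>)"
      using norm_emb_ge_1[OF y0] \<alpha> by (intro powr_mono2') auto
    then have "c\<^sub>0 * (?d * real k) powr - (?d + \<alpha>) \<le> s y"
      using s_ge[OF y0] c0_pos by (smt (verit) mult_left_mono)
    then show "c\<^sub>0 * (?d * real k) powr - (?d + \<alpha>) * (sin (\<theta> $ i * real k))\<^sup>2 \<le> ?w y"
      unfolding yi of_int_of_nat_eq by (rule mult_right_mono) simp
  qed
  also have "\<dots> = (\<Sum>y\<in>(\<Union>k\<in>{1..N}. slab i k). ?w y)"
    by (rule sum.UNION_disjoint[symmetric]) (auto simp: finite_slab, metis of_nat_eq_iff slab_nth)
  also have "\<dots> \<le> (\<Sum>\<^sub>\<infinity>y. ?w y)"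
    by (rule finite_sum_le_infsum)
       (auto simp: finite_slab nonneg intro!: summable_bounded[where M = 1] abs_square_le_1[THEN iffD2])
  also have "\<dots> \<le> 2 * psi \<theta>" using psi_ge_sin[of \<theta> i] by simp
  finally show ?thesis by simp
qed

text \<open>As long as \<open>\<bar>\<theta> $ i\<bar> * k\<close> is at most 1, the sine is at
  least half its argument; the square of this half is the factor 1/4.\<close>

lemma psi_ge_sum_small:
  assumes th: "\<theta> $ i \<noteq> 0" and N: "\<bar>\<theta> $ i\<bar> * real N \<le> 1"
  shows "c\<^sub>1 / 4 * ((\<theta> $ i)\<^sup>2 * (\<Sum>k=1..N. real k powr (1 - \<alpha>))) \<le> psi \<theta>"
proof -
  have "c\<^sub>1 / 4 * ((\<theta> $ i)\<^sup>2 * (\<Sum>k=1..N. real k powr (1 - \<alpha>)))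
      = c\<^sub>1 * (\<Sum>k=1..N. real k powr (1 - \<alpha>) * (\<theta> $ i)\<^sup>2 / 4)"
    by (simp add: sum_distrib_left sum_divide_distrib mult_ac)
  also have "\<dots> \<le> c\<^sub>1 * (\<Sum>k=1..N. real k powr (- 1 - \<alpha>) * (sin (\<theta> $ i * real k))\<^sup>2)"
  proof (intro mult_left_mono sum_mono)
    fix k assume k: "k \<in> {1..N}"
    let ?x = "\<bar>\<theta> $ i\<bar> * real k"
    have "?x \<le> \<bar>\<theta> $ i\<bar> * real N" using k by (intro mult_left_mono) auto
    then have x: "0 \<le> ?x" "?x \<le> 1" using N by auto
    have "(?x / 2)\<^sup>2 \<le> (sin ?x)\<^sup>2" using half_le_sin[OF x] x by (intro power_mono) auto
    also have "(sin ?x)\<^sup>2 = (sin (\<theta> $ i * real k))\<^sup>2" by (cases "\<theta> $ i \<ge> 0") auto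
    finally have "real k powr (- 1 - \<alpha>) * (?x / 2)\<^sup>2 \<le> real k powr (- 1 - \<alpha>) * (sin (\<theta> $ i * real k))\<^sup>2"
      by (rule mult_left_mono) simp
    moreover have "real k powr (1 - \<alpha>) = real k powr (- 1 - \<alpha>) * (real k)\<^sup>2"
      using k by (intro powr_split_square) auto
    ultimately show "real k powr (1 - \<alpha>) * (\<theta> $ i)\<^sup>2 / 4 \<le> real k powr (- 1 - \<alpha>) * (sin (\<theta> $ i * real k))\<^sup>2"
      by (simp add: power_mult_distrib power_divide mult_ac)
  qed (use c1_pos in simp)
  also have "\<dots> \<le> psi \<theta>" by (rule psi_ge_sum)
  finally show ?thesis .
qed

text \<open>Away from the origin the single jump to the nearest neighbour in direction
  \<open>i\<close> suffices.\<close>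

lemma psi_ge_const:
  assumes "1 < \<bar>\<theta> $ i\<bar>" "\<theta> \<in> tbox"
  shows "c\<^sub>0 * (1 - cos 1) \<le> psi \<theta>"
proof -
  define y where "y = (\<chi> j. if j = i then 1 else (0 :: int))"
  have emby: "emb y = axis i 1" by (simp add: vec_eq_iff y_def axis_def)
  then have y0: "y \<noteq> 0" by (auto simp: y_def vec_eq_iff)
  have "cos \<bar>\<theta> $ i\<bar> \<le> cos 1" using assms by (intro cos_monotone_0_pi_le) (auto simp: mem_tbox)
  then have c: "cos (\<theta> $ i) \<le> cos 1" by simp
  have "c\<^sub>0 * (1 - cos 1) \<le> s y * (1 - cos (\<theta> \<bullet> emb y))"
    using s_ge[OF y0] c0_pos c by (intro mult_mono) (auto simp: emby inner_axis nonneg)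
  also have "\<dots> = (\<Sum>y\<in>{y}. s y * (1 - cos (\<theta> \<bullet> emb y)))" by simp
  also have "\<dots> \<le> psi \<theta>"
    unfolding psi_def by (rule finite_sum_le_infsum) (auto simp: psi_summable nonneg)
  finally show ?thesis .
qed

lemma floor_inverse:
  assumes "0 < x" "x \<le> (1::real)"
  obtains N :: nat where "1 \<le> N" "x * real N \<le> 1" "1 / x < real N + 1" "1 / (2 * x) \<le> real N"
proof -
  define N where "N = nat \<lfloor>1 / x\<rfloor>"
  have 1: "1 \<le> 1 / x" using assms by simp
  then have f1: "1 \<le> \<lfloor>1 / x\<rfloor>" by (simp add: le_floor_iff)
  then have N: "real N = of_int \<lfloor>1 / x\<rfloor>" and N1: "1 \<le> N" unfolding N_def by linarith+
  have "real N \<le> 1 / x" "1 / x < real N + 1" unfolding N by linarith+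
  moreover from this have "x * real N \<le> 1" using assms by (simp add: field_simps)
  moreover have "1 / (2 * x) = (1 / x) / 2" by simp
  ultimately show ?thesis using N1 by (intro that[of N]) linarith+
qed

lemma psi_ge_powr: "\<exists>c>0. \<forall>\<theta>\<in>tbox. \<forall>i. c * \<bar>\<theta> $ i\<bar> powr \<alpha> \<le> psi \<theta>"
proof -
  \<comment> \<open>\<open>c\<^sub>1 / 96\<close> is the quarter from
    \<open>psi_ge_sum_small\<close> times the 1/24 found below. The other term serves components
    above 1, whose power is at most that of \<pi>.\<close>
  define c where "c = min (c\<^sub>1 / 96) (c\<^sub>0 * (1 - cos 1) / pi powr \<alpha>)"
  have c_le: "c \<le> c\<^sub>1 / 96" "c \<le> c\<^sub>0 * (1 - cos 1) / pi powr \<alpha>"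
    by (simp_all only: c_def min.cobounded1 min.cobounded2)
  have cos1: "cos 1 < (1 :: real)" using cos_monotone_0_pi[of 0 1] pi_gt3 by simp
  have "c * \<bar>\<theta> $ i\<bar> powr \<alpha> \<le> psi \<theta>" if \<theta>: "\<theta> \<in> tbox" for \<theta> i
  proof -
    consider "\<theta> $ i = 0" | "0 < \<bar>\<theta> $ i\<bar>" "\<bar>\<theta> $ i\<bar> \<le> 1" | "1 < \<bar>\<theta> $ i\<bar>" by linarith
    then show ?thesis
    proof cases
      case 1
      then show ?thesis using psi_nonneg \<alpha> by simp
    next
      case 2
      let ?x = "\<bar>\<theta> $ i\<bar>"
      obtain N where N: "1 \<le> N" "?x * real N \<le> 1" "1 / (2 * ?x) \<le> real N" using floor_inverse[OF 2] by metis
      \<comment> \<open>Bounding \<open>k powr (- 1 - \<alpha>)\<close> below by its value at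
        \<open>1 / ?x\<close> reduces every \<alpha> to a sum of squares, so the sign of 1 -
        \<alpha> does not have to be distinguished.\<close>
      have "(1 / ?x) powr (- 1 - \<alpha>) * (\<Sum>k=1..N. (real k)\<^sup>2) \<le> (\<Sum>k=1..N. real k powr (1 - \<alpha>))"
        unfolding sum_distrib_left
      proof (rule sum_mono)
        fix k assume k: "k \<in> {1..N}"
        have "?x * real k \<le> ?x * real N" using k by (intro mult_left_mono) auto
        then have "?x * real k \<le> 1" using N by linarith
        then have "real k \<le> 1 / ?x" using 2 by (simp add: field_simps)
        then have "(1 / ?x) powr (- 1 - \<alpha>) \<le> real k powr (- 1 - \<alpha>)"
          using k \<alpha> by (intro powr_mono2') auto
        then have "(1 / ?x) powr (- 1 - \<alpha>) * (real k)\<^sup>2 \<le> real k powr (- 1 - \<alpha>) * (real k)\<^sup>2"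
          by (rule mult_right_mono) simp
        also have "\<dots> = real k powr (1 - \<alpha>)"
          using k by (intro powr_split_square[symmetric]) auto
        finally show "(1 / ?x) powr (- 1 - \<alpha>) * (real k)\<^sup>2 \<le> real k powr (1 - \<alpha>)" .
      qed
      \<comment> \<open>The squares sum to at least \<open>N ^ 3 / 3\<close>, and \<open>N\<close>
        is at least \<open>1 / (2 * ?x)\<close>; together this is the 24 = 8 * 3 below.\<close>
      moreover have "(1 / (2 * ?x)) ^ 3 / 3 \<le> (\<Sum>k=1..N. (real k)\<^sup>2)"
      proof -
        have "(1 / (2 * ?x)) ^ 3 \<le> real N ^ 3" using N 2 by (intro power_mono) auto
        moreover have "real M ^ 3 \<le> 3 * (\<Sum>k=1..M. (real k)\<^sup>2)" for M
          by (induction M) (auto simp: power2_eq_square power3_eq_cube algebra_simps)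
        from this[of N] calculation show ?thesis by linarith
      qed
      ultimately have "(1 / ?x) powr (- 1 - \<alpha>) * ((1 / (2 * ?x)) ^ 3 / 3) \<le> (\<Sum>k=1..N. real k powr (1 - \<alpha>))"
        by (smt (verit) mult_left_mono powr_ge_zero)
      moreover have "(1 / ?x) powr (- 1 - \<alpha>) * ((1 / (2 * ?x)) ^ 3 / 3) = ?x powr \<alpha> / ?x\<^sup>2 / 24"
        using 2 by (simp add: powr_divide powr_diff powr_minus power_divide power_mult_distrib power2_eq_square power3_eq_cube field_simps)
      ultimately have "?x\<^sup>2 * (?x powr \<alpha> / ?x\<^sup>2 / 24) \<le> ?x\<^sup>2 * (\<Sum>k=1..N. real k powr (1 - \<alpha>))"
        by (intro mult_left_mono) auto
      then have "?x powr \<alpha> / 24 \<le> (\<theta> $ i)\<^sup>2 * (\<Sum>k=1..N. real k powr (1 - \<alpha>))"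
        using 2 by simp
      then have "c\<^sub>1 / 4 * (?x powr \<alpha> / 24) \<le> c\<^sub>1 / 4 * ((\<theta> $ i)\<^sup>2 * (\<Sum>k=1..N. real k powr (1 - \<alpha>)))"
        using c1_pos by (intro mult_left_mono) auto
      also have "\<dots> \<le> psi \<theta>" using 2 N by (intro psi_ge_sum_small) auto
      finally have "c\<^sub>1 / 96 * ?x powr \<alpha> \<le> psi \<theta>" by simp
      moreover have "c * ?x powr \<alpha> \<le> c\<^sub>1 / 96 * ?x powr \<alpha>" by (intro mult_right_mono c_le) simp
      ultimately show ?thesis by linarith
    next
      case 3
      have "c * \<bar>\<theta> $ i\<bar> powr \<alpha> \<le> (c\<^sub>0 * (1 - cos 1) / pi powr \<alpha>) * pi powr \<alpha>"
        using \<theta> \<alpha> c0_pos cos1 by (intro mult_mono powr_mono2) (auto simp: c_le mem_tbox)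
      also have "\<dots> \<le> psi \<theta>" using psi_ge_const[OF 3 \<theta>] by simp
      finally show ?thesis .
    qed
  qed
  moreover have "c > 0" using c1_pos c0_pos cos1 by (simp add: c_def)
  ultimately show ?thesis by blast
qed

text \<open>For small components the term with \<open>k = 1\<close> alone gives the quadratic bound,
  whatever the value of \<alpha>.\<close>

lemma psi_ge_square: "\<exists>c>0. \<forall>\<theta>\<in>tbox. \<forall>i. c * (\<theta> $ i)\<^sup>2 \<le> psi \<theta>"
proof -
  define c where "c = min (c\<^sub>1 / 4) (c\<^sub>0 * (1 - cos 1) / pi\<^sup>2)"
  have c_le: "c \<le> c\<^sub>1 / 4" "c \<le> c\<^sub>0 * (1 - cos 1) / pi\<^sup>2"
    by (simp_all only: c_def min.cobounded1 min.cobounded2)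
  have cos1: "cos 1 < (1 :: real)" using cos_monotone_0_pi[of 0 1] pi_gt3 by simp
  have "c * (\<theta> $ i)\<^sup>2 \<le> psi \<theta>" if \<theta>: "\<theta> \<in> tbox" for \<theta> i
  proof -
    consider "\<theta> $ i = 0" | "\<theta> $ i \<noteq> 0" "\<bar>\<theta> $ i\<bar> \<le> 1" | "1 < \<bar>\<theta> $ i\<bar>" by linarith
    then show ?thesis
    proof cases
      case 1
      then show ?thesis using psi_nonneg by simp
    next
      case 2
      have "c * (\<theta> $ i)\<^sup>2 \<le> c\<^sub>1 / 4 * (\<theta> $ i)\<^sup>2" by (intro mult_right_mono c_le) simp
      also have "\<dots> \<le> psi \<theta>" using psi_ge_sum_small[of \<theta> i 1] 2 by simp
      finally show ?thesis .
    next
      case 3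
      have "(\<theta> $ i)\<^sup>2 \<le> pi\<^sup>2" using \<theta> by (simp add: mem_tbox power2_le_iff_abs_le)
      then have "c * (\<theta> $ i)\<^sup>2 \<le> (c\<^sub>0 * (1 - cos 1) / pi\<^sup>2) * pi\<^sup>2"
        using c0_pos cos1 by (intro mult_mono c_le) auto
      also have "\<dots> \<le> psi \<theta>" using psi_ge_const[OF 3 \<theta>] by simp
      finally show ?thesis .
    qed
  qed
  moreover have "c > 0" using c1_pos c0_pos cos1 by (simp add: c_def)
  ultimately show ?thesis by blast
qed

text \<open>At \<alpha> = 2 the truncated sum is harmonic, and truncating at the inverse of the
  component produces the logarithm. For components above 1 the logarithm is negative and the bound
  trivial.\<close>

lemma psi_ge_log:
  assumes "\<alpha> = 2"
  shows "\<exists>c>0. \<forall>\<theta>\<in>tbox. \<forall>i. \<theta> $ i \<noteq> 0 \<longrightarrow> c * ((\<theta> $ i)\<^sup>2 * ln (1 / \<bar>\<theta> $ i\<bar>)) \<le> psi \<theta>"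
proof -
  have "c\<^sub>1 / 4 * ((\<theta> $ i)\<^sup>2 * ln (1 / \<bar>\<theta> $ i\<bar>)) \<le> psi \<theta>" if \<theta>: "\<theta> $ i \<noteq> 0" for \<theta> i
  proof (cases "\<bar>\<theta> $ i\<bar> \<le> 1")
    case True
    let ?x = "\<bar>\<theta> $ i\<bar>"
    have x: "0 < ?x" using \<theta> by simp
    obtain N where N: "1 \<le> N" "?x * real N \<le> 1" "1 / ?x < real N + 1" using floor_inverse[OF x True] by metis
    have "ln (1 / ?x) \<le> ln (real N + 1)" using N x by (subst ln_le_cancel_iff) auto
    also have "\<dots> \<le> harm N" by (rule ln_le_harm)
    also have "\<dots> = (\<Sum>k=1..N. real k powr (1 - \<alpha>))"
      using assms by (simp add: harm_def powr_minus)
    finally have "c\<^sub>1 / 4 * ((\<theta> $ i)\<^sup>2 * ln (1 / ?x)) \<le> c\<^sub>1 / 4 * ((\<theta> $ i)\<^sup>2 * (\<Sum>k=1..N. real k powr (1 - \<alpha>)))"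
      using c1_pos by (intro mult_left_mono) auto
    also have "\<dots> \<le> psi \<theta>" by (rule psi_ge_sum_small[OF \<theta> N(2)])
    finally show ?thesis .
  next
    case False
    then have "ln (1 / \<bar>\<theta> $ i\<bar>) \<le> 0" by (simp add: ln_div)
    then have "c\<^sub>1 / 4 * ((\<theta> $ i)\<^sup>2 * ln (1 / \<bar>\<theta> $ i\<bar>)) \<le> 0"
      using c1_pos by (intro mult_nonneg_nonpos) auto
    then show ?thesis using psi_nonneg[of \<theta>] by linarith
  qed
  then show ?thesis using c1_pos by (intro exI[of _ "c\<^sub>1 / 4"]) auto
qed

end

section \<open>Local limit theorem\<close>

lemma power_le_exp:
  assumes "0 \<le> (x::real)"
  shows "x ^ n \<le> fact n * exp x"
proof -
  have "(\<Sum>k\<in>{n}. x ^ k /\<^sub>R fact k) \<le> (\<Sum>k. x ^ k /\<^sub>R fact k)"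
    using assms by (intro sum_le_suminf summable_exp_generic) auto
  then show ?thesis by (simp add: exp_def field_simps)
qed

text \<open>A majorant of one fixed shape for all the scalings below; its product over the
  coordinates is integrable.\<close>

lemma exp_powr_le:
  assumes c: "0 < (c::real)" and \<beta>: "0 < \<beta>"
  shows "\<exists>K. \<forall>x. exp (- c * \<bar>x\<bar> powr \<beta>) \<le> K / (1 + x\<^sup>2)"
proof -
  \<comment> \<open>With \<open>\<beta> * n\<close> at least 2, the power \<open>y ^ n\<close>
    dominates the square of \<open>x\<close> outside the unit interval, and the exponential absorbs
    this power.\<close>
  obtain n :: nat where n: "2 / \<beta> \<le> real n" using real_arch_simple by blast
  have "exp (- c * \<bar>x\<bar> powr \<beta>) \<le> (2 + fact n / c ^ n) / (1 + x\<^sup>2)" for x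
  proof -
    define y where "y = \<bar>x\<bar> powr \<beta>"
    have y0: "0 \<le> y" by (simp add: y_def)
    have "x\<^sup>2 \<le> 1 + y ^ n"
    proof (cases "\<bar>x\<bar> \<le> 1")
      case True
      then have "x\<^sup>2 \<le> 1" by (simp add: abs_square_le_1)
      then show ?thesis using y0 by (simp add: add_increasing2)
    next
      case False
      have "x\<^sup>2 = \<bar>x\<bar> powr 2" using False by (simp add: powr_numeral)
      also have "\<dots> \<le> \<bar>x\<bar> powr (\<beta> * real n)"
        using n \<beta> False by (intro powr_mono) (auto simp: field_simps)
      also have "\<dots> = y ^ n" using False by (simp add: y_def powr_powr[symmetric] powr_realpow)
      finally show ?thesis by simp
    qed
    moreover have "y ^ n \<le> fact n / c ^ n * exp (c * y)"
      using power_le_exp[of "c * y" n] c y0 by (simp add: power_mult_distrib field_simps)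
    moreover have "1 \<le> exp (c * y)" using c y0 by simp
    ultimately have "1 + x\<^sup>2 \<le> (2 + fact n / c ^ n) * exp (c * y)"
      unfolding distrib_right by linarith
    then have "exp (- (c * y)) * (1 + x\<^sup>2) \<le> exp (- (c * y)) * ((2 + fact n / c ^ n) * exp (c * y))"
      by (rule mult_left_mono) simp
    also have "\<dots> = 2 + fact n / c ^ n" by (simp add: exp_minus)
    finally show ?thesis by (simp add: y_def pos_le_divide_eq add_pos_nonneg)
  qed
  then show ?thesis by blast
qed

lemma integrable_inverse_square: "integrable lborel (\<lambda>x::real. K / (1 + x\<^sup>2))"
proof -
  have "integrable lborel (\<lambda>x::real. inverse (1 + x\<^sup>2))"
    using integrable_inverse_1_plus_square by (simp add: set_integrable_def)
  then have "integrable lborel (\<lambda>x::real. K * inverse (1 + x\<^sup>2))" by (rule integrable_mult_right)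
  then show ?thesis by (simp add: divide_inverse)
qed

lemma integrable_prod_inverse_square: "integrable lborel (\<lambda>\<phi>::real ^ 'd::finite. \<Prod>i\<in>UNIV. K / (1 + (\<phi> $ i)\<^sup>2))"
  by (rule lborel_prod_cart(1)[of "\<lambda>_ x. K / (1 + x\<^sup>2)"]) (rule integrable_inverse_square)

lemma lborel_integral_scale:
  fixes f :: "'a::euclidean_space \<Rightarrow> real"
  assumes a: "0 < a" and f: "f \<in> borel_measurable borel"
  shows "(\<integral>x. f x \<partial>lborel) = a ^ DIM('a) * (\<integral>x. f (a *\<^sub>R x) \<partial>lborel)"
proof -
  have m: "(\<lambda>x::'a. 0 + a *\<^sub>R x) \<in> measurable lborel borel" by simp
  have "(\<integral>x. f x \<partial>lborel) = (\<integral>x. f x \<partial>density (distr lborel borel (\<lambda>x. 0 + a *\<^sub>R x)) (\<lambda>_. \<bar>a\<bar> ^ DIM('a)))"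
    using lborel_affine[of a "0::'a"] a by simp
  also have "\<dots> = (\<integral>x. \<bar>a\<bar> ^ DIM('a) *\<^sub>R f x \<partial>distr lborel borel (\<lambda>x::'a. 0 + a *\<^sub>R x))"
    using integral_density[of f "distr lborel borel (\<lambda>x::'a. 0 + a *\<^sub>R x)" "\<lambda>_. \<bar>a\<bar> ^ DIM('a)"] f
    by simp
  also have "\<dots> = (\<integral>x. \<bar>a\<bar> ^ DIM('a) *\<^sub>R f (0 + a *\<^sub>R x) \<partial>lborel)"
    using f by (intro integral_distr[OF m]) simp
  finally show ?thesis using a by simp
qed

section \<open>The rescaled heat kernel and dominated convergence\<close>

context symmetric_kernel
begin

lemma borel_psi [measurable]: "psi \<in> borel_measurable borel"
  by (rule borel_measurable_continuous_onI[OF continuous_psi])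

lemma tbox_borel [measurable]: "(tbox :: (real ^ 'd) set) \<in> sets borel"
  by (simp add: tbox_def)

lemma hk_lborel:
  "hk t x = (\<integral>\<theta>. indicator tbox \<theta> * (cos (\<theta> \<bullet> emb x) * exp (- t * psi \<theta>)) \<partial>lborel) / (2 * pi) ^ CARD('d)"
proof -
  have "set_integrable lborel tbox (\<lambda>\<theta>. cos (\<theta> \<bullet> emb x) * exp (- t * psi \<theta>))"
    unfolding set_integrable_def
    by (rule borel_integrable_compact) (auto simp: tbox_def intro!: continuous_intros)
  from set_borel_integral_eq_integral(2)[OF this] show ?thesis
    by (simp add: hk_def set_lebesgue_integral_def)
qed

lemma hk_scale:
  assumes "0 < a"
  shows "hk t x = a ^ CARD('d) * ((\<integral>\<phi>. indicator tbox (a *\<^sub>R \<phi>) * (cos ((a *\<^sub>R \<phi>) \<bullet> emb x) * exp (- t * psi (a *\<^sub>R \<phi>))) \<partial>lborel) / (2 * pi) ^ CARD('d))"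
  unfolding hk_lborel by (subst lborel_integral_scale[OF assms]) auto

text \<open>Dividing the exponent by the dimension splits \<open>exp (- t * psi)\<close> into
  \<open>d\<close> equal factors, each of which is charged to one coordinate. Lower bounds for
  \<open>psi\<close> in single components thus yield a majorant integrable over the whole
  space.\<close>

definition dominated :: "real \<Rightarrow> real \<Rightarrow> real \<Rightarrow> bool" where
  "dominated K t a \<longleftrightarrow> (\<forall>\<phi>. a *\<^sub>R \<phi> \<in> tbox \<longrightarrow>
     (\<forall>i. exp (- (t * psi (a *\<^sub>R \<phi>)) / real CARD('d)) \<le> K / (1 + (\<phi> $ i)\<^sup>2)))"

lemma dominated_bound:
  assumes "dominated K t a"
  shows "indicator tbox (a *\<^sub>R \<phi>) * exp (- t * psi (a *\<^sub>R \<phi>)) \<le> (\<Prod>i\<in>UNIV. K / (1 + (\<phi> $ i)\<^sup>2))"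
proof (cases "a *\<^sub>R \<phi> \<in> tbox")
  case True
  have "exp (- t * psi (a *\<^sub>R \<phi>)) = (\<Prod>i\<in>(UNIV::'d set). exp (- (t * psi (a *\<^sub>R \<phi>)) / real CARD('d)))"
    by (simp add: exp_of_nat_mult[symmetric])
  also have "\<dots> \<le> (\<Prod>i\<in>UNIV. K / (1 + (\<phi> $ i)\<^sup>2))"
    using assms True by (intro prod_mono) (auto simp: dominated_def)
  finally show ?thesis using True by simp
next
  case False
  have "0 \<in> (tbox :: (real ^ 'd) set)" by (simp add: mem_tbox)
  then have "exp (- (t * psi 0) / real CARD('d)) \<le> K / (1 + (0::real)\<^sup>2)"
    using assms unfolding dominated_def by (metis scaleR_zero_right zero_index)
  then have "0 \<le> K / (1 + (0::real)\<^sup>2)" by (rule order_trans[OF exp_ge_zero])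
  then have "0 \<le> K" by simp
  then show ?thesis using False by (simp add: prod_nonneg add_nonneg_nonneg)
qed

lemma hk_upper:
  assumes "0 < a" "dominated K t a"
  shows "hk t 0 \<le> a ^ CARD('d) * ((\<integral>\<phi>. (\<Prod>i\<in>UNIV. K / (1 + (\<phi> $ i)\<^sup>2)) \<partial>(lborel :: (real ^ 'd) measure)) / (2 * pi) ^ CARD('d))"
  unfolding hk_scale[OF assms(1)]
proof (intro mult_left_mono divide_right_mono integral_mono')
  show "integrable lborel (\<lambda>\<phi>::real ^ 'd. \<Prod>i\<in>UNIV. K / (1 + (\<phi> $ i)\<^sup>2))"
    by (rule integrable_prod_inverse_square)
  show "indicator tbox (a *\<^sub>R \<phi>) * (cos ((a *\<^sub>R \<phi>) \<bullet> emb 0) * exp (- t * psi (a *\<^sub>R \<phi>))) \<le> (\<Prod>i\<in>UNIV. K / (1 + (\<phi> $ i)\<^sup>2))" for \<phi>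
    using dominated_bound[OF assms(2)] by simp
  show "0 \<le> (\<Prod>i\<in>UNIV. K / (1 + (\<phi> $ i)\<^sup>2))" for \<phi> :: "real ^ 'd"
    by (rule order_trans[OF _ dominated_bound[OF assms(2)]]) simp
qed (use assms in auto)

text \<open>After the substitution \<open>\<theta> = a t *\<^sub>R \<phi>\<close> the cosine tends
  to 1 for every \<open>x\<close> and the box fills the space, so the limit is the same for all
  \<open>x\<close>. It is positive because the limiting integrand vanishes nowhere.\<close>

lemma hk_limit:
  assumes a0: "(a \<longlongrightarrow> 0) at_top"
    and dom: "\<forall>\<^sub>F t in at_top. 0 < a t \<and> dominated K t (a t)"
    and lim: "\<And>\<phi>. ((\<lambda>t. t * psi (a t *\<^sub>R \<phi>)) \<longlongrightarrow> q \<phi>) at_top"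
  shows "\<exists>\<kappa>>0. \<forall>x. ((\<lambda>t. hk t x / a t ^ CARD('d)) \<longlongrightarrow> \<kappa>) at_top"
proof -
  define \<kappa> where "\<kappa> = (\<integral>\<phi>. exp (- q \<phi>) \<partial>lborel) / (2 * pi) ^ CARD('d)"
  define F where "F x t \<phi> = indicator tbox (a t *\<^sub>R \<phi>) * (cos ((a t *\<^sub>R \<phi>) \<bullet> emb x) * exp (- t * psi (a t *\<^sub>R \<phi>)))" for x t \<phi>
  have q: "q \<in> borel_measurable borel"
  proof (rule borel_measurable_LIMSEQ_real)
    show "(\<lambda>n. real n * psi (a (real n) *\<^sub>R \<phi>)) \<longlonglongrightarrow> q \<phi>" for \<phi>
      using lim[of \<phi>] filterlim_real_sequentially by (rule filterlim_compose)
  qed measurable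
  have m: "(\<lambda>\<phi>. exp (- q \<phi>)) \<in> borel_measurable lborel" using q by measurable
  have Fm: "F x t \<in> borel_measurable lborel" for x t unfolding F_def by measurable
  have bound: "\<forall>\<^sub>F t in at_top. AE \<phi> in lborel. norm (F x t \<phi>) \<le> (\<Prod>i\<in>UNIV. K / (1 + (\<phi> $ i)\<^sup>2))" for x
    using dom
  proof eventually_elim
    case (elim t)
    have "norm (F x t \<phi>) \<le> indicator tbox (a t *\<^sub>R \<phi>) * exp (- t * psi (a t *\<^sub>R \<phi>))" for \<phi>
    proof -
      have "\<bar>cos ((a t *\<^sub>R \<phi>) \<bullet> emb x)\<bar> * exp (- t * psi (a t *\<^sub>R \<phi>)) \<le> 1 * exp (- t * psi (a t *\<^sub>R \<phi>))"
        by (intro mult_right_mono) auto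
      then show ?thesis unfolding F_def abs_mult real_norm_def by (auto simp: indicator_def)
    qed
    then show ?case using dominated_bound[of K t "a t"] elim order_trans by (intro AE_I2) blast
  qed
  have pw: "((\<lambda>t. F x t \<phi>) \<longlongrightarrow> exp (- q \<phi>)) at_top" for x \<phi>
  proof -
    have a\<phi>: "((\<lambda>t. a t *\<^sub>R \<phi>) \<longlongrightarrow> 0) at_top" using tendsto_scaleR[OF a0 tendsto_const[of \<phi>]] by simp
    have "\<forall>\<^sub>F t in at_top. a t *\<^sub>R \<phi> \<in> box (\<chi> i. - pi) (\<chi> i. pi)"
      by (rule topological_tendstoD[OF a\<phi>]) (auto simp: mem_box_cart open_box)
    then have "\<forall>\<^sub>F t in at_top. indicator tbox (a t *\<^sub>R \<phi>) = (1::real)"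
      by eventually_elim (use box_subset_cbox in \<open>auto simp: tbox_def indicator_def\<close>)
    then have 1: "((\<lambda>t. indicator tbox (a t *\<^sub>R \<phi>)) \<longlongrightarrow> (1::real)) at_top" by (rule tendsto_eventually)
    have 2: "((\<lambda>t. cos ((a t *\<^sub>R \<phi>) \<bullet> emb x)) \<longlongrightarrow> cos (0 \<bullet> emb x)) at_top"
      by (intro tendsto_intros a\<phi>)
    have 3: "((\<lambda>t. exp (- (t * psi (a t *\<^sub>R \<phi>)))) \<longlongrightarrow> exp (- q \<phi>)) at_top"
      by (intro tendsto_intros lim)
    show ?thesis unfolding F_def using tendsto_mult[OF 1 tendsto_mult[OF 2 3]] by simp
  qed
  have conv: "((\<lambda>t. \<integral>\<phi>. F x t \<phi> \<partial>lborel) \<longlongrightarrow> (\<integral>\<phi>. exp (- q \<phi>) \<partial>lborel)) at_top" for x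
    by (rule integral_dominated_convergence_at_top[where s = "F x", OF m Fm integrable_prod_inverse_square _ bound]) (simp add: pw)
  have int: "integrable lborel (\<lambda>\<phi>. exp (- q \<phi>))"
    by (rule integrable_dominated_convergence_at_top[where s = "F 0", OF m Fm integrable_prod_inverse_square _ bound]) (simp add: pw)
  have "(\<integral>\<phi>. exp (- q \<phi>) \<partial>lborel) \<noteq> 0"
  proof
    assume "(\<integral>\<phi>. exp (- q \<phi>) \<partial>lborel) = 0"
    then have "AE \<phi> in lborel. exp (- q \<phi>) = 0"
      using integral_nonneg_eq_0_iff_AE[OF int] by simp
    then have "AE \<phi> in (lborel :: (real ^ 'd) measure). False" by simp
    then have "emeasure (lborel :: (real ^ 'd) measure) UNIV = 0" by (simp add: AE_iff_null null_sets_def)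
    then show False by simp
  qed
  moreover have "0 \<le> (\<integral>\<phi>. exp (- q \<phi>) \<partial>lborel)" by (rule integral_nonneg_AE) simp
  ultimately have "0 < (\<integral>\<phi>. exp (- q \<phi>) \<partial>lborel)" by linarith
  then have "\<kappa> > 0" unfolding \<kappa>_def by (intro divide_pos_pos) auto
  moreover have "((\<lambda>t. hk t x / a t ^ CARD('d)) \<longlongrightarrow> \<kappa>) at_top" for x
  proof (rule Lim_transform_eventually)
    show "((\<lambda>t. (\<integral>\<phi>. F x t \<phi> \<partial>lborel) / (2 * pi) ^ CARD('d)) \<longlongrightarrow> \<kappa>) at_top"
      unfolding \<kappa>_def by (intro tendsto_intros conv) simp
    show "\<forall>\<^sub>F t in at_top. (\<integral>\<phi>. F x t \<phi> \<partial>lborel) / (2 * pi) ^ CARD('d) = hk t x / a t ^ CARD('d)"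
      using dom
    proof eventually_elim
      case (elim t)
      then show ?case using hk_scale[of "a t" t x, folded F_def] by simp
    qed
  qed
  ultimately show ?thesis by blast
qed

text \<open>At the scale \<open>t powr (- 1 / \<beta>)\<close> the factor \<open>t\<close> cancels
  exactly against the lower bound for \<open>psi\<close>, leaving a function of the rescaled
  variable alone.\<close>

lemma dominated_powr:
  assumes c: "0 < c" and \<beta>: "0 < \<beta>" and psi: "\<And>\<theta> i. \<theta> \<in> tbox \<Longrightarrow> c * \<bar>\<theta> $ i\<bar> powr \<beta> \<le> psi \<theta>"
  shows "\<exists>K. \<forall>t>0. dominated K t (t powr (- 1 / \<beta>))"
proof -
  obtain K where K: "\<And>x. exp (- (c / real CARD('d)) * \<bar>x\<bar> powr \<beta>) \<le> K / (1 + x\<^sup>2)"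
    using exp_powr_le[of "c / real CARD('d)" \<beta>] c \<beta> by auto
  have "dominated K t (t powr (- 1 / \<beta>))" if t: "t > 0" for t
    unfolding dominated_def
  proof (intro allI impI)
    fix \<phi> :: "real ^ 'd" and i
    let ?a = "t powr (- 1 / \<beta>)"
    assume "?a *\<^sub>R \<phi> \<in> tbox"
    from psi[OF this, of i] have "t * (c * \<bar>(?a *\<^sub>R \<phi>) $ i\<bar> powr \<beta>) \<le> t * psi (?a *\<^sub>R \<phi>)"
      using t by (intro mult_left_mono) auto
    also have "t * (c * \<bar>(?a *\<^sub>R \<phi>) $ i\<bar> powr \<beta>) = c * \<bar>\<phi> $ i\<bar> powr \<beta>"
    proof -
      have "\<bar>(?a *\<^sub>R \<phi>) $ i\<bar> powr \<beta> = ?a powr \<beta> * \<bar>\<phi> $ i\<bar> powr \<beta>"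
        by (simp add: abs_mult powr_mult)
      moreover have "?a powr \<beta> = 1 / t" using t \<beta> by (subst powr_powr) (simp add: powr_minus_divide)
      ultimately show ?thesis using t by simp
    qed
    finally have "- (t * psi (?a *\<^sub>R \<phi>)) / real CARD('d) \<le> - (c / real CARD('d)) * \<bar>\<phi> $ i\<bar> powr \<beta>"
      by (simp add: field_simps)
    then show "exp (- (t * psi (?a *\<^sub>R \<phi>)) / real CARD('d)) \<le> K / (1 + (\<phi> $ i)\<^sup>2)"
      using K[of "\<phi> $ i"] by (meson exp_le_cancel_iff order_trans)
  qed
  then show ?thesis by blast
qed

text \<open>With \<open>a\<close> the scale, the logarithmic bound helps only where the component is
  small. For \<open>\<bar>\<phi> $ i\<bar>\<close> up to \<open>a powr (- 1 / 2)\<close> the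
  logarithm is at least \<open>ln t / 4\<close>, which cancels the \<open>ln t\<close> in the scale.
  Beyond, the component exceeds \<open>ln t\<close>, and the plain quadratic bound, weaker by that
  factor, still gives linear growth.\<close>

lemma dominated_log:
  assumes c: "0 < c" and sq: "\<And>\<theta> i. \<theta> \<in> tbox \<Longrightarrow> c * (\<theta> $ i)\<^sup>2 \<le> psi \<theta>"
    and lg: "\<And>\<theta> i. \<theta> \<in> tbox \<Longrightarrow> \<theta> $ i \<noteq> 0 \<Longrightarrow> c * ((\<theta> $ i)\<^sup>2 * ln (1 / \<bar>\<theta> $ i\<bar>)) \<le> psi \<theta>"
  shows "\<exists>K. \<forall>\<^sub>F t in at_top. dominated K t ((t * ln t) powr (- 1 / 2))"
proof -
  \<comment> \<open>The quarter is the fraction of \<open>ln t\<close> that the logarithm retains in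
    the inner range.\<close>
  define c' where "c' = c / 4"
  have c': "0 < c'" using c by (simp add: c'_def)
  obtain K where K: "\<And>x. exp (- (c' / real CARD('d)) * \<bar>x\<bar> powr 1) \<le> K / (1 + x\<^sup>2)"
    using exp_powr_le[of "c' / real CARD('d)" 1] c' by auto
  have ev: "\<forall>\<^sub>F t::real in at_top. exp 1 \<le> t \<and> ln t \<le> t powr (1 / 4)"
  proof (intro eventually_conj eventually_ge_at_top)
    show "\<forall>\<^sub>F t::real in at_top. ln t \<le> t powr (1 / 4)" by real_asymp
  qed
  have "\<forall>\<^sub>F t in at_top. dominated (exp (c' / real CARD('d)) * K) t ((t * ln t) powr (- 1 / 2))"
    using ev
  proof eventually_elim
    case (elim t)
    have t1: "1 < t" using elim exp_gt_one[of 1] by linarith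
    have l1: "1 \<le> ln t" using elim by (metis exp_gt_zero ln_exp ln_le_cancel_iff order_less_le_trans)
    define a where "a = (t * ln t) powr (- 1 / 2)"
    have a: "0 < a" "a\<^sup>2 = 1 / (t * ln t)"
      using t1 l1 by (auto simp: a_def power2_eq_square powr_add[symmetric] powr_minus_divide)
    have tl: "t \<le> t * ln t" using t1 l1 by simp
    show ?case unfolding dominated_def a_def[symmetric]
    proof (intro allI impI)
      fix \<phi> :: "real ^ 'd" and i
      assume box: "a *\<^sub>R \<phi> \<in> tbox"
      let ?p = "\<bar>\<phi> $ i\<bar>"
      have ta: "t * a\<^sup>2 = 1 / ln t" using t1 by (simp add: a(2))
      \<comment> \<open>A linear lower bound is enough for the majorant; subtracting
        \<open>c'\<close> makes it trivial when the component is at most 1.\<close>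
      have "c' * ?p - c' \<le> t * psi (a *\<^sub>R \<phi>)"
      proof (cases "?p \<le> 1")
        case True
        then have "c' * ?p \<le> c' * 1" using c' by (intro mult_left_mono) auto
        then show ?thesis using psi_nonneg[of "a *\<^sub>R \<phi>"] t1 by (smt (verit) mult_nonneg_nonneg)
      next
        case p1: False
        have pp: "?p \<le> ?p\<^sup>2" using mult_left_mono[of 1 ?p ?p] p1 by (simp add: power2_eq_square)
        show ?thesis
        proof (cases "?p \<le> a powr (- 1 / 2)")
          case True
          have "?p * a \<le> a powr (- 1 / 2) * a" using True a by (intro mult_right_mono) auto
          also have "\<dots> = a powr (1 / 2)" using a powr_add[of a "- 1 / 2" 1] by simp
          finally have pa: "?p * a \<le> a powr (1 / 2)" .
          have "ln t / 4 \<le> ln (t * ln t) / 4" using tl t1 by (intro divide_right_mono) (auto simp: ln_le_cancel_iff)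
          also have "\<dots> = - ln (a powr (1 / 2))"
            using t1 l1 by (simp add: a_def powr_powr ln_powr)
          also have "\<dots> \<le> - ln (?p * a)" using pa p1 a by (subst neg_le_iff_le, subst ln_le_cancel_iff) auto
          also have "\<dots> = ln (1 / \<bar>(a *\<^sub>R \<phi>) $ i\<bar>)" using a p1 by (simp add: abs_mult ln_div mult.commute)
          finally have "((a *\<^sub>R \<phi>) $ i)\<^sup>2 * (ln t / 4) \<le> ((a *\<^sub>R \<phi>) $ i)\<^sup>2 * ln (1 / \<bar>(a *\<^sub>R \<phi>) $ i\<bar>)"
            by (rule mult_left_mono) simp
          then have "c * (((a *\<^sub>R \<phi>) $ i)\<^sup>2 * (ln t / 4)) \<le> c * (((a *\<^sub>R \<phi>) $ i)\<^sup>2 * ln (1 / \<bar>(a *\<^sub>R \<phi>) $ i\<bar>))"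
            by (rule mult_left_mono[OF _ less_imp_le[OF c]])
          also have "\<dots> \<le> psi (a *\<^sub>R \<phi>)" using box a p1 by (intro lg) auto
          finally have "t * (c * (((a *\<^sub>R \<phi>) $ i)\<^sup>2 * (ln t / 4))) \<le> t * psi (a *\<^sub>R \<phi>)"
            using t1 by (intro mult_left_mono) auto
          also have "t * (c * (((a *\<^sub>R \<phi>) $ i)\<^sup>2 * (ln t / 4))) = (t * a\<^sup>2) * ln t * (c' * ?p\<^sup>2)"
            by (simp add: power_mult_distrib c'_def)
          also have "\<dots> = c' * ?p\<^sup>2" unfolding ta using l1 by simp
          finally show ?thesis using mult_left_mono[OF pp, of c'] c' by linarith
        next
          case False
          have "ln t \<le> t powr (1 / 4)" using elim by simp
          also have "\<dots> \<le> (t * ln t) powr (1 / 4)" using tl t1 by (intro powr_mono2) auto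
          also have "\<dots> = a powr (- 1 / 2)" by (simp add: a_def powr_powr)
          also have "\<dots> < ?p" using False by simp
          finally have "?p * ln t \<le> ?p * ?p" using p1 by (intro mult_left_mono) auto
          then have "?p \<le> ?p\<^sup>2 / ln t" using l1 by (simp add: field_simps power2_eq_square)
          then have "c * ?p \<le> c * (?p\<^sup>2 / ln t)" using c by (intro mult_left_mono) auto
          also have "\<dots> = t * a\<^sup>2 * (c * ?p\<^sup>2)" unfolding ta by simp
          also have "\<dots> = t * (c * ((a *\<^sub>R \<phi>) $ i)\<^sup>2)" by (simp add: power_mult_distrib)
          also have "\<dots> \<le> t * psi (a *\<^sub>R \<phi>)" using sq[OF box, of i] t1 by (intro mult_left_mono) auto
          finally have "c * ?p \<le> t * psi (a *\<^sub>R \<phi>)" .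
          moreover have "c' * ?p \<le> c * ?p" using c by (intro mult_right_mono) (auto simp: c'_def)
          ultimately show ?thesis using c' by linarith
        qed
      qed
      then have "- (t * psi (a *\<^sub>R \<phi>)) / real CARD('d) \<le> (c' - c' * ?p) / real CARD('d)"
        by (intro divide_right_mono) auto
      then have "exp (- (t * psi (a *\<^sub>R \<phi>)) / real CARD('d)) \<le> exp ((c' - c' * ?p) / real CARD('d))" by simp
      also have "\<dots> = exp (c' / real CARD('d)) * exp (- (c' / real CARD('d)) * ?p powr 1)"
        by (simp add: exp_add[symmetric] diff_divide_distrib)
      also have "\<dots> \<le> exp (c' / real CARD('d)) * (K / (1 + (\<phi> $ i)\<^sup>2))"
        by (intro mult_left_mono K) simp
      finally show "exp (- (t * psi (a *\<^sub>R \<phi>)) / real CARD('d)) \<le> exp (c' / real CARD('d)) * K / (1 + (\<phi> $ i)\<^sup>2)" by simp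
    qed
  qed
  then show ?thesis by blast
qed

end

section \<open>Limits of trigonometric sums\<close>

lemma has_sum_dominated_at_top:
  fixes f :: "real \<Rightarrow> 'a \<Rightarrow> real"
  assumes g: "g summable_on A" and bound: "\<And>t y. t > 0 \<Longrightarrow> y \<in> A \<Longrightarrow> \<bar>f t y\<bar> \<le> g y"
    and lim: "\<And>y. y \<in> A \<Longrightarrow> ((\<lambda>t. f t y) \<longlongrightarrow> f' y) at_top"
  shows "((\<lambda>t. \<Sum>\<^sub>\<infinity>y\<in>A. f t y) \<longlongrightarrow> (\<Sum>\<^sub>\<infinity>y\<in>A. f' y)) at_top"
proof -
  have bd': "\<bar>f' y\<bar> \<le> g y" if "y \<in> A" for y
  proof (rule tendsto_upperbound[OF tendsto_rabs[OF lim[OF that]]])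
    show "\<forall>\<^sub>F t in at_top. \<bar>f t y\<bar> \<le> g y"
      using eventually_gt_at_top[of 0] by eventually_elim (rule bound[OF _ that])
  qed simp
  have inf: "Infinite_Set_Sum.abs_summable_on h A \<and> (\<integral>y. h y \<partial>count_space A) = (\<Sum>\<^sub>\<infinity>y\<in>A. h y)" if "\<And>y. y \<in> A \<Longrightarrow> \<bar>h y\<bar> \<le> g y" for h :: "'a \<Rightarrow> real"
  proof -
    have "(\<lambda>y. norm (h y)) summable_on A"
      by (rule summable_on_comparison_test[OF g]) (use that in auto)
    then have "Infinite_Set_Sum.abs_summable_on h A" using abs_summable_equivalent by blast
    then show ?thesis using infsetsum_infsum[of h A] \<open>(\<lambda>y. norm (h y)) summable_on A\<close> by (simp add: infsetsum_def)
  qed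
  have gi: "integrable (count_space A) g"
  proof -
    have g0: "0 \<le> g y" if "y \<in> A" for y using bd'[OF that] by linarith
    then have "\<bar>g y\<bar> \<le> g y" if "y \<in> A" for y using that by simp
    then have "(\<lambda>y. norm (g y)) summable_on A"
      by (intro summable_on_comparison_test[OF g]) auto
    then show ?thesis using abs_summable_equivalent[of g A] by (simp add: Infinite_Set_Sum.abs_summable_on_def)
  qed
  have "((\<lambda>t. \<integral>y. f t y \<partial>count_space A) \<longlongrightarrow> (\<integral>y. f' y \<partial>count_space A)) at_top"
  proof (rule integral_dominated_convergence_at_top[OF _ _ gi])
    show "\<forall>\<^sub>F t in at_top. AE y in count_space A. norm (f t y) \<le> g y"
      using eventually_gt_at_top[of 0] by eventually_elim (auto simp: AE_count_space bound)
  qed (auto simp: AE_count_space lim)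
  moreover have "\<forall>\<^sub>F t in at_top. (\<integral>y. f t y \<partial>count_space A) = (\<Sum>\<^sub>\<infinity>y\<in>A. f t y)"
    using eventually_gt_at_top[of 0] by eventually_elim (use inf bound in blast)
  ultimately show ?thesis using inf[OF bd'] by (auto intro: Lim_transform_eventually)
qed

text \<open>The normalised sum is exactly the integral of \<open>G\<close> with its argument rounded
  up to the grid. Rounding up keeps this step function below the decreasing majorant
  \<open>g\<close>, even if \<open>g\<close> is singular at 0, and dominated convergence
  applies.\<close>

lemma riemann_sum_at_top:
  fixes G g :: "real \<Rightarrow> real"
  assumes [measurable]: "G \<in> borel_measurable borel" and cont: "\<And>u. u > 0 \<Longrightarrow> isCont G u"
    and le: "\<And>u. u > 0 \<Longrightarrow> \<bar>G u\<bar> \<le> g u" and mono: "\<And>u v. 0 < u \<Longrightarrow> u \<le> v \<Longrightarrow> g v \<le> g u"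
    and int: "set_integrable lborel {0<..} g"
    and sm: "\<And>\<tau>. \<tau> > 0 \<Longrightarrow> summable (\<lambda>n. G (real (Suc n) / \<tau>))"
  shows "((\<lambda>\<tau>. (\<Sum>n. G (real (Suc n) / \<tau>)) / \<tau>) \<longlongrightarrow> (LBINT u:{0<..}. G u)) at_top"
proof -
  define S where "S \<tau> u = G (of_int \<lceil>u * \<tau>\<rceil> / \<tau>)" for \<tau> u :: real
  have ceil: "u \<le> of_int \<lceil>u * \<tau>\<rceil> / \<tau>" "of_int \<lceil>u * \<tau>\<rceil> / \<tau> < u + 1 / \<tau>" if "\<tau> > 0" for u \<tau> :: real
  proof -
    have "u * \<tau> \<le> of_int \<lceil>u * \<tau>\<rceil>" "of_int \<lceil>u * \<tau>\<rceil> < u * \<tau> + 1" by linarith+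
    then show "u \<le> of_int \<lceil>u * \<tau>\<rceil> / \<tau>" "of_int \<lceil>u * \<tau>\<rceil> / \<tau> < u + 1 / \<tau>"
      using that by (auto simp: field_simps)
  qed
  have Sm [measurable]: "S \<tau> \<in> borel_measurable borel" for \<tau> unfolding S_def by measurable
  have bound: "\<bar>S \<tau> u\<bar> \<le> g u" if "\<tau> > 0" "u > 0" for \<tau> u
  proof -
    have u: "u \<le> of_int \<lceil>u * \<tau>\<rceil> / \<tau>" by (rule ceil(1)[OF that(1)])
    then have "\<bar>S \<tau> u\<bar> \<le> g (of_int \<lceil>u * \<tau>\<rceil> / \<tau>)" unfolding S_def using that by (intro le) linarith
    also have "\<dots> \<le> g u" using u that by (intro mono) auto
    finally show ?thesis .
  qed
  have Sint: "set_integrable lborel {0<..} (S \<tau>)" if "\<tau> > 0" for \<tau>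
    unfolding set_integrable_def
  proof (rule Bochner_Integration.integrable_bound)
    show "integrable lborel (\<lambda>u. indicator {0<..} u *\<^sub>R g u)" using int by (simp add: set_integrable_def)
    show "AE u in lborel. norm (indicat_real {0<..} u *\<^sub>R S \<tau> u) \<le> norm (indicat_real {0<..} u *\<^sub>R g u)"
      using order_trans[OF bound[OF that] abs_ge_self] by (intro AE_I2) (simp add: indicator_def)
  qed measurable
  have sum: "(LBINT u:{0<..}. S \<tau> u) = (\<Sum>n. G (real (Suc n) / \<tau>)) / \<tau>" if \<tau>: "\<tau> > 0" for \<tau>
  proof -
    \<comment> \<open>Cells are open on the left, so that the ceiling is constant on each: cell
      \<open>n\<close> carries the value at \<open>Suc n\<close>.\<close>
    define A where "A n = {real n / \<tau> <.. real (Suc n) / \<tau>}" for n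
    have mem: "u \<in> A n \<longleftrightarrow> u > 0 \<and> \<lceil>u * \<tau>\<rceil> = int n + 1" for u n
    proof -
      have "u \<in> A n \<longleftrightarrow> real n < u * \<tau> \<and> u * \<tau> \<le> real n + 1" using \<tau> by (simp add: A_def field_simps)
      also have "\<dots> \<longleftrightarrow> \<lceil>u * \<tau>\<rceil> = int n + 1" by (simp add: ceiling_eq_iff)
      finally show ?thesis using \<tau>
        by (auto simp: A_def) (metis divide_nonneg_pos le_less_trans of_nat_0_le_iff)+
    qed
    have UA: "(\<Union>n. A n) = {0<..}"
    proof (intro equalityI subsetI)
      fix u :: real assume "u \<in> {0<..}"
      then have "u > 0" "0 < \<lceil>u * \<tau>\<rceil>" using \<tau> by (auto simp: zero_less_ceiling)
      then have "u \<in> A (nat (\<lceil>u * \<tau>\<rceil> - 1))" unfolding mem by simp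
      then show "u \<in> (\<Union>n. A n)" by blast
    qed (use mem in auto)
    have "(LBINT u:(\<Union>n. A n). S \<tau> u) = (\<Sum>n. LBINT u:A n. S \<tau> u)"
    proof (rule lebesgue_integral_countable_add)
      show "A i \<inter> A j = {}" if "i \<noteq> j" for i j using that mem by auto
      show "set_integrable lborel (\<Union>n. A n) (S \<tau>)" unfolding UA by (rule Sint[OF \<tau>])
    qed (simp add: A_def)
    also have "\<dots> = (\<Sum>n. G (real (Suc n) / \<tau>) * (1 / \<tau>))"
    proof (rule suminf_cong)
      fix n
      have "(LBINT u:A n. S \<tau> u) = (LBINT u:A n. G (real (Suc n) / \<tau>))"
      proof (rule set_lebesgue_integral_cong)
        show "\<forall>u. u \<in> A n \<longrightarrow> S \<tau> u = G (real (Suc n) / \<tau>)" using mem by (auto simp: S_def add.commute)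
      qed (simp add: A_def)
      also have "\<dots> = G (real (Suc n) / \<tau>) * measure lborel (A n)"
        by (simp add: set_lebesgue_integral_def A_def)
      also have "measure lborel (A n) = 1 / \<tau>"
        using \<tau> by (simp add: A_def divide_right_mono field_simps)
      finally show "(LBINT u:A n. S \<tau> u) = G (real (Suc n) / \<tau>) * (1 / \<tau>)" .
    qed
    also have "\<dots> = (\<Sum>n. G (real (Suc n) / \<tau>)) / \<tau>"
      using suminf_divide[OF sm[OF \<tau>], of \<tau>] by simp
    finally show ?thesis by (simp add: UA)
  qed
  have "((\<lambda>\<tau>. LBINT u:{0<..}. S \<tau> u) \<longlongrightarrow> (LBINT u:{0<..}. G u)) at_top"
    unfolding set_lebesgue_integral_def
  proof (rule integral_dominated_convergence_at_top)
    show "integrable lborel (\<lambda>u. indicator {0<..} u *\<^sub>R g u)" using int by (simp add: set_integrable_def)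
    show "\<forall>\<^sub>F \<tau> in at_top. AE u in lborel. norm (indicat_real {0<..} u *\<^sub>R S \<tau> u) \<le> indicat_real {0<..} u *\<^sub>R g u"
      using eventually_gt_at_top[of 0] by eventually_elim (auto simp: indicator_def bound)
    show "AE u in lborel. ((\<lambda>\<tau>. indicat_real {0<..} u *\<^sub>R S \<tau> u) \<longlongrightarrow> indicat_real {0<..} u *\<^sub>R G u) at_top"
    proof (rule AE_I2)
      fix u :: real
      show "((\<lambda>\<tau>. indicat_real {0<..} u *\<^sub>R S \<tau> u) \<longlongrightarrow> indicat_real {0<..} u *\<^sub>R G u) at_top"
      proof (cases "u > 0")
        case True
        have "((\<lambda>\<tau>. of_int \<lceil>u * \<tau>\<rceil> / \<tau>) \<longlongrightarrow> u) at_top"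
        proof (rule tendsto_sandwich)
          show "\<forall>\<^sub>F \<tau> in at_top. u \<le> of_int \<lceil>u * \<tau>\<rceil> / \<tau>"
            using eventually_gt_at_top[of 0] by eventually_elim (rule ceil)
          show "\<forall>\<^sub>F \<tau> in at_top. of_int \<lceil>u * \<tau>\<rceil> / \<tau> \<le> u + 1 / \<tau>"
            using eventually_gt_at_top[of 0] by eventually_elim (rule less_imp_le[OF ceil(2)])
          show "((\<lambda>\<tau>. u + 1 / \<tau>) \<longlongrightarrow> u) at_top" by real_asymp
        qed simp
        from isCont_tendsto_compose[OF cont[OF True] this] show ?thesis using True by (simp add: S_def)
      qed simp
    qed
  qed measurable
  moreover have "\<forall>\<^sub>F \<tau> in at_top. (LBINT u:{0<..}. S \<tau> u) = (\<Sum>n. G (real (Suc n) / \<tau>)) / \<tau>"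
    using eventually_gt_at_top[of 0] by eventually_elim (rule sum)
  ultimately show ?thesis by (rule Lim_transform_eventually)
qed

lemma one_minus_cos_le: "1 - cos u \<le> u\<^sup>2 / (2::real)"
proof -
  have "1 - cos u = 2 * (sin (u / 2))\<^sup>2" using cos_double_sin[of "u / 2"] by simp
  also have "\<dots> \<le> 2 * (u / 2)\<^sup>2"
    using abs_sin_x_le_abs_x[of "u / 2"] by (intro mult_left_mono) (auto simp: abs_le_square_iff[symmetric])
  finally show ?thesis by (simp add: power_divide)
qed

lemma one_minus_cos_le_2: "1 - cos u \<le> (2::real)"
  using cos_ge_minus_one[of u] by linarith

lemma set_integrable_powr_majorant:
  assumes "0 < (\<alpha>::real)" "\<alpha> < 2"
  shows "set_integrable lborel {0<..} (\<lambda>u. if u \<le> 1 then u powr (1 - \<alpha>) else u powr (- 1 - \<alpha>))"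
proof -
  have 1: "set_integrable lborel {0<..1} (\<lambda>u. u powr (1 - \<alpha>))"
  proof -
    have "(\<lambda>u. u powr (1 - \<alpha>)) absolutely_integrable_on {0<..1}"
      by (rule nonnegative_absolutely_integrable_1) (use assms in \<open>auto intro!: integrable_on_powr_from_0'\<close>)
    then show ?thesis unfolding set_integrable_def
      by (subst (asm) integrable_completion) auto
  qed
  have 2: "set_integrable lborel {1<..} (\<lambda>u. u powr (- 1 - \<alpha>))"
  proof -
    have "(\<lambda>u. u powr (- 1 - \<alpha>)) integrable_on {1..}"
      using has_integral_powr_to_inf[of "- 1 - \<alpha>" 1] assms by (auto simp: integrable_on_def)
    then have "(\<lambda>u. u powr (- 1 - \<alpha>)) integrable_on {1<..}"
      by (rule integrable_spike_set) (auto intro: negligible_subset[of "{1}"])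
    then have "(\<lambda>u. u powr (- 1 - \<alpha>)) absolutely_integrable_on {1<..}"
      by (intro nonnegative_absolutely_integrable_1) auto
    then show ?thesis unfolding set_integrable_def
      by (subst (asm) integrable_completion) auto
  qed
  have "set_integrable lborel ({0<..1} \<union> {1<..}) (\<lambda>u. if u \<le> 1 then u powr (1 - \<alpha>) else u powr (- 1 - \<alpha>))"
  proof (rule set_integrable_Un)
    show "set_integrable lborel {0<..1} (\<lambda>u. if u \<le> 1 then u powr (1 - \<alpha>) else u powr (- 1 - \<alpha>))"
      using 1 by (rule set_integrable_cong[THEN iffD1, rotated -1]) auto
    show "set_integrable lborel {1<..} (\<lambda>u. if u \<le> 1 then u powr (1 - \<alpha>) else u powr (- 1 - \<alpha>))"
      using 2 by (rule set_integrable_cong[THEN iffD1, rotated -1]) auto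
  qed auto
  moreover have "{0<..(1::real)} \<union> {1<..} = {0<..}" by auto
  ultimately show ?thesis by simp
qed

lemma summable_stable:
  assumes "0 < (\<alpha>::real)"
  shows "summable (\<lambda>n. real (Suc n) powr (- 1 - \<alpha>) * (1 - cos (real (Suc n) / \<tau>)))"
proof (rule summable_comparison_test')
  have "summable (\<lambda>n. real n powr (- 1 - \<alpha>))" using assms by (simp add: summable_real_powr_iff)
  then have "summable (\<lambda>n. real (Suc n) powr (- 1 - \<alpha>))" by (subst summable_Suc_iff)
  then show "summable (\<lambda>n. real (Suc n) powr (- 1 - \<alpha>) * 2)" by (rule summable_mult2)
  show "norm (real (Suc n) powr (- 1 - \<alpha>) * (1 - cos (real (Suc n) / \<tau>))) \<le> real (Suc n) powr (- 1 - \<alpha>) * 2" if "n \<ge> 0" for n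
    using one_minus_cos_le_2[of "real (Suc n) / \<tau>"] by (simp add: abs_mult mult_left_mono)
qed

text \<open>The scaled sum is a Riemann sum of \<open>u powr (- 1 - \<alpha>) * (1 - cos u)\<close>.
  Integrability at 0 comes from \<alpha> < 2, and \<alpha> at least 1 makes the majorant
  nonincreasing on the unit interval.\<close>

lemma stable_sum_limit:
  assumes "1 \<le> (\<alpha>::real)" "\<alpha> < 2"
  shows "\<exists>I. ((\<lambda>\<tau>. \<tau> powr \<alpha> * (\<Sum>n. real (Suc n) powr (- 1 - \<alpha>) * (1 - cos (real (Suc n) / \<tau>)))) \<longlongrightarrow> I) at_top"
proof -
  define G where "G u = u powr (- 1 - \<alpha>) * (1 - cos u)" for u :: real
  define g where "g u = 2 * (if u \<le> 1 then u powr (1 - \<alpha>) else u powr (- 1 - \<alpha>))" for u :: real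
  note sm = summable_stable[OF less_le_trans[OF zero_less_one assms(1)]]
  have G_eq: "G (real (Suc n) / \<tau>) = \<tau> powr (1 + \<alpha>) * (real (Suc n) powr (- 1 - \<alpha>) * (1 - cos (real (Suc n) / \<tau>)))"
    if \<tau>: "\<tau> > 0" for n \<tau>
  proof -
    have "(real (Suc n) / \<tau>) powr (- 1 - \<alpha>) = real (Suc n) powr (- 1 - \<alpha>) / \<tau> powr (- 1 - \<alpha>)"
      by (rule powr_divide)
    also have "\<tau> powr (- 1 - \<alpha>) = 1 / \<tau> powr (1 + \<alpha>)"
      using powr_minus_divide[of \<tau> "1 + \<alpha>"] by simp
    finally show ?thesis by (simp add: G_def)
  qed
  have "((\<lambda>\<tau>. (\<Sum>n. G (real (Suc n) / \<tau>)) / \<tau>) \<longlongrightarrow> (LBINT u:{0<..}. G u)) at_top"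
  proof (rule riemann_sum_at_top)
    show "G \<in> borel_measurable borel" unfolding G_def by measurable
    show "isCont G u" if "u > 0" for u
      unfolding G_def using that by (intro continuous_intros) auto
    show "\<bar>G u\<bar> \<le> g u" if u: "u > 0" for u
    proof -
      have "\<bar>G u\<bar> = u powr (- 1 - \<alpha>) * (1 - cos u)" by (simp add: G_def)
      also have "\<dots> \<le> g u"
      proof (cases "u \<le> 1")
        case True
        have "u powr (- 1 - \<alpha>) * (1 - cos u) \<le> u powr (- 1 - \<alpha>) * (2 * u\<^sup>2)"
          using one_minus_cos_le[of u] zero_le_power2[of u] by (intro mult_left_mono[OF _ powr_ge_zero]) linarith
        then show ?thesis using True by (simp add: g_def powr_split_square[OF u])
      next
        case False
        have "u powr (- 1 - \<alpha>) * (1 - cos u) \<le> u powr (- 1 - \<alpha>) * 2"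
          using one_minus_cos_le_2[of u] by (intro mult_left_mono) auto
        then show ?thesis using False by (simp add: g_def)
      qed
      finally show ?thesis .
    qed
    show "g v \<le> g u" if "0 < u" "u \<le> v" for u v
    proof -
      consider "v \<le> 1" | "u \<le> 1" "1 < v" | "1 < u" by linarith
      then show ?thesis
      proof cases
        case 1
        then show ?thesis using that assms by (auto simp: g_def intro!: powr_mono2')
      next
        case 2
        have "v powr (- 1 - \<alpha>) \<le> 1 powr (- 1 - \<alpha>)" using 2 assms by (intro powr_mono2') auto
        moreover have "1 powr (1 - \<alpha>) \<le> u powr (1 - \<alpha>)" using 2 that assms by (intro powr_mono2') auto
        ultimately show ?thesis using 2 by (simp add: g_def)
      next
        case 3
        then show ?thesis using that assms by (auto simp: g_def intro!: powr_mono2')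
      qed
    qed
    show "set_integrable lborel {0<..} g"
      unfolding g_def using set_integrable_powr_majorant[of \<alpha>] assms by (intro set_integrable_mult_right) auto
    show "summable (\<lambda>n. G (real (Suc n) / \<tau>))" if "\<tau> > 0" for \<tau>
      unfolding G_eq[OF that] by (intro summable_mult sm)
  qed
  moreover have "\<forall>\<^sub>F \<tau> in at_top. (\<Sum>n. G (real (Suc n) / \<tau>)) / \<tau>
      = \<tau> powr \<alpha> * (\<Sum>n. real (Suc n) powr (- 1 - \<alpha>) * (1 - cos (real (Suc n) / \<tau>)))"
    using eventually_gt_at_top[of 0]
  proof eventually_elim
    case (elim \<tau>)
    show ?case unfolding G_eq[OF elim] suminf_mult[OF sm] using elim by (simp add: powr_add)
  qed
  ultimately show ?thesis by (blast intro: Lim_transform_eventually)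
qed

lemma summable_inverse_square_sum:
  assumes \<tau>: "\<tau> > 0"
  shows "summable (\<lambda>n. 1 / (1 + (real (Suc n) / \<tau>)\<^sup>2)\<^sup>2)"
proof (rule summable_comparison_test')
  have "summable (\<lambda>n. inverse ((real (Suc n))\<^sup>2))"
    by (subst summable_Suc_iff) (rule inverse_power_summable, simp)
  then show "summable (\<lambda>n. \<tau>\<^sup>2 * inverse ((real (Suc n))\<^sup>2))" by (rule summable_mult)
  show "norm (1 / (1 + (real (Suc n) / \<tau>)\<^sup>2)\<^sup>2) \<le> \<tau>\<^sup>2 * inverse ((real (Suc n))\<^sup>2)" if "n \<ge> 0" for n
  proof -
    define u where "u = (real (Suc n) / \<tau>)\<^sup>2"
    have u: "u > 0" unfolding u_def using \<tau> by simp
    have "1 * u \<le> (1 + u) * (1 + u)" using u by (intro mult_mono) auto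
    then have "1 / (1 + u)\<^sup>2 \<le> 1 / u" using u by (intro frac_le) (simp_all only: power2_eq_square mult_1)
    also have "\<dots> = \<tau>\<^sup>2 * inverse ((real (Suc n))\<^sup>2)" using \<tau> by (simp add: u_def field_simps del: of_nat_Suc)
    finally show ?thesis by (simp add: u_def)
  qed
qed

text \<open>These sums arise at \<alpha> = 2 in dimension two, where the kernel decays like the
  fourth inverse power of the norm and one coordinate has been scaled out.\<close>

lemma inverse_square_sum_limit:
  "\<exists>J>0. ((\<lambda>\<tau>. (\<Sum>n. 1 / (1 + (real (Suc n) / \<tau>)\<^sup>2)\<^sup>2) / \<tau>) \<longlongrightarrow> J) at_top"
proof -
  define G where "G u = 1 / (1 + u\<^sup>2)\<^sup>2" for u :: real
  define g where "g u = 1 / (1 + u\<^sup>2)" for u :: real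
  have pos: "1 + u\<^sup>2 > 0" for u :: real by (simp add: add_pos_nonneg)
  have gi: "set_integrable lborel {0<..} g"
    unfolding g_def set_integrable_def
    using integrable_mult_indicator[OF _ integrable_inverse_square[of 1], of "{0<..}"] by simp
  have le: "\<bar>G u\<bar> \<le> g u" for u
  proof -
    have "(1 + u\<^sup>2) * 1 \<le> (1 + u\<^sup>2) * (1 + u\<^sup>2)" by (intro mult_left_mono) auto
    then show ?thesis using pos[of u] by (simp add: G_def g_def power2_eq_square[of "1 + u\<^sup>2"] frac_le)
  qed
  have [measurable]: "G \<in> borel_measurable borel" unfolding G_def by measurable
  have Gi: "set_integrable lborel {0<..} G"
    unfolding set_integrable_def
    by (rule Bochner_Integration.integrable_bound[OF gi[unfolded set_integrable_def]])
       (use order_trans[OF le abs_ge_self] in \<open>auto simp: indicator_def\<close>)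
  have "((\<lambda>\<tau>. (\<Sum>n. G (real (Suc n) / \<tau>)) / \<tau>) \<longlongrightarrow> (LBINT u:{0<..}. G u)) at_top"
  proof (rule riemann_sum_at_top[where g = g, OF _ _ le _ gi])
    show "isCont G u" for u unfolding G_def using pos[of u] by (intro continuous_intros) auto
    show "g v \<le> g u" if "0 < u" "u \<le> v" for u v
      using that pos[of u] by (auto simp: g_def intro!: frac_le power_mono)
    show "summable (\<lambda>n. G (real (Suc n) / \<tau>))" if "\<tau> > 0" for \<tau>
      unfolding G_def by (rule summable_inverse_square_sum[OF that])
  qed auto
  moreover have "(LBINT u:{0<..}. G u) > 0"
  proof -
    have nn: "0 \<le> indicat_real {0<..} u *\<^sub>R G u" for u by (simp add: G_def)
    have "(LBINT u:{0<..}. G u) \<noteq> 0"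
    proof
      assume "(LBINT u:{0<..}. G u) = 0"
      then have "AE u in lborel. indicat_real {0<..} u *\<^sub>R G u = 0"
        using integral_nonneg_eq_0_iff_AE[OF Gi[unfolded set_integrable_def]] nn by (simp add: set_lebesgue_integral_def)
      then have "AE u in lborel. u \<notin> {0<..(1::real)}"
        by eventually_elim (use pos in \<open>auto simp: G_def add_nonneg_eq_0_iff\<close>)
      then have "emeasure lborel {0<..(1::real)} = 0"
        by (subst (asm) AE_iff_measurable[of "{0<..1}"]) auto
      then show False by simp
    qed
    moreover have "0 \<le> (LBINT u:{0<..}. G u)" unfolding set_lebesgue_integral_def using nn by (intro integral_nonneg_AE) auto
    ultimately show ?thesis by linarith
  qed
  ultimately show ?thesis unfolding G_def by blast
qed

text \<open>The harmonic sum is asymptotic to the logarithm, and the finitely many terms far from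
  the limit are negligible against it.\<close>

lemma cesaro_log:
  fixes a :: "nat \<Rightarrow> real"
  assumes "a \<longlonglongrightarrow> c"
  shows "(\<lambda>N. (\<Sum>n=1..N. a n / real n) / ln (real N)) \<longlonglongrightarrow> c"
proof -
  have ln: "filterlim (\<lambda>N. ln (real N)) at_top sequentially" by real_asymp
  have "(\<lambda>N. (harm N - ln (real N)) / ln (real N)) \<longlonglongrightarrow> 0"
    using euler_mascheroni_LIMSEQ by (rule tendsto_divide_0) (rule filterlim_at_top_imp_at_infinity[OF ln])
  from tendsto_add[OF this tendsto_const[of 1]]
  have harm_ln: "(\<lambda>N. (harm N - ln (real N)) / ln (real N) + 1) \<longlonglongrightarrow> 1" by simp
  have harm: "(\<lambda>N. harm N / ln (real N)) \<longlonglongrightarrow> 1"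
  proof (rule Lim_transform_eventually[OF harm_ln])
    show "\<forall>\<^sub>F N in sequentially. (harm N - ln (real N)) / ln (real N) + 1 = harm N / ln (real N)"
      using eventually_gt_at_top[of 1] by eventually_elim (simp add: diff_divide_distrib)
  qed
  have "(\<lambda>N. (\<Sum>n=1..N. (a n - c) / real n) / ln (real N)) \<longlonglongrightarrow> 0"
  proof (rule LIMSEQ_I, unfold real_norm_def diff_zero)
    fix e :: real assume e: "e > 0"
    obtain n0 where n0: "\<And>n. n \<ge> n0 \<Longrightarrow> \<bar>a n - c\<bar> < e / 4"
      using LIMSEQ_D[OF assms, of "e / 4"] e by auto
    define B where "B = (\<Sum>n=1..n0. \<bar>a n - c\<bar> / real n)"
    have le: "\<bar>\<Sum>n=1..N. (a n - c) / real n\<bar> \<le> B + e / 4 * harm N" for N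
    proof -
      have "\<bar>\<Sum>n=1..N. (a n - c) / real n\<bar> \<le> (\<Sum>n=1..N. \<bar>a n - c\<bar> / real n)"
        by (rule order_trans[OF sum_abs]) simp
      also have "\<dots> \<le> (\<Sum>n=1..N. (if n \<le> n0 then \<bar>a n - c\<bar> / real n else 0) + e / 4 * inverse (real n))"
      proof (rule sum_mono)
        fix n
        have "0 \<le> e / 4 * inverse (real n)" using e by simp
        moreover have "\<bar>a n - c\<bar> / real n \<le> e / 4 * inverse (real n)" if "\<not> n \<le> n0"
        proof -
          have "\<bar>a n - c\<bar> \<le> e / 4" using n0[of n] that by simp
          from mult_right_mono[OF this, of "inverse (real n)"]
          show ?thesis unfolding divide_inverse[of "\<bar>a n - c\<bar>"] by simp
        qed
        ultimately show "\<bar>a n - c\<bar> / real n \<le> (if n \<le> n0 then \<bar>a n - c\<bar> / real n else 0) + e / 4 * inverse (real n)"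
          by simp
      qed
      also have "\<dots> = (\<Sum>n=1..N. if n \<le> n0 then \<bar>a n - c\<bar> / real n else 0) + e / 4 * harm N"
        by (simp add: sum.distrib harm_def sum_distrib_left)
      also have "(\<Sum>n=1..N. if n \<le> n0 then \<bar>a n - c\<bar> / real n else 0) = (\<Sum>n\<in>{1..N} \<inter> {..n0}. \<bar>a n - c\<bar> / real n)"
        by (subst sum.inter_restrict) (auto intro!: sum.cong)
      also have "\<dots> \<le> B" unfolding B_def by (rule sum_mono2) auto
      finally show ?thesis by simp
    qed
    have "(\<lambda>N. B / ln (real N) + e / 4 * (harm N / ln (real N))) \<longlonglongrightarrow> 0 + e / 4 * 1"
      by (intro tendsto_add tendsto_mult tendsto_const harm tendsto_divide_0[OF tendsto_const] filterlim_at_top_imp_at_infinity ln)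
    then have "\<forall>\<^sub>F N in sequentially. B / ln (real N) + e / 4 * (harm N / ln (real N)) < e"
      by (rule order_tendstoD) (use e in simp)
    with eventually_gt_at_top[of 1]
    have "\<forall>\<^sub>F N in sequentially. \<bar>(\<Sum>n=1..N. (a n - c) / real n) / ln (real N)\<bar> < e"
    proof eventually_elim
      case (elim N)
      then have l: "ln (real N) > 0" by simp
      have "\<bar>(\<Sum>n=1..N. (a n - c) / real n) / ln (real N)\<bar> \<le> (B + e / 4 * harm N) / ln (real N)"
        using le[of N] l by (simp add: divide_right_mono)
      also have "\<dots> < e" using elim by (simp add: add_divide_distrib)
      finally show ?case .
    qed
    then show "\<exists>no. \<forall>n\<ge>no. \<bar>(\<Sum>n=1..n. (a n - c) / real n) / ln (real n)\<bar> < e"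
      by (simp add: eventually_sequentially)
  qed
  from tendsto_add[OF this tendsto_mult[OF tendsto_const[of c] harm]]
  have "(\<lambda>N. (\<Sum>n=1..N. (a n - c) / real n) / ln (real N) + c * (harm N / ln (real N))) \<longlonglongrightarrow> c" by simp
  moreover have "(\<Sum>n=1..N. (a n - c) / real n) / ln (real N) + c * (harm N / ln (real N)) = (\<Sum>n=1..N. a n / real n) / ln (real N)" for N
  proof -
    have "(\<Sum>n=1..N. (a n - c) / real n) + c * harm N = (\<Sum>n=1..N. a n / real n)"
      by (simp add: harm_def sum_distrib_left sum.distrib[symmetric] diff_divide_distrib inverse_eq_divide)
    then show ?thesis by (metis add_divide_distrib times_divide_eq_right)
  qed
  ultimately show ?thesis by simp
qed

lemma one_minus_cos_taylor: "\<bar>1 - cos u - u\<^sup>2 / 2\<bar> \<le> u ^ 4 / (24 :: real)"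
proof -
  obtain t where t: "cos u = (\<Sum>m<4. cos_coeff m * u ^ m) + (cos (t + 1 / 2 * real 4 * pi) / fact 4) * u ^ 4"
    using Maclaurin_cos_expansion[of u 4] by blast
  have "(\<Sum>m<4. h m) = h 0 + h 1 + h 2 + h 3" for h :: "nat \<Rightarrow> real"
    by (simp add: eval_nat_numeral)
  then have "(\<Sum>m<4. cos_coeff m * u ^ m) = 1 - u\<^sup>2 / 2"
    by (simp add: cos_coeff_def)
  then have "1 - cos u - u\<^sup>2 / 2 = - (cos (t + 1 / 2 * real 4 * pi) * (u ^ 4 / 24))"
    using t by (simp add: fact_numeral)
  then have "\<bar>1 - cos u - u\<^sup>2 / 2\<bar> = \<bar>cos (t + 1 / 2 * real 4 * pi)\<bar> * (u ^ 4 / 24)"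
    by (simp add: abs_mult)
  also have "\<dots> \<le> 1 * (u ^ 4 / 24)" by (intro mult_right_mono abs_cos_le_one) simp
  finally show ?thesis by simp
qed

text \<open>The sum is cut at \<open>\<tau>\<close>. Below, the cosine is replaced by its quadratic
  Taylor polynomial, which leaves a logarithmic average; the Taylor error and the tail are both of
  order \<open>1 / \<tau>\<^sup>2\<close>, smaller than the main term by a logarithm.\<close>

lemma log_sum_limit:
  fixes r :: "nat \<Rightarrow> real"
  assumes r0: "\<And>n. 0 \<le> r n" and lim: "(\<lambda>n. real n ^ 3 * r n) \<longlonglongrightarrow> c"
  shows "((\<lambda>\<tau>. (\<Sum>n. r (Suc n) * (1 - cos (real (Suc n) / \<tau>))) * \<tau>\<^sup>2 / ln \<tau>) \<longlongrightarrow> c / 2) at_top"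
proof -
  define f where "f \<tau> = (\<Sum>n. r (Suc n) * (1 - cos (real (Suc n) / \<tau>)))" for \<tau>
  define Sg where "Sg N = (\<Sum>n=1..N. (real n ^ 3 * r n) / real n)" for N
  obtain M where M: "\<And>n. \<bar>real n ^ 3 * r n\<bar> \<le> M"
    using convergent_imp_Bseq[of "\<lambda>n. real n ^ 3 * r n"] lim by (auto simp: convergent_def Bseq_def)
  have M0: "0 \<le> M" using M[of 0] by simp
  have rb: "r (Suc n) \<le> M / real (Suc n) ^ 3" for n
    using M[of "Suc n"] r0[of "Suc n"] by (simp add: field_simps abs_mult del: of_nat_Suc)
  \<comment> \<open>A telescoping majorant for inverse cubes, so that the tail beyond
    \<open>N\<close> is at most \<open>1 / N ^ 2\<close> without an integral comparison.\<close>
  have cube: "1 / real (Suc m) ^ 3 \<le> 1 / real m ^ 2 - 1 / real (Suc m) ^ 2" if "m \<ge> 1" for m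
  proof -
    have "real m ^ 2 \<le> (2 * real m + 1) * real (Suc m)" by (simp add: power2_eq_square algebra_simps)
    then have "1 / real (Suc m) ^ 3 \<le> (2 * real m + 1) / (real m ^ 2 * real (Suc m) ^ 2)"
      using that by (simp add: divide_simps power2_eq_square power3_eq_cube mult_ac del: of_nat_Suc)
    also have "\<dots> = 1 / real m ^ 2 - 1 / real (Suc m) ^ 2"
      using that by (simp add: divide_simps) (simp add: power2_eq_square algebra_simps)
    finally show ?thesis .
  qed
  have tele: "(\<lambda>n. 1 / real (n + N) ^ 2 - 1 / real (Suc (n + N)) ^ 2) sums (1 / real N ^ 2)" for N
  proof -
    have "(\<lambda>n. 1 / real (n + N) ^ 2) \<longlonglongrightarrow> 0" by real_asymp
    from telescope_sums'[OF this] show ?thesis by simp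
  qed
  have sm: "summable (\<lambda>n. r (Suc n) * (1 - cos (real (Suc n) / \<tau>)))" for \<tau>
  proof (rule summable_comparison_test')
    show "summable (\<lambda>n. 2 * M * (1 / real (n + 1) ^ 2))"
      using summable_mult[OF summable_Suc_iff[THEN iffD2, OF inverse_power_summable[of 2]], of "2 * M"] by (simp add: inverse_eq_divide)
    show "norm (r (Suc n) * (1 - cos (real (Suc n) / \<tau>))) \<le> 2 * M * (1 / real (n + 1) ^ 2)" if "n \<ge> 0" for n
    proof -
      have "r (Suc n) * (1 - cos (real (Suc n) / \<tau>)) \<le> M / real (Suc n) ^ 3 * 2"
        using r0 rb M0 by (intro mult_mono one_minus_cos_le_2) auto
      also have "\<dots> \<le> M / real (Suc n) ^ 2 * 2"
        using M0 by (intro mult_right_mono divide_left_mono power_increasing) auto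
      finally show ?thesis using r0 by (simp add: abs_mult mult.commute)
    qed
  qed
  \<comment> \<open>The Taylor error below \<open>\<tau>\<close> totals \<open>M\<close>. In the
    tail, bounding \<open>1 - cos\<close> by 2 costs \<open>8 * M\<close>, because
    \<open>\<tau>\<close> is at most \<open>2 * N\<close>.\<close>
  have main: "\<bar>f \<tau> * \<tau>\<^sup>2 - Sg (nat \<lfloor>\<tau>\<rfloor>) / 2\<bar> \<le> 9 * M" if \<tau>: "\<tau> \<ge> 1" for \<tau>
  proof -
    define N where "N = nat \<lfloor>\<tau>\<rfloor>"
    have N: "real N \<le> \<tau>" "\<tau> < real N + 1" "N \<ge> 1" using \<tau> unfolding N_def by linarith+
    have N2: "\<tau> \<le> 2 * real N" using N by linarith
    have split: "f \<tau> = (\<Sum>n. r (Suc (n + N)) * (1 - cos (real (Suc (n + N)) / \<tau>))) + (\<Sum>n<N. r (Suc n) * (1 - cos (real (Suc n) / \<tau>)))"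
      unfolding f_def by (rule suminf_split_initial_segment[OF sm])
    have SgN: "Sg N = (\<Sum>n<N. r (Suc n) * (real (Suc n))\<^sup>2)"
      unfolding Sg_def by (rule sum.reindex_bij_witness[of _ Suc "\<lambda>n. n - 1"]) (auto simp: power2_eq_square power3_eq_cube field_simps)
    have "\<bar>(\<Sum>n<N. r (Suc n) * (1 - cos (real (Suc n) / \<tau>))) - Sg N / (2 * \<tau>\<^sup>2)\<bar> \<le> (\<Sum>n<N. M * \<tau> / \<tau> ^ 4)"
    proof -
      have "(\<Sum>n<N. r (Suc n) * (1 - cos (real (Suc n) / \<tau>))) - Sg N / (2 * \<tau>\<^sup>2)
          = (\<Sum>n<N. r (Suc n) * (1 - cos (real (Suc n) / \<tau>) - (real (Suc n) / \<tau>)\<^sup>2 / 2))"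
        unfolding SgN by (simp add: sum_divide_distrib sum_subtractf[symmetric] right_diff_distrib power_divide mult.commute)
      also have "\<bar>\<dots>\<bar> \<le> (\<Sum>n<N. M * \<tau> / \<tau> ^ 4)"
      proof (intro order_trans[OF sum_abs] sum_mono)
        fix n assume n: "n \<in> {..<N}"
        let ?u = "real (Suc n) / \<tau>"
        have "\<bar>r (Suc n) * (1 - cos ?u - ?u\<^sup>2 / 2)\<bar> \<le> r (Suc n) * (?u ^ 4 / 24)"
          unfolding abs_mult abs_of_nonneg[OF r0] by (intro mult_left_mono one_minus_cos_taylor r0)
        also have "\<dots> \<le> r (Suc n) * ?u ^ 4"
          using r0[of "Suc n"] by (intro mult_left_mono) auto
        also have "\<dots> \<le> M / real (Suc n) ^ 3 * ?u ^ 4" using rb[of n] by (intro mult_right_mono) auto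
        also have "\<dots> = M * real (Suc n) / \<tau> ^ 4"
          by (simp add: power_divide field_simps power3_eq_cube power4_eq_xxxx del: of_nat_Suc)
        also have "\<dots> \<le> M * \<tau> / \<tau> ^ 4"
          using n N \<tau> M0 by (intro divide_right_mono mult_left_mono) auto
        finally show "\<bar>r (Suc n) * (1 - cos ?u - ?u\<^sup>2 / 2)\<bar> \<le> M * \<tau> / \<tau> ^ 4" .
      qed
      finally show ?thesis .
    qed
    also have "\<dots> = real N * (M * \<tau> / \<tau> ^ 4)" by simp
    also have "\<dots> \<le> \<tau> * (M * \<tau> / \<tau> ^ 4)" using N \<tau> M0 by (intro mult_right_mono) auto
    also have "\<dots> = M / \<tau>\<^sup>2" using \<tau> by (simp add: power2_eq_square power4_eq_xxxx)
    finally have 1: "\<bar>(\<Sum>n<N. r (Suc n) * (1 - cos (real (Suc n) / \<tau>))) - Sg N / (2 * \<tau>\<^sup>2)\<bar> \<le> M / \<tau>\<^sup>2" .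
    have "(\<Sum>n. r (Suc (n + N)) * (1 - cos (real (Suc (n + N)) / \<tau>))) \<le> (\<Sum>n. 2 * M * (1 / real (n + N) ^ 2 - 1 / real (Suc (n + N)) ^ 2))"
    proof (rule suminf_le)
      show "summable (\<lambda>n. r (Suc (n + N)) * (1 - cos (real (Suc (n + N)) / \<tau>)))"
        using summable_ignore_initial_segment[OF sm, of N] .
      show "summable (\<lambda>n. 2 * M * (1 / real (n + N) ^ 2 - 1 / real (Suc (n + N)) ^ 2))"
        using tele by (intro summable_mult) (auto simp: sums_iff)
      fix n
      have "r (Suc (n + N)) * (1 - cos (real (Suc (n + N)) / \<tau>)) \<le> M / real (Suc (n + N)) ^ 3 * 2"
        using M0 by (intro mult_mono one_minus_cos_le_2 rb) auto
      also have "\<dots> = 2 * M * (1 / real (Suc (n + N)) ^ 3)" by simp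
      also have "\<dots> \<le> 2 * M * (1 / real (n + N) ^ 2 - 1 / real (Suc (n + N)) ^ 2)"
        using cube[of "n + N"] N M0 by (intro mult_left_mono) auto
      finally show "r (Suc (n + N)) * (1 - cos (real (Suc (n + N)) / \<tau>)) \<le> 2 * M * (1 / real (n + N) ^ 2 - 1 / real (Suc (n + N)) ^ 2)" .
    qed
    also have "\<dots> = 2 * M * (1 / real N ^ 2)" using sums_mult[OF tele, of "2 * M"] by (simp add: sums_iff)
    also have "\<dots> \<le> 2 * M * (4 / \<tau>\<^sup>2)"
    proof (intro mult_left_mono)
      have "\<tau>\<^sup>2 \<le> (2 * real N)\<^sup>2" using N2 \<tau> by (intro power_mono) auto
      then show "1 / real N ^ 2 \<le> 4 / \<tau>\<^sup>2" using N \<tau> by (simp add: field_simps power_mult_distrib)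
    qed (use M0 in simp)
    finally have 2: "(\<Sum>n. r (Suc (n + N)) * (1 - cos (real (Suc (n + N)) / \<tau>))) \<le> 8 * M / \<tau>\<^sup>2" by simp
    have 3: "0 \<le> (\<Sum>n. r (Suc (n + N)) * (1 - cos (real (Suc (n + N)) / \<tau>)))"
      using r0 by (intro suminf_nonneg summable_ignore_initial_segment[OF sm]) auto
    have "\<bar>f \<tau> - Sg N / (2 * \<tau>\<^sup>2)\<bar> \<le> M / \<tau>\<^sup>2 + 8 * M / \<tau>\<^sup>2" using 1 2 3 split by linarith
    then have "\<bar>f \<tau> - Sg N / (2 * \<tau>\<^sup>2)\<bar> * \<tau>\<^sup>2 \<le> (M / \<tau>\<^sup>2 + 8 * M / \<tau>\<^sup>2) * \<tau>\<^sup>2" by (rule mult_right_mono) simp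
    also have "\<dots> = 9 * M" using \<tau> by (simp add: field_simps)
    also have "\<bar>f \<tau> - Sg N / (2 * \<tau>\<^sup>2)\<bar> * \<tau>\<^sup>2 = \<bar>(f \<tau> - Sg N / (2 * \<tau>\<^sup>2)) * \<tau>\<^sup>2\<bar>" by (simp add: abs_mult)
    also have "(f \<tau> - Sg N / (2 * \<tau>\<^sup>2)) * \<tau>\<^sup>2 = f \<tau> * \<tau>\<^sup>2 - Sg N / 2" using \<tau> by (simp add: field_simps)
    finally show ?thesis by (simp add: N_def)
  qed
  have 0: "((\<lambda>\<tau>. (f \<tau> * \<tau>\<^sup>2 - Sg (nat \<lfloor>\<tau>\<rfloor>) / 2) / ln \<tau>) \<longlongrightarrow> 0) at_top"
  proof (rule Lim_null_comparison)
    show "\<forall>\<^sub>F \<tau> in at_top. norm ((f \<tau> * \<tau>\<^sup>2 - Sg (nat \<lfloor>\<tau>\<rfloor>) / 2) / ln \<tau>) \<le> 9 * M / ln \<tau>"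
      using eventually_gt_at_top[of 1] by eventually_elim (use main in \<open>auto simp: intro!: divide_right_mono\<close>)
    show "((\<lambda>\<tau>::real. 9 * M / ln \<tau>) \<longlongrightarrow> 0) at_top" by real_asymp
  qed
  have fl: "filterlim (\<lambda>\<tau>::real. nat \<lfloor>\<tau>\<rfloor>) sequentially at_top"
    by (intro filterlim_compose[OF filterlim_nat_sequentially filterlim_floor_sequentially])
  have "((\<lambda>\<tau>::real. Sg (nat \<lfloor>\<tau>\<rfloor>) / ln (real (nat \<lfloor>\<tau>\<rfloor>))) \<longlongrightarrow> c) at_top"
    using filterlim_compose[OF cesaro_log[OF lim] fl] unfolding Sg_def .
  moreover have "((\<lambda>\<tau>::real. ln (real (nat \<lfloor>\<tau>\<rfloor>)) / ln \<tau>) \<longlongrightarrow> 1) at_top" by real_asymp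
  ultimately have "((\<lambda>\<tau>. Sg (nat \<lfloor>\<tau>\<rfloor>) / ln (real (nat \<lfloor>\<tau>\<rfloor>)) * (ln (real (nat \<lfloor>\<tau>\<rfloor>)) / ln \<tau>) / 2) \<longlongrightarrow> c * 1 / 2) at_top"
    by (intro tendsto_intros) auto
  from tendsto_add[OF 0 this] have lim: "((\<lambda>\<tau>. (f \<tau> * \<tau>\<^sup>2 - Sg (nat \<lfloor>\<tau>\<rfloor>) / 2) / ln \<tau>
      + Sg (nat \<lfloor>\<tau>\<rfloor>) / ln (real (nat \<lfloor>\<tau>\<rfloor>)) * (ln (real (nat \<lfloor>\<tau>\<rfloor>)) / ln \<tau>) / 2) \<longlongrightarrow> c / 2) at_top"
    by simp
  show ?thesis
  proof (rule Lim_transform_eventually[OF lim])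
    show "\<forall>\<^sub>F \<tau> in at_top. (f \<tau> * \<tau>\<^sup>2 - Sg (nat \<lfloor>\<tau>\<rfloor>) / 2) / ln \<tau>
        + Sg (nat \<lfloor>\<tau>\<rfloor>) / ln (real (nat \<lfloor>\<tau>\<rfloor>)) * (ln (real (nat \<lfloor>\<tau>\<rfloor>)) / ln \<tau>) / 2
      = (\<Sum>n. r (Suc n) * (1 - cos (real (Suc n) / \<tau>))) * \<tau>\<^sup>2 / ln \<tau>"
      using eventually_ge_at_top[of 2]
    proof eventually_elim
      case (elim \<tau>)
      then have "2 \<le> \<lfloor>\<tau>\<rfloor>" by (simp add: le_floor_iff)
      then have "2 \<le> nat \<lfloor>\<tau>\<rfloor>" by linarith
      then have "ln (real (nat \<lfloor>\<tau>\<rfloor>)) > 0" by (intro ln_gt_zero) linarith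
      moreover have "ln \<tau> > 0" using elim by simp
      moreover have "(p - X / 2) / l + X / Y * (Y / l) / 2 = p / l" if "0 < Y" "0 < l" for p X Y l :: real
        using that by (simp add: field_simps)
      ultimately show ?case unfolding f_def[symmetric] by blast
    qed
  qed
qed

lemma has_sum_int_even:
  fixes w :: "int \<Rightarrow> real"
  assumes even: "\<And>k. w (- k) = w k" and W: "((\<lambda>n. w (int (Suc n))) has_sum W) UNIV"
  shows "(w has_sum (w 0 + 2 * W)) UNIV"
proof -
  have 1: "(w has_sum W) (range (\<lambda>n. int (Suc n)))"
    using W by (subst has_sum_reindex) (auto simp: inj_on_def o_def)
  have 2: "(w has_sum W) (range (\<lambda>n. - int (Suc n)))"
  proof (subst has_sum_reindex)
    show "inj_on (\<lambda>n. - int (Suc n)) UNIV" by (simp add: inj_on_def)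
    show "((w \<circ> (\<lambda>n. - int (Suc n))) has_sum W) UNIV" using W by (simp only: o_def even)
  qed
  have "(w has_sum (w 0 + (W + W))) ({0} \<union> (range (\<lambda>n. int (Suc n)) \<union> range (\<lambda>n. - int (Suc n))))"
    by (intro has_sum_Un_disjoint 1 2 has_sum_finiteI) auto
  moreover have "{0} \<union> (range (\<lambda>n. int (Suc n)) \<union> range (\<lambda>n. - int (Suc n))) = UNIV"
  proof -
    have "k \<in> {0} \<union> (range (\<lambda>n. int (Suc n)) \<union> range (\<lambda>n. - int (Suc n)))" for k
    proof (cases k rule: int_cases3)
      case (pos n)
      then have "k = int (Suc (n - 1))" by simp
      then show ?thesis by blast
    next
      case (neg n)
      then have "k = - int (Suc (n - 1))" by simp
      then show ?thesis by blast
    qed simp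
    then show ?thesis by blast
  qed
  ultimately show ?thesis by simp
qed

section \<open>The characteristic exponent near the origin\<close>

context lr_kernel
begin

lemma summable_second_moment:
  assumes "2 < \<alpha>"
  shows "(\<lambda>y. s y * ((\<phi> \<bullet> emb y)\<^sup>2 / 2)) summable_on UNIV"
proof -
  let ?K = "C * (\<Sum>i\<in>UNIV. b i) * (norm \<phi>)\<^sup>2"
  have "(\<lambda>y. ?K * norm (emb y) powr - (real CARD('d) + (\<alpha> - 2))) summable_on (UNIV - {0::int ^ 'd})"
    using assms by (intro summable_on_cmult_right summable_on_norm_powr) simp
  then have "(\<lambda>y. s y * ((\<phi> \<bullet> emb y)\<^sup>2 / 2)) summable_on (UNIV - {0})"
  proof (rule summable_on_comparison_test)
    fix y :: "int ^ 'd" assume "y \<in> UNIV - {0}"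
    then have y: "y \<noteq> 0" by simp
    have n: "1 \<le> norm (emb y)" by (rule norm_emb_ge_1[OF y])
    have "\<bar>\<phi> \<bullet> emb y\<bar> \<le> norm \<phi> * norm (emb y)" by (rule Cauchy_Schwarz_ineq2)
    then have "(\<phi> \<bullet> emb y)\<^sup>2 \<le> (norm \<phi> * norm (emb y))\<^sup>2" by (simp add: abs_le_square_iff[symmetric] abs_mult)
    then have "(\<phi> \<bullet> emb y)\<^sup>2 / 2 \<le> (norm \<phi> * norm (emb y))\<^sup>2" using zero_le_power2[of "\<phi> \<bullet> emb y"] by linarith
    then have "s y * ((\<phi> \<bullet> emb y)\<^sup>2 / 2) \<le> (C * (\<Sum>i\<in>UNIV. b i) * norm (emb y) powr - (real CARD('d) + \<alpha>)) * (norm \<phi> * norm (emb y))\<^sup>2"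
      using s_le[OF y] nonneg[of y] by (intro mult_mono) (auto intro: order_trans)
    also have "\<dots> = ?K * (norm (emb y) powr - (real CARD('d) + \<alpha>) * norm (emb y) powr 2)"
      using n by (simp add: power_mult_distrib powr_numeral)
    also have "norm (emb y) powr - (real CARD('d) + \<alpha>) * norm (emb y) powr 2 = norm (emb y) powr - (real CARD('d) + (\<alpha> - 2))"
      unfolding powr_add[symmetric] by (rule arg_cong[where f = "(powr) (norm (emb y))"]) simp
    finally show "s y * ((\<phi> \<bullet> emb y)\<^sup>2 / 2) \<le> ?K * norm (emb y) powr - (real CARD('d) + (\<alpha> - 2))" .
  qed (simp add: nonneg)
  then show ?thesis
    by (rule summable_on_cong_neutral[THEN iffD1, rotated -1]) (auto simp: s_eq)
qed

lemma psi_limit_square: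
  assumes "2 < \<alpha>"
  shows "((\<lambda>t. t * psi (t powr (- 1 / 2) *\<^sub>R \<phi>)) \<longlongrightarrow> (\<Sum>\<^sub>\<infinity>y. s y * ((\<phi> \<bullet> emb y)\<^sup>2 / 2))) at_top"
proof -
  have eq: "t * psi (t powr (- 1 / 2) *\<^sub>R \<phi>) = (\<Sum>\<^sub>\<infinity>y. s y * (t * (1 - cos (t powr (- 1 / 2) * (\<phi> \<bullet> emb y)))))" for t
    unfolding psi_def infsum_cmult_right'[symmetric] by (simp add: mult.left_commute)
  show ?thesis unfolding eq
  proof (rule has_sum_dominated_at_top[OF summable_second_moment[OF assms]])
    fix t :: real and y assume t: "t > 0"
    let ?u = "\<phi> \<bullet> emb y"
    have "t * (1 - cos (t powr (- 1 / 2) * ?u)) \<le> t * ((t powr (- 1 / 2) * ?u)\<^sup>2 / 2)"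
      using t by (intro mult_left_mono one_minus_cos_le) auto
    also have "\<dots> = t * (t powr (- 1 / 2))\<^sup>2 * (?u\<^sup>2 / 2)" by (simp add: power_mult_distrib)
    also have "t * (t powr (- 1 / 2))\<^sup>2 = 1"
      using t by (simp add: power2_eq_square powr_add[symmetric] powr_minus_divide)
    finally have "t * (1 - cos (t powr (- 1 / 2) * ?u)) \<le> ?u\<^sup>2 / 2" by simp
    then have "s y * (t * (1 - cos (t powr (- 1 / 2) * ?u))) \<le> s y * (?u\<^sup>2 / 2)" by (rule mult_left_mono[OF _ nonneg])
    moreover have "0 \<le> s y * (t * (1 - cos (t powr (- 1 / 2) * ?u)))" using t nonneg by simp
    ultimately show "\<bar>s y * (t * (1 - cos (t powr (- 1 / 2) * ?u)))\<bar> \<le> s y * (?u\<^sup>2 / 2)" by simp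
  next
    fix y
    have "((\<lambda>t. t * (1 - cos (t powr (- 1 / 2) * u))) \<longlongrightarrow> u\<^sup>2 / 2) at_top" for u :: real
    proof (cases "u = 0")
      case False
      have "((\<lambda>t. t * (1 - cos (t powr (- 1 / 2) * u))) \<longlongrightarrow> u\<^sup>2 / 2) at_top" if "u > 0" for u :: real
        using that by (real_asymp simp: power2_eq_square)
      from this[of "\<bar>u\<bar>"] False show ?thesis by (cases "u > 0") auto
    qed simp
    then show "((\<lambda>t. s y * (t * (1 - cos (t powr (- 1 / 2) * (\<phi> \<bullet> emb y))))) \<longlongrightarrow> s y * ((\<phi> \<bullet> emb y)\<^sup>2 / 2)) at_top"
      by (intro tendsto_mult tendsto_const)
  qed
qed

text \<open>The characteristic exponent of coordinate \<open>i\<close> alone, that is,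
  \<open>psi\<close> on the \<open>i\<close>th axis.\<close>

definition axis_sum :: "'d \<Rightarrow> real \<Rightarrow> real" where
  "axis_sum i h = (\<Sum>\<^sub>\<infinity>y. s y * (1 - cos (h * real_of_int (y $ i))))"

definition fiber :: "'d \<Rightarrow> nat \<Rightarrow> (int ^ 'd) set" where
  "fiber i n = {y. nat \<bar>y $ i\<bar> = n}"

text \<open>The law of the absolute value of coordinate \<open>i\<close> of a jump; since the cosine
  is even, it determines \<open>axis_sum\<close>.\<close>

definition marg :: "'d \<Rightarrow> nat \<Rightarrow> real" where
  "marg i n = (\<Sum>\<^sub>\<infinity>y\<in>fiber i n. s y)"

lemma marg_nonneg: "0 \<le> marg i n"
  unfolding marg_def by (intro infsum_nonneg nonneg)

lemma one_minus_cos_bound: "\<bar>1 - cos u\<bar> \<le> (2::real)"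
  using one_minus_cos_le_2[of u] by simp

lemma axis_sum_eq: "axis_sum i h = (\<Sum>n. marg i (Suc n) * (1 - cos (h * real (Suc n))))"
proof -
  define f where "f y = s y * (1 - cos (h * real_of_int (y $ i)))" for y
  have sm: "f summable_on B" for B
    unfolding f_def by (rule summable_bounded[where M = 2]) (rule one_minus_cos_bound)
  have bij: "bij_betw snd (Sigma UNIV (fiber i)) UNIV"
    by (rule bij_betwI[where g = "\<lambda>y. (nat \<bar>y $ i\<bar>, y)"]) (auto simp: fiber_def)
  have smS: "(\<lambda>p. f (snd p)) summable_on (Sigma UNIV (fiber i))"
    using summable_on_reindex_bij_betw[OF bij, of f] sm by simp
  have inner: "(\<Sum>\<^sub>\<infinity>y\<in>fiber i n. f y) = marg i n * (1 - cos (h * real n))" for n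
  proof -
    have "(\<Sum>\<^sub>\<infinity>y\<in>fiber i n. f y) = (\<Sum>\<^sub>\<infinity>y\<in>fiber i n. s y * (1 - cos (h * real n)))"
    proof (rule infsum_cong)
      fix y assume "y \<in> fiber i n"
      then have "real_of_int (y $ i) = real n \<or> real_of_int (y $ i) = - real n" by (auto simp: fiber_def)
      then show "f y = s y * (1 - cos (h * real n))" by (auto simp: f_def)
    qed
    then show ?thesis unfolding marg_def by (simp add: infsum_cmult_left')
  qed
  have "axis_sum i h = (\<Sum>\<^sub>\<infinity>p\<in>Sigma UNIV (fiber i). f (snd p))"
    unfolding axis_sum_def f_def[symmetric] by (rule infsum_reindex_bij_betw[OF bij, symmetric])
  also have "\<dots> = (\<Sum>\<^sub>\<infinity>n. \<Sum>\<^sub>\<infinity>y\<in>fiber i n. f y)"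
    using infsum_Sigma_banach[OF smS] by simp
  finally have eq: "axis_sum i h = (\<Sum>\<^sub>\<infinity>n. marg i n * (1 - cos (h * real n)))" by (simp add: inner)
  have "(\<lambda>n. \<Sum>\<^sub>\<infinity>y\<in>fiber i n. f y) summable_on UNIV"
    using summable_on_Sigma_banach[of "\<lambda>n y. f y" UNIV "fiber i"] smS by (simp add: case_prod_unfold)
  then have "(\<lambda>n. marg i n * (1 - cos (h * real n))) summable_on UNIV" by (simp add: inner)
  then have "(\<lambda>n. marg i n * (1 - cos (h * real n))) sums axis_sum i h"
    unfolding eq by (intro has_sum_imp_sums has_sum_infsum)
  then have "(\<lambda>n. marg i (Suc n) * (1 - cos (h * real (Suc n)))) sums axis_sum i h"
    by (subst sums_Suc_iff) simp
  then show ?thesis by (simp add: sums_iff)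
qed

lemma axis_sum_0 [simp]: "axis_sum i 0 = 0"
  by (simp add: axis_sum_def)

lemma axis_sum_abs: "axis_sum i \<bar>h\<bar> = axis_sum i h"
  by (cases "h \<ge> 0") (simp_all add: axis_sum_def)

lemma psi_dim1:
  assumes "UNIV = {i :: 'd}"
  shows "psi \<theta> = axis_sum i (\<theta> $ i)"
  by (simp add: psi_def axis_sum_def inner_vec_def assms)

lemma marg_dim1:
  assumes i: "UNIV = {i :: 'd}"
  shows "marg i (Suc n) = 2 * C * b i * real (Suc n) powr (- 1 - \<alpha>)"
proof -
  define v :: "int \<Rightarrow> int ^ 'd" where "v k = (\<chi> j. k)" for k
  have v: "v k $ i = k" for k by (simp add: v_def)
  have all: "j = i" for j using i by blast
  have vec: "y = v (y $ i)" for y :: "int ^ 'd"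
    unfolding vec_eq_iff by (metis all v)
  have fib: "fiber i (Suc n) = {v (int (Suc n)), v (- int (Suc n))}"
  proof (intro equalityI subsetI)
    fix y assume "y \<in> fiber i (Suc n)"
    then have "y $ i = int (Suc n) \<or> y $ i = - int (Suc n)" by (auto simp: fiber_def)
    then show "y \<in> {v (int (Suc n)), v (- int (Suc n))}" by (subst vec[of y]) auto
  qed (auto simp: fiber_def v)
  have card: "CARD('d) = 1" unfolding i by simp
  have s_v: "s (v k) = C * b i * \<bar>real_of_int k\<bar> powr (- 1 - \<alpha>)" if "k \<noteq> 0" for k
  proof -
    have "v k \<noteq> (0 :: int ^ 'd)" using that v[of k] by auto
    moreover have "norm (emb (v k :: int ^ 'd)) = \<bar>real_of_int k\<bar>"
      by (simp add: norm_vec_def L2_set_def i v)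
    ultimately show ?thesis using that by (simp add: s_eq card i v)
  qed
  have ne: "v (int (Suc n)) \<noteq> (v (- int (Suc n)) :: int ^ 'd)"
    using v[of "int (Suc n)"] v[of "- int (Suc n)"] by auto
  have "marg i (Suc n) = s (v (int (Suc n))) + s (v (- int (Suc n)))"
    unfolding marg_def fib using ne by simp
  then show ?thesis by (simp add: s_v add.commute)
qed

lemma psi_limit_stable:
  assumes i: "UNIV = {i :: 'd}" and a: "1 \<le> \<alpha>" "\<alpha> < 2"
  shows "\<exists>q. \<forall>\<phi>. ((\<lambda>t. t * psi (t powr (- 1 / \<alpha>) *\<^sub>R \<phi>)) \<longlongrightarrow> q \<phi>) at_top"
proof -
  obtain I where I: "((\<lambda>\<tau>. \<tau> powr \<alpha> * (\<Sum>n. real (Suc n) powr (- 1 - \<alpha>) * (1 - cos (real (Suc n) / \<tau>)))) \<longlongrightarrow> I) at_top"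
    using stable_sum_limit[OF a] by blast
  have "((\<lambda>t. t * psi (t powr (- 1 / \<alpha>) *\<^sub>R \<phi>)) \<longlongrightarrow> 2 * C * b i * \<bar>\<phi> $ i\<bar> powr \<alpha> * I) at_top" for \<phi>
  proof (cases "\<phi> $ i = 0")
    case True
    then show ?thesis using \<alpha> by (simp add: psi_dim1[OF i])
  next
    case False
    define x where "x = \<bar>\<phi> $ i\<bar>"
    have x: "x > 0" using False by (simp add: x_def)
    \<comment> \<open>This is the \<open>\<tau>\<close> for which \<open>n / \<tau>\<close> equals
      \<open>n\<close> times the absolute value of the rescaled component.\<close>
    have "filterlim (\<lambda>t. t powr (1 / \<alpha>) / x) at_top at_top"
      using \<alpha> x by real_asymp
    from tendsto_mult[OF tendsto_const[of "2 * C * b i * x powr \<alpha>"] filterlim_compose[OF I this]]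
    show ?thesis unfolding x_def[symmetric]
    proof (rule Lim_transform_eventually)
      show "\<forall>\<^sub>F t in at_top. 2 * C * b i * x powr \<alpha> * ((t powr (1 / \<alpha>) / x) powr \<alpha> *
          (\<Sum>n. real (Suc n) powr (- 1 - \<alpha>) * (1 - cos (real (Suc n) / (t powr (1 / \<alpha>) / x))))) = t * psi (t powr (- 1 / \<alpha>) *\<^sub>R \<phi>)"
        using eventually_gt_at_top[of 0]
      proof eventually_elim
        case (elim t)
        let ?S = "\<Sum>n. real (Suc n) powr (- 1 - \<alpha>) * (1 - cos (real (Suc n) / (t powr (1 / \<alpha>) / x)))"
        have sm: "summable (\<lambda>n. real (Suc n) powr (- 1 - \<alpha>) * (1 - cos (real (Suc n) / (t powr (1 / \<alpha>) / x))))"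
          by (rule summable_stable[OF \<alpha>])
        have h: "\<bar>(t powr (- 1 / \<alpha>) *\<^sub>R \<phi>) $ i\<bar> * real (Suc n) = real (Suc n) / (t powr (1 / \<alpha>) / x)" for n
          using elim by (simp add: abs_mult x_def powr_minus_divide del: of_nat_Suc)
        have "psi (t powr (- 1 / \<alpha>) *\<^sub>R \<phi>) = axis_sum i \<bar>(t powr (- 1 / \<alpha>) *\<^sub>R \<phi>) $ i\<bar>"
          unfolding axis_sum_abs by (rule psi_dim1[OF i])
        also have "\<dots> = (\<Sum>n. 2 * C * b i * (real (Suc n) powr (- 1 - \<alpha>) * (1 - cos (real (Suc n) / (t powr (1 / \<alpha>) / x)))))"
          unfolding axis_sum_eq marg_dim1[OF i] h by (simp add: mult.assoc)
        also have "\<dots> = 2 * C * b i * ?S" by (rule suminf_mult[OF sm])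
        finally have p: "psi (t powr (- 1 / \<alpha>) *\<^sub>R \<phi>) = 2 * C * b i * ?S" .
        have "x powr \<alpha> * (t powr (1 / \<alpha>) / x) powr \<alpha> = t"
          using elim x \<alpha> by (simp add: powr_divide powr_powr)
        moreover have "2 * C * b i * u * (v * w) = z * (2 * C * b i * w)" if "u * v = z" for u v w z
          unfolding that[symmetric] by (simp only: mult_ac)
        ultimately show ?case unfolding p by blast
      qed
    qed
  qed
  then show ?thesis by (intro exI[of _ "\<lambda>\<phi>. 2 * C * b i * \<bar>\<phi> $ i\<bar> powr \<alpha> * I"]) blast
qed

text \<open>The scale \<open>\<tau>\<close> is of the order of the square root of
  \<open>t * ln t\<close>, so \<open>ln \<tau>\<close> is asymptotic to \<open>ln t / 2\<close>.
  With the Taylor coefficient 1/2 this makes the factor 1/4.\<close>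

lemma axis_sum_log_limit:
  assumes lim: "(\<lambda>n. real n ^ 3 * marg i n) \<longlonglongrightarrow> c"
  shows "((\<lambda>t. t * axis_sum i ((t * ln t) powr (- 1 / 2) * x)) \<longlongrightarrow> c / 4 * x\<^sup>2) at_top"
proof (cases "x = 0")
  case False
  define k where "k = \<bar>x\<bar>"
  have k: "k > 0" using False by (simp add: k_def)
  define \<tau> where "\<tau> t = (t * ln t) powr (1 / 2) / k" for t
  have "filterlim \<tau> at_top at_top" unfolding \<tau>_def using k by real_asymp
  from filterlim_compose[OF log_sum_limit[OF marg_nonneg lim] this]
  have 1: "((\<lambda>t. (\<Sum>n. marg i (Suc n) * (1 - cos (real (Suc n) / \<tau> t))) * (\<tau> t)\<^sup>2 / ln (\<tau> t)) \<longlongrightarrow> c / 2) at_top" .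
  have "((\<lambda>t. k\<^sup>2 * (ln ((t * ln t) powr (1 / 2) / k) / ln t)) \<longlongrightarrow> k\<^sup>2 / 2) at_top" using k by real_asymp
  from tendsto_mult[OF 1 this[folded \<tau>_def]]
  have lim2: "((\<lambda>t. (\<Sum>n. marg i (Suc n) * (1 - cos (real (Suc n) / \<tau> t))) * (\<tau> t)\<^sup>2 / ln (\<tau> t) * (k\<^sup>2 * (ln (\<tau> t) / ln t))) \<longlongrightarrow> c / 4 * x\<^sup>2) at_top"
    by (simp add: k_def)
  have ev: "\<forall>\<^sub>F t in at_top. ln (\<tau> t) > 0" unfolding \<tau>_def using k by real_asymp
  show ?thesis
  proof (rule Lim_transform_eventually[OF lim2])
    show "\<forall>\<^sub>F t in at_top. (\<Sum>n. marg i (Suc n) * (1 - cos (real (Suc n) / \<tau> t))) * (\<tau> t)\<^sup>2 / ln (\<tau> t) * (k\<^sup>2 * (ln (\<tau> t) / ln t))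
      = t * axis_sum i ((t * ln t) powr (- 1 / 2) * x)"
      using eventually_gt_at_top[of 1] ev
    proof eventually_elim
      case (elim t)
      have l: "ln t > 0" "t * ln t > 0" using elim by auto
      have h: "\<bar>(t * ln t) powr (- 1 / 2) * x\<bar> * real (Suc n) = real (Suc n) / \<tau> t" for n
        using l by (simp add: abs_mult \<tau>_def k_def powr_minus_divide del: of_nat_Suc)
      have "axis_sum i ((t * ln t) powr (- 1 / 2) * x) = axis_sum i \<bar>(t * ln t) powr (- 1 / 2) * x\<bar>" by (simp only: axis_sum_abs)
      also have "\<dots> = (\<Sum>n. marg i (Suc n) * (1 - cos (real (Suc n) / \<tau> t)))" unfolding axis_sum_eq h ..
      finally have e: "axis_sum i ((t * ln t) powr (- 1 / 2) * x) = (\<Sum>n. marg i (Suc n) * (1 - cos (real (Suc n) / \<tau> t)))" .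
      have "(\<tau> t)\<^sup>2 * k\<^sup>2 = t * ln t"
        using k l by (simp add: \<tau>_def power_divide power2_eq_square[of "_ powr _"] powr_add[symmetric])
      then show ?case unfolding e using elim l by (simp add: field_simps)
    qed
  qed
qed simp

lemma psi_limit_log_dim1:
  assumes i: "UNIV = {i :: 'd}" and a: "\<alpha> = 2"
  shows "\<exists>q. \<forall>\<phi>. ((\<lambda>t. t * psi ((t * ln t) powr (- 1 / 2) *\<^sub>R \<phi>)) \<longlongrightarrow> q \<phi>) at_top"
proof -
  have "(\<lambda>n. real (Suc n) ^ 3 * marg i (Suc n)) = (\<lambda>n. 2 * C * b i)"
  proof
    fix n
    have "real (Suc n) powr (- 1 - \<alpha>) = 1 / real (Suc n) ^ 3"
      using a powr_minus_divide[of "real (Suc n)" 3] by (simp add: powr_numeral)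
    then show "real (Suc n) ^ 3 * marg i (Suc n) = 2 * C * b i" unfolding marg_dim1[OF i] by simp
  qed
  then have "(\<lambda>n. real (Suc n) ^ 3 * marg i (Suc n)) \<longlonglongrightarrow> 2 * C * b i" by simp
  then have "(\<lambda>n. real n ^ 3 * marg i n) \<longlonglongrightarrow> 2 * C * b i" by (rule LIMSEQ_imp_Suc)
  from axis_sum_log_limit[OF this] show ?thesis
    unfolding psi_dim1[OF i] vector_scaleR_component real_scaleR_def
    by (intro exI[of _ "\<lambda>\<phi>. 2 * C * b i / 4 * (\<phi> $ i)\<^sup>2"]) blast
qed

section \<open>The critical exponent 2 in dimension two\<close>

lemma s_dim2:
  assumes ij: "UNIV = {i, j :: 'd}" "i \<noteq> j" and a: "\<alpha> = 2" and y: "y $ i \<noteq> 0"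
  shows "s y = C * (b i + b j * of_bool (y $ j \<noteq> 0)) / ((real_of_int (y $ i))\<^sup>2 + (real_of_int (y $ j))\<^sup>2)\<^sup>2"
proof -
  have card: "CARD('d) = 2" unfolding ij(1) using ij(2) by simp
  have y0: "y \<noteq> 0" using y by auto
  let ?q = "(real_of_int (y $ i))\<^sup>2 + (real_of_int (y $ j))\<^sup>2"
  have q: "?q > 0" using y by (simp add: add_pos_nonneg)
  have n: "(norm (emb y))\<^sup>2 = ?q"
    unfolding norm_vec_def L2_set_def ij(1) using ij(2) by simp
  have "norm (emb y) powr - (real CARD('d) + \<alpha>) = 1 / norm (emb y) powr 4"
    by (simp add: card a powr_minus_divide)
  also have "norm (emb y) powr 4 = ((norm (emb y))\<^sup>2)\<^sup>2"
    using norm_emb_ge_1[OF y0] by (simp add: powr_numeral)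
  moreover have "(\<Sum>l\<in>UNIV. b l * of_bool (y $ l \<noteq> 0)) = b i + b j * of_bool (y $ j \<noteq> 0)"
    unfolding ij(1) using ij(2) y by simp
  ultimately show ?thesis using y0 unfolding s_eq by (simp add: n)
qed

text \<open>The fiber consists of two lines, at plus and minus \<open>Suc n\<close>. On each line
  the point on the axis carries only the weight \<open>b i\<close>; all others carry
  \<open>b i + b j\<close> and are paired by the sign of the second coordinate.\<close>

lemma marg_dim2:
  assumes ij: "UNIV = {i, j :: 'd}" "i \<noteq> j" and a: "\<alpha> = 2"
  shows "marg i (Suc n) = 2 * (C * b i / real (Suc n) ^ 4 + 2 * (C * (b i + b j) / real (Suc n) ^ 4 *
     (\<Sum>m. 1 / (1 + (real (Suc m) / real (Suc n))\<^sup>2)\<^sup>2)))"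
proof -
  let ?N = "int (Suc n)"
  define v where "v = (\<lambda>(k, m). \<chi> l. if l = i then k else (m :: int))"
  have vi: "(v (k, m) :: int ^ 'd) $ i = k" and vj: "(v (k, m) :: int ^ 'd) $ j = m" for k m
    using ij by (auto simp: v_def)
  have vec: "y = v (y $ i, y $ j)" for y :: "int ^ 'd"
    unfolding vec_eq_iff
  proof
    fix l have "l = i \<or> l = j" using ij by blast
    then show "y $ l = (v (y $ i, y $ j) :: int ^ 'd) $ l" using vi vj by auto
  qed
  have bij: "bij_betw v ({?N, - ?N} \<times> UNIV) (fiber i (Suc n))"
  proof (rule bij_betwI[where g = "\<lambda>y. (y $ i, y $ j)"])
    show "v \<in> {?N, - ?N} \<times> UNIV \<rightarrow> fiber i (Suc n)" by (auto simp: fiber_def vi)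
    show "(\<lambda>y. (y $ i, y $ j)) \<in> fiber i (Suc n) \<rightarrow> {?N, - ?N} \<times> UNIV"
    proof
      fix y assume "y \<in> fiber i (Suc n)"
      then have "y $ i = ?N \<or> y $ i = - ?N" by (auto simp: fiber_def)
      then show "(y $ i, y $ j) \<in> {?N, - ?N} \<times> UNIV" by blast
    qed
  qed (auto simp: vi vj vec[symmetric])
  define w where "w m = C * (b i + b j * of_bool (m \<noteq> 0)) / ((real (Suc n))\<^sup>2 + (real_of_int m)\<^sup>2)\<^sup>2" for m :: int
  have sv: "s (v (k, m)) = w m" if "k \<in> {?N, - ?N}" for k m
  proof -
    from that have "k = ?N \<or> k = - ?N" by blast
    then have "k \<noteq> 0" "k\<^sup>2 = ?N\<^sup>2" by (auto simp del: of_nat_Suc)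
    then have "k \<noteq> 0" "(real_of_int k)\<^sup>2 = (real (Suc n))\<^sup>2"
      by (metis, metis of_int_of_nat_eq of_int_power)
    then show ?thesis using s_dim2[OF ij a, of "v (k, m)"] by (simp only: vi vj w_def not_False_eq_True simp_thms)
  qed
  define W where "W = (\<Sum>m. w (int (Suc m)))"
  have smv: "(\<lambda>p. s (v p)) summable_on ({?N, - ?N} \<times> UNIV)"
    using summable_on_reindex_bij_betw[OF bij, of s]
      summable_on_subset_banach[OF has_sum_imp_summable[OF s_has_sum] subset_UNIV[of "fiber i (Suc n)"]] by simp
  have smw: "w summable_on UNIV"
  proof -
    have "(\<lambda>p. s (v p)) summable_on (Pair ?N ` UNIV)"
      by (rule summable_on_subset_banach[OF smv]) auto
    then have "(\<lambda>m. s (v (?N, m))) summable_on UNIV"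
      by (subst (asm) summable_on_reindex) (auto simp: inj_on_def o_def)
    then show ?thesis by (simp only: sv insertI1)
  qed
  have inj: "inj (\<lambda>m. int (Suc m))" by (simp add: inj_on_def)
  have smW: "(\<lambda>m. w (int (Suc m))) summable_on UNIV"
  proof -
    have "w summable_on range (\<lambda>m. int (Suc m))" using smw summable_on_subset_banach by blast
    then show ?thesis using summable_on_reindex[OF inj, of w] by (simp only: o_def)
  qed
  have hsW: "((\<lambda>m. w (int (Suc m))) has_sum W) UNIV"
  proof -
    have "((\<lambda>m. w (int (Suc m))) has_sum (\<Sum>\<^sub>\<infinity>m. w (int (Suc m)))) UNIV" using smW by (rule has_sum_infsum)
    moreover from has_sum_imp_sums[OF this] have "(\<Sum>\<^sub>\<infinity>m. w (int (Suc m))) = W" by (simp add: W_def sums_iff)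
    ultimately show ?thesis by simp
  qed
  have "(w has_sum (w 0 + 2 * W)) UNIV" by (rule has_sum_int_even[OF _ hsW]) (simp add: w_def)
  then have wsum: "(\<Sum>\<^sub>\<infinity>m. w m) = w 0 + 2 * W" by (rule infsumI)
  have "marg i (Suc n) = (\<Sum>\<^sub>\<infinity>p\<in>{?N, - ?N} \<times> UNIV. s (v p))"
    unfolding marg_def by (rule infsum_reindex_bij_betw[OF bij, symmetric])
  also have "\<dots> = (\<Sum>\<^sub>\<infinity>k\<in>{?N, - ?N}. \<Sum>\<^sub>\<infinity>m. s (v (k, m)))"
    using infsum_Sigma_banach[OF smv] by simp
  also have "\<dots> = (\<Sum>\<^sub>\<infinity>k\<in>{?N, - ?N}. w 0 + 2 * W)"
    by (rule infsum_cong) (simp only: sv wsum)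
  also have "\<dots> = 2 * (w 0 + 2 * W)" by simp
  finally have m: "marg i (Suc n) = 2 * (w 0 + 2 * W)" .
  have "W = (\<Sum>m. C * (b i + b j) / real (Suc n) ^ 4 * (1 / (1 + (real (Suc m) / real (Suc n))\<^sup>2)\<^sup>2))"
    unfolding W_def
  proof (rule suminf_cong)
    fix m
    have "(real (Suc n))\<^sup>2 + (real (Suc m))\<^sup>2 = (real (Suc n))\<^sup>2 * (1 + (real (Suc m) / real (Suc n))\<^sup>2)"
      by (simp add: field_simps del: of_nat_Suc)
    then show "w (int (Suc m)) = C * (b i + b j) / real (Suc n) ^ 4 * (1 / (1 + (real (Suc m) / real (Suc n))\<^sup>2)\<^sup>2)"
      by (simp add: w_def power_mult_distrib del: of_nat_Suc)
  qed
  also have "\<dots> = C * (b i + b j) / real (Suc n) ^ 4 * (\<Sum>m. 1 / (1 + (real (Suc m) / real (Suc n))\<^sup>2)\<^sup>2)"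
    by (rule suminf_mult[OF summable_inverse_square_sum]) simp
  finally show ?thesis unfolding m by (simp add: w_def)
qed

text \<open>The axis points are of order \<open>n powr - 4\<close>, but the Riemann sum over the
  transverse coordinate gains a factor \<open>n\<close>. The marginal thus decays like the inverse
  cube, the borderline at which \<open>log_sum_limit\<close> applies.\<close>

lemma marg_limit_dim2:
  assumes ij: "UNIV = {i, j :: 'd}" "i \<noteq> j" and a: "\<alpha> = 2"
  shows "\<exists>c. (\<lambda>n. real n ^ 3 * marg i n) \<longlonglongrightarrow> c"
proof -
  obtain J where J: "((\<lambda>\<tau>. (\<Sum>n. 1 / (1 + (real (Suc n) / \<tau>)\<^sup>2)\<^sup>2) / \<tau>) \<longlongrightarrow> J) at_top"
    using inverse_square_sum_limit by blast
  have "filterlim (\<lambda>n. real (Suc n)) at_top sequentially" by real_asymp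
  from filterlim_compose[OF J this]
  have 1: "(\<lambda>n. (\<Sum>m. 1 / (1 + (real (Suc m) / real (Suc n))\<^sup>2)\<^sup>2) / real (Suc n)) \<longlonglongrightarrow> J" .
  have 2: "(\<lambda>n. 2 * C * b i / real (Suc n)) \<longlonglongrightarrow> 0" by real_asymp
  have "(\<lambda>n. real (Suc n) ^ 3 * marg i (Suc n)) \<longlonglongrightarrow> 0 + 4 * C * (b i + b j) * J"
  proof (rule Lim_transform_eventually[OF tendsto_add[OF 2 tendsto_mult[OF tendsto_const 1]]])
    show "\<forall>\<^sub>F n in sequentially. 2 * C * b i / real (Suc n) + 4 * C * (b i + b j) * ((\<Sum>m. 1 / (1 + (real (Suc m) / real (Suc n))\<^sup>2)\<^sup>2) / real (Suc n))
        = real (Suc n) ^ 3 * marg i (Suc n)"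
    proof (rule always_eventually, rule allI)
      fix n
      have "2 * p / N + 4 * q * (z / N) = N ^ 3 * (2 * (p / N ^ 4 + 2 * (q / N ^ 4 * z)))" if "N > 0" for p q z N :: real
        using that by (simp add: field_simps power3_eq_cube power4_eq_xxxx)
      from this[of "real (Suc n)" "C * b i" "C * (b i + b j)"]
      show "2 * C * b i / real (Suc n) + 4 * C * (b i + b j) * ((\<Sum>m. 1 / (1 + (real (Suc m) / real (Suc n))\<^sup>2)\<^sup>2) / real (Suc n))
        = real (Suc n) ^ 3 * marg i (Suc n)"
        unfolding marg_dim2[OF ij a] by (simp only: mult.assoc of_nat_0_less_iff zero_less_Suc)
    qed
  qed
  then show ?thesis by (intro exI) (rule LIMSEQ_imp_Suc)
qed

text \<open>The last term in \<open>1 - cos A * cos B = (1 - cos A) + (1 - cos B) - (1 - cos A) * (1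
  - cos B)\<close>, where \<open>A\<close> and \<open>B\<close> are the phases of the two
  coordinates.\<close>

definition cross_term :: "'d \<Rightarrow> 'd \<Rightarrow> real ^ 'd \<Rightarrow> real" where
  "cross_term i j \<theta> = (\<Sum>\<^sub>\<infinity>y. s y * ((1 - cos (\<theta> $ i * real_of_int (y $ i))) * (1 - cos (\<theta> $ j * real_of_int (y $ j)))))"

lemma summable_cross_term:
  "(\<lambda>y. s y * ((1 - cos (\<theta> $ i * real_of_int (y $ i))) * (1 - cos (\<theta> $ j * real_of_int (y $ j))))) summable_on UNIV"
proof (rule summable_bounded[where M = "2 * 2"])
  show "\<bar>(1 - cos (\<theta> $ i * real_of_int (y $ i))) * (1 - cos (\<theta> $ j * real_of_int (y $ j)))\<bar> \<le> 2 * 2" for y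
    unfolding abs_mult by (intro mult_mono one_minus_cos_bound) auto
qed

lemma psi_dim2:
  assumes ij: "UNIV = {i, j :: 'd}" "i \<noteq> j"
  shows "psi \<theta> = axis_sum i (\<theta> $ i) + axis_sum j (\<theta> $ j) - cross_term i j \<theta>"
proof -
  have inner: "\<theta> \<bullet> emb y - \<theta> $ i * real_of_int (y $ i) = \<theta> $ j * real_of_int (y $ j)" for y
    unfolding inner_vec_def ij(1) using ij(2) by simp
  have ax: "((\<lambda>y. s y * (1 - cos (h * real_of_int (y $ k)))) has_sum axis_sum k h) UNIV" for k h
    unfolding axis_sum_def by (intro has_sum_infsum summable_bounded[where M = 2] one_minus_cos_bound)
  have "((\<lambda>y. s y * (1 - cos (\<theta> $ i * real_of_int (y $ i))) + s y * (1 - cos (\<theta> $ j * real_of_int (y $ j)))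
      - s y * ((1 - cos (\<theta> $ i * real_of_int (y $ i))) * (1 - cos (\<theta> $ j * real_of_int (y $ j)))))
      has_sum (axis_sum i (\<theta> $ i) + axis_sum j (\<theta> $ j) - cross_term i j \<theta>)) UNIV"
    unfolding cross_term_def by (intro has_sum_diff has_sum_add ax has_sum_infsum summable_cross_term)
  moreover have "s y * (1 - cos (\<theta> $ i * real_of_int (y $ i))) + s y * (1 - cos (\<theta> $ j * real_of_int (y $ j)))
      - s y * ((1 - cos (\<theta> $ i * real_of_int (y $ i))) * (1 - cos (\<theta> $ j * real_of_int (y $ j))))
      = s y * (1 - cos (\<theta> $ j * real_of_int (y $ j)) * cos (\<theta> $ i * real_of_int (y $ i)))" for y
    by (simp add: algebra_simps)
  ultimately show ?thesis unfolding psi_refl[of \<theta> i] inner by (simp add: infsumI)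
qed

text \<open>The one-dimensional exponent of index 1 up to a constant, hence linear in the absolute
  value of \<open>h\<close> near 0. The term \<open>k = 0\<close> is zero.\<close>

definition line_sum :: "real \<Rightarrow> real" where
  "line_sum h = (\<Sum>\<^sub>\<infinity>k::int. (1 - cos (h * real_of_int k)) / (real_of_int k)\<^sup>2)"

lemma has_sum_line:
  "((\<lambda>k::int. (1 - cos (h * real_of_int k)) / (real_of_int k)\<^sup>2) has_sum
     2 * (\<Sum>n. real (Suc n) powr (- 1 - 1) * (1 - cos (\<bar>h\<bar> * real (Suc n))))) UNIV"
proof -
  define w where "w k = (1 - cos (h * real_of_int k)) / (real_of_int k)\<^sup>2" for k :: int
  have eq: "w (int (Suc n)) = real (Suc n) powr (- 1 - 1) * (1 - cos (\<bar>h\<bar> * real (Suc n)))" for n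
  proof -
    have "real (Suc n) powr (- 1 - 1) = 1 / (real (Suc n))\<^sup>2"
      using powr_minus_divide[of "real (Suc n)" 2] by (simp add: powr_numeral)
    moreover have "cos (\<bar>h\<bar> * real (Suc n)) = cos (h * real (Suc n))" by (cases "h \<ge> 0") simp_all
    ultimately show ?thesis by (simp add: w_def)
  qed
  have "summable (\<lambda>n. real (Suc n) powr (- 1 - 1) * (1 - cos (\<bar>h\<bar> * real (Suc n))))"
    using summable_stable[of 1 "1 / \<bar>h\<bar>"] by (simp add: mult.commute)
  then have "((\<lambda>n. w (int (Suc n))) has_sum (\<Sum>n. real (Suc n) powr (- 1 - 1) * (1 - cos (\<bar>h\<bar> * real (Suc n))))) UNIV"
    unfolding eq by (intro sums_nonneg_imp_has_sum summable_sums) auto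
  from has_sum_int_even[OF _ this] show ?thesis by (simp add: w_def[abs_def])
qed

lemma line_sum_limit: "\<exists>L. ((\<lambda>h. line_sum (h * x) / h) \<longlongrightarrow> L) (at_right 0)"
proof (cases "x = 0")
  case True
  then show ?thesis by (intro exI[of _ 0]) (simp add: line_sum_def)
next
  case False
  obtain I where I: "((\<lambda>\<tau>. \<tau> powr 1 * (\<Sum>n. real (Suc n) powr (- 1 - 1) * (1 - cos (real (Suc n) / \<tau>)))) \<longlongrightarrow> I) at_top"
    using stable_sum_limit[of 1] by auto
  have k: "\<bar>x\<bar> > 0" using False by simp
  then have "filterlim (\<lambda>h. 1 / (h * \<bar>x\<bar>)) at_top (at_right 0)" by real_asymp
  from tendsto_mult[OF tendsto_const[of "2 * \<bar>x\<bar>"] filterlim_compose[OF I this]]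
  have lim: "((\<lambda>h. 2 * \<bar>x\<bar> * ((1 / (h * \<bar>x\<bar>)) powr 1 * (\<Sum>n. real (Suc n) powr (- 1 - 1) * (1 - cos (real (Suc n) / (1 / (h * \<bar>x\<bar>))))))) \<longlongrightarrow> 2 * \<bar>x\<bar> * I) (at_right 0)" .
  have "((\<lambda>h. line_sum (h * x) / h) \<longlongrightarrow> 2 * \<bar>x\<bar> * I) (at_right 0)"
  proof (rule Lim_transform_eventually[OF lim])
    show "\<forall>\<^sub>F h in at_right 0. 2 * \<bar>x\<bar> * ((1 / (h * \<bar>x\<bar>)) powr 1 * (\<Sum>n. real (Suc n) powr (- 1 - 1) * (1 - cos (real (Suc n) / (1 / (h * \<bar>x\<bar>))))))
        = line_sum (h * x) / h"
      using eventually_at_right_less[of 0]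
    proof eventually_elim
      case (elim h)
      have "real (Suc n) / (1 / (h * \<bar>x\<bar>)) = \<bar>h * x\<bar> * real (Suc n)" for n
        using elim by (simp add: abs_mult)
      then have "line_sum (h * x) = 2 * (\<Sum>n. real (Suc n) powr (- 1 - 1) * (1 - cos (real (Suc n) / (1 / (h * \<bar>x\<bar>)))))"
        by (simp only: line_sum_def infsumI[OF has_sum_line])
      then show ?case using elim k by (simp add: powr_one abs_mult mult_ac)
    qed
  qed
  then show ?thesis by blast
qed

text \<open>With \<open>p\<close> and \<open>q\<close> the squared coordinates,
  \<open>(p + q)\<^sup>2\<close> is at least \<open>p * q\<close>. The kernel is thus dominated by a
  product of two inverse squares, and each factor sums to something linear in its component. The
  cross term is quadratic without a logarithm, so \<open>t\<close> times it vanishes at the scale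
  \<open>(t * ln t) powr (- 1 / 2)\<close>.\<close>

lemma cross_term_le:
  assumes ij: "UNIV = {i, j :: 'd}" "i \<noteq> j" and a: "\<alpha> = 2"
  shows "cross_term i j \<theta> \<le> C * (b i + b j) * line_sum (\<theta> $ i) * line_sum (\<theta> $ j)"
  unfolding cross_term_def
proof (rule infsum_le_finite_sums[OF summable_cross_term])
  fix F :: "(int ^ 'd) set" assume F: "finite F"
  define w where "w h k = (1 - cos (h * real_of_int k)) / (real_of_int k)\<^sup>2" for h and k :: int
  have w0: "0 \<le> w h k" for h k by (simp add: w_def)
  have K: "0 \<le> C * (b i + b j)" using C b[of i] b[of j] by simp
  define P where "P = (\<lambda>y. y $ i) ` F"
  define Q where "Q = (\<lambda>y. y $ j) ` F"
  have fin: "finite P" "finite Q" using F by (simp_all add: P_def Q_def)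
  have inj: "inj_on (\<lambda>y. (y $ i, y $ j)) F"
  proof (rule inj_onI)
    fix y z :: "int ^ 'd" assume "(y $ i, y $ j) = (z $ i, z $ j)"
    moreover have "l = i \<or> l = j" for l using ij(1) by blast
    ultimately have "y $ l = z $ l" for l by (metis Pair_inject)
    then show "y = z" by (simp add: vec_eq_iff)
  qed
  have term_le: "s y * ((1 - cos (\<theta> $ i * real_of_int (y $ i))) * (1 - cos (\<theta> $ j * real_of_int (y $ j))))
      \<le> C * (b i + b j) * (w (\<theta> $ i) (y $ i) * w (\<theta> $ j) (y $ j))" for y
  proof (cases "y $ i = 0 \<or> y $ j = 0")
    case True
    then show ?thesis by (auto simp: w_def)
  next
    case False
    let ?p = "(real_of_int (y $ i))\<^sup>2" and ?q = "(real_of_int (y $ j))\<^sup>2"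
    have pq: "0 < ?p" "0 < ?q" using False by auto
    have "?p * ?q \<le> (?p + ?q)\<^sup>2" using pq by (simp add: power2_sum)
    then have "C * (b i + b j) / (?p + ?q)\<^sup>2 \<le> C * (b i + b j) / (?p * ?q)"
      using K pq by (intro divide_left_mono) auto
    moreover have "s y = C * (b i + b j) / (?p + ?q)\<^sup>2" using s_dim2[OF ij a, of y] False by simp
    ultimately have "s y * ((1 - cos (\<theta> $ i * real_of_int (y $ i))) * (1 - cos (\<theta> $ j * real_of_int (y $ j))))
      \<le> C * (b i + b j) / (?p * ?q) * ((1 - cos (\<theta> $ i * real_of_int (y $ i))) * (1 - cos (\<theta> $ j * real_of_int (y $ j))))"
      by (intro mult_right_mono) auto
    then show ?thesis by (simp add: w_def)
  qed
  have "(\<Sum>y\<in>F. s y * ((1 - cos (\<theta> $ i * real_of_int (y $ i))) * (1 - cos (\<theta> $ j * real_of_int (y $ j)))))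
      \<le> (\<Sum>y\<in>F. C * (b i + b j) * (w (\<theta> $ i) (y $ i) * w (\<theta> $ j) (y $ j)))"
    by (rule sum_mono) (rule term_le)
  also have "\<dots> = C * (b i + b j) * (\<Sum>p\<in>(\<lambda>y. (y $ i, y $ j)) ` F. w (\<theta> $ i) (fst p) * w (\<theta> $ j) (snd p))"
    by (simp add: sum.reindex[OF inj] sum_distrib_left)
  also have "\<dots> \<le> C * (b i + b j) * (\<Sum>p\<in>P \<times> Q. w (\<theta> $ i) (fst p) * w (\<theta> $ j) (snd p))"
    by (intro mult_left_mono[OF _ K] sum_mono2 finite_cartesian_product fin) (auto simp: w0 P_def Q_def)
  also have "\<dots> = C * (b i + b j) * ((\<Sum>k\<in>P. w (\<theta> $ i) k) * (\<Sum>m\<in>Q. w (\<theta> $ j) m))"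
    by (simp add: sum_product sum.cartesian_product case_prod_unfold)
  also have "\<dots> \<le> C * (b i + b j) * (line_sum (\<theta> $ i) * line_sum (\<theta> $ j))"
  proof (intro mult_left_mono[OF _ K] mult_mono sum_nonneg w0)
    have "w h summable_on UNIV" for h unfolding w_def[abs_def] by (rule has_sum_imp_summable[OF has_sum_line])
    then have le: "(\<Sum>k\<in>A. w h k) \<le> line_sum h" if "finite A" for A h
      unfolding line_sum_def w_def[symmetric] using that by (intro finite_sum_le_infsum) (auto simp: w0)
    show "(\<Sum>k\<in>P. w (\<theta> $ i) k) \<le> line_sum (\<theta> $ i)" "(\<Sum>k\<in>Q. w (\<theta> $ j) k) \<le> line_sum (\<theta> $ j)"
      by (rule le[OF fin(1)], rule le[OF fin(2)])
    show "0 \<le> line_sum (\<theta> $ i)" unfolding line_sum_def by (intro infsum_nonneg) simp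
  qed
  finally show "(\<Sum>y\<in>F. s y * ((1 - cos (\<theta> $ i * real_of_int (y $ i))) * (1 - cos (\<theta> $ j * real_of_int (y $ j)))))
      \<le> C * (b i + b j) * line_sum (\<theta> $ i) * line_sum (\<theta> $ j)" by (simp add: mult.assoc)
qed

lemma psi_limit_log_dim2:
  assumes ij: "UNIV = {i, j :: 'd}" "i \<noteq> j" and a: "\<alpha> = 2"
  shows "\<exists>q. \<forall>\<phi>. ((\<lambda>t. t * psi ((t * ln t) powr (- 1 / 2) *\<^sub>R \<phi>)) \<longlongrightarrow> q \<phi>) at_top"
proof -
  obtain ci where ci: "(\<lambda>n. real n ^ 3 * marg i n) \<longlonglongrightarrow> ci" using marg_limit_dim2[OF ij a] by blast
  have ji: "UNIV = {j, i :: 'd}" "j \<noteq> i" using ij by auto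
  obtain cj where cj: "(\<lambda>n. real n ^ 3 * marg j n) \<longlonglongrightarrow> cj" using marg_limit_dim2[OF ji a] by blast
  define A where "A t = (t * ln t) powr (- 1 / 2)" for t :: real
  have "((\<lambda>t. t * psi (A t *\<^sub>R \<phi>)) \<longlongrightarrow> ci / 4 * (\<phi> $ i)\<^sup>2 + cj / 4 * (\<phi> $ j)\<^sup>2 - 0) at_top" for \<phi>
  proof -
    obtain Li where Li: "((\<lambda>h. line_sum (h * \<phi> $ i) / h) \<longlongrightarrow> Li) (at_right 0)" using line_sum_limit by blast
    obtain Lj where Lj: "((\<lambda>h. line_sum (h * \<phi> $ j) / h) \<longlongrightarrow> Lj) (at_right 0)" using line_sum_limit by blast
    have A0: "filterlim A (at_right 0) at_top" unfolding A_def by real_asymp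
    have ta: "((\<lambda>t. C * (b i + b j) / ln t) \<longlongrightarrow> 0) at_top" by real_asymp
    have bound: "((\<lambda>t. C * (b i + b j) / ln t * ((line_sum (A t * \<phi> $ i) / A t) * (line_sum (A t * \<phi> $ j) / A t))) \<longlongrightarrow> 0 * (Li * Lj)) at_top"
      by (intro tendsto_mult ta filterlim_compose[OF Li A0] filterlim_compose[OF Lj A0])
    have "((\<lambda>t. t * cross_term i j (A t *\<^sub>R \<phi>)) \<longlongrightarrow> 0) at_top"
    proof (rule Lim_null_comparison)
      show "\<forall>\<^sub>F t in at_top. norm (t * cross_term i j (A t *\<^sub>R \<phi>)) \<le> C * (b i + b j) / ln t * ((line_sum (A t * \<phi> $ i) / A t) * (line_sum (A t * \<phi> $ j) / A t))"
        using eventually_gt_at_top[of 1]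
      proof eventually_elim
        case (elim t)
        have l: "0 < ln t" "0 < t * ln t" "t \<noteq> 0" using elim by auto
        have Apos: "A t > 0" using l by (simp add: A_def)
        have tA: "t * (A t * A t) = 1 / ln t"
          using l elim by (simp add: A_def powr_add[symmetric] powr_minus_divide powr_one)
        have nn: "0 \<le> cross_term i j \<theta>" for \<theta>
          unfolding cross_term_def by (intro infsum_nonneg mult_nonneg_nonneg nonneg) auto
        have "norm (t * cross_term i j (A t *\<^sub>R \<phi>)) = t * cross_term i j (A t *\<^sub>R \<phi>)" using nn elim by simp
        also have "\<dots> \<le> t * (C * (b i + b j) * line_sum (A t * \<phi> $ i) * line_sum (A t * \<phi> $ j))"
          using cross_term_le[OF ij a, of "A t *\<^sub>R \<phi>"] elim by (intro mult_left_mono) auto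
        also have "\<dots> = C * (b i + b j) * (t * (A t * A t)) * ((line_sum (A t * \<phi> $ i) / A t) * (line_sum (A t * \<phi> $ j) / A t))"
          using Apos by simp
        finally show ?case unfolding tA by simp
      qed
    qed (use bound in simp)
    from tendsto_diff[OF tendsto_add[OF axis_sum_log_limit[OF ci, of "\<phi> $ i"] axis_sum_log_limit[OF cj, of "\<phi> $ j"]] this]
    show ?thesis unfolding psi_dim2[OF ij] A_def[symmetric] by (simp add: algebra_simps)
  qed
  then show ?thesis unfolding A_def
    by (intro exI[of _ "\<lambda>\<phi>. ci / 4 * (\<phi> $ i)\<^sup>2 + cj / 4 * (\<phi> $ j)\<^sup>2 - 0"] allI)
qed

end

section \<open>Heat kernel of the long-range kernel\<close>

context lr_kernel
begin

lemma dominated_square: "\<exists>K. \<forall>t>0. dominated K t (t powr (- 1 / 2))"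
proof -
  obtain c where c: "c > 0" "\<forall>\<theta>\<in>tbox. \<forall>i. c * (\<theta> $ i)\<^sup>2 \<le> psi \<theta>" using psi_ge_square by auto
  show ?thesis
  proof (rule dominated_powr[OF c(1)])
    show "c * \<bar>\<theta> $ i\<bar> powr 2 \<le> psi \<theta>" if "\<theta> \<in> tbox" for \<theta> i
    proof -
      have "\<bar>\<theta> $ i\<bar> powr 2 = (\<theta> $ i)\<^sup>2" by (cases "\<theta> $ i = 0") (simp_all add: powr_numeral)
      then show ?thesis using c(2) that by simp
    qed
  qed simp
qed

lemma dominated_stable: "\<exists>K. \<forall>t>0. dominated K t (t powr (- 1 / \<alpha>))"
proof -
  obtain c where c: "c > 0" "\<forall>\<theta>\<in>tbox. \<forall>i. c * \<bar>\<theta> $ i\<bar> powr \<alpha> \<le> psi \<theta>" using psi_ge_powr by auto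
  show ?thesis by (rule dominated_powr[OF c(1) \<alpha>]) (use c(2) in blast)
qed

lemma hk_powr_upper:
  assumes dom: "\<exists>K. \<forall>t>0. dominated K t (t powr (- 1 / \<beta>))"
  shows "\<exists>K. \<forall>t>0. hk t 0 \<le> K * t powr (- (real CARD('d) / \<beta>))"
proof -
  obtain K where K: "\<And>t. t > 0 \<Longrightarrow> dominated K t (t powr (- 1 / \<beta>))" using dom by auto
  define L where "L = (\<integral>\<phi>. (\<Prod>i\<in>UNIV. K / (1 + (\<phi> $ i)\<^sup>2)) \<partial>(lborel :: (real ^ 'd) measure)) / (2 * pi) ^ CARD('d)"
  have "hk t 0 \<le> L * t powr (- (real CARD('d) / \<beta>))" if t: "t > 0" for t
  proof -
    have "(t powr (- 1 / \<beta>)) ^ CARD('d) = t powr (- (real CARD('d) / \<beta>))"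
      using t by (simp add: powr_realpow[symmetric] powr_powr)
    then show ?thesis using hk_upper[OF _ K[OF t]] t by (simp add: L_def mult.commute)
  qed
  then show ?thesis by blast
qed

lemma hk_limit_square:
  assumes "2 < \<alpha>"
  shows "\<exists>\<kappa>>0. \<forall>x. ((\<lambda>t. hk t x / (t powr (- 1 / 2)) ^ CARD('d)) \<longlongrightarrow> \<kappa>) at_top"
proof -
  obtain K where K: "\<forall>t>0. dominated K t (t powr (- 1 / 2))" using dominated_square by auto
  show ?thesis
  proof (rule hk_limit)
    show "((\<lambda>t::real. t powr (- 1 / 2)) \<longlongrightarrow> 0) at_top" by real_asymp
    show "\<forall>\<^sub>F t in at_top. 0 < t powr (- 1 / 2) \<and> dominated K t (t powr (- 1 / 2))"
      using eventually_gt_at_top[of 0] by eventually_elim (use K in auto)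
  qed (rule psi_limit_square[OF assms])
qed

lemma hk_limit_stable:
  assumes "UNIV = {i :: 'd}" "1 \<le> \<alpha>" "\<alpha> < 2"
  shows "\<exists>\<kappa>>0. \<forall>x. ((\<lambda>t. hk t x / (t powr (- 1 / \<alpha>)) ^ CARD('d)) \<longlongrightarrow> \<kappa>) at_top"
proof -
  obtain K where K: "\<forall>t>0. dominated K t (t powr (- 1 / \<alpha>))" using dominated_stable by auto
  obtain q where q: "\<And>\<phi>. ((\<lambda>t. t * psi (t powr (- 1 / \<alpha>) *\<^sub>R \<phi>)) \<longlongrightarrow> q \<phi>) at_top"
    using psi_limit_stable[OF assms] by auto
  show ?thesis
  proof (rule hk_limit)
    show "((\<lambda>t::real. t powr (- 1 / \<alpha>)) \<longlongrightarrow> 0) at_top" using \<alpha> by real_asymp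
    show "\<forall>\<^sub>F t in at_top. 0 < t powr (- 1 / \<alpha>) \<and> dominated K t (t powr (- 1 / \<alpha>))"
      using eventually_gt_at_top[of 0] by eventually_elim (use K in auto)
  qed (rule q)
qed

lemma hk_limit_log:
  assumes "CARD('d) \<le> 2" "\<alpha> = 2"
  shows "\<exists>\<kappa>>0. \<forall>x. ((\<lambda>t. hk t x / ((t * ln t) powr (- 1 / 2)) ^ CARD('d)) \<longlongrightarrow> \<kappa>) at_top"
proof -
  obtain c\<^sub>2 where c2: "c\<^sub>2 > 0" "\<forall>\<theta>\<in>tbox. \<forall>i. c\<^sub>2 * (\<theta> $ i)\<^sup>2 \<le> psi \<theta>" using psi_ge_square by auto
  obtain c\<^sub>3 where c3: "c\<^sub>3 > 0" "\<forall>\<theta>\<in>tbox. \<forall>i. \<theta> $ i \<noteq> 0 \<longrightarrow> c\<^sub>3 * ((\<theta> $ i)\<^sup>2 * ln (1 / \<bar>\<theta> $ i\<bar>)) \<le> psi \<theta>"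
    using psi_ge_log[OF assms(2)] by auto
  \<comment> \<open>\<open>dominated_log\<close> takes a single constant. Lowering the logarithmic
    one is harmless where the logarithm is nonnegative, and elsewhere the bound follows from
    \<open>psi_nonneg\<close>.\<close>
  define c where "c = min c\<^sub>2 c\<^sub>3"
  have c: "0 < c" "c \<le> c\<^sub>2" "c \<le> c\<^sub>3" using c2 c3 by (simp_all add: c_def)
  obtain K where K: "\<forall>\<^sub>F t in at_top. dominated K t ((t * ln t) powr (- 1 / 2))"
  proof -
    have "\<exists>K. \<forall>\<^sub>F t in at_top. dominated K t ((t * ln t) powr (- 1 / 2))"
    proof (rule dominated_log[OF c(1)])
      fix \<theta> :: "real ^ 'd" and i assume \<theta>: "\<theta> \<in> tbox"
      have "c * (\<theta> $ i)\<^sup>2 \<le> c\<^sub>2 * (\<theta> $ i)\<^sup>2" using c by (intro mult_right_mono) auto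
      then show "c * (\<theta> $ i)\<^sup>2 \<le> psi \<theta>" using c2(2) \<theta> by (meson order_trans)
      assume nz: "\<theta> $ i \<noteq> 0"
      show "c * ((\<theta> $ i)\<^sup>2 * ln (1 / \<bar>\<theta> $ i\<bar>)) \<le> psi \<theta>"
      proof (cases "ln (1 / \<bar>\<theta> $ i\<bar>) \<ge> 0")
        case True
        then have "c * ((\<theta> $ i)\<^sup>2 * ln (1 / \<bar>\<theta> $ i\<bar>)) \<le> c\<^sub>3 * ((\<theta> $ i)\<^sup>2 * ln (1 / \<bar>\<theta> $ i\<bar>))"
          using c by (intro mult_right_mono) auto
        then show ?thesis using c3(2) \<theta> nz by (meson order_trans)
      next
        case False
        then have "c * ((\<theta> $ i)\<^sup>2 * ln (1 / \<bar>\<theta> $ i\<bar>)) \<le> 0"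
          using c by (intro mult_nonneg_nonpos) auto
        then show ?thesis using psi_nonneg[of \<theta>] by linarith
      qed
    qed
    then show ?thesis using that by blast
  qed
  obtain q where q: "\<And>\<phi>. ((\<lambda>t. t * psi ((t * ln t) powr (- 1 / 2) *\<^sub>R \<phi>)) \<longlongrightarrow> q \<phi>) at_top"
  proof -
    have "CARD('d) = 1 \<or> CARD('d) = 2" using assms(1) zero_less_card_finite[where 'a = 'd] by linarith
    then have "\<exists>q. \<forall>\<phi>. ((\<lambda>t. t * psi ((t * ln t) powr (- 1 / 2) *\<^sub>R \<phi>)) \<longlongrightarrow> q \<phi>) at_top"
      using psi_limit_log_dim1[OF _ assms(2)] psi_limit_log_dim2[OF _ _ assms(2)]
      by (auto simp: card_1_singleton_iff card_2_iff)
    then show ?thesis using that by blast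
  qed
  show ?thesis
  proof (rule hk_limit)
    show "((\<lambda>t::real. (t * ln t) powr (- 1 / 2)) \<longlongrightarrow> 0) at_top" by real_asymp
    show "\<forall>\<^sub>F t in at_top. 0 < (t * ln t) powr (- 1 / 2) \<and> dominated K t ((t * ln t) powr (- 1 / 2))"
      using eventually_gt_at_top[of 1] K by eventually_elim auto
  qed (rule q)
qed

end

lemma lr_kernel_sym_kernel:
  fixes bp bm :: "'d::finite \<Rightarrow> real"
  assumes bp: "\<And>i. bp i > 0" and bm: "\<And>i. bm i > 0" and \<alpha>: "\<alpha> > 0"
  shows "lr_kernel (\<lambda>i. (bp i + bm i) / 2) \<alpha> (kernel_const bp bm \<alpha>) (sym_kernel bp bm \<alpha>)"
proof -
  let ?b = "\<lambda>i. (bp i + bm i) / 2"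
  let ?e = "real CARD('d) + \<alpha>"
  let ?r = "raw_kernel bp bm \<alpha>"
  let ?B = "\<Sum>i\<in>UNIV. ?b i"
  have b: "?b i > 0" for i using bp[of i] bm[of i] by simp
  have r: "?r y = (if y = 0 then 0 else norm (emb y) powr - ?e * (\<Sum>i\<in>UNIV. ?b i * of_bool (y $ i \<noteq> 0)))" for y
    unfolding raw_kernel_def eucl_norm_emb powr_minus_divide ..
  have B: "0 \<le> (\<Sum>i\<in>UNIV. ?b i * of_bool (y $ i \<noteq> 0))" "(\<Sum>i\<in>UNIV. ?b i * of_bool (y $ i \<noteq> 0)) \<le> ?B" for y :: "int ^ 'd"
    using b by (auto intro!: sum_nonneg sum_mono simp: less_imp_le of_bool_def)
  have r0: "?r y \<ge> 0" for y unfolding r using B(1)[of y] by (auto intro: mult_nonneg_nonneg)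
  have "?r summable_on (UNIV - {0})"
  proof (rule summable_on_comparison_test)
    show "(\<lambda>y::int ^ 'd. norm (emb y) powr - ?e * ?B) summable_on (UNIV - {0})"
      by (intro summable_on_cmult_left summable_on_norm_powr \<alpha>)
    show "?r y \<le> norm (emb y) powr - ?e * ?B" if "y \<in> UNIV - {0}" for y
      using that B(2)[of y] unfolding r by (simp del: sum_mult_of_bool_eq add: mult_left_mono)
  qed (rule r0)
  then have sm: "?r summable_on UNIV"
    using summable_on_insert_iff[of ?r 0 "UNIV - {0}"] by (simp add: insert_UNIV)
  define T where "T = (\<Sum>\<^sub>\<infinity>y\<in>UNIV. ?r y)"
  have hs: "(?r has_sum T) UNIV" unfolding T_def by (rule has_sum_infsum[OF sm])
  have T: "T > 0"
  proof -
    define y :: "int ^ 'd" where "y = (\<chi> i. 1)"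
    have yi: "y $ i = 1" for i by (simp add: y_def)
    have y0: "y \<noteq> 0" using yi by (metis zero_index zero_neq_one)
    have "?B > 0" using b by (intro sum_pos) auto
    moreover have "norm (emb y) > 0" using norm_emb_ge_1[OF y0] by linarith
    ultimately have "?r y > 0" using y0 by (simp add: r yi)
    also have "?r y \<le> T" unfolding T_def using finite_sum_le_infsum[OF sm, of "{y}"] r0 by simp
    finally show ?thesis .
  qed
  have C: "kernel_const bp bm \<alpha> = 1 / T" by (simp add: kernel_const_def T_def)
  show ?thesis
  proof
    show "(sym_kernel bp bm \<alpha> has_sum 1) UNIV"
      using has_sum_cmult_right[OF hs, of "1 / T"] T by (simp add: sym_kernel_def[abs_def] C)
  qed (use b \<alpha> T in \<open>auto simp: C sym_kernel_def r\<close>)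
qed

section \<open>Occupation time variance of the stationary process\<close>

lemma real_antiderivative:
  fixes c :: "real \<Rightarrow> real"
  assumes "\<And>x. isCont c x"
  shows "\<exists>G. \<forall>x. (G has_real_derivative c x) (at x)"
  using einterval_antiderivative[of "-\<infinity>" "\<infinity>" c] assms
  by (auto simp: has_real_derivative_iff_has_vector_derivative)

text \<open>Indicators of cylinder sets are local functions, and cylinders determine a measure on
  the product.\<close>

lemma measure_eqI_local:
  fixes \<mu> \<nu> :: "'d::finite config measure"
  assumes \<mu>: "prob_space \<mu>" "sets \<mu> = sets config_space" and \<nu>: "prob_space \<nu>" "sets \<nu> = sets config_space"
    and eq: "\<And>h. local_fun (apply_bcontfun h) \<Longrightarrow> (\<integral>\<eta>. apply_bcontfun h \<eta> \<partial>\<mu>) = (\<integral>\<eta>. apply_bcontfun h \<eta> \<partial>\<nu>)"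
  shows "\<mu> = \<nu>"
proof (rule measure_eqI_PiM_infinite[OF \<mu>(2) \<nu>(2)])
  interpret \<mu>: prob_space \<mu> by fact
  interpret \<nu>: prob_space \<nu> by fact
  show "finite_measure \<mu>" by unfold_locales
  fix A :: "int ^ 'd \<Rightarrow> bool set" and J :: "(int ^ 'd) set"
  assume J: "finite J" "J \<subseteq> UNIV" and A: "\<And>i. i \<in> J \<Longrightarrow> A i \<in> sets (count_space UNIV)"
  define X where "X = prod_emb UNIV (\<lambda>_::int ^ 'd. count_space (UNIV :: bool set)) J (Pi\<^sub>E J A)"
  have X: "X \<in> sets config_space" unfolding X_def using J A by (intro sets_PiM_I) auto
  have mem: "\<eta> \<in> X \<longleftrightarrow> (\<forall>x\<in>J. \<eta> x \<in> A x)" for \<eta>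
    by (auto simp: X_def prod_emb_def PiE_def Pi_def)
  have loc: "local_fun (indicator X :: 'd config \<Rightarrow> real)"
    by (rule local_funI[OF J(1)]) (simp add: indicator_def mem)
  then have ap: "apply_bcontfun (Bcontfun (indicator X :: 'd config \<Rightarrow> real)) = indicator X"
    by (intro Bcontfun_inverse local_fun_bcontfun)
  have "measure \<mu> X = measure \<nu> X"
    using eq[of "Bcontfun (indicator X)"] loc X \<mu>(2) \<nu>(2)
    by (simp add: ap \<mu>.emeasure_eq_measure)
  then show "emeasure \<mu> X = emeasure \<nu> X"
    by (simp add: \<mu>.emeasure_eq_measure \<nu>.emeasure_eq_measure)
qed

section \<open>The stationary process: Markov property, law and measurability in time\<close>

locale stationary_exclusion = symmetric_kernel s + prob_space M
  for s :: "int ^ 'd::finite \<Rightarrow> real" and M :: "'w measure" +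
  fixes \<rho> :: real and \<eta> :: "real \<Rightarrow> 'w \<Rightarrow> 'd config"
    and S :: "real \<Rightarrow> ('d config \<Rightarrow>\<^sub>C real) \<Rightarrow> ('d config \<Rightarrow>\<^sub>C real)"
  assumes measurable_eta: "\<And>t. t \<ge> 0 \<Longrightarrow> \<eta> t \<in> measurable M config_space"
    and cadlag_eta: "\<And>\<omega>. \<omega> \<in> space M \<Longrightarrow> cadlag (\<lambda>t. \<eta> t \<omega>)"
    and initial: "distr M config_space (\<eta> 0) = bernoulli_product \<rho>"
    and semigroup: "exclusion_semigroup s S"
    and markov: "\<And>t u g. t \<ge> 0 \<Longrightarrow> u \<ge> 0 \<Longrightarrow> AE \<omega> in M.
      real_cond_exp M (history M \<eta> t) (\<lambda>\<omega>'. apply_bcontfun g (\<eta> (t + u) \<omega>')) \<omega> = apply_bcontfun (S u g) (\<eta> t \<omega>)"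
begin

lemma measurable_bcontfun_eta: "t \<ge> 0 \<Longrightarrow> (\<lambda>\<omega>. apply_bcontfun (g :: 'd config \<Rightarrow>\<^sub>C real) (\<eta> t \<omega>)) \<in> borel_measurable M"
  using measurable_compose[OF measurable_eta borel_measurable_bcontfun[of config_space g]] by simp

lemma markov_property:
  assumes t: "t \<ge> 0" and u: "u \<ge> 0"
  shows "(\<integral>\<omega>. apply_bcontfun g (\<eta> t \<omega>) * apply_bcontfun h (\<eta> (t + u) \<omega>) \<partial>M)
    = (\<integral>\<omega>. apply_bcontfun g (\<eta> t \<omega>) * apply_bcontfun (S u h) (\<eta> t \<omega>) \<partial>M)"
proof -
  let ?F = "history M \<eta> t"
  let ?P = "\<lambda>\<omega>. \<lambda>u\<in>{0..t}. \<eta> u \<omega>"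
  have P: "?P \<in> measurable M (PiM {0..t} (\<lambda>_. config_space))"
    by (intro measurable_restrict measurable_eta) simp
  have sub: "subalgebra M ?F"
    unfolding subalgebra_def history_def using sets_image_in_sets[OF refl P] by simp
  interpret finite_measure_subalgebra M ?F by unfold_locales (rule sub)
  have "?P \<in> measurable ?F (PiM {0..t} (\<lambda>_. config_space))"
    unfolding history_def by (rule measurable_vimage_algebra1) (use measurable_space[OF P] in blast)
  from measurable_compose[OF this measurable_component_singleton[of t]]
  have "(\<lambda>\<omega>. \<eta> t \<omega>) \<in> measurable ?F config_space" using t by simp
  from measurable_compose[OF this borel_measurable_bcontfun[of config_space g]]
  have g: "(\<lambda>\<omega>. apply_bcontfun g (\<eta> t \<omega>)) \<in> borel_measurable ?F" by simp
  have h: "(\<lambda>\<omega>. apply_bcontfun h (\<eta> (t + u) \<omega>)) \<in> borel_measurable M"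
    using t u by (intro measurable_bcontfun_eta) simp
  have int: "integrable M (\<lambda>\<omega>. apply_bcontfun g (\<eta> t \<omega>) * apply_bcontfun h (\<eta> (t + u) \<omega>))"
  proof (rule integrable_const_bound[where B = "norm g * norm h"])
    show "AE \<omega> in M. norm (apply_bcontfun g (\<eta> t \<omega>) * apply_bcontfun h (\<eta> (t + u) \<omega>)) \<le> norm g * norm h"
      by (auto simp: abs_mult intro!: mult_mono abs_apply_bcontfun_le)
    show "(\<lambda>\<omega>. apply_bcontfun g (\<eta> t \<omega>) * apply_bcontfun h (\<eta> (t + u) \<omega>)) \<in> borel_measurable M"
      using measurable_bcontfun_eta[OF t, of g] h by simp
  qed
  show ?thesis
    unfolding real_cond_exp_intg(2)[OF int g h, symmetric]
    using markov[OF t u, of h] by (intro integral_cong_AE borel_measurable_times measurable_bcontfun_eta t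
      measurable_from_subalg[OF sub borel_measurable_cond_exp]) auto
qed

text \<open>Stationarity follows from reversibility tested against the constant function 1, which
  the semigroup fixes.\<close>

lemma law_eta:
  assumes u: "u \<ge> 0"
  shows "distr M config_space (\<eta> u) = bernoulli_product \<rho>"
proof (rule measure_eqI_local)
  let ?ip = "ip (bernoulli_product \<rho>)"
  let ?one = "const_bcontfun 1 :: 'd config \<Rightarrow>\<^sub>C real"
  have one: "apply_bcontfun ?one = (\<lambda>_. 1)" by (simp add: const_bcontfun.rep_eq)
  show "prob_space (distr M config_space (\<eta> u))" using measurable_eta[OF u] by (rule prob_space_distr)
  fix h :: "'d config \<Rightarrow>\<^sub>C real" assume h: "local_fun (apply_bcontfun h)"
  have "local_fun (apply_bcontfun ?one)" unfolding one by (rule local_funI[of "{}"]) auto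
  then have g1: "(?one, genC ?one) \<in> generator_graph S" by (rule genC_graph[OF semigroup])
  have gh: "(h, genC h) \<in> generator_graph S" by (rule genC_graph[OF semigroup h])
  have S1: "S u ?one = ?one" using semigroup u by (simp add: exclusion_semigroup_def markov_semigroup_def)
  have "(\<integral>x. apply_bcontfun h x \<partial>distr M config_space (\<eta> u)) = (\<integral>\<omega>. apply_bcontfun ?one (\<eta> 0 \<omega>) * apply_bcontfun h (\<eta> (0 + u) \<omega>) \<partial>M)"
    using borel_measurable_bcontfun[OF refl, of h] by (simp add: integral_distr[OF measurable_eta[OF u]] one)
  also have "\<dots> = (\<integral>\<omega>. apply_bcontfun (S u h) (\<eta> 0 \<omega>) \<partial>M)"
    by (subst markov_property[OF order_refl u]) (simp add: one)
  also have "\<dots> = (\<integral>x. apply_bcontfun (S u h) x \<partial>bernoulli_product \<rho>)"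
    unfolding initial[symmetric] using borel_measurable_bcontfun[OF refl, of "S u h"]
    by (simp add: integral_distr[OF measurable_eta])
  also have "\<dots> = ?ip ?one (S u h)" by (simp add: ip_def one)
  also have "\<dots> = ?ip ?one h" using ip_semigroup[OF semigroup u g1 gh] S1 by simp
  also have "\<dots> = (\<integral>x. apply_bcontfun h x \<partial>bernoulli_product \<rho>)" by (simp add: ip_def one)
  finally show "(\<integral>x. apply_bcontfun h x \<partial>distr M config_space (\<eta> u)) = (\<integral>x. apply_bcontfun h x \<partial>bernoulli_product \<rho>)" .
qed (simp_all add: prob_space_bernoulli_product sets_bernoulli_product)

lemma correlation_ordered:
  assumes "0 \<le> a" "a \<le> b"
  shows "(\<integral>\<omega>. apply_bcontfun g (\<eta> a \<omega>) * apply_bcontfun h (\<eta> b \<omega>) \<partial>M) = ip (bernoulli_product \<rho>) g (S (b - a) h)"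
proof -
  have "(\<integral>\<omega>. apply_bcontfun g (\<eta> a \<omega>) * apply_bcontfun h (\<eta> b \<omega>) \<partial>M)
      = (\<integral>\<omega>. apply_bcontfun g (\<eta> a \<omega>) * apply_bcontfun (S (b - a) h) (\<eta> a \<omega>) \<partial>M)"
    using markov_property[OF assms(1), of "b - a" g h] assms by simp
  also have "\<dots> = ip (bernoulli_product \<rho>) g (S (b - a) h)"
    unfolding ip_def law_eta[OF assms(1), symmetric]
    by (subst integral_distr[OF measurable_eta[OF assms(1)]])
       (auto intro!: borel_measurable_times borel_measurable_bcontfun)
  finally show ?thesis .
qed

lemma correlation:
  assumes "0 \<le> a" "0 \<le> b"
  shows "(\<integral>\<omega>. apply_bcontfun g (\<eta> a \<omega>) * apply_bcontfun g (\<eta> b \<omega>) \<partial>M) = ip (bernoulli_product \<rho>) g (S \<bar>a - b\<bar> g)"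
  using correlation_ordered[of a b g g] correlation_ordered[of b a g g] assms
  by (cases "a \<le> b") (simp_all add: mult.commute)

text \<open>Paths are right-continuous, so the process is the limit of processes that read the path
  at a grid time strictly to the right, and each of these uses countably many times. Truncating time
  at 0 stays where \<open>\<eta>\<close> is constrained.\<close>

lemma jointly_measurable:
  fixes g :: "'d config \<Rightarrow>\<^sub>C real"
  shows
  "(\<lambda>(u, \<omega>). apply_bcontfun g (\<eta> (max 0 u) \<omega>)) \<in> borel_measurable (lborel \<Otimes>\<^sub>M M)"
  unfolding case_prod_unfold
proof -
  define r where "r n k = max 0 ((real_of_int k + 1) / real (Suc n))" for n and k :: int
  define v where "v n u = r n \<lfloor>max 0 u * real (Suc n)\<rfloor>" for n and u :: real
  have 1: "(\<lambda>p. apply_bcontfun g (\<eta> (v n (fst p)) (snd p))) \<in> borel_measurable (lborel \<Otimes>\<^sub>M M)" for n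
    unfolding v_def
  proof (rule measurable_compose_countable)
    show "(\<lambda>p. apply_bcontfun g (\<eta> (r n k) (snd p))) \<in> borel_measurable (lborel \<Otimes>\<^sub>M M)" for k
      using measurable_compose[OF measurable_snd measurable_bcontfun_eta[of "r n k" g], of lborel] by (simp add: r_def)
    show "(\<lambda>p. \<lfloor>max 0 (fst p) * real (Suc n)\<rfloor>) \<in> measurable (lborel \<Otimes>\<^sub>M M) (count_space UNIV)"
      by measurable
  qed
  have 2: "(\<lambda>n. apply_bcontfun g (\<eta> (v n (fst p)) (snd p))) \<longlonglongrightarrow> apply_bcontfun g (\<eta> (max 0 (fst p)) (snd p))"
    if "p \<in> space (lborel \<Otimes>\<^sub>M M)" for p
  proof -
  from that have \<omega>: "snd p \<in> space M" by (auto simp: space_pair_measure)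
  let ?u = "max 0 (fst p)"
  have v: "?u < v n (fst p)" "v n (fst p) \<le> ?u + 1 / real (Suc n)" for n
  proof -
    let ?k = "\<lfloor>?u * real (Suc n)\<rfloor>"
    have k: "?u * real (Suc n) < real_of_int ?k + 1" "real_of_int ?k \<le> ?u * real (Suc n)" by linarith+
    have "?u < (real_of_int ?k + 1) / real (Suc n)" using k(1) by (simp only: pos_less_divide_eq of_nat_0_less_iff zero_less_Suc)
    moreover have "(real_of_int ?k + 1) / real (Suc n) \<le> ?u + 1 / real (Suc n)"
      using k(2) by (simp add: add_divide_distrib pos_divide_le_eq del: of_nat_Suc)
    ultimately show "?u < v n (fst p)" "v n (fst p) \<le> ?u + 1 / real (Suc n)" by (auto simp: v_def r_def)
  qed
  have lim: "(\<lambda>n. v n (fst p)) \<longlonglongrightarrow> ?u"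
  proof (rule tendsto_sandwich[OF _ _ tendsto_const])
    show "(\<lambda>n. ?u + 1 / real (Suc n)) \<longlonglongrightarrow> ?u"
      using tendsto_add[OF tendsto_const[of ?u] LIMSEQ_inverse_real_of_nat] by (simp add: inverse_eq_divide)
    show "\<forall>\<^sub>F n in sequentially. ?u \<le> v n (fst p)" by (intro always_eventually allI less_imp_le v(1))
    show "\<forall>\<^sub>F n in sequentially. v n (fst p) \<le> ?u + 1 / real (Suc n)" by (intro always_eventually allI v(2))
  qed
  have "filterlim (\<lambda>n. v n (fst p)) (at_right ?u) sequentially"
    unfolding filterlim_at using lim v(1) by (auto simp del: max_less_iff_conj simp: less_imp_neq[symmetric])
  moreover have "((\<lambda>t. \<eta> t (snd p)) \<longlongrightarrow> \<eta> ?u (snd p)) (at_right ?u)"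
    using cadlag_eta[OF \<omega>] unfolding cadlag_def continuous_within by simp
  ultimately have "(\<lambda>n. \<eta> (v n (fst p)) (snd p)) \<longlonglongrightarrow> \<eta> ?u (snd p)" by (rule filterlim_compose[rotated])
  then show ?thesis
    by (rule continuous_on_tendsto_compose[OF continuous_on_apply_bcontfun[of UNIV g]]) auto
  qed
  show "(\<lambda>p. apply_bcontfun g (\<eta> (max 0 (fst p)) (snd p))) \<in> borel_measurable (lborel \<Otimes>\<^sub>M M)"
    by (rule borel_measurable_LIMSEQ_real[OF 2 1])
qed

lemma occ_var_eq:
  assumes t: "t \<ge> 0"
  shows "occ_var M \<eta> (apply_bcontfun g) t =
    (\<integral>u. (\<integral>v. ip (bernoulli_product \<rho>) g (S \<bar>u - v\<bar> g) * indicator {0..t} v \<partial>lborel) * indicator {0..t} u \<partial>lborel)"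
proof -
  define N where "N = restrict_space lborel {0..t}"
  define X where "X u \<omega> = apply_bcontfun g (\<eta> (max 0 u) \<omega>)" for u \<omega>
  define C where "C u v = ip (bernoulli_product \<rho>) g (S \<bar>u - v\<bar> g)" for u v
  let ?\<Gamma> = "occ_time \<eta> (apply_bcontfun g) t"
  have N: "(\<integral>u. F u \<partial>N) = (\<integral>u. F u * indicator {0..t} u \<partial>lborel)" for F :: "real \<Rightarrow> real"
    unfolding N_def by (subst integral_restrict_space) (auto simp: mult.commute)
  have sN: "space N = {0..t}" by (simp add: N_def space_restrict_space)
  interpret N: finite_measure N
    by (rule finite_measureI) (use t in \<open>simp add: sN N_def emeasure_restrict_space\<close>)
  interpret P: pair_sigma_finite N M by unfold_locales
  interpret PF: finite_measure "N \<Otimes>\<^sub>M M" by (rule finite_measure_pair_measure) unfold_locales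
  have idm: "(\<lambda>x. x) \<in> measurable N lborel" unfolding N_def by (rule measurable_restrict_space1) simp
  have Xm [measurable]: "(\<lambda>p. X (fst p) (snd p)) \<in> borel_measurable (N \<Otimes>\<^sub>M M)"
  proof -
    have "(\<lambda>p. (fst p, snd p)) \<in> measurable (N \<Otimes>\<^sub>M M) (lborel \<Otimes>\<^sub>M M)"
      by (intro measurable_Pair measurable_snd measurable_compose[OF measurable_fst idm])
    from measurable_compose[OF this jointly_measurable[of g]] show ?thesis by (simp add: X_def)
  qed
  have Xu: "X u \<in> borel_measurable M" for u
    unfolding X_def[abs_def] by (rule measurable_bcontfun_eta) simp
  have Xb: "\<bar>X u \<omega>\<bar> \<le> norm g" for u \<omega> by (simp add: X_def abs_apply_bcontfun_le)
  have \<Gamma>: "?\<Gamma> \<omega> = (\<integral>u. X u \<omega> \<partial>N)" for \<omega>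
    unfolding occ_time_def N set_lebesgue_integral_def
    by (intro Bochner_Integration.integral_cong) (auto simp: X_def indicator_def max_def)
  have \<Gamma>m [measurable]: "?\<Gamma> \<in> borel_measurable M"
  proof -
    have "(\<lambda>\<omega>. \<integral>u. X u \<omega> \<partial>N) \<in> borel_measurable M"
    proof (rule N.borel_measurable_lebesgue_integral)
      have "(\<lambda>p. (snd p, fst p)) \<in> measurable (M \<Otimes>\<^sub>M N) (N \<Otimes>\<^sub>M M)" by measurable
      from measurable_compose[OF this Xm] show "(\<lambda>(\<omega>, u). X u \<omega>) \<in> borel_measurable (M \<Otimes>\<^sub>M N)"
        by (simp add: case_prod_unfold)
    qed
    then show ?thesis by (simp add: \<Gamma>[abs_def])
  qed
  have \<Gamma>b: "\<bar>?\<Gamma> \<omega>\<bar> \<le> norm g * t" for \<omega>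
  proof -
    have "\<bar>?\<Gamma> \<omega>\<bar> \<le> (\<integral>u. norm g \<partial>N)"
      unfolding \<Gamma> by (intro order_trans[OF integral_abs_bound] integral_mono' Xb N.integrable_const) simp
    also have "\<dots> = norm g * t" using t by (simp add: sN N_def measure_restrict_space mult.commute)
    finally show ?thesis .
  qed
  have bnd: "\<bar>a * b\<bar> \<le> norm g * B" if "\<bar>a\<bar> \<le> norm g" "\<bar>b\<bar> \<le> B" for a b B :: real
    unfolding abs_mult using that by (intro mult_mono) auto
  have "occ_var M \<eta> (apply_bcontfun g) t = (\<integral>\<omega>. (\<integral>u. X u \<omega> * ?\<Gamma> \<omega> \<partial>N) \<partial>M)"
    unfolding occ_var_def by (simp add: power2_eq_square \<Gamma>)
  also have "\<dots> = (\<integral>u. (\<integral>\<omega>. X u \<omega> * ?\<Gamma> \<omega> \<partial>M) \<partial>N)"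
  proof (rule P.Fubini_integral)
    have "(\<lambda>p. X (fst p) (snd p) * ?\<Gamma> (snd p)) \<in> borel_measurable (N \<Otimes>\<^sub>M M)" by measurable
    then show "integrable (N \<Otimes>\<^sub>M M) (\<lambda>(u, \<omega>). X u \<omega> * ?\<Gamma> \<omega>)"
      by (intro PF.integrable_const_bound[where B = "norm g * (norm g * t)"])
         (auto simp: case_prod_unfold intro!: AE_I2 bnd Xb \<Gamma>b)
  qed
  also have "\<dots> = (\<integral>u. (\<integral>v. C u v \<partial>N) \<partial>N)"
  proof (rule Bochner_Integration.integral_cong[OF refl])
    fix u assume "u \<in> space N"
    then have u: "u \<ge> 0" by (simp add: sN)
    have "(\<integral>\<omega>. X u \<omega> * ?\<Gamma> \<omega> \<partial>M) = (\<integral>\<omega>. (\<integral>v. X u \<omega> * X v \<omega> \<partial>N) \<partial>M)"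
      by (simp add: \<Gamma>)
    also have "\<dots> = (\<integral>v. (\<integral>\<omega>. X u \<omega> * X v \<omega> \<partial>M) \<partial>N)"
    proof (rule P.Fubini_integral)
      have "(\<lambda>p. X u (snd p) * X (fst p) (snd p)) \<in> borel_measurable (N \<Otimes>\<^sub>M M)"
        using measurable_compose[OF measurable_snd Xu] by measurable
      then show "integrable (N \<Otimes>\<^sub>M M) (\<lambda>(v, \<omega>). X u \<omega> * X v \<omega>)"
        by (intro PF.integrable_const_bound[where B = "norm g * norm g"])
           (auto simp: case_prod_unfold intro!: AE_I2 bnd Xb)
    qed
    also have "\<dots> = (\<integral>v. C u v \<partial>N)"
    proof (rule Bochner_Integration.integral_cong[OF refl])
      fix v assume "v \<in> space N"
      then have "v \<ge> 0" by (simp add: sN)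
      then show "(\<integral>\<omega>. X u \<omega> * X v \<omega> \<partial>M) = C u v"
        using correlation[OF u, of v g] u by (simp add: X_def C_def max_def)
    qed
    finally show "(\<integral>\<omega>. X u \<omega> * ?\<Gamma> \<omega> \<partial>M) = (\<integral>v. C u v \<partial>N)" .
  qed
  finally show ?thesis unfolding N C_def .
qed

lemma continuous_correlation: "isCont (\<lambda>t. ip (bernoulli_product \<rho>) g (S \<bar>t\<bar> g)) x"
proof -
  interpret bounded_bilinear "ip (bernoulli_product \<rho> :: 'd config measure)"
    by (rule bounded_bilinear_ip[OF prob_space_bernoulli_product sets_bernoulli_product])
  have "continuous_on UNIV (\<lambda>t. S \<bar>t\<bar> g)"
    using semigroup by (intro continuous_on_compose2[OF markov_continuous[of S g]]) (auto simp: exclusion_semigroup_def intro!: continuous_intros)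
  then have "continuous_on UNIV (\<lambda>t. ip (bernoulli_product \<rho>) g (S \<bar>t\<bar> g))"
    by (intro continuous_on) auto
  then show ?thesis by (simp add: continuous_on_eq_continuous_at)
qed

text \<open>The correlation depends on the time difference and is extended evenly, so the double
  integral over a square is the second difference \<open>W t + W (- t) - 2 * W 0\<close> of a
  twofold primitive. In this form it extends to all real times and has two-sided
  derivatives.\<close>

lemma occ_var_derivatives:
  "\<exists>V D. (\<forall>t\<ge>0. occ_var M \<eta> (apply_bcontfun g) t = V t) \<and> D 0 = 0 \<and>
     (\<forall>t. (V has_real_derivative D t) (at t)) \<and>
     (\<forall>t. (D has_real_derivative 2 * ip (bernoulli_product \<rho>) g (S \<bar>t\<bar> g)) (at t))"
proof -
  define c where "c t = ip (bernoulli_product \<rho>) g (S \<bar>t\<bar> g)" for t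
  have c: "isCont c x" for x unfolding c_def[abs_def] by (rule continuous_correlation)
  obtain G where G: "\<And>x. (G has_real_derivative c x) (at x)" using real_antiderivative[of c] c by auto
  have Gc: "isCont G x" for x using G DERIV_isCont by blast
  obtain W where W: "\<And>x. (W has_real_derivative G x) (at x)" using real_antiderivative[of G] Gc by auto
  define V where "V t = W t + W (- t) - 2 * W 0" for t
  define D where "D t = G t - G (- t)" for t
  have inner: "(\<integral>v. c (u - v) * indicator {0..t} v \<partial>lborel) = G u - G (u - t)" if t: "t \<ge> 0" for t u
  proof -
    have "(\<integral>v. c (u - v) * indicator {0..t} v \<partial>lborel) = - G (u - t) - (- G (u - 0))"
    proof (rule integral_FTC_Icc_real[OF t])
      show "((\<lambda>v. - G (u - v)) has_real_derivative c (u - v)) (at v)" for v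
        by (auto intro!: derivative_eq_intros DERIV_chain2[OF G])
      show "isCont (\<lambda>v. c (u - v)) v" for v
        by (intro isCont_o2[OF _ c] continuous_intros)
    qed
    then show ?thesis by simp
  qed
  have "occ_var M \<eta> (apply_bcontfun g) t = V t" if t: "t \<ge> 0" for t
  proof -
    have "occ_var M \<eta> (apply_bcontfun g) t = (\<integral>u. (G u - G (u - t)) * indicator {0..t} u \<partial>lborel)"
      unfolding occ_var_eq[OF t] c_def[symmetric] inner[OF t] ..
    also have "\<dots> = (W t - W (t - t)) - (W 0 - W (0 - t))"
    proof (rule integral_FTC_Icc_real[OF t])
      show "((\<lambda>u. W u - W (u - t)) has_real_derivative G u - G (u - t)) (at u)" for u
        by (auto intro!: derivative_eq_intros DERIV_chain2[OF W] W)
      show "isCont (\<lambda>u. G u - G (u - t)) u" for u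
        by (intro continuous_intros Gc isCont_o2[OF _ Gc])
    qed
    finally show ?thesis by (simp add: V_def)
  qed
  moreover have "(V has_real_derivative D t) (at t)" for t
    unfolding V_def[abs_def] D_def by (auto intro!: derivative_eq_intros DERIV_chain2[OF W] W)
  moreover have "(D has_real_derivative 2 * c t) (at t)" for t
    unfolding D_def[abs_def] by (auto intro!: derivative_eq_intros DERIV_chain2[OF G] G simp: c_def)
  ultimately show ?thesis unfolding c_def by (intro exI[of _ V] exI[of _ D]) (auto simp: D_def)
qed

end

section \<open>From correlations to variances\<close>

text \<open>\<open>D\<close> is nondecreasing because \<open>c\<close> is nonnegative, bounded
  because \<open>c\<close> is integrable, and eventually positive because \<open>c 0\<close> is; so
  it has a positive limit, which is the rate of growth of \<open>V\<close>.\<close>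

lemma order_transient:
  fixes V D c :: "real \<Rightarrow> real"
  assumes V: "\<And>t. (V has_real_derivative D t) (at t)"
    and D: "\<And>t. 0 \<le> t \<Longrightarrow> (D has_real_derivative c t) (at t)" "D 0 = 0"
    and c: "0 < c 0" "\<And>t. 0 \<le> t \<Longrightarrow> 0 \<le> c t" "\<And>t. 0 < t \<Longrightarrow> c t \<le> K * t powr - \<gamma>"
    and \<gamma>: "1 < \<gamma>"
  shows "V \<asymp> (\<lambda>t. t)"
proof -
  have mono: "D x \<le> D y" if "0 \<le> x" "x \<le> y" for x y
    using that(2)
  proof (rule DERIV_nonneg_imp_nondecreasing)
    fix z assume "x \<le> z"
    then show "\<exists>l. (D has_real_derivative l) (at z) \<and> 0 \<le> l" using D(1)[of z] c(2)[of z] that by auto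
  qed
  have K: "0 \<le> K" using c(2)[of 1] c(3)[of 1] by simp
  \<comment> \<open>The added term is the integral of the bound on \<open>c\<close> from
    \<open>t\<close> to infinity; its derivative outweighs \<open>c\<close>, so \<open>E\<close>
    decreases beyond 1 and bounds \<open>D\<close>.\<close>
  define E where "E t = D t + K / (\<gamma> - 1) * t powr (1 - \<gamma>)" for t
  have anti: "E t \<le> E 1" if "1 \<le> t" for t
    using that
  proof (rule DERIV_nonpos_imp_nonincreasing)
    fix z :: real assume z: "1 \<le> z"
    have "((\<lambda>t. K / (\<gamma> - 1) * t powr (1 - \<gamma>)) has_real_derivative K / (\<gamma> - 1) * ((1 - \<gamma>) * z powr (1 - \<gamma> - 1))) (at z)"
      using z by (intro DERIV_cmult has_real_derivative_powr) auto
    moreover have "K / (\<gamma> - 1) * ((1 - \<gamma>) * z powr (1 - \<gamma> - 1)) = - (K * z powr - \<gamma>)"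
      using \<gamma> by (simp add: field_simps)
    ultimately have "(E has_real_derivative c z + - (K * z powr - \<gamma>)) (at z)"
      unfolding E_def[abs_def] using D(1)[of z] z by (intro DERIV_add) auto
    moreover have "c z + - (K * z powr - \<gamma>) \<le> 0" using c(3)[of z] z by simp
    ultimately show "\<exists>l. (E has_real_derivative l) (at z) \<and> l \<le> 0" by blast
  qed
  have bound: "D t \<le> E 1" if "0 \<le> t" for t
  proof -
    have "D t \<le> D (max 1 t)" using that by (intro mono) auto
    also have "\<dots> \<le> E (max 1 t)" using K \<gamma> by (simp add: E_def)
    also have "\<dots> \<le> E 1" by (rule anti) simp
    finally show ?thesis .
  qed
  define L where "L = (SUP t\<in>{0..}. D t)"
  have bdd: "bdd_above (D ` {0..})" using bound by (intro bdd_aboveI[of _ "E 1"]) auto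
  have upper: "D t \<le> L" if "0 \<le> t" for t unfolding L_def using that by (intro cSUP_upper bdd) auto
  have lim: "(D \<longlongrightarrow> L) at_top"
  proof (rule increasing_tendsto)
    show "\<forall>\<^sub>F t in at_top. D t \<le> L" using eventually_ge_at_top[of 0] by eventually_elim (rule upper)
    fix x assume "x < L"
    then obtain u where u: "0 \<le> u" "x < D u" unfolding L_def by (subst (asm) less_cSUP_iff[OF _ bdd]) auto
    show "\<forall>\<^sub>F t in at_top. x < D t" using eventually_ge_at_top[of u]
      by eventually_elim (use u mono in \<open>meson less_le_trans\<close>)
  qed
  have "0 < L"
  proof -
    obtain d where "0 < d" "\<forall>h>0. h < d \<longrightarrow> D 0 < D (0 + h)" using DERIV_pos_inc_right[OF D(1)[OF order_refl] c(1)] by blast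
    then have "0 < D (d / 2)" using D(2) by simp
    also have "\<dots> \<le> L" using \<open>0 < d\<close> by (intro upper) simp
    finally show ?thesis .
  qed
  moreover have "((\<lambda>t. V t / t) \<longlongrightarrow> L) at_top"
    by (rule lhospital_at_top_at_top[where f' = D and g' = "\<lambda>_. 1"])
       (use V lim in \<open>auto intro: always_eventually filterlim_ident\<close>)
  ultimately show ?thesis unfolding same_order_def by blast
qed

text \<open>\<open>w\<close> is a common scale for the correlation and for the second derivative of
  the target; divergence of \<open>b'\<close> and \<open>b\<close> carries the limit of the quotient
  back through both integrations.\<close>

lemma order_recurrent:
  fixes V D c w b b' b'' :: "real \<Rightarrow> real"
  assumes V: "\<And>t. (V has_real_derivative D t) (at t)"
    and D: "\<And>t. 0 \<le> t \<Longrightarrow> (D has_real_derivative c t) (at t)"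
    and c: "((\<lambda>t. c t / w t) \<longlongrightarrow> \<kappa>) at_top" "0 < \<kappa>"
    and w: "\<forall>\<^sub>F t in at_top. 0 < w t"
    and b: "\<forall>\<^sub>F t in at_top. (b has_real_derivative b' t) (at t)"
    and b': "\<forall>\<^sub>F t in at_top. (b' has_real_derivative b'' t) (at t)"
    and top: "filterlim b at_top at_top" "filterlim b' at_top at_top"
    and b'': "((\<lambda>t. b'' t / w t) \<longlongrightarrow> m) at_top" "0 < m"
  shows "V \<asymp> b"
proof -
  have "\<forall>\<^sub>F t in at_top. 0 < b'' t / w t" using order_tendstoD(1)[OF b''] .
  then have nz: "\<forall>\<^sub>F t in at_top. b'' t \<noteq> 0" by eventually_elim auto
  have "((\<lambda>t. (c t / w t) / (b'' t / w t)) \<longlongrightarrow> \<kappa> / m) at_top"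
    using b''(2) by (intro tendsto_divide c b'') simp
  then have lim: "((\<lambda>t. c t / b'' t) \<longlongrightarrow> \<kappa> / m) at_top"
    by (rule Lim_transform_eventually) (use w in \<open>eventually_elim, simp\<close>)
  have "\<forall>\<^sub>F t in at_top. (D has_real_derivative c t) (at t)"
    using eventually_ge_at_top[of 0] by eventually_elim (rule D)
  from lhospital_at_top_at_top[OF top(2) nz this b' lim]
  have "((\<lambda>t. D t / b' t) \<longlongrightarrow> \<kappa> / m) at_top" .
  moreover have "\<forall>\<^sub>F t in at_top. b' t \<noteq> 0"
    using top(2) by (auto simp: filterlim_at_top_dense elim!: allE[of _ 0] eventually_mono)
  ultimately have "((\<lambda>t. V t / b t) \<longlongrightarrow> \<kappa> / m) at_top"
    using V by (intro lhospital_at_top_at_top[OF top(1) _ _ b]) auto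
  then show ?thesis unfolding same_order_def using c(2) b''(2) by (intro exI[of _ "\<kappa> / m"]) simp
qed

lemma same_order_cong:
  assumes "V \<asymp> b" "\<And>t. 0 \<le> t \<Longrightarrow> V' t = V t"
  shows "V' \<asymp> b"
proof -
  obtain L where L: "L > 0" "((\<lambda>t. V t / b t) \<longlongrightarrow> L) at_top" using assms(1) unfolding same_order_def by blast
  have "((\<lambda>t. V' t / b t) \<longlongrightarrow> L) at_top"
    by (rule Lim_transform_eventually[OF L(2)])
       (use eventually_ge_at_top[of 0] in \<open>eventually_elim, simp add: assms(2)\<close>)
  with L(1) show ?thesis unfolding same_order_def by blast
qed

section \<open>The correlation function of a local function of degree one\<close>

locale degree_one_exclusion = lr_kernel b \<alpha> C s + stationary_exclusion s M \<rho> \<eta> S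
  for b :: "'d::finite \<Rightarrow> real" and \<alpha> C :: real and s :: "int ^ 'd \<Rightarrow> real"
    and M :: "'w measure" and \<rho> \<eta> S +
  fixes f :: "'d config \<Rightarrow> real" and F :: "'d config \<Rightarrow>\<^sub>C real" and \<Lambda> :: "(int ^ 'd) set" and c
  assumes rho: "0 < \<rho>" "\<rho> < 1" and F: "apply_bcontfun F = f" "local_fun f" and \<Lambda>: "finite \<Lambda>"
    and expansion: "\<And>\<eta>. f \<eta> = (\<Sum>A\<in>Pow \<Lambda>. c A * (\<Prod>x\<in>A. of_bool (\<eta> x) - \<rho>))"
    and degree: "c {} = 0" "(\<Sum>x\<in>\<Lambda>. c {x}) \<noteq> 0"
begin

definition corr :: "real \<Rightarrow> real" where
  "corr t = ip (bernoulli_product \<rho>) F (S t F)"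

lemma corr_estimate:
  "\<exists>K\<ge>0. \<forall>t\<ge>0. \<bar>corr t - \<rho> * (1 - \<rho>) * (\<Sum>x\<in>\<Lambda>. \<Sum>y\<in>\<Lambda>. c {x} * c {y} * hk t (x - y))\<bar> \<le> K * (hk t 0)\<^sup>2"
  unfolding corr_def using rho F
  by (intro correlation_estimate semigroup \<Lambda> degree) (auto simp: expansion)

lemma corr_upper: "\<exists>K\<ge>0. \<forall>t\<ge>0. corr t \<le> K * hk t 0"
proof -
  obtain K where K: "K \<ge> 0" "\<forall>t\<ge>0. \<bar>corr t - \<rho> * (1 - \<rho>) * (\<Sum>x\<in>\<Lambda>. \<Sum>y\<in>\<Lambda>. c {x} * c {y} * hk t (x - y))\<bar> \<le> K * (hk t 0)\<^sup>2"
    using corr_estimate by auto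
  define B where "B = \<rho> * (1 - \<rho>) * (\<Sum>x\<in>\<Lambda>. \<Sum>y\<in>\<Lambda>. \<bar>c {x} * c {y}\<bar>)"
  have "corr t \<le> (B + K) * hk t 0" if t: "0 \<le> t" for t
  proof -
    have "(\<Sum>x\<in>\<Lambda>. \<Sum>y\<in>\<Lambda>. c {x} * c {y} * hk t (x - y)) \<le> (\<Sum>x\<in>\<Lambda>. \<Sum>y\<in>\<Lambda>. \<bar>c {x} * c {y}\<bar> * hk t 0)"
    proof (intro sum_mono)
      fix x y
      have "c {x} * c {y} * hk t (x - y) \<le> \<bar>c {x} * c {y}\<bar> * \<bar>hk t (x - y)\<bar>" by (metis abs_ge_self abs_mult)
      also have "\<dots> \<le> \<bar>c {x} * c {y}\<bar> * hk t 0" using p_le[OF t] by (intro mult_left_mono) auto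
      finally show "c {x} * c {y} * hk t (x - y) \<le> \<bar>c {x} * c {y}\<bar> * hk t 0" .
    qed
    then have "\<rho> * (1 - \<rho>) * (\<Sum>x\<in>\<Lambda>. \<Sum>y\<in>\<Lambda>. c {x} * c {y} * hk t (x - y)) \<le> B * hk t 0"
      using rho by (simp add: B_def sum_distrib_right mult_left_mono mult.assoc)
    moreover have "K * (hk t 0)\<^sup>2 \<le> K * hk t 0"
      using K(1) p_nonneg[OF t] p_le_1[OF t] by (intro mult_left_mono) (auto simp: power2_eq_square mult_left_le_one_le)
    moreover have "\<bar>corr t - \<rho> * (1 - \<rho>) * (\<Sum>x\<in>\<Lambda>. \<Sum>y\<in>\<Lambda>. c {x} * c {y} * hk t (x - y))\<bar> \<le> K * (hk t 0)\<^sup>2"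
      using K(2) t by blast
    ultimately show ?thesis by (simp add: distrib_right)
  qed
  moreover have "0 \<le> B + K" using K(1) rho by (simp add: B_def sum_nonneg)
  ultimately show ?thesis by blast
qed

text \<open>Divided by \<open>w\<close>, the quadratic remainder is a bounded quantity times
  \<open>w\<close>. Since the heat kernel has the same limit at all displacements, the double sum
  becomes the square of the sum of the singleton coefficients, which is nonzero by the degree
  condition.\<close>

lemma corr_limit:
  assumes w: "\<forall>\<^sub>F t in at_top. 0 < w t" "(w \<longlongrightarrow> 0) at_top"
    and hk: "\<And>x. ((\<lambda>t. hk t x / w t) \<longlongrightarrow> \<kappa>) at_top"
  shows "((\<lambda>t. corr t / w t) \<longlongrightarrow> \<rho> * (1 - \<rho>) * (\<Sum>x\<in>\<Lambda>. c {x})\<^sup>2 * \<kappa>) at_top"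
proof -
  let ?m = "\<lambda>t. \<rho> * (1 - \<rho>) * (\<Sum>x\<in>\<Lambda>. \<Sum>y\<in>\<Lambda>. c {x} * c {y} * hk t (x - y))"
  obtain K where K: "K \<ge> 0" "\<forall>t\<ge>0. \<bar>corr t - ?m t\<bar> \<le> K * (hk t 0)\<^sup>2"
    using corr_estimate by auto
  have "((\<lambda>t. (corr t - ?m t) / w t) \<longlongrightarrow> 0) at_top"
  proof (rule Lim_null_comparison)
    show "((\<lambda>t. K * (hk t 0 / w t)\<^sup>2 * w t) \<longlongrightarrow> 0) at_top"
      using tendsto_mult[OF tendsto_mult[OF tendsto_const[of K] tendsto_power[OF hk[of 0], of 2]] w(2)] by simp
    show "\<forall>\<^sub>F t in at_top. norm ((corr t - ?m t) / w t) \<le> K * (hk t 0 / w t)\<^sup>2 * w t"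
      using w(1) eventually_ge_at_top[of 0]
    proof eventually_elim
      case (elim t)
      then have "\<bar>corr t - ?m t\<bar> / w t \<le> K * (hk t 0)\<^sup>2 / w t" using K(2) by (intro divide_right_mono) auto
      then show ?case using elim by (simp add: power2_eq_square)
    qed
  qed
  moreover have "((\<lambda>t. \<rho> * (1 - \<rho>) * (\<Sum>x\<in>\<Lambda>. \<Sum>y\<in>\<Lambda>. c {x} * c {y} * (hk t (x - y) / w t)))
      \<longlongrightarrow> \<rho> * (1 - \<rho>) * (\<Sum>x\<in>\<Lambda>. \<Sum>y\<in>\<Lambda>. c {x} * c {y} * \<kappa>)) at_top"
    by (intro tendsto_intros hk)
  ultimately have "((\<lambda>t. (corr t - ?m t) / w t + \<rho> * (1 - \<rho>) * (\<Sum>x\<in>\<Lambda>. \<Sum>y\<in>\<Lambda>. c {x} * c {y} * (hk t (x - y) / w t)))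
      \<longlongrightarrow> 0 + \<rho> * (1 - \<rho>) * (\<Sum>x\<in>\<Lambda>. \<Sum>y\<in>\<Lambda>. c {x} * c {y} * \<kappa>)) at_top" by (rule tendsto_add)
  moreover have "(corr t - ?m t) / w t + \<rho> * (1 - \<rho>) * (\<Sum>x\<in>\<Lambda>. \<Sum>y\<in>\<Lambda>. c {x} * c {y} * (hk t (x - y) / w t)) = corr t / w t" for t
    by (simp add: diff_divide_distrib sum_divide_distrib[symmetric])
  moreover have "(\<Sum>x\<in>\<Lambda>. \<Sum>y\<in>\<Lambda>. c {x} * c {y} * \<kappa>) = (\<Sum>x\<in>\<Lambda>. c {x})\<^sup>2 * \<kappa>"
  proof -
    have "(\<Sum>x\<in>\<Lambda>. \<Sum>y\<in>\<Lambda>. c {x} * c {y} * \<kappa>) = (\<Sum>x\<in>\<Lambda>. \<Sum>y\<in>\<Lambda>. c {x} * c {y}) * \<kappa>"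
      by (simp only: sum_distrib_right)
    then show ?thesis by (simp only: power2_eq_square sum_product)
  qed
  ultimately show ?thesis by (simp add: mult.assoc)
qed

lemma corr_nonneg: "0 \<le> t \<Longrightarrow> 0 \<le> corr t"
  using ip_semigroup_square[OF semigroup, of "t / 2" F \<rho>] F
  by (simp add: corr_def ip_def flip: power2_eq_square)

text \<open>Parseval's identity for the orthogonal centred products; the degree condition provides a
  singleton with nonzero coefficient.\<close>

lemma corr_0: "0 < corr 0"
proof -
  let ?ip = "ip (bernoulli_product \<rho> :: 'd config measure)"
  let ?p = "prodC (\<lambda>b. of_bool b - \<rho>)"
  interpret ip: bounded_bilinear ?ip
    by (rule bounded_bilinear_ip[OF prob_space_bernoulli_product sets_bernoulli_product])
  have fin: "finite (Pow \<Lambda>)" "finite A" if "A \<in> Pow \<Lambda>" for A using \<Lambda> that finite_subset by auto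
  have Fsum: "F = (\<Sum>A\<in>Pow \<Lambda>. c A *\<^sub>R ?p A)"
  proof (rule bcontfun_eqI)
    have ap: "apply_bcontfun (\<Sum>A\<in>I. c A *\<^sub>R ?p A) x = (\<Sum>A\<in>I. c A * apply_bcontfun (?p A) x)" for I x
      by (induction I rule: infinite_finite_induct) auto
    show "apply_bcontfun F x = apply_bcontfun (\<Sum>A\<in>Pow \<Lambda>. c A *\<^sub>R ?p A) x" for x
      unfolding ap F(1) expansion by (simp add: apply_prodC)
  qed
  have "corr 0 = ?ip F F" using semigroup by (simp add: corr_def exclusion_semigroup_def markov_semigroup_def)
  also have "\<dots> = (\<Sum>A\<in>Pow \<Lambda>. \<Sum>B\<in>Pow \<Lambda>. c A * c B * ?ip (?p A) (?p B))"
    unfolding Fsum ip.sum_left ip.sum_right ip.scaleR_left ip.scaleR_right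
    by (simp add: sum_distrib_left mult.assoc, subst sum.swap) (simp add: mult.left_commute)
  also have "\<dots> = (\<Sum>A\<in>Pow \<Lambda>. \<Sum>B\<in>Pow \<Lambda>. if A = B then (c A)\<^sup>2 * (\<rho> * (1 - \<rho>)) ^ card A else 0)"
    using rho fin by (intro sum.cong refl) (simp add: ip_bernoulli_prodC power2_eq_square)
  also have "\<dots> = (\<Sum>A\<in>Pow \<Lambda>. (c A)\<^sup>2 * (\<rho> * (1 - \<rho>)) ^ card A)"
    using \<Lambda> by (intro sum.cong refl) (simp add: sum.delta)
  finally have eq: "corr 0 = (\<Sum>A\<in>Pow \<Lambda>. (c A)\<^sup>2 * (\<rho> * (1 - \<rho>)) ^ card A)" .
  obtain x where x: "x \<in> \<Lambda>" "c {x} \<noteq> 0" using degree(2) by (meson sum.neutral)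
  have "0 < (c {x})\<^sup>2 * (\<rho> * (1 - \<rho>)) ^ card {x}" using x rho by simp
  also have "\<dots> \<le> corr 0" unfolding eq
    using x rho \<Lambda> by (intro member_le_sum) auto
  finally show ?thesis .
qed

lemma occ_var_transient:
  assumes hk: "\<exists>K. \<forall>t>0. hk t 0 \<le> K * t powr - \<gamma>" and \<gamma>: "1 < \<gamma>"
  shows "occ_var M \<eta> f \<asymp> (\<lambda>t. t)"
proof -
  obtain V D where VD: "\<forall>t\<ge>0. occ_var M \<eta> f t = V t" "D 0 = 0" "\<forall>t. (V has_real_derivative D t) (at t)"
      "\<forall>t. (D has_real_derivative 2 * corr \<bar>t\<bar>) (at t)"
    using occ_var_derivatives[of F] unfolding F(1) corr_def by auto
  obtain K where K: "\<And>t. t > 0 \<Longrightarrow> hk t 0 \<le> K * t powr - \<gamma>" using hk by auto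
  obtain B where B: "B \<ge> 0" "\<And>t. t \<ge> 0 \<Longrightarrow> corr t \<le> B * hk t 0" using corr_upper by auto
  have "V \<asymp> (\<lambda>t. t)"
  proof (rule order_transient[where c = "\<lambda>t. 2 * corr t"])
    show "(D has_real_derivative 2 * corr t) (at t)" if "0 \<le> t" for t using VD(4)[rule_format, of t] that by simp
    show "2 * corr t \<le> 2 * B * K * t powr - \<gamma>" if "0 < t" for t
      using B(2)[of t] mult_left_mono[OF K[OF that] B(1)] that by simp
  qed (use VD corr_0 corr_nonneg \<gamma> in auto)
  then show ?thesis by (rule same_order_cong) (use VD(1) in blast)
qed

lemma occ_var_recurrent:
  assumes hk: "\<exists>\<kappa>>0. \<forall>x. ((\<lambda>t. hk t x / w t) \<longlongrightarrow> \<kappa>) at_top"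
    and w: "\<forall>\<^sub>F t in at_top. 0 < w t" "(w \<longlongrightarrow> 0) at_top"
    and g: "\<forall>\<^sub>F t in at_top. (g has_real_derivative g' t) (at t)"
    and g': "\<forall>\<^sub>F t in at_top. (g' has_real_derivative g'' t) (at t)"
    and top: "filterlim g at_top at_top" "filterlim g' at_top at_top"
    and g'': "((\<lambda>t. g'' t / w t) \<longlongrightarrow> m) at_top" "0 < m"
  shows "occ_var M \<eta> f \<asymp> g"
proof -
  obtain V D where VD: "\<forall>t\<ge>0. occ_var M \<eta> f t = V t" "D 0 = 0" "\<forall>t. (V has_real_derivative D t) (at t)"
      "\<forall>t. (D has_real_derivative 2 * corr \<bar>t\<bar>) (at t)"
    using occ_var_derivatives[of F] unfolding F(1) corr_def by auto
  obtain \<kappa> where \<kappa>: "\<kappa> > 0" "\<And>x. ((\<lambda>t. hk t x / w t) \<longlongrightarrow> \<kappa>) at_top" using hk by auto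
  have lim: "((\<lambda>t. 2 * (corr t / w t)) \<longlongrightarrow> 2 * (\<rho> * (1 - \<rho>) * (\<Sum>x\<in>\<Lambda>. c {x})\<^sup>2 * \<kappa>)) at_top"
    by (intro tendsto_mult tendsto_const corr_limit w \<kappa>(2))
  have "V \<asymp> g"
  proof (rule order_recurrent[where c = "\<lambda>t. 2 * corr t", OF _ _ _ _ w(1) g g' top g''])
    show "(D has_real_derivative 2 * corr t) (at t)" if "0 \<le> t" for t using VD(4)[rule_format, of t] that by simp
    show "((\<lambda>t. 2 * corr t / w t) \<longlongrightarrow> 2 * (\<rho> * (1 - \<rho>) * (\<Sum>x\<in>\<Lambda>. c {x})\<^sup>2 * \<kappa>)) at_top" using lim by simp
    show "0 < 2 * (\<rho> * (1 - \<rho>) * (\<Sum>x\<in>\<Lambda>. c {x})\<^sup>2 * \<kappa>)" using rho degree(2) \<kappa>(1) by simp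
  qed (use VD in auto)
  then show ?thesis by (rule same_order_cong) (use VD(1) in blast)
qed

lemma occ_var_powr:
  assumes \<theta>: "0 < \<theta>" "\<theta> < 1"
    and hk: "\<exists>\<kappa>>0. \<forall>x. ((\<lambda>t. hk t x / t powr - \<theta>) \<longlongrightarrow> \<kappa>) at_top"
  shows "occ_var M \<eta> f \<asymp> (\<lambda>t. t powr (2 - \<theta>))"
proof (rule occ_var_recurrent[OF hk])
  show "\<forall>\<^sub>F t in at_top. ((\<lambda>t. t powr (2 - \<theta>)) has_real_derivative (2 - \<theta>) * t powr (1 - \<theta>)) (at t)"
    using eventually_gt_at_top[of 0] by eventually_elim (auto intro!: derivative_eq_intros)
  show "\<forall>\<^sub>F t in at_top. ((\<lambda>t. (2 - \<theta>) * t powr (1 - \<theta>)) has_real_derivative (2 - \<theta>) * ((1 - \<theta>) * t powr - \<theta>)) (at t)"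
    using eventually_gt_at_top[of 0] by eventually_elim (auto intro!: derivative_eq_intros)
  show "((\<lambda>t. (2 - \<theta>) * ((1 - \<theta>) * t powr - \<theta>) / t powr - \<theta>) \<longlongrightarrow> (2 - \<theta>) * (1 - \<theta>)) at_top"
    by (rule Lim_transform_eventually[OF tendsto_const])
       (use eventually_gt_at_top[of 0] in \<open>eventually_elim, simp\<close>)
  show "((\<lambda>t::real. t powr - \<theta>) \<longlongrightarrow> 0) at_top" using \<theta> by real_asymp
  show "filterlim (\<lambda>t. t powr (2 - \<theta>)) at_top at_top" using \<theta> by real_asymp
  show "filterlim (\<lambda>t. (2 - \<theta>) * t powr (1 - \<theta>)) at_top at_top" using \<theta> by real_asymp
  show "\<forall>\<^sub>F t::real in at_top. 0 < t powr - \<theta>" using eventually_gt_at_top[of 0] by eventually_elim simp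
qed (use \<theta> in simp)

lemma occ_var_log:
  assumes hk: "\<exists>\<kappa>>0. \<forall>x. ((\<lambda>t. hk t x / (1 / t)) \<longlongrightarrow> \<kappa>) at_top"
  shows "occ_var M \<eta> f \<asymp> (\<lambda>t. t * ln t)"
proof (rule occ_var_recurrent[OF hk])
  show "\<forall>\<^sub>F t in at_top. ((\<lambda>t. t * ln t) has_real_derivative ln t + 1) (at t)"
    using eventually_gt_at_top[of 0] by eventually_elim (auto intro!: derivative_eq_intros)
  show "\<forall>\<^sub>F t in at_top. ((\<lambda>t. ln t + 1) has_real_derivative 1 / t) (at t)"
    using eventually_gt_at_top[of 0] by eventually_elim (auto intro!: derivative_eq_intros)
  show "((\<lambda>t::real. (1 / t) / (1 / t)) \<longlongrightarrow> 1) at_top" by real_asymp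
  show "((\<lambda>t::real. 1 / t) \<longlongrightarrow> 0) at_top" by real_asymp
  show "filterlim (\<lambda>t::real. t * ln t) at_top at_top" by real_asymp
  show "filterlim (\<lambda>t::real. ln t + 1) at_top at_top" by real_asymp
  show "\<forall>\<^sub>F t::real in at_top. 0 < 1 / t" by real_asymp
qed simp

text \<open>Terms in which a derivative falls on the logarithm are smaller by a factor
  \<open>1 / ln t\<close>, so the second derivative has leading coefficient 3/2 * 1/2 = 3/4.\<close>

lemma occ_var_log_sqrt:
  assumes hk: "\<exists>\<kappa>>0. \<forall>x. ((\<lambda>t. hk t x / (t * ln t) powr (- 1 / 2)) \<longlongrightarrow> \<kappa>) at_top"
  shows "occ_var M \<eta> f \<asymp> (\<lambda>t. t powr (3 / 2) * ln t powr (- 1 / 2))"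
proof (rule occ_var_recurrent[OF hk])
  show "\<forall>\<^sub>F t in at_top. ((\<lambda>t. t powr (3 / 2) * ln t powr (- 1 / 2)) has_real_derivative
      3 / 2 * (t powr (1 / 2) * ln t powr (- 1 / 2)) - 1 / 2 * (t powr (1 / 2) * ln t powr (- 3 / 2))) (at t)"
    using eventually_gt_at_top[of 1]
  proof eventually_elim
    case (elim t)
    then have t: "t powr (3 / 2) = t * t powr (1 / 2)" using powr_add[of t 1 "1 / 2"] by simp
    show ?case using elim by (auto intro!: derivative_eq_intros simp: t algebra_simps)
  qed
  show "\<forall>\<^sub>F t in at_top. ((\<lambda>t. 3 / 2 * (t powr (1 / 2) * ln t powr (- 1 / 2)) - 1 / 2 * (t powr (1 / 2) * ln t powr (- 3 / 2))) has_real_derivative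
      3 / 4 * (t powr (- 1 / 2) * ln t powr (- 1 / 2)) - t powr (- 1 / 2) * ln t powr (- 3 / 2) + 3 / 4 * (t powr (- 1 / 2) * ln t powr (- 5 / 2))) (at t)"
    using eventually_gt_at_top[of 1]
  proof eventually_elim
    case (elim t)
    then have t: "t powr (1 / 2) = t * t powr (- 1 / 2)" using powr_add[of t 1 "- 1 / 2"] by simp
    show ?case using elim by (auto intro!: derivative_eq_intros simp: t field_simps)
  qed
  show "((\<lambda>t::real. (3 / 4 * (t powr (- 1 / 2) * ln t powr (- 1 / 2)) - t powr (- 1 / 2) * ln t powr (- 3 / 2) + 3 / 4 * (t powr (- 1 / 2) * ln t powr (- 5 / 2)))
      / (t * ln t) powr (- 1 / 2)) \<longlongrightarrow> 3 / 4) at_top" by real_asymp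
  show "((\<lambda>t::real. (t * ln t) powr (- 1 / 2)) \<longlongrightarrow> 0) at_top" by real_asymp
  show "filterlim (\<lambda>t::real. t powr (3 / 2) * ln t powr (- 1 / 2)) at_top at_top" by real_asymp
  show "filterlim (\<lambda>t::real. 3 / 2 * (t powr (1 / 2) * ln t powr (- 1 / 2)) - 1 / 2 * (t powr (1 / 2) * ln t powr (- 3 / 2))) at_top at_top" by real_asymp
  show "\<forall>\<^sub>F t::real in at_top. 0 < (t * ln t) powr (- 1 / 2)" by real_asymp
qed simp

text \<open>The heat kernel order \<open>1 / (t * ln t)\<close> barely fails to be integrable; its
  primitive \<open>ln (ln t)\<close> is the growth of the first derivative of the variance.\<close>

lemma occ_var_log_log:
  assumes hk: "\<exists>\<kappa>>0. \<forall>x. ((\<lambda>t. hk t x / (1 / (t * ln t))) \<longlongrightarrow> \<kappa>) at_top"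
  shows "occ_var M \<eta> f \<asymp> (\<lambda>t. t * ln (ln t))"
proof (rule occ_var_recurrent[OF hk])
  show "\<forall>\<^sub>F t in at_top. ((\<lambda>t. t * ln (ln t)) has_real_derivative ln (ln t) + 1 / ln t) (at t)"
    using eventually_gt_at_top[of 1] by eventually_elim (auto intro!: derivative_eq_intros)
  show "\<forall>\<^sub>F t in at_top. ((\<lambda>t. ln (ln t) + 1 / ln t) has_real_derivative 1 / (t * ln t) - 1 / (t * (ln t)\<^sup>2)) (at t)"
    using eventually_gt_at_top[of 1]
  proof eventually_elim
    case (elim t)
    then show ?case
      by (auto intro!: derivative_eq_intros) (auto simp: power2_eq_square divide_simps)
  qed
  show "((\<lambda>t::real. (1 / (t * ln t) - 1 / (t * (ln t)\<^sup>2)) / (1 / (t * ln t))) \<longlongrightarrow> 1) at_top" by real_asymp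
  show "((\<lambda>t::real. 1 / (t * ln t)) \<longlongrightarrow> 0) at_top" by real_asymp
  show "filterlim (\<lambda>t::real. t * ln (ln t)) at_top at_top" by real_asymp
  show "filterlim (\<lambda>t::real. ln (ln t) + 1 / ln t) at_top at_top" by real_asymp
  show "\<forall>\<^sub>F t::real in at_top. 0 < 1 / (t * ln t)" by real_asymp
qed simp

end

lemma (in symmetric_kernel) hk_limit_cong:
  assumes lim: "\<exists>\<kappa>>0. \<forall>x. ((\<lambda>t. hk t x / w t) \<longlongrightarrow> \<kappa>) at_top" and eq: "\<forall>\<^sub>F t in at_top. w t = v t"
  shows "\<exists>\<kappa>>0. \<forall>x. ((\<lambda>t. hk t x / v t) \<longlongrightarrow> \<kappa>) at_top"
proof -
  obtain \<kappa> where \<kappa>: "\<kappa> > 0" "\<And>x. ((\<lambda>t. hk t x / w t) \<longlongrightarrow> \<kappa>) at_top" using lim by auto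
  have "((\<lambda>t. hk t x / v t) \<longlongrightarrow> \<kappa>) at_top" for x
    by (rule Lim_transform_eventually[OF \<kappa>(2)[of x]]) (use eq in \<open>eventually_elim, simp\<close>)
  with \<kappa>(1) show ?thesis by blast
qed

theorem theorem2p8:
  fixes bp bm :: "'d::finite \<Rightarrow> real"
    and \<alpha> \<rho> :: real
    and M :: "'w measure"
    and \<eta> :: "real \<Rightarrow> 'w \<Rightarrow> 'd config"
    and f :: "'d config \<Rightarrow> real"
  assumes "\<And>i. bp i > 0" and "\<And>i. bm i > 0"
    and "\<alpha> > 0"
    and "0 < \<rho>" and "\<rho> < 1"
    and "exclusion_process (sym_kernel bp bm \<alpha>) (bernoulli_product \<rho>) M \<eta>"
    and "local_fun f"
    and "degree_one \<rho> f"
  shows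
    "(CARD('d) = 1 \<longrightarrow>
        (\<alpha> < 1 \<longrightarrow> occ_var M \<eta> f \<asymp> (\<lambda>t. t)) \<and>
        (\<alpha> = 1 \<longrightarrow> occ_var M \<eta> f \<asymp> (\<lambda>t. t * ln t)) \<and>
        (1 < \<alpha> \<and> \<alpha> < 2 \<longrightarrow> occ_var M \<eta> f \<asymp> (\<lambda>t. t powr (2 - 1 / \<alpha>))) \<and>
        (\<alpha> = 2 \<longrightarrow> occ_var M \<eta> f \<asymp> (\<lambda>t. t powr (3 / 2) * ln t powr (- 1 / 2))) \<and>
        (\<alpha> > 2 \<longrightarrow> occ_var M \<eta> f \<asymp> (\<lambda>t. t powr (3 / 2)))) \<and>
     (CARD('d) = 2 \<longrightarrow>
        (\<alpha> < 2 \<longrightarrow> occ_var M \<eta> f \<asymp> (\<lambda>t. t)) \<and>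
        (\<alpha> = 2 \<longrightarrow> occ_var M \<eta> f \<asymp> (\<lambda>t. t * ln (ln t))) \<and>
        (\<alpha> > 2 \<longrightarrow> occ_var M \<eta> f \<asymp> (\<lambda>t. t * ln t))) \<and>
     (CARD('d) \<ge> 3 \<longrightarrow> occ_var M \<eta> f \<asymp> (\<lambda>t. t))"
proof -
  let ?b = "\<lambda>i. (bp i + bm i) / 2" and ?C = "kernel_const bp bm \<alpha>" and ?s = "sym_kernel bp bm \<alpha>"
  interpret lr_kernel ?b \<alpha> ?C ?s using assms(1-3) by (rule lr_kernel_sym_kernel)
  obtain \<Lambda> c where \<Lambda>: "finite \<Lambda>" and expansion: "\<And>\<eta>. f \<eta> = (\<Sum>A\<in>Pow \<Lambda>. c A * (\<Prod>x\<in>A. of_bool (\<eta> x) - \<rho>))"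
    using local_fun_expand[OF assms(7), where \<rho> = \<rho>] by metis
  note degree = degree_one_coefficients[OF assms(4,5) \<Lambda> assms(8) expansion]
  have F: "apply_bcontfun (Bcontfun f) = f" by (rule Bcontfun_inverse[OF local_fun_bcontfun[OF assms(7)]])
  obtain S where S: "exclusion_semigroup ?s S"
    "\<forall>t\<ge>0. \<forall>u\<ge>0. \<forall>g. AE \<omega> in M. real_cond_exp M (history M \<eta> t) (\<lambda>\<omega>'. apply_bcontfun g (\<eta> (t + u) \<omega>')) \<omega>
      = apply_bcontfun (S u g) (\<eta> t \<omega>)"
    using assms(6) unfolding exclusion_process_def by auto
  interpret prob_space M using assms(6) unfolding exclusion_process_def by auto
  interpret degree_one_exclusion ?b \<alpha> ?C ?s M \<rho> \<eta> S f "Bcontfun f" \<Lambda> c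
    by unfold_locales (use assms(4-7) S \<Lambda> expansion degree F in \<open>auto simp: exclusion_process_def\<close>)
  let ?d = "real CARD('d)"
  \<comment> \<open>The two transient criteria cover every linear regime:
    \<open>CARD('d) / \<alpha> > 1\<close> gives the heavy-tailed cases in dimensions one and two,
    and \<open>CARD('d) / 2 > 1\<close> gives all \<alpha> from dimension three on.\<close>
  have stable: "occ_var M \<eta> f \<asymp> (\<lambda>t. t)" if "\<alpha> < ?d"
    using hk_powr_upper[OF dominated_stable] that \<alpha> by (intro occ_var_transient) auto
  have square: "occ_var M \<eta> f \<asymp> (\<lambda>t. t)" if "2 < ?d"
    using hk_powr_upper[OF dominated_square] that by (intro occ_var_transient) auto
  have dim1: "(\<alpha> = 1 \<longrightarrow> occ_var M \<eta> f \<asymp> (\<lambda>t. t * ln t)) \<and>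
        (1 < \<alpha> \<and> \<alpha> < 2 \<longrightarrow> occ_var M \<eta> f \<asymp> (\<lambda>t. t powr (2 - 1 / \<alpha>))) \<and>
        (\<alpha> = 2 \<longrightarrow> occ_var M \<eta> f \<asymp> (\<lambda>t. t powr (3 / 2) * ln t powr (- 1 / 2))) \<and>
        (\<alpha> > 2 \<longrightarrow> occ_var M \<eta> f \<asymp> (\<lambda>t. t powr (3 / 2)))" if card: "CARD('d) = 1"
  proof (intro conjI impI)
    obtain i where i: "UNIV = {i :: 'd}" using card by (auto simp: card_1_singleton_iff)
    note stab = hk_limit_stable[OF i, unfolded card power_one_right]
    show "occ_var M \<eta> f \<asymp> (\<lambda>t. t * ln t)" if a: "\<alpha> = 1"
    proof (rule occ_var_log[OF hk_limit_cong[OF stab]])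
      show "\<forall>\<^sub>F t in at_top. t powr (- 1 / \<alpha>) = 1 / t"
        using eventually_gt_at_top[of 0] by eventually_elim (simp add: a powr_minus_divide)
    qed (use a in auto)
    show "occ_var M \<eta> f \<asymp> (\<lambda>t. t powr (2 - 1 / \<alpha>))" if a: "1 < \<alpha> \<and> \<alpha> < 2"
      using occ_var_powr[of "1 / \<alpha>"] stab a by simp
    show "occ_var M \<eta> f \<asymp> (\<lambda>t. t powr (3 / 2) * ln t powr (- 1 / 2))" if a: "\<alpha> = 2"
      using occ_var_log_sqrt hk_limit_log[OF _ a] card by simp
    show "occ_var M \<eta> f \<asymp> (\<lambda>t. t powr (3 / 2))" if a: "2 < \<alpha>"
      using occ_var_powr[of "1 / 2"] hk_limit_square[OF a] card by simp
  qed
  have dim2: "(\<alpha> = 2 \<longrightarrow> occ_var M \<eta> f \<asymp> (\<lambda>t. t * ln (ln t))) \<and>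
        (\<alpha> > 2 \<longrightarrow> occ_var M \<eta> f \<asymp> (\<lambda>t. t * ln t))" if card: "CARD('d) = 2"
  proof (intro conjI impI)
    have sq: "(u powr (- 1 / 2)) ^ CARD('d) = 1 / u" if "u > 0" for u :: real
      using that by (simp add: card power2_eq_square powr_add[symmetric] powr_minus_divide)
    show "occ_var M \<eta> f \<asymp> (\<lambda>t. t * ln (ln t))" if a: "\<alpha> = 2"
    proof (rule occ_var_log_log[OF hk_limit_cong[OF hk_limit_log[OF _ a]]])
      show "\<forall>\<^sub>F t::real in at_top. ((t * ln t) powr (- 1 / 2)) ^ CARD('d) = 1 / (t * ln t)"
        using eventually_gt_at_top[of 1] by eventually_elim (rule sq, simp)
    qed (simp add: card)
    show "occ_var M \<eta> f \<asymp> (\<lambda>t. t * ln t)" if a: "2 < \<alpha>"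
    proof (rule occ_var_log[OF hk_limit_cong[OF hk_limit_square[OF a]]])
      show "\<forall>\<^sub>F t::real in at_top. (t powr (- 1 / 2)) ^ CARD('d) = 1 / t"
        using eventually_gt_at_top[of 0] by eventually_elim (rule sq)
    qed
  qed
  from stable square dim1 dim2 show ?thesis by auto
qed

end
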